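(* Let $\mathbf{A}$ be a polycategory. Then $\Sigma\Pi_{\mathbf{A}}$ is the free polycategory generated from $\mathbf{A}$ with finite (poly-)sums and (poly-)products.
   Context: Polycategory (always symmetric): a class of objects; for finite lists of objects $\Gamma,\Delta$ a set of polymorphisms $\Gamma\to\Delta$; identities; cut operations composing along one object (subject to the usual planarity condition); an action of permutations on domain and codomain lists; cut is unital, associative, satisfies the interchange law (independence of order of cuts on two different channels), and is compatible with permutations. Domains and codomains are treated as unordered families labelled by distinct channel names, and $f;_\gamma g$ denotes the cut on channel $\gamma$ (the only channel name shared by $f$ and $g$). A morphism of polycategories is a map on objects and on poly-hom-sets preserving identities, cuts and symmetric actions. Poly-sum: an object $\sum_{i\in I}X_i$ is the poly-sum of $(X_i)_{i\in I}$ if there is a bijection, for all $\Gamma,\Delta$, between families $(f_i:\Gamma,\alpha{:}X_i\to\Delta)_{i\in I}$ and maps $\alpha\{f_i\}_i:\Gamma,\alpha{:}\sum_iX_i\to\Delta$ which is poly-natural: $h;_\gamma\alpha\{f_i\}_i=\alpha\{h;_\gamma f_i\}_i$ and $\alpha\{f_i\}_i;_\gamma h=\alpha\{f_i;_\gamma h\}_i$ for $\gamma\neq\alpha$. Poly-product is the dual notion (for codomain channels). "Finite" means for all finite (including empty) $I$. Free: for every polycategory $\mathbf{B}$ with (chosen) finite poly-sums and poly-products and every morphism of polycategories $F:\mathbf{A}\to\mathbf{B}$ there is a unique morphism of polycategories $F^*:\Sigma\Pi_{\mathbf{A}}\to\mathbf{B}$ preserving the (chosen) sums and products with $F^*\circ\mathcal{I}=F$,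 where $\mathcal{I}:\mathbf{A}\to\Sigma\Pi_{\mathbf{A}}$ is the inclusion of atoms and axioms. The polycategory $\Sigma\Pi_{\mathbf{A}}$. Objects are formulas: the objects of $\mathbf{A}$ (atoms) and, for every finite (possibly empty) set $I$ and formulas $X_i$, the sum $\sum_{i\in I}a_i{:}X_i$ and the product $\prod_{i\in I}a_i{:}X_i$ (the $a_i$ are distinct names of the components). A sequent $\Gamma\vdash\Delta$ consists of two finite unordered families of formulas labelled by distinct channel names; morphisms $\Gamma\to\Delta$ are $\sim$-classes of derivations of $\Gamma\vdash\Delta$. Derivations (terms): - Axioms: every polymorphism of $\mathbf{A}$ between atoms (including $1_A$). - Cotuple: from $f_i$ deriving $\Gamma,\alpha{:}X_i\vdash\Delta$ ($i\in I$), $\alpha\{a_i\mapsto f_i\}_{i\in I}$ derives $\Gamma,\alpha{:}\sum_i a_i{:}X_i\vdash\Delta$. - Tuple: from $f_i$ deriving $\Gamma\vdash\alpha{:}X_i,\Delta$ ($i\in I$), $\alpha(a_i\mapsto f_i)_{i\in I}$ derives $\Gamma\vdash\alpha{:}\prod_i a_i{:}X_i,\Delta$. - Projection: from $f$ deriving $\Gamma,\alpha{:}X_k\vdash\Delta$, $\overleftarrow{\alpha}[a_k](f)$ derives $\Gamma,\alpha{:}\prod_i a_i{:}X_i\vdash\Delta$. - Injection: from $f$ deriving $\Gamma\vdash\alpha{:}X_k,\Delta$, $\overrightarrow{\alpha}[a_k](f)$ derives $\Gamma\vdash\alpha{:}\sum_i a_i{:}X_i,\Delta$. - Cut: from $f$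 deriving $\Gamma\vdash\Delta,\gamma{:}Z$ and $g$ deriving $\gamma{:}Z,\Gamma'\vdash\Delta'$, $f;_\gamma g$ derives $\Gamma,\Gamma'\vdash\Delta,\Delta'$. Composition is cut; identities $\iota_X:\alpha{:}X\vdash\beta{:}X$ are $1_A$ for atoms, $\alpha\{a_i\mapsto\overrightarrow{\beta}[a_i](\iota_{X_i})\}_i$ for sums, $\beta(a_i\mapsto\overleftarrow{\alpha}[a_i](\iota_{X_i}))_i$ for products. The sum and product formulas, with cotupling and tupling, are the chosen poly-sums and poly-products. The relation $\sim$ is the equivalence relation on derivations of a sequent generated (in any context) by identifying a cut between two axioms with the axiom given by composition in $\mathbf{A}$, and by the following (different Greek letters denote distinct channels; (1),(2) up to renaming of the channel; index sets of cotuples/tuples may be empty): (1) $f;_\gamma 1\Rightarrow f$; (2) $1;_\gamma f\Rightarrow f$; (3) $\alpha\{a_i\mapsto f_i\}_i;_\gamma g\Rightarrow\alpha\{a_i\mapsto f_i;_\gamma g\}_i$; (4) $f;_\gamma\beta(b_i\mapsto g_i)_i\Rightarrow\beta(b_i\mapsto f;_\gamma g_i)_i$; (5) $\overrightarrow{\alpha}[a_k](f);_\gamma g\Rightarrow\overrightarrow{\alpha}[a_k](f;_\gamma g)$; (6) $f;_\gamma\overleftarrow{\beta}[b_k](g)\Rightarrow\overleftarrow{\beta}[b_k](f;_\gamma g)$; (7) $\overleftarrow{\alpha}[a_k](f);_\gamma g\Rightarrow\overleftarrow{\alpha}[a_k](f;_\gamma g)$; (8) $f;_\gamma\overrightarrow{\beta}[b_k](g)\Rightarrow\overrightarrow{\beta}[b_k](f;_\gamma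 g)$; (9) $\alpha(a_i\mapsto f_i)_i;_\gamma g\Rightarrow\alpha(a_i\mapsto f_i;_\gamma g)_i$; (10) $f;_\gamma\beta\{b_i\mapsto g_i\}_i\Rightarrow\beta\{b_i\mapsto f;_\gamma g_i\}_i$; (11) $\overrightarrow{\gamma}[a_k](f);_\gamma\gamma\{a_i\mapsto g_i\}_i\Rightarrow f;_\gamma g_k$; (12) $\gamma(a_i\mapsto f_i)_i;_\gamma\overleftarrow{\gamma}[a_k](g)\Rightarrow f_k;_\gamma g$; (13) $\alpha\{a_i\mapsto\beta\{b_j\mapsto f_{ij}\}_j\}_i\leftrightarrow\beta\{b_j\mapsto\alpha\{a_i\mapsto f_{ij}\}_i\}_j$; (14) $\alpha(a_i\mapsto\beta(b_j\mapsto f_{ij})_j)_i\leftrightarrow\beta(b_j\mapsto\alpha(a_i\mapsto f_{ij})_i)_j$; (15) $\alpha\{a_i\mapsto\overrightarrow{\beta}[b_k](f_i)\}_i\leftrightarrow\overrightarrow{\beta}[b_k](\alpha\{a_i\mapsto f_i\}_i)$; (16) $\overleftarrow{\alpha}[a_k](\beta(b_i\mapsto g_i)_i)\leftrightarrow\beta(b_i\mapsto\overleftarrow{\alpha}[a_k](g_i))_i$; (17) $\alpha\{a_i\mapsto\overleftarrow{\beta}[b_k](f_i)\}_i\leftrightarrow\overleftarrow{\beta}[b_k](\alpha\{a_i\mapsto f_i\}_i)$; (18) $\overrightarrow{\alpha}[a_k](\beta(b_i\mapsto g_i)_i)\leftrightarrow\beta(b_i\mapsto\overrightarrow{\alpha}[a_k](g_i))_i$;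 (19) $\alpha\{a_i\mapsto\beta(b_j\mapsto f_{ij})_j\}_i\leftrightarrow\beta(b_j\mapsto\alpha\{a_i\mapsto f_{ij}\}_i)_j$; (20) $\overrightarrow{\alpha}[a_k](\overrightarrow{\beta}[b_l](f))\leftrightarrow\overrightarrow{\beta}[b_l](\overrightarrow{\alpha}[a_k](f))$; (21) $\overleftarrow{\alpha}[a_k](\overleftarrow{\beta}[b_l](f))\leftrightarrow\overleftarrow{\beta}[b_l](\overleftarrow{\alpha}[a_k](f))$; (22) $\overrightarrow{\alpha}[a_k](\overleftarrow{\beta}[b_l](f))\leftrightarrow\overleftarrow{\beta}[b_l](\overrightarrow{\alpha}[a_k](f))$. *)

theory Defs
  imports "HOL-Library.Finite_Map" "HOL-Combinatorics.Perm"
begin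

section \<open>Symmetric polycategories, with channel names\<close>

text \<open>
  Domains and codomains are unordered finite families of objects labelled by channel names drawn
  from a fixed countably infinite supply; all names occurring in a sequent are distinct.  The
  permutation actions on domain and codomain lists then become one action of the finitely
  supported permutations of names by renaming.  In this presentation the planarity condition on
  cuts disappears, since the order of the channels carries no information.
\<close>

type_synonym chan = nat
type_synonym name = nat
type_synonym 'o ctx = "(chan, 'o) fmap"

abbreviation single :: "chan \<Rightarrow> 'o \<Rightarrow> 'o ctx" where
  "single \<alpha> X \<equiv> fmupd \<alpha> X fmempty"

context
  includes fmap.lifting
begin

lift_definition rename_ctx :: "chan perm \<Rightarrow> 'o ctx \<Rightarrow> 'o ctx"
  is "\<lambda>p m. m \<circ> inv p"
proof -
  fix p :: "chan \<Rightarrow> chan" and m :: "chan \<Rightarrow> 'o option"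
  assume "bij p \<and> finite {a. p a \<noteq> a}" and "finite (dom m)"
  moreover from this have "dom (m \<circ> inv p) \<subseteq> p ` dom m"
    by (auto simp: image_iff) (metis bij_inv_eq_iff domI)
  ultimately show "finite (dom (m \<circ> inv p))"
    by (meson finite_imageI finite_subset)
qed

end

definition sequent :: "'o set \<Rightarrow> 'o ctx \<Rightarrow> 'o ctx \<Rightarrow> bool" where
  "sequent Ob \<Gamma> \<Delta> \<longleftrightarrow> fmdom \<Gamma> |\<inter>| fmdom \<Delta> = {||} \<and> fmran' \<Gamma> \<subseteq> Ob \<and> fmran' \<Delta> \<subseteq> Ob"

text \<open>
  The poly-hom-sets are the fibres of \<open>(src, tgt)\<close>.  The polymorphism \<open>idn P \<alpha> \<beta> X\<close> is the identity
  \<open>\<alpha>:X \<rightarrow> \<beta>:X\<close>, and \<open>cut P \<gamma> f g\<close> is the composite of \<open>f\<close> followed by \<open>g\<close> along \<open>\<gamma>\<close>.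
\<close>

record ('o, 'm) polycat =
  obj :: "'o set"
  arr :: "'m set"
  src :: "'m \<Rightarrow> 'o ctx"
  tgt :: "'m \<Rightarrow> 'o ctx"
  idn :: "chan \<Rightarrow> chan \<Rightarrow> 'o \<Rightarrow> 'm"
  cut :: "chan \<Rightarrow> 'm \<Rightarrow> 'm \<Rightarrow> 'm"
  ren :: "chan perm \<Rightarrow> 'm \<Rightarrow> 'm"

definition hom :: "('o, 'm, 'z) polycat_scheme \<Rightarrow> 'o ctx \<Rightarrow> 'o ctx \<Rightarrow> 'm set" where
  "hom P \<Gamma> \<Delta> = {f \<in> arr P. src P f = \<Gamma> \<and> tgt P f = \<Delta>}"

definition chans :: "('o, 'm, 'z) polycat_scheme \<Rightarrow> 'm \<Rightarrow> chan fset" where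
  "chans P f = fmdom (src P f) |\<union>| fmdom (tgt P f)"

definition cuttable :: "('o, 'm, 'z) polycat_scheme \<Rightarrow> chan \<Rightarrow> 'm \<Rightarrow> 'm \<Rightarrow> bool" where
  "cuttable P \<gamma> f g \<longleftrightarrow> f \<in> arr P \<and> g \<in> arr P
     \<and> (\<exists>Z. fmlookup (tgt P f) \<gamma> = Some Z \<and> fmlookup (src P g) \<gamma> = Some Z)
     \<and> chans P f |\<inter>| chans P g = {|\<gamma>|}"

text \<open>
  The law \<open>ren_fix\<close> says that renaming depends only on what it does to the channels of the
  polymorphism.  Identities \<open>idn P \<alpha> \<beta> X\<close> necessarily have two different channels, so the unit laws
  hold up to renaming of the channel.
\<close>

locale polycategory =
  fixes P :: "('o, 'm, 'z) polycat_scheme"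
  assumes arr_sequent: "f \<in> arr P \<Longrightarrow> sequent (obj P) (src P f) (tgt P f)"
    and idn_hom: "\<lbrakk>X \<in> obj P; \<alpha> \<noteq> \<beta>\<rbrakk> \<Longrightarrow> idn P \<alpha> \<beta> X \<in> hom P (single \<alpha> X) (single \<beta> X)"
    and cut_hom: "cuttable P \<gamma> f g \<Longrightarrow>
      cut P \<gamma> f g \<in> hom P (src P f ++\<^sub>f fmdrop \<gamma> (src P g)) (fmdrop \<gamma> (tgt P f) ++\<^sub>f tgt P g)"
    and ren_hom: "f \<in> arr P \<Longrightarrow>
      ren P p f \<in> hom P (rename_ctx p (src P f)) (rename_ctx p (tgt P f))"
    and ren_mult: "f \<in> arr P \<Longrightarrow> ren P (p * q) f = ren P p (ren P q f)"
    and ren_fix: "\<lbrakk>f \<in> arr P; \<And>\<alpha>. \<alpha> |\<in>| chans P f \<Longrightarrow> apply p \<alpha> = \<alpha>\<rbrakk> \<Longrightarrow> ren P p f = f"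
    and ren_idn: "\<lbrakk>X \<in> obj P; \<alpha> \<noteq> \<beta>\<rbrakk> \<Longrightarrow>
      ren P p (idn P \<alpha> \<beta> X) = idn P (apply p \<alpha>) (apply p \<beta>) X"
    and ren_cut: "cuttable P \<gamma> f g \<Longrightarrow>
      ren P p (cut P \<gamma> f g) = cut P (apply p \<gamma>) (ren P p f) (ren P p g)"
    and cut_idn: "\<lbrakk>f \<in> arr P; fmlookup (tgt P f) \<gamma> = Some X; \<beta> |\<notin>| chans P f\<rbrakk> \<Longrightarrow>
      cut P \<gamma> f (idn P \<gamma> \<beta> X) = ren P (swap \<gamma> \<beta>) f"
    and idn_cut: "\<lbrakk>f \<in> arr P; fmlookup (src P f) \<gamma> = Some X; \<alpha> |\<notin>| chans P f\<rbrakk> \<Longrightarrow>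
      cut P \<gamma> (idn P \<alpha> \<gamma> X) f = ren P (swap \<gamma> \<alpha>) f"
    and assoc: "\<lbrakk>cuttable P \<gamma> f g; cuttable P \<delta> g h; chans P f |\<inter>| chans P h = {||}\<rbrakk> \<Longrightarrow>
      cut P \<delta> (cut P \<gamma> f g) h = cut P \<gamma> f (cut P \<delta> g h)"
    and interchange_tgt:
      "\<lbrakk>cuttable P \<gamma> f g; cuttable P \<delta> f h; chans P g |\<inter>| chans P h = {||}\<rbrakk> \<Longrightarrow>
      cut P \<delta> (cut P \<gamma> f g) h = cut P \<gamma> (cut P \<delta> f h) g"
    and interchange_src:
      "\<lbrakk>cuttable P \<gamma> f h; cuttable P \<delta> g h; chans P f |\<inter>| chans P g = {||}\<rbrakk> \<Longrightarrow>
      cut P \<gamma> f (cut P \<delta> g h) = cut P \<delta> g (cut P \<gamma> f h)"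

definition polycat_morphism ::
  "('o, 'm, 'y) polycat_scheme \<Rightarrow> ('p, 'n, 'z) polycat_scheme \<Rightarrow> ('o \<Rightarrow> 'p) \<Rightarrow> ('m \<Rightarrow> 'n) \<Rightarrow> bool"
where
  "polycat_morphism P Q Fo Fm \<longleftrightarrow>
     (\<forall>X \<in> obj P. Fo X \<in> obj Q) \<and>
     (\<forall>f \<in> arr P. Fm f \<in> hom Q (fmmap Fo (src P f)) (fmmap Fo (tgt P f))) \<and>
     (\<forall>X \<in> obj P. \<forall>\<alpha> \<beta>. \<alpha> \<noteq> \<beta> \<longrightarrow> Fm (idn P \<alpha> \<beta> X) = idn Q \<alpha> \<beta> (Fo X)) \<and>
     (\<forall>\<gamma> f g. cuttable P \<gamma> f g \<longrightarrow> Fm (cut P \<gamma> f g) = cut Q \<gamma> (Fm f) (Fm g)) \<and>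
     (\<forall>f \<in> arr P. \<forall>p. Fm (ren P p f) = ren Q p (Fm f))"

section \<open>Poly-sums and poly-products\<close>

text \<open>
  A finite family \<open>(X\<^sub>i)\<close> is a finite map from component names to objects; its domain is the index
  set, which may be empty.
\<close>

definition cofamilies ::
  "('o, 'm, 'z) polycat_scheme \<Rightarrow> (name, 'o) fmap \<Rightarrow> 'o ctx \<Rightarrow> 'o ctx \<Rightarrow> chan \<Rightarrow> (name, 'm) fmap set"
where
  "cofamilies P X \<Gamma> \<Delta> \<alpha> = {fs. fmrel (\<lambda>f Y. f \<in> hom P (fmupd \<alpha> Y \<Gamma>) \<Delta>) fs X}"

text \<open>
  The argument \<open>ct\<close> of \<open>poly_sum\<close> is the operation sending \<open>\<Gamma>\<close>, \<open>\<Delta>\<close>, \<open>\<alpha>\<close> and a family to its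
  cotuple, with \<open>\<Gamma>\<close> and \<open>\<Delta>\<close> the contexts without the channel \<open>\<alpha>\<close>.  The four groups of conditions are
  bijectivity, the two naturality laws, and invariance under renaming of channels; the last one is
  needed because here the channel names are part of the data of a polymorphism.
\<close>

definition poly_sum ::
  "('o, 'm, 'z) polycat_scheme \<Rightarrow> (name, 'o) fmap \<Rightarrow> 'o
    \<Rightarrow> ('o ctx \<Rightarrow> 'o ctx \<Rightarrow> chan \<Rightarrow> (name, 'm) fmap \<Rightarrow> 'm) \<Rightarrow> bool"
where
  "poly_sum P X S ct \<longleftrightarrow> fmran' X \<subseteq> obj P \<and> S \<in> obj P \<and>
     (\<forall>\<Gamma> \<Delta> \<alpha>. sequent (obj P) \<Gamma> \<Delta> \<and> \<alpha> |\<notin>| fmdom \<Gamma> |\<union>| fmdom \<Delta> \<longrightarrow>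
        bij_betw (ct \<Gamma> \<Delta> \<alpha>) (cofamilies P X \<Gamma> \<Delta> \<alpha>) (hom P (fmupd \<alpha> S \<Gamma>) \<Delta>) \<and>
        (\<forall>fs \<in> cofamilies P X \<Gamma> \<Delta> \<alpha>.
           (\<forall>\<gamma> h. \<gamma> \<noteq> \<alpha> \<and> cuttable P \<gamma> h (ct \<Gamma> \<Delta> \<alpha> fs) \<longrightarrow>
              cut P \<gamma> h (ct \<Gamma> \<Delta> \<alpha> fs)
              = ct (src P h ++\<^sub>f fmdrop \<gamma> \<Gamma>) (fmdrop \<gamma> (tgt P h) ++\<^sub>f \<Delta>) \<alpha> (fmmap (cut P \<gamma> h) fs)) \<and>
           (\<forall>\<gamma> h. \<gamma> \<noteq> \<alpha> \<and> cuttable P \<gamma> (ct \<Gamma> \<Delta> \<alpha> fs) h \<longrightarrow>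
              cut P \<gamma> (ct \<Gamma> \<Delta> \<alpha> fs) h
              = ct (\<Gamma> ++\<^sub>f fmdrop \<gamma> (src P h)) (fmdrop \<gamma> \<Delta> ++\<^sub>f tgt P h) \<alpha>
                  (fmmap (\<lambda>f. cut P \<gamma> f h) fs)) \<and>
           (\<forall>p. ren P p (ct \<Gamma> \<Delta> \<alpha> fs)
              = ct (rename_ctx p \<Gamma>) (rename_ctx p \<Delta>) (apply p \<alpha>) (fmmap (ren P p) fs))))"

definition opposite :: "('o, 'm, 'z) polycat_scheme \<Rightarrow> ('o, 'm) polycat" where
  "opposite P = \<lparr>obj = obj P, arr = arr P, src = tgt P, tgt = src P,
     idn = (\<lambda>\<alpha> \<beta>. idn P \<beta> \<alpha>), cut = (\<lambda>\<gamma> f g. cut P \<gamma> g f), ren = ren P\<rparr>"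

definition families ::
  "('o, 'm, 'z) polycat_scheme \<Rightarrow> (name, 'o) fmap \<Rightarrow> 'o ctx \<Rightarrow> 'o ctx \<Rightarrow> chan \<Rightarrow> (name, 'm) fmap set"
where
  "families P X \<Gamma> \<Delta> \<alpha> = {fs. fmrel (\<lambda>f Y. f \<in> hom P \<Gamma> (fmupd \<alpha> Y \<Delta>)) fs X}"

definition poly_product ::
  "('o, 'm, 'z) polycat_scheme \<Rightarrow> (name, 'o) fmap \<Rightarrow> 'o
    \<Rightarrow> ('o ctx \<Rightarrow> 'o ctx \<Rightarrow> chan \<Rightarrow> (name, 'm) fmap \<Rightarrow> 'm) \<Rightarrow> bool"
where
  "poly_product P X S tp \<longleftrightarrow> poly_sum (opposite P) X S (\<lambda>\<Gamma> \<Delta>. tp \<Delta> \<Gamma>)"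

record ('o, 'm) sp_polycat = "('o, 'm) polycat" +
  sum_ob :: "(name, 'o) fmap \<Rightarrow> 'o"
  prod_ob :: "(name, 'o) fmap \<Rightarrow> 'o"
  cotuple :: "(name, 'o) fmap \<Rightarrow> 'o ctx \<Rightarrow> 'o ctx \<Rightarrow> chan \<Rightarrow> (name, 'm) fmap \<Rightarrow> 'm"
  tuple :: "(name, 'o) fmap \<Rightarrow> 'o ctx \<Rightarrow> 'o ctx \<Rightarrow> chan \<Rightarrow> (name, 'm) fmap \<Rightarrow> 'm"

locale sp_polycategory = polycategory P
  for P :: "('o, 'm, 'z) sp_polycat_scheme" +
  assumes sums: "fmran' X \<subseteq> obj P \<Longrightarrow> poly_sum P X (sum_ob P X) (cotuple P X)"
    and products: "fmran' X \<subseteq> obj P \<Longrightarrow> poly_product P X (prod_ob P X) (tuple P X)"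

definition preserves_sums_products ::
  "('o, 'm, 'y) sp_polycat_scheme \<Rightarrow> ('p, 'n, 'z) sp_polycat_scheme
    \<Rightarrow> ('o \<Rightarrow> 'p) \<Rightarrow> ('m \<Rightarrow> 'n) \<Rightarrow> bool"
where
  "preserves_sums_products P Q Fo Fm \<longleftrightarrow>
     (\<forall>X. fmran' X \<subseteq> obj P \<longrightarrow>
        Fo (sum_ob P X) = sum_ob Q (fmmap Fo X) \<and>
        Fo (prod_ob P X) = prod_ob Q (fmmap Fo X) \<and>
        (\<forall>\<Gamma> \<Delta> \<alpha>. sequent (obj P) \<Gamma> \<Delta> \<and> \<alpha> |\<notin>| fmdom \<Gamma> |\<union>| fmdom \<Delta> \<longrightarrow>
           (\<forall>fs \<in> cofamilies P X \<Gamma> \<Delta> \<alpha>. Fm (cotuple P X \<Gamma> \<Delta> \<alpha> fs)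
              = cotuple Q (fmmap Fo X) (fmmap Fo \<Gamma>) (fmmap Fo \<Delta>) \<alpha> (fmmap Fm fs)) \<and>
           (\<forall>fs \<in> families P X \<Gamma> \<Delta> \<alpha>. Fm (tuple P X \<Gamma> \<Delta> \<alpha> fs)
              = tuple Q (fmmap Fo X) (fmmap Fo \<Gamma>) (fmmap Fo \<Delta>) \<alpha> (fmmap Fm fs))))"

section \<open>Formulas and derivations\<close>

datatype (atoms: 'o) form =
    Atom 'o
  | Sum "(name, 'o form) fmap"
  | Prod "(name, 'o form) fmap"

definition formulas :: "('o, 'm, 'z) polycat_scheme \<Rightarrow> 'o form set" where
  "formulas A = {X. atoms X \<subseteq> obj A}"

text \<open>
  Terms carry enough annotations to determine their sequent, so that a term denotes a single
  derivation.  \<open>Cotuple \<Gamma> \<Delta> \<alpha> X fs\<close> and \<open>Tuple \<Gamma> \<Delta> \<alpha> X fs\<close> carry the family \<open>X\<close> of components and the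
  contexts \<open>\<Gamma>\<close>, \<open>\<Delta>\<close> without \<open>\<alpha>\<close> (which \<open>fs\<close> would not determine if it is empty); \<open>Proj \<alpha> a X f\<close> and
  \<open>Inj \<alpha> a X f\<close> carry the family of components of the new formula.
\<close>

datatype ('o, 'm) deriv =
    Axiom 'm
  | Cotuple "'o form ctx" "'o form ctx" chan "(name, 'o form) fmap" "(name, ('o, 'm) deriv) fmap"
  | Tuple "'o form ctx" "'o form ctx" chan "(name, 'o form) fmap" "(name, ('o, 'm) deriv) fmap"
  | Proj chan name "(name, 'o form) fmap" "('o, 'm) deriv"
  | Inj chan name "(name, 'o form) fmap" "('o, 'm) deriv"
  | Cut chan "('o, 'm) deriv" "('o, 'm) deriv"

declare fmap.rel_mono [mono]

inductive derives ::
  "('o, 'm, 'z) polycat_scheme \<Rightarrow> ('o, 'm) deriv \<Rightarrow> 'o form ctx \<Rightarrow> 'o form ctx \<Rightarrow> bool"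
  for A
where
  axiom: "m \<in> arr A \<Longrightarrow> derives A (Axiom m) (fmmap Atom (src A m)) (fmmap Atom (tgt A m))"
| cotuple: "\<lbrakk>sequent (formulas A) (fmupd \<alpha> (Sum X) \<Gamma>) \<Delta>; \<alpha> |\<notin>| fmdom \<Gamma>;
     fmrel (\<lambda>f Y. derives A f (fmupd \<alpha> Y \<Gamma>) \<Delta>) fs X\<rbrakk>
   \<Longrightarrow> derives A (Cotuple \<Gamma> \<Delta> \<alpha> X fs) (fmupd \<alpha> (Sum X) \<Gamma>) \<Delta>"
| tuple: "\<lbrakk>sequent (formulas A) \<Gamma> (fmupd \<alpha> (Prod X) \<Delta>); \<alpha> |\<notin>| fmdom \<Delta>;
     fmrel (\<lambda>f Y. derives A f \<Gamma> (fmupd \<alpha> Y \<Delta>)) fs X\<rbrakk>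
   \<Longrightarrow> derives A (Tuple \<Gamma> \<Delta> \<alpha> X fs) \<Gamma> (fmupd \<alpha> (Prod X) \<Delta>)"
| proj: "\<lbrakk>derives A f (fmupd \<alpha> Y \<Gamma>) \<Delta>; \<alpha> |\<notin>| fmdom \<Gamma>; fmlookup X a = Some Y; Prod X \<in> formulas A\<rbrakk>
   \<Longrightarrow> derives A (Proj \<alpha> a X f) (fmupd \<alpha> (Prod X) \<Gamma>) \<Delta>"
| inj: "\<lbrakk>derives A f \<Gamma> (fmupd \<alpha> Y \<Delta>); \<alpha> |\<notin>| fmdom \<Delta>; fmlookup X a = Some Y; Sum X \<in> formulas A\<rbrakk>
   \<Longrightarrow> derives A (Inj \<alpha> a X f) \<Gamma> (fmupd \<alpha> (Sum X) \<Delta>)"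
| cut: "\<lbrakk>derives A f \<Gamma> (fmupd \<gamma> Z \<Delta>); derives A g (fmupd \<gamma> Z \<Gamma>') \<Delta>';
     \<gamma> |\<notin>| fmdom \<Delta>; \<gamma> |\<notin>| fmdom \<Gamma>';
     (fmdom \<Gamma> |\<union>| fmdom \<Delta>) |\<inter>| (fmdom \<Gamma>' |\<union>| fmdom \<Delta>') = {||}\<rbrakk>
   \<Longrightarrow> derives A (Cut \<gamma> f g) (\<Gamma> ++\<^sub>f \<Gamma>') (\<Delta> ++\<^sub>f \<Delta>')"

primrec rename_deriv ::
  "('o, 'm, 'z) polycat_scheme \<Rightarrow> chan perm \<Rightarrow> ('o, 'm) deriv \<Rightarrow> ('o, 'm) deriv"
where
  "rename_deriv A p (Axiom m) = Axiom (ren A p m)"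
| "rename_deriv A p (Cotuple \<Gamma> \<Delta> \<alpha> X fs)
     = Cotuple (rename_ctx p \<Gamma>) (rename_ctx p \<Delta>) (apply p \<alpha>) X (fmmap (rename_deriv A p) fs)"
| "rename_deriv A p (Tuple \<Gamma> \<Delta> \<alpha> X fs)
     = Tuple (rename_ctx p \<Gamma>) (rename_ctx p \<Delta>) (apply p \<alpha>) X (fmmap (rename_deriv A p) fs)"
| "rename_deriv A p (Proj \<alpha> a X f) = Proj (apply p \<alpha>) a X (rename_deriv A p f)"
| "rename_deriv A p (Inj \<alpha> a X f) = Inj (apply p \<alpha>) a X (rename_deriv A p f)"
| "rename_deriv A p (Cut \<gamma> f g) = Cut (apply p \<gamma>) (rename_deriv A p f) (rename_deriv A p g)"

primrec iota ::
  "('o, 'm, 'z) polycat_scheme \<Rightarrow> chan \<Rightarrow> chan \<Rightarrow> 'o form \<Rightarrow> ('o, 'm) deriv"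
where
  "iota A \<alpha> \<beta> (Atom a) = Axiom (idn A \<alpha> \<beta> a)"
| "iota A \<alpha> \<beta> (Sum X)
     = Cotuple fmempty (single \<beta> (Sum X)) \<alpha> X
         (fmmap_keys (\<lambda>a. Inj \<beta> a X) (fmmap (iota A \<alpha> \<beta>) X))"
| "iota A \<alpha> \<beta> (Prod X)
     = Tuple (single \<alpha> (Prod X)) fmempty \<beta> X
         (fmmap_keys (\<lambda>a. Proj \<alpha> a X) (fmmap (iota A \<alpha> \<beta>) X))"

section \<open>Equality of derivations\<close>

text \<open>
  The generators \<open>conv\<close> are stated on raw terms and are only used (in \<open>sim\<close>) between two derivations
  of the same sequent.  In particular, the contexts annotating the right-hand sides of \<open>c3\<close>, \<open>c4\<close>,
  \<open>c9\<close> and \<open>c10\<close> may be left arbitrary: they are determined by that sequent.  The doubly indexed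
  families in \<open>c13\<close>, \<open>c14\<close> and \<open>c19\<close> are given by functions \<open>F\<close> restricted to the component names
  of \<open>X\<close> and \<open>Y\<close>.  In \<open>c1\<close> and \<open>c2\<close> the unit is the identity axiom \<open>1\<^sub>A\<close> at an atom, and the result
  is renamed so as to derive the sequent of the cut.
\<close>

inductive conv :: "('o, 'm, 'z) polycat_scheme \<Rightarrow> ('o, 'm) deriv \<Rightarrow> ('o, 'm) deriv \<Rightarrow> bool"
  for A
where
  c0: "conv A (Cut \<gamma> (Axiom m) (Axiom n)) (Axiom (cut A \<gamma> m n))"
| c1: "\<lbrakk>a \<in> obj A; \<gamma> \<noteq> \<beta>\<rbrakk> \<Longrightarrow>
    conv A (Cut \<gamma> f (Axiom (idn A \<gamma> \<beta> a))) (rename_deriv A (swap \<gamma> \<beta>) f)"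
| c2: "\<lbrakk>a \<in> obj A; \<alpha> \<noteq> \<gamma>\<rbrakk> \<Longrightarrow>
    conv A (Cut \<gamma> (Axiom (idn A \<alpha> \<gamma> a)) f) (rename_deriv A (swap \<gamma> \<alpha>) f)"
| c3: "\<alpha> \<noteq> \<gamma> \<Longrightarrow>
    conv A (Cut \<gamma> (Cotuple \<Gamma> \<Delta> \<alpha> X fs) g) (Cotuple \<Gamma>' \<Delta>' \<alpha> X (fmmap (\<lambda>f. Cut \<gamma> f g) fs))"
| c4: "\<beta> \<noteq> \<gamma> \<Longrightarrow>
    conv A (Cut \<gamma> f (Tuple \<Gamma> \<Delta> \<beta> Y gs)) (Tuple \<Gamma>' \<Delta>' \<beta> Y (fmmap (\<lambda>g. Cut \<gamma> f g) gs))"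
| c5: "\<alpha> \<noteq> \<gamma> \<Longrightarrow> conv A (Cut \<gamma> (Inj \<alpha> k X f) g) (Inj \<alpha> k X (Cut \<gamma> f g))"
| c6: "\<beta> \<noteq> \<gamma> \<Longrightarrow> conv A (Cut \<gamma> f (Proj \<beta> k Y g)) (Proj \<beta> k Y (Cut \<gamma> f g))"
| c7: "\<alpha> \<noteq> \<gamma> \<Longrightarrow> conv A (Cut \<gamma> (Proj \<alpha> k X f) g) (Proj \<alpha> k X (Cut \<gamma> f g))"
| c8: "\<beta> \<noteq> \<gamma> \<Longrightarrow> conv A (Cut \<gamma> f (Inj \<beta> k Y g)) (Inj \<beta> k Y (Cut \<gamma> f g))"
| c9: "\<alpha> \<noteq> \<gamma> \<Longrightarrow>
    conv A (Cut \<gamma> (Tuple \<Gamma> \<Delta> \<alpha> X fs) g) (Tuple \<Gamma>' \<Delta>' \<alpha> X (fmmap (\<lambda>f. Cut \<gamma> f g) fs))"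
| c10: "\<beta> \<noteq> \<gamma> \<Longrightarrow>
    conv A (Cut \<gamma> f (Cotuple \<Gamma> \<Delta> \<beta> Y gs)) (Cotuple \<Gamma>' \<Delta>' \<beta> Y (fmmap (\<lambda>g. Cut \<gamma> f g) gs))"
| c11: "fmlookup gs k = Some g \<Longrightarrow>
    conv A (Cut \<gamma> (Inj \<gamma> k X f) (Cotuple \<Gamma> \<Delta> \<gamma> X gs)) (Cut \<gamma> f g)"
| c12: "fmlookup fs k = Some f \<Longrightarrow>
    conv A (Cut \<gamma> (Tuple \<Gamma> \<Delta> \<gamma> X fs) (Proj \<gamma> k X g)) (Cut \<gamma> f g)"
| c13: "\<alpha> \<noteq> \<beta> \<Longrightarrow> conv A
    (Cotuple (fmupd \<beta> (Sum Y) \<Gamma>) \<Delta> \<alpha> X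
       (fmmap_keys (\<lambda>i Xi. Cotuple (fmupd \<alpha> Xi \<Gamma>) \<Delta> \<beta> Y (fmmap_keys (\<lambda>j _. F i j) Y)) X))
    (Cotuple (fmupd \<alpha> (Sum X) \<Gamma>) \<Delta> \<beta> Y
       (fmmap_keys (\<lambda>j Yj. Cotuple (fmupd \<beta> Yj \<Gamma>) \<Delta> \<alpha> X (fmmap_keys (\<lambda>i _. F i j) X)) Y))"
| c14: "\<alpha> \<noteq> \<beta> \<Longrightarrow> conv A
    (Tuple \<Gamma> (fmupd \<beta> (Prod Y) \<Delta>) \<alpha> X
       (fmmap_keys (\<lambda>i Xi. Tuple \<Gamma> (fmupd \<alpha> Xi \<Delta>) \<beta> Y (fmmap_keys (\<lambda>j _. F i j) Y)) X))
    (Tuple \<Gamma> (fmupd \<alpha> (Prod X) \<Delta>) \<beta> Y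
       (fmmap_keys (\<lambda>j Yj. Tuple \<Gamma> (fmupd \<beta> Yj \<Delta>) \<alpha> X (fmmap_keys (\<lambda>i _. F i j) X)) Y))"
| c15: "\<lbrakk>\<alpha> \<noteq> \<beta>; fmlookup Y k = Some Yk\<rbrakk> \<Longrightarrow> conv A
    (Cotuple \<Gamma> (fmupd \<beta> (Sum Y) \<Delta>) \<alpha> X (fmmap (Inj \<beta> k Y) fs))
    (Inj \<beta> k Y (Cotuple \<Gamma> (fmupd \<beta> Yk \<Delta>) \<alpha> X fs))"
| c16: "\<lbrakk>\<alpha> \<noteq> \<beta>; fmlookup X k = Some Xk\<rbrakk> \<Longrightarrow> conv A
    (Proj \<alpha> k X (Tuple (fmupd \<alpha> Xk \<Gamma>) \<Delta> \<beta> Y gs))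
    (Tuple (fmupd \<alpha> (Prod X) \<Gamma>) \<Delta> \<beta> Y (fmmap (Proj \<alpha> k X) gs))"
| c17: "\<lbrakk>\<alpha> \<noteq> \<beta>; fmlookup Y k = Some Yk\<rbrakk> \<Longrightarrow> conv A
    (Cotuple (fmupd \<beta> (Prod Y) \<Gamma>) \<Delta> \<alpha> X (fmmap (Proj \<beta> k Y) fs))
    (Proj \<beta> k Y (Cotuple (fmupd \<beta> Yk \<Gamma>) \<Delta> \<alpha> X fs))"
| c18: "\<lbrakk>\<alpha> \<noteq> \<beta>; fmlookup X k = Some Xk\<rbrakk> \<Longrightarrow> conv A
    (Inj \<alpha> k X (Tuple \<Gamma> (fmupd \<alpha> Xk \<Delta>) \<beta> Y gs))
    (Tuple \<Gamma> (fmupd \<alpha> (Sum X) \<Delta>) \<beta> Y (fmmap (Inj \<alpha> k X) gs))"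
| c19: "\<alpha> \<noteq> \<beta> \<Longrightarrow> conv A
    (Cotuple \<Gamma> (fmupd \<beta> (Prod Y) \<Delta>) \<alpha> X
       (fmmap_keys (\<lambda>i Xi. Tuple (fmupd \<alpha> Xi \<Gamma>) \<Delta> \<beta> Y (fmmap_keys (\<lambda>j _. F i j) Y)) X))
    (Tuple (fmupd \<alpha> (Sum X) \<Gamma>) \<Delta> \<beta> Y
       (fmmap_keys (\<lambda>j Yj. Cotuple \<Gamma> (fmupd \<beta> Yj \<Delta>) \<alpha> X (fmmap_keys (\<lambda>i _. F i j) X)) Y))"
| c20: "\<alpha> \<noteq> \<beta> \<Longrightarrow> conv A (Inj \<alpha> k X (Inj \<beta> l Y f)) (Inj \<beta> l Y (Inj \<alpha> k X f))"
| c21: "\<alpha> \<noteq> \<beta> \<Longrightarrow> conv A (Proj \<alpha> k X (Proj \<beta> l Y f)) (Proj \<beta> l Y (Proj \<alpha> k X f))"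
| c22: "\<alpha> \<noteq> \<beta> \<Longrightarrow> conv A (Inj \<alpha> k X (Proj \<beta> l Y f)) (Proj \<beta> l Y (Inj \<alpha> k X f))"

inductive sim :: "('o, 'm, 'z) polycat_scheme \<Rightarrow> ('o, 'm) deriv \<Rightarrow> ('o, 'm) deriv \<Rightarrow> bool"
  for A
where
  conv: "\<lbrakk>conv A t u; derives A t \<Gamma> \<Delta>; derives A u \<Gamma> \<Delta>\<rbrakk> \<Longrightarrow> sim A t u"
| refl: "derives A t \<Gamma> \<Delta> \<Longrightarrow> sim A t t"
| sym: "sim A t u \<Longrightarrow> sim A u t"
| trans: "\<lbrakk>sim A t u; sim A u v\<rbrakk> \<Longrightarrow> sim A t v"
| cotuple: "\<lbrakk>fmrel (sim A) fs gs; derives A (Cotuple \<Gamma> \<Delta> \<alpha> X fs) \<Gamma>' \<Delta>';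
     derives A (Cotuple \<Gamma> \<Delta> \<alpha> X gs) \<Gamma>' \<Delta>'\<rbrakk>
   \<Longrightarrow> sim A (Cotuple \<Gamma> \<Delta> \<alpha> X fs) (Cotuple \<Gamma> \<Delta> \<alpha> X gs)"
| tuple: "\<lbrakk>fmrel (sim A) fs gs; derives A (Tuple \<Gamma> \<Delta> \<alpha> X fs) \<Gamma>' \<Delta>';
     derives A (Tuple \<Gamma> \<Delta> \<alpha> X gs) \<Gamma>' \<Delta>'\<rbrakk>
   \<Longrightarrow> sim A (Tuple \<Gamma> \<Delta> \<alpha> X fs) (Tuple \<Gamma> \<Delta> \<alpha> X gs)"
| proj: "\<lbrakk>sim A f g; derives A (Proj \<alpha> a X f) \<Gamma> \<Delta>; derives A (Proj \<alpha> a X g) \<Gamma> \<Delta>\<rbrakk>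
   \<Longrightarrow> sim A (Proj \<alpha> a X f) (Proj \<alpha> a X g)"
| inj: "\<lbrakk>sim A f g; derives A (Inj \<alpha> a X f) \<Gamma> \<Delta>; derives A (Inj \<alpha> a X g) \<Gamma> \<Delta>\<rbrakk>
   \<Longrightarrow> sim A (Inj \<alpha> a X f) (Inj \<alpha> a X g)"
| cut: "\<lbrakk>sim A f f'; sim A g g'; derives A (Cut \<gamma> f g) \<Gamma> \<Delta>; derives A (Cut \<gamma> f' g') \<Gamma> \<Delta>\<rbrakk>
   \<Longrightarrow> sim A (Cut \<gamma> f g) (Cut \<gamma> f' g')"

section \<open>The polycategory of formulas and derivations\<close>

text \<open>
  The operations are defined on representatives; the choice is immaterial because \<open>sim\<close> is a
  congruence.
\<close>

type_synonym ('o, 'm) sp_arr = "'o form ctx \<times> 'o form ctx \<times> ('o, 'm) deriv set"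

definition mor ::
  "('o, 'm, 'z) polycat_scheme \<Rightarrow> 'o form ctx \<Rightarrow> 'o form ctx \<Rightarrow> ('o, 'm) deriv \<Rightarrow> ('o, 'm) sp_arr"
where
  "mor A \<Gamma> \<Delta> t = (\<Gamma>, \<Delta>, {u. sim A t u})"

abbreviation dom_ctx :: "('o, 'm) sp_arr \<Rightarrow> 'o form ctx" where
  "dom_ctx f \<equiv> fst f"

abbreviation cod_ctx :: "('o, 'm) sp_arr \<Rightarrow> 'o form ctx" where
  "cod_ctx f \<equiv> fst (snd f)"

definition rep :: "('o, 'm) sp_arr \<Rightarrow> ('o, 'm) deriv" where
  "rep f = (SOME t. t \<in> snd (snd f))"

definition sigma_pi ::
  "('o, 'm, 'z) polycat_scheme \<Rightarrow> ('o form, ('o, 'm) sp_arr) sp_polycat"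
where
  "sigma_pi A = \<lparr>
     obj = formulas A,
     arr = {mor A \<Gamma> \<Delta> t | \<Gamma> \<Delta> t. derives A t \<Gamma> \<Delta>},
     src = dom_ctx,
     tgt = cod_ctx,
     idn = (\<lambda>\<alpha> \<beta> X. mor A (single \<alpha> X) (single \<beta> X) (iota A \<alpha> \<beta> X)),
     cut = (\<lambda>\<gamma> f g. mor A (dom_ctx f ++\<^sub>f fmdrop \<gamma> (dom_ctx g)) (fmdrop \<gamma> (cod_ctx f) ++\<^sub>f cod_ctx g)
              (Cut \<gamma> (rep f) (rep g))),
     ren = (\<lambda>p f. mor A (rename_ctx p (dom_ctx f)) (rename_ctx p (cod_ctx f))
              (rename_deriv A p (rep f))),
     sum_ob = Sum,
     prod_ob = Prod,
     cotuple = (\<lambda>X \<Gamma> \<Delta> \<alpha> fs. mor A (fmupd \<alpha> (Sum X) \<Gamma>) \<Delta> (Cotuple \<Gamma> \<Delta> \<alpha> X (fmmap rep fs))),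
     tuple = (\<lambda>X \<Gamma> \<Delta> \<alpha> fs. mor A \<Gamma> (fmupd \<alpha> (Prod X) \<Delta>) (Tuple \<Gamma> \<Delta> \<alpha> X (fmmap rep fs)))\<rparr>"

definition axiom_arr :: "('o, 'm, 'z) polycat_scheme \<Rightarrow> 'm \<Rightarrow> ('o, 'm) sp_arr" where
  "axiom_arr A m = mor A (fmmap Atom (src A m)) (fmmap Atom (tgt A m)) (Axiom m)"

section \<open>Freeness\<close>

definition sp_extension ::
  "('o, 'm, 'y) polycat_scheme \<Rightarrow> ('p, 'n, 'z) sp_polycat_scheme \<Rightarrow> ('o \<Rightarrow> 'p) \<Rightarrow> ('m \<Rightarrow> 'n)
    \<Rightarrow> ('o form \<Rightarrow> 'p) \<Rightarrow> (('o, 'm) sp_arr \<Rightarrow> 'n) \<Rightarrow> bool"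
where
  "sp_extension A B Fo Fm Go Gm \<longleftrightarrow>
     polycat_morphism (sigma_pi A) B Go Gm \<and>
     preserves_sums_products (sigma_pi A) B Go Gm \<and>
     (\<forall>a \<in> obj A. Go (Atom a) = Fo a) \<and>
     (\<forall>m \<in> arr A. Gm (axiom_arr A m) = Fm m)"

end

theory Submission
  imports Defs
begin

text \<open>
  Every cut of cut-free derivations is pushed upwards by the conversions (3)--(12) until it meets two
  principal rules or two axioms, so every derivation is equal to a cut-free one.  Since equality of
  derivations is an equivalence relation, no confluence is needed: associativity, interchange and the
  unit laws are proved for cut-free derivations by induction on their heights, each case pushing both
  sides of the equation in the same way and ending with the laws of the given polycategory.  The
  cotuple of a family is then injective because cutting with the injections recovers the family, and
  surjective because the identity of a sum is a cotuple.

  Conversely, in any polycategory with sums and products the injections and projections are defined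
  as the components of identities, and the conversions (3)--(22) hold, so that derivations can be
  interpreted.  The interpretation is unique because a selection rule amounts to a cut with an
  injection or projection, which every morphism preserving sums and products has to preserve.
\<close>

section \<open>Finite maps and signed contexts\<close>

text \<open>There is no contraction, so pushing a cut upwards shortens one premise and a principal
  step shortens both: the sum of the heights is a measure for cut elimination, without an induction
  on the cut formula. The result, however, comes with no useful bound on its height. Associativity
  therefore leaves both cuts standing and measures only the three cut-free pieces between which they
  stand. Duality would multiply every argument. Giving each channel a sign and each cut a direction
  merges sums with products, leaves three schemes for moving and reducing cuts and three for
  commuting rules, and turns associativity and the two interchange laws into one equation about a
  middle piece with two others attached to it. Names are the remaining obstacle. A term with cuts
  mentions channels that its sequent does not show, so a renaming that fixes the sequent need not
  fix the term; it fixes it up to \<open>sim\<close>, again by cut elimination.\<close>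

lemma fmap_eqI: "(\<And>c x. fmlookup m c = Some x \<longleftrightarrow> fmlookup n c = Some x) \<Longrightarrow> m = n"
  by (rule fmap_ext) (metis option.exhaust)

lemma in_fmdom_iff: "c |\<in>| fmdom m \<longleftrightarrow> fmlookup m c \<noteq> None"
  by (simp add: fmlookup_dom_iff)

lemma fmlookup_add_Some: "fmlookup (m ++\<^sub>f n) c = Some x \<longleftrightarrow>
    fmlookup n c = Some x \<or> fmlookup n c = None \<and> fmlookup m c = Some x"
  by (auto simp: in_fmdom_iff)

lemma fmdom_disjoint_iff: "fmdom m |\<inter>| fmdom n = {||} \<longleftrightarrow> (\<forall>c x y. fmlookup m c = Some x \<longrightarrow> fmlookup n c \<noteq> Some y)"
  by (simp add: fset_eq_iff in_fmdom_iff) (metis not_None_eq)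

lemma fmrel_Some_iff: "fmrel R m n \<longleftrightarrow> fmdom m = fmdom n \<and>
    (\<forall>i x y. fmlookup m i = Some x \<longrightarrow> fmlookup n i = Some y \<longrightarrow> R x y)"
proof
  assume "fmrel R m n"
  then show "fmdom m = fmdom n \<and> (\<forall>i x y. fmlookup m i = Some x \<longrightarrow> fmlookup n i = Some y \<longrightarrow> R x y)"
    by (auto simp: fmrel_fmdom_eq) (metis fmrelD option.rel_inject(2))
next
  assume *: "fmdom m = fmdom n \<and> (\<forall>i x y. fmlookup m i = Some x \<longrightarrow> fmlookup n i = Some y \<longrightarrow> R x y)"
  show "fmrel R m n"
  proof (rule fmrelI)
    fix i
    have "fmlookup m i = None \<longleftrightarrow> fmlookup n i = None"
      using * by (metis in_fmdom_iff)
    then show "rel_option R (fmlookup m i) (fmlookup n i)"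
      using * by (cases "fmlookup m i"; cases "fmlookup n i") auto
  qed
qed

lemma fmrelE1:
  assumes "fmrel R m n" "fmlookup m i = Some x"
  obtains y where "fmlookup n i = Some y" "R x y"
  using assms by (cases rule: fmrel_cases[of R m n i]) auto

lemma fmrelE2:
  assumes "fmrel R m n" "fmlookup n i = Some y"
  obtains x where "fmlookup m i = Some x" "R x y"
  using assms by (cases rule: fmrel_cases[of R m n i]) auto

section \<open>Renaming of contexts by permutations of channels\<close>

lemma fmlookup_rename [simp]: "fmlookup (rename_ctx p m) c = fmlookup m (apply (inverse p) c)"
  by (simp add: rename_ctx.rep_eq apply_inverse)

lemma apply_inverse_simps [simp]:
  "apply (inverse p) (apply p c) = c" "apply p (apply (inverse p) c) = c"
  by (simp_all add: apply_sequence)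

lemma apply_eq_iff [simp]: "apply p c = apply p d \<longleftrightarrow> c = d"
  by (metis apply_inverse_simps(1))

lemma apply_inverse_eq_iff: "apply (inverse p) c = d \<longleftrightarrow> c = apply p d"
  by auto

lemma rename_ctx_empty [simp]: "rename_ctx p fmempty = fmempty"
  by (rule fmap_ext) simp

lemma rename_ctx_upd [simp]: "rename_ctx p (fmupd c x m) = fmupd (apply p c) x (rename_ctx p m)"
  by (rule fmap_ext) (auto simp: apply_inverse_eq_iff)

lemma rename_ctx_add [simp]: "rename_ctx p (m ++\<^sub>f n) = rename_ctx p m ++\<^sub>f rename_ctx p n"
  by (rule fmap_ext) (simp add: in_fmdom_iff)

lemma rename_ctx_drop [simp]: "rename_ctx p (fmdrop c m) = fmdrop (apply p c) (rename_ctx p m)"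
  by (rule fmap_ext) (auto simp: apply_inverse_eq_iff)

lemma rename_ctx_map [simp]: "rename_ctx p (fmmap h m) = fmmap h (rename_ctx p m)"
  by (rule fmap_ext) simp

lemma rename_ctx_mult: "rename_ctx (p * q) m = rename_ctx p (rename_ctx q m)"
  by (rule fmap_ext) (simp add: apply_times)

lemma rename_ctx_fix: "(\<And>c. c |\<in>| fmdom m \<Longrightarrow> apply p c = c) \<Longrightarrow> rename_ctx p m = m"
  by (rule fmap_eqI) (metis apply_inverse_simps fmdomI fmlookup_rename)

lemma apply_in_fmdom_rename [simp]: "apply p c |\<in>| fmdom (rename_ctx p m) \<longleftrightarrow> c |\<in>| fmdom m"
  by (simp add: in_fmdom_iff)

lemma fmran'_rename [simp]: "fmran' (rename_ctx p m) = fmran' m"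
  by (auto simp: fmlookup_ran'_iff) (metis apply_inverse_simps(1))

text \<open>
  A sequent is coded as one finite map: the sign \<open>False\<close> marks the channels of the domain and \<open>True\<close>
  those of the codomain.  All rules then come in a single form for both sides.
\<close>

definition part :: "bool \<Rightarrow> (chan, bool \<times> 'o) fmap \<Rightarrow> 'o ctx" where
  "part b S = fmmap snd (fmfilter (\<lambda>c. \<exists>X. fmlookup S c = Some (b, X)) S)"

definition signed :: "'o ctx \<Rightarrow> 'o ctx \<Rightarrow> (chan, bool \<times> 'o) fmap" where
  "signed \<Gamma> \<Delta> = fmmap (Pair False) \<Gamma> ++\<^sub>f fmmap (Pair True) \<Delta>"

definition join :: "chan \<Rightarrow> (chan, 'v) fmap \<Rightarrow> (chan, 'v) fmap \<Rightarrow> (chan, 'v) fmap" where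
  "join \<gamma> S T = fmdrop \<gamma> S ++\<^sub>f fmdrop \<gamma> T"

text \<open>The sign is the side of \<open>S\<close> that holds the cut formula, so cuts in either
  direction share this relation. The last clause is the separation of names in the cut rule.\<close>

definition compat :: "chan \<Rightarrow> bool \<Rightarrow> (chan, bool \<times> 'o) fmap \<Rightarrow> (chan, bool \<times> 'o) fmap \<Rightarrow> bool" where
  "compat \<gamma> s S T \<longleftrightarrow> (\<exists>Z. fmlookup S \<gamma> = Some (s, Z) \<and> fmlookup T \<gamma> = Some (\<not> s, Z))
     \<and> fmdom S |\<inter>| fmdom T = {|\<gamma>|}"

definition over :: "'o set \<Rightarrow> (chan, bool \<times> 'o) fmap \<Rightarrow> bool" where
  "over Ob S \<longleftrightarrow> (\<forall>c b X. fmlookup S c = Some (b, X) \<longrightarrow> X \<in> Ob)"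

lemma fmlookup_part_Some [simp]: "fmlookup (part b S) c = Some X \<longleftrightarrow> fmlookup S c = Some (b, X)"
  by (auto simp: part_def)

lemma fmlookup_part_None: "fmlookup (part b S) c = None \<longleftrightarrow> (\<forall>X. fmlookup S c \<noteq> Some (b, X))"
  by (auto simp: part_def)

lemma part_signed:
  assumes "fmdom \<Gamma> |\<inter>| fmdom \<Delta> = {||}"
  shows "part b (signed \<Gamma> \<Delta>) = (if b then \<Delta> else \<Gamma>)"
  by (rule fmap_eqI) (use assms in \<open>auto simp: fmdom_disjoint_iff signed_def fmlookup_add_Some; metis not_None_eq\<close>)

lemma signed_part [simp]: "signed (part False S) (part True S) = S"
  by (rule fmap_eqI) (auto simp: signed_def fmlookup_add_Some fmlookup_part_None)

lemma fmdom_part: "fmdom (part False S) |\<union>| fmdom (part True S) = fmdom S"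
  by (auto simp: fset_eq_iff fmlookup_dom_iff)

lemma in_fmdom_part: "c |\<in>| fmdom (part b S) \<Longrightarrow> c |\<in>| fmdom S"
  by (auto simp: fmlookup_dom_iff)

lemma part_upd:
  "c |\<notin>| fmdom S \<Longrightarrow> part b (fmupd c (s, X) S) = (if b = s then fmupd c X (part b S) else part b S)"
  by (rule fmap_eqI) (auto simp: in_fmdom_iff)

lemma part_empty [simp]: "part b fmempty = fmempty"
  by (rule fmap_eqI) auto

lemma part_rename: "part b (rename_ctx p S) = rename_ctx p (part b S)"
  by (rule fmap_eqI) auto

lemma sequent_part: "sequent Ob (part False S) (part True S) \<longleftrightarrow> over Ob S"
  by (auto simp: sequent_def over_def fmdom_disjoint_iff fmlookup_ran'_iff subset_iff)
    (metis (full_types))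

lemma over_upd: "c |\<notin>| fmdom S \<Longrightarrow> over Ob (fmupd c (s, X) S) \<longleftrightarrow> X \<in> Ob \<and> over Ob S"
  by (auto simp: over_def in_fmdom_iff split: if_splits) (metis option.distinct(1))

lemma over_join: "over Ob S \<Longrightarrow> over Ob T \<Longrightarrow> over Ob (join \<gamma> S T)"
  by (auto simp: over_def join_def fmlookup_add_Some split: if_splits)

lemma over_rename: "over Ob S \<Longrightarrow> over Ob (rename_ctx p S)"
  by (auto simp: over_def)

lemma compat_sym: "compat \<gamma> s S T \<Longrightarrow> compat \<gamma> (\<not> s) T S"
  by (auto simp: compat_def inf_commute)

lemma compat_dom: "compat \<gamma> s S T \<Longrightarrow> c |\<in>| fmdom S \<Longrightarrow> c |\<in>| fmdom T \<Longrightarrow> c = \<gamma>"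
  by (auto simp: compat_def fset_eq_iff)

lemma compatI:
  assumes "fmlookup S \<gamma> = Some (s, Z)" "fmlookup T \<gamma> = Some (\<not> s, Z)"
    "\<And>c. c |\<in>| fmdom S \<Longrightarrow> c |\<in>| fmdom T \<Longrightarrow> c = \<gamma>"
  shows "compat \<gamma> s S T"
  using assms by (auto simp: compat_def fset_eq_iff in_fmdom_iff)

lemma compat_in: "compat \<gamma> s S T \<Longrightarrow> \<gamma> |\<in>| fmdom S" "compat \<gamma> s S T \<Longrightarrow> \<gamma> |\<in>| fmdom T"
  by (auto simp: compat_def in_fmdom_iff)

lemma fmdom_join [simp]: "fmdom (join \<gamma> S T) = (fmdom S |\<union>| fmdom T) |-| {|\<gamma>|}"
  by (auto simp: join_def)

lemma fmlookup_join: "fmlookup (join \<gamma> S T) c =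
    (if c = \<gamma> then None else if fmlookup T c = None then fmlookup S c else fmlookup T c)"
  by (auto simp: join_def in_fmdom_iff)

lemma join_upd: "c \<noteq> \<gamma> \<Longrightarrow> c |\<notin>| fmdom T \<Longrightarrow> join \<gamma> (fmupd c v S) T = fmupd c v (join \<gamma> S T)"
  by (rule fmap_ext) (auto simp: fmlookup_join in_fmdom_iff)

lemma join_upd_same [simp]: "join \<gamma> (fmupd \<gamma> v S) T = join \<gamma> S T" "join \<gamma> S (fmupd \<gamma> v T) = join \<gamma> S T"
  by (rule fmap_ext, auto simp: fmlookup_join)+

lemma join_commute:
  assumes "\<And>c. c |\<in>| fmdom S \<Longrightarrow> c |\<in>| fmdom T \<Longrightarrow> c = \<gamma>"
  shows "join \<gamma> S T = join \<gamma> T S"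
  by (rule fmap_ext) (use assms in \<open>auto simp: fmlookup_join in_fmdom_iff\<close>)

text \<open>Context bookkeeping for associativity: \<open>T\<close> is the middle sequent, to which
  \<open>S\<close> and \<open>U\<close> are attached along \<open>\<gamma>\<close> and
  \<open>\<delta>\<close>.\<close>

lemma join_join:
  assumes "fmdom S |\<inter>| fmdom U = {||}" "\<gamma> |\<notin>| fmdom U" "\<delta> |\<notin>| fmdom S"
    "\<And>c. c |\<in>| fmdom S \<Longrightarrow> c |\<in>| fmdom T \<Longrightarrow> c = \<gamma>"
    "\<And>c. c |\<in>| fmdom T \<Longrightarrow> c |\<in>| fmdom U \<Longrightarrow> c = \<delta>"
  shows "join \<gamma> (join \<delta> T U) S = join \<delta> (join \<gamma> T S) U"
  by (rule fmap_ext) (use assms in \<open>auto simp: fmlookup_join in_fmdom_iff fmdom_disjoint_iff\<close>)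

lemma join_rename: "rename_ctx p (join \<gamma> S T) = join (apply p \<gamma>) (rename_ctx p S) (rename_ctx p T)"
  by (simp add: join_def)

lemma compat_rename: "compat \<gamma> s S T \<Longrightarrow> compat (apply p \<gamma>) s (rename_ctx p S) (rename_ctx p T)"
  by (auto simp: compat_def fset_eq_iff in_fmdom_iff apply_inverse_eq_iff)

section \<open>Polycategories in signed form\<close>

lemma compat_join_commute: "compat \<gamma> s S T \<Longrightarrow> join \<gamma> T S = join \<gamma> S T"
  by (rule join_commute) (metis compat_dom)

lemma part_join:
  assumes c: "compat \<gamma> True S T"
  shows "part False (join \<gamma> S T) = part False S ++\<^sub>f fmdrop \<gamma> (part False T)"
    "part True (join \<gamma> S T) = fmdrop \<gamma> (part True S) ++\<^sub>f part True T"
proof -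
  obtain Z where Z: "fmlookup S \<gamma> = Some (True, Z)" "fmlookup T \<gamma> = Some (False, Z)"
    using c by (auto simp: compat_def)
  have disj: "fmlookup S c = None \<or> fmlookup T c = None" if "c \<noteq> \<gamma>" for c
    using compat_dom[OF c, of c] that unfolding in_fmdom_iff by blast
  have "fmlookup (part False (join \<gamma> S T)) c = Some X \<longleftrightarrow>
      fmlookup (part False S ++\<^sub>f fmdrop \<gamma> (part False T)) c = Some X" for c X
    using disj[of c] Z unfolding fmlookup_add_Some fmlookup_part_Some
    by (cases "c = \<gamma>") (auto simp: fmlookup_join fmlookup_part_None)
  then show "part False (join \<gamma> S T) = part False S ++\<^sub>f fmdrop \<gamma> (part False T)"
    by (rule fmap_eqI)
  have "fmlookup (part True (join \<gamma> S T)) c = Some X \<longleftrightarrow>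
      fmlookup (fmdrop \<gamma> (part True S) ++\<^sub>f part True T) c = Some X" for c X
    using disj[of c] Z unfolding fmlookup_add_Some fmlookup_part_Some
    by (cases "c = \<gamma>") (auto simp: fmlookup_join fmlookup_part_None)
  then show "part True (join \<gamma> S T) = fmdrop \<gamma> (part True S) ++\<^sub>f part True T"
    by (rule fmap_eqI)
qed

text \<open>Once \<open>\<gamma>\<close> is dropped the two contexts are disjoint, so either order
  of \<open>++\<^sub>f\<close> is correct. Both are recorded because the two naturality laws of
  \<open>poly_sum\<close> add the contexts of the other polymorphism on different sides.\<close>

lemma part_join_drop:
  assumes "compat \<gamma> s S T"
  shows "part b (join \<gamma> S T) = fmdrop \<gamma> (part b S) ++\<^sub>f fmdrop \<gamma> (part b T)"
    and "part b (join \<gamma> S T) = fmdrop \<gamma> (part b T) ++\<^sub>f fmdrop \<gamma> (part b S)"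
proof -
  have disj: "fmlookup S c = None \<or> fmlookup T c = None" if "c \<noteq> \<gamma>" for c
    using compat_dom[OF assms, of c] that unfolding in_fmdom_iff by blast
  have "fmlookup (part b (join \<gamma> S T)) c = Some X \<longleftrightarrow> fmlookup (fmdrop \<gamma> (part b S) ++\<^sub>f fmdrop \<gamma> (part b T)) c = Some X" for c X
    using disj[of c] unfolding fmlookup_add_Some fmlookup_part_Some
    by (cases "c = \<gamma>") (auto simp: fmlookup_join fmlookup_part_None)
  then show "part b (join \<gamma> S T) = fmdrop \<gamma> (part b S) ++\<^sub>f fmdrop \<gamma> (part b T)"
    by (rule fmap_eqI)
  have "fmlookup (part b (join \<gamma> S T)) c = Some X \<longleftrightarrow> fmlookup (fmdrop \<gamma> (part b T) ++\<^sub>f fmdrop \<gamma> (part b S)) c = Some X" for c X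
    using disj[of c] unfolding fmlookup_add_Some fmlookup_part_Some
    by (cases "c = \<gamma>") (auto simp: fmlookup_join fmlookup_part_None)
  then show "part b (join \<gamma> S T) = fmdrop \<gamma> (part b T) ++\<^sub>f fmdrop \<gamma> (part b S)"
    by (rule fmap_eqI)
qed

lemma fmdrop_part: "fmlookup S \<gamma> = Some (\<not> b, Z) \<Longrightarrow> fmdrop \<gamma> (part b S) = part b S"
  by (rule fmdrop_idle) (auto simp: in_fmdom_iff)

lemma compat_updD: "compat \<gamma> s (fmupd \<alpha> v S) T \<Longrightarrow> \<alpha> \<noteq> \<gamma> \<Longrightarrow> compat \<gamma> s S T"
  unfolding compat_def fset_eq_iff by (auto simp: in_fmdom_iff)

lemma fmdom_signed [simp]: "fmdom (signed \<Gamma> \<Delta>) = fmdom \<Gamma> |\<union>| fmdom \<Delta>"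
  by (simp add: signed_def)

lemma rename_signed: "rename_ctx p (signed \<Gamma> \<Delta>) = signed (rename_ctx p \<Gamma>) (rename_ctx p \<Delta>)"
  by (simp add: signed_def)

definition sig :: "('o, 'm, 'z) polycat_scheme \<Rightarrow> 'm \<Rightarrow> (chan, bool \<times> 'o) fmap" where
  "sig P f = signed (src P f) (tgt P f)"

text \<open>For sign \<open>False\<close> the arguments change places, so \<open>s\<close> is always
  the side of the first argument on which the cut channel lies.\<close>

definition pcut :: "('o, 'm, 'z) polycat_scheme \<Rightarrow> bool \<Rightarrow> chan \<Rightarrow> 'm \<Rightarrow> 'm \<Rightarrow> 'm" where
  "pcut P s \<gamma> f g = (if s then cut P \<gamma> f g else cut P \<gamma> g f)"

text \<open>The sign is that of the second channel \<open>\<beta>\<close>; the first channel carries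
  the opposite one.\<close>

definition pidn :: "('o, 'm, 'z) polycat_scheme \<Rightarrow> bool \<Rightarrow> chan \<Rightarrow> chan \<Rightarrow> 'o \<Rightarrow> 'm" where
  "pidn P s \<alpha> \<beta> X = (if s then idn P \<alpha> \<beta> X else idn P \<beta> \<alpha> X)"

lemma pcut_not: "pcut P (\<not> s) \<gamma> f g = pcut P s \<gamma> g f"
  by (simp add: pcut_def)

lemma pidn_not: "pidn P (\<not> s) \<alpha> \<beta> X = pidn P s \<beta> \<alpha> X"
  by (simp add: pidn_def)

context polycategory
begin

lemma src_sig: "f \<in> arr P \<Longrightarrow> src P f = part False (sig P f)"
  and tgt_sig: "f \<in> arr P \<Longrightarrow> tgt P f = part True (sig P f)"
  using arr_sequent[of f] by (simp_all add: sig_def part_signed sequent_def)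

lemma sig_hom: "f \<in> hom P (part False S) (part True S) \<longleftrightarrow> f \<in> arr P \<and> sig P f = S"
  by (auto simp: hom_def sig_def) (simp_all flip: sig_def src_sig tgt_sig)

lemma fmdom_sig: "fmdom (sig P f) = chans P f"
  by (simp add: sig_def chans_def)

lemma cuttable_sig: "cuttable P \<gamma> f g \<longleftrightarrow> f \<in> arr P \<and> g \<in> arr P \<and> compat \<gamma> True (sig P f) (sig P g)"
  by (auto simp: cuttable_def compat_def fmdom_sig src_sig tgt_sig)

lemma cuttable_pcut: "f \<in> arr P \<Longrightarrow> g \<in> arr P \<Longrightarrow> compat \<gamma> s (sig P f) (sig P g) \<Longrightarrow>
    if s then cuttable P \<gamma> f g else cuttable P \<gamma> g f"
  using compat_sym[of \<gamma> s "sig P f" "sig P g"] by (cases s) (simp_all add: cuttable_sig)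

lemma cut_sig:
  assumes c: "cuttable P \<gamma> f g"
  shows "cut P \<gamma> f g \<in> arr P" "sig P (cut P \<gamma> f g) = join \<gamma> (sig P f) (sig P g)"
proof -
  have f: "f \<in> arr P" "g \<in> arr P" "compat \<gamma> True (sig P f) (sig P g)"
    using c by (simp_all add: cuttable_sig)
  have "cut P \<gamma> f g \<in> hom P (part False (join \<gamma> (sig P f) (sig P g))) (part True (join \<gamma> (sig P f) (sig P g)))"
    using cut_hom[OF c] f by (simp add: src_sig tgt_sig part_join)
  then show "cut P \<gamma> f g \<in> arr P" "sig P (cut P \<gamma> f g) = join \<gamma> (sig P f) (sig P g)"
    by (simp_all add: sig_hom)
qed

lemma pcut:
  assumes "f \<in> arr P" "g \<in> arr P" "compat \<gamma> s (sig P f) (sig P g)"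
  shows "pcut P s \<gamma> f g \<in> arr P" "sig P (pcut P s \<gamma> f g) = join \<gamma> (sig P f) (sig P g)"
  using cuttable_pcut[OF assms] cut_sig[of \<gamma> f g] cut_sig[of \<gamma> g f] compat_join_commute[OF assms(3)]
  by (cases s; simp add: pcut_def)+

lemma ren_sig: "f \<in> arr P \<Longrightarrow> ren P p f \<in> arr P"
  "f \<in> arr P \<Longrightarrow> sig P (ren P p f) = rename_ctx p (sig P f)"
  using ren_hom[of f p] by (simp_all add: hom_def sig_def rename_signed)

lemma ren_pcut:
  assumes "f \<in> arr P" "g \<in> arr P" "compat \<gamma> s (sig P f) (sig P g)"
  shows "ren P p (pcut P s \<gamma> f g) = pcut P s (apply p \<gamma>) (ren P p f) (ren P p g)"
  using cuttable_pcut[OF assms] by (cases s) (simp_all add: pcut_def ren_cut)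

lemma ren_fix_sig: "f \<in> arr P \<Longrightarrow> (\<And>c. c |\<in>| fmdom (sig P f) \<Longrightarrow> apply p c = c) \<Longrightarrow> ren P p f = f"
  by (rule ren_fix) (simp_all add: fmdom_sig)

lemma ren_swap_fix: "f \<in> arr P \<Longrightarrow> a |\<notin>| fmdom (sig P f) \<Longrightarrow> b |\<notin>| fmdom (sig P f) \<Longrightarrow> ren P (Perm.swap a b) f = f"
  by (rule ren_fix_sig) (metis apply_swap_same)+

lemma ren_swap_swap: "f \<in> arr P \<Longrightarrow> ren P (Perm.swap a b) (ren P (Perm.swap a b) f) = f"
  by (simp add: ren_mult[symmetric] ren_fix)

text \<open>The middle polymorphism \<open>g\<close> is cut with both others. According to the sides
  of the two channels this one equation is associativity, read in one direction or the other, or one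
  of the two interchange laws.\<close>

lemma pcut_assoc:
  assumes f: "f \<in> arr P" and g: "g \<in> arr P" and h: "h \<in> arr P"
    and c: "compat \<gamma> s (sig P g) (sig P f)" and d: "compat \<delta> r (sig P g) (sig P h)"
    and disj: "fmdom (sig P f) |\<inter>| fmdom (sig P h) = {||}"
  shows "pcut P r \<delta> (pcut P s \<gamma> g f) h = pcut P s \<gamma> (pcut P r \<delta> g h) f"
proof -
  note c' = cuttable_pcut[OF g f c] and d' = cuttable_pcut[OF g h d]
  have disj: "chans P f |\<inter>| chans P h = {||}" "chans P h |\<inter>| chans P f = {||}"
    using disj by (simp_all add: fmdom_sig inf_commute)
  show ?thesis
    using c' d' assoc[of \<gamma> f g \<delta> h, OF _ _ disj(1)] assoc[of \<delta> h g \<gamma> f, OF _ _ disj(2)]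
      interchange_tgt[of \<gamma> g f \<delta> h, OF _ _ disj(1)] interchange_src[of \<gamma> f g \<delta> h, OF _ _ disj(1)]
    by (cases s; cases r) (simp_all add: pcut_def)
qed

lemma pidn:
  assumes "X \<in> obj P" "\<alpha> \<noteq> \<beta>"
  shows "pidn P s \<alpha> \<beta> X \<in> arr P" "sig P (pidn P s \<alpha> \<beta> X) = fmupd \<alpha> (\<not> s, X) (single \<beta> (s, X))"
proof -
  have h: "idn P \<alpha> \<beta> X \<in> hom P (single \<alpha> X) (single \<beta> X)" "idn P \<beta> \<alpha> X \<in> hom P (single \<beta> X) (single \<alpha> X)"
    using idn_hom assms by auto
  then show "pidn P s \<alpha> \<beta> X \<in> arr P"
    by (simp add: pidn_def hom_def)
  show "sig P (pidn P s \<alpha> \<beta> X) = fmupd \<alpha> (\<not> s, X) (single \<beta> (s, X))"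
    by (rule fmap_ext) (use h assms in \<open>auto simp: pidn_def hom_def sig_def signed_def in_fmdom_iff\<close>)
qed

lemma ren_pidn: "X \<in> obj P \<Longrightarrow> \<alpha> \<noteq> \<beta> \<Longrightarrow> ren P p (pidn P s \<alpha> \<beta> X) = pidn P s (apply p \<alpha>) (apply p \<beta>) X"
  by (simp add: pidn_def ren_idn)

text \<open>Both unit laws in one: the free end of the identity is fresh, and the cut merely moves
  \<open>\<gamma>\<close> to it.\<close>

lemma pcut_pidn:
  assumes "f \<in> arr P" "fmlookup (sig P f) \<gamma> = Some (s, X)" "\<beta> |\<notin>| fmdom (sig P f)"
  shows "pcut P s \<gamma> f (pidn P s \<gamma> \<beta> X) = ren P (Perm.swap \<gamma> \<beta>) f"
  using assms cut_idn[of f \<gamma> X \<beta>] idn_cut[of f \<gamma> X \<beta>]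
  by (cases s) (simp_all add: pcut_def pidn_def src_sig tgt_sig fmdom_sig)

end

text \<open>The double opposite in the second branch forgets additional record fields, so that both
  branches have the same type.\<close>

definition sided :: "bool \<Rightarrow> ('o, 'm, 'z) polycat_scheme \<Rightarrow> ('o, 'm) polycat" where
  "sided s A = (if s then opposite A else opposite (opposite A))"

text \<open>The contexts change places together with the two sides, as in the definition of
  \<open>poly_product\<close>.\<close>

definition sided_cotuple :: "bool \<Rightarrow> ('o, 'm, 'z) sp_polycat_scheme \<Rightarrow> (name, 'o) fmap \<Rightarrow> 'o ctx \<Rightarrow> 'o ctx \<Rightarrow> chan
    \<Rightarrow> (name, 'm) fmap \<Rightarrow> 'm" where
  "sided_cotuple s A X \<Gamma> \<Delta> = (if s then tuple A X \<Delta> \<Gamma> else cotuple A X \<Gamma> \<Delta>)"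

lemma sided_simps [simp]: "obj (sided s A) = obj A" "arr (sided s A) = arr A"
  "src (sided s A) = (if s then tgt A else src A)" "tgt (sided s A) = (if s then src A else tgt A)"
  "cut (sided s A) \<gamma> f g = (if s then cut A \<gamma> g f else cut A \<gamma> f g)" "ren (sided s A) = ren A"
  by (simp_all add: sided_def opposite_def)

lemma poly_sum_opposite_opposite: "poly_sum (opposite (opposite A)) X S ct = poly_sum A X S ct"
  by (simp add: poly_sum_def opposite_def cofamilies_def hom_def cuttable_def chans_def)

definition pfamilies :: "('o, 'm, 'z) polycat_scheme \<Rightarrow> bool \<Rightarrow> (name, 'o) fmap \<Rightarrow> (chan, bool \<times> 'o) fmap \<Rightarrow> chan
    \<Rightarrow> (name, 'm) fmap set" where
  "pfamilies P s X S \<alpha> = {fs. fmrel (\<lambda>f Y. f \<in> arr P \<and> sig P f = fmupd \<alpha> (s, Y) S) fs X}"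

lemma pfamilies_dom: "fs \<in> pfamilies P s X S \<alpha> \<Longrightarrow> fmdom fs = fmdom X"
  by (simp add: pfamilies_def fmrel_fmdom_eq)

lemma pfamiliesD:
  assumes "fs \<in> pfamilies P s X S \<alpha>" "fmlookup X i = Some Y"
  obtains f where "fmlookup fs i = Some f" "f \<in> arr P" "sig P f = fmupd \<alpha> (s, Y) S"
  using assms unfolding pfamilies_def by (auto elim: fmrelE2)

lemma pfamiliesI:
  assumes "fmdom fs = fmdom X"
    "\<And>i f Y. fmlookup fs i = Some f \<Longrightarrow> fmlookup X i = Some Y \<Longrightarrow> f \<in> arr P \<and> sig P f = fmupd \<alpha> (s, Y) S"
  shows "fs \<in> pfamilies P s X S \<alpha>"
  unfolding pfamilies_def fmrel_Some_iff mem_Collect_eq using assms by blast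

lemma pfamilies_map:
  assumes "fs \<in> pfamilies P s X S \<alpha>"
    "\<And>f Y. f \<in> arr P \<Longrightarrow> sig P f = fmupd \<alpha> (s, Y) S \<Longrightarrow> Y \<in> fmran' X \<Longrightarrow>
      h f \<in> arr P \<and> sig P (h f) = fmupd \<beta> (s, Y) T"
  shows "fmmap h fs \<in> pfamilies P s X T \<beta>"
  using assms(1) unfolding pfamilies_def mem_Collect_eq fmap.rel_map
  by (rule fmap.rel_mono_strong) (metis assms(2))

lemma pfamilies_eqI:
  assumes "fs \<in> pfamilies P s X S \<alpha>" "fmdom gs = fmdom X"
    "\<And>i Y f. fmlookup X i = Some Y \<Longrightarrow> fmlookup fs i = Some f \<Longrightarrow> f \<in> arr P \<Longrightarrow> sig P f = fmupd \<alpha> (s, Y) S \<Longrightarrow> fmlookup gs i = Some f"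
  shows "fs = gs"
proof (rule fmap_ext)
  fix i
  show "fmlookup fs i = fmlookup gs i"
  proof (cases "fmlookup X i")
    case None
    then show ?thesis using pfamilies_dom[OF assms(1)] assms(2) by (metis fmdom_notD fmdom_notI)
  next
    case (Some Y)
    from pfamiliesD[OF assms(1) this] assms(3)[OF this] show ?thesis by metis
  qed
qed

lemma pfamilies_lookup:
  assumes "fs \<in> pfamilies P s X S \<alpha>" "fmlookup fs i = Some f" "fmlookup X i = Some Y"
  shows "f \<in> arr P" "sig P f = fmupd \<alpha> (s, Y) S"
  using assms unfolding pfamilies_def fmrel_Some_iff mem_Collect_eq by blast+

lemma pfamilies_rel:
  assumes "fs \<in> pfamilies P s X S \<alpha>"
    "\<And>f Y. f \<in> arr P \<Longrightarrow> sig P f = fmupd \<alpha> (s, Y) S \<Longrightarrow> R f f"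
  shows "fmrel R fs fs"
proof (rule fmrel_Some_iff[THEN iffD2], intro conjI allI impI HOL.refl)
  fix i f g assume f: "fmlookup fs i = Some f" and "fmlookup fs i = Some g"
  then have "g = f" by simp
  obtain Y where Y: "fmlookup X i = Some Y"
    using f pfamilies_dom[OF assms(1)] by (metis fmdomE fmdomI)
  show "R f g"
    unfolding \<open>g = f\<close> by (rule assms(2)[OF pfamilies_lookup[OF assms(1) f Y]])
qed

section \<open>Hom-sets and families of a polycategory and of its opposite in signed form\<close>

context polycategory
begin

lemma sided_parts:
  assumes "sequent Ob \<Gamma> \<Delta>"
  obtains S where "\<Gamma> = part s S" "\<Delta> = part (\<not> s) S" "over Ob S" "fmdom S = fmdom \<Gamma> |\<union>| fmdom \<Delta>"
proof (cases s)
  case True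
  have d: "fmdom \<Delta> |\<inter>| fmdom \<Gamma> = {||}" using assms by (simp add: sequent_def inf_commute)
  show thesis
    by (rule that[of "signed \<Delta> \<Gamma>"])
      (use True assms in \<open>auto simp: part_signed[OF d] sequent_part[symmetric] sequent_def\<close>)
next
  case False
  have d: "fmdom \<Gamma> |\<inter>| fmdom \<Delta> = {||}" using assms by (simp add: sequent_def)
  show thesis
    by (rule that[of "signed \<Gamma> \<Delta>"])
      (use False assms in \<open>auto simp: part_signed[OF d] sequent_part[symmetric] sequent_def\<close>)
qed

lemma hom_sided_sig: "hom (sided s P) (part s S) (part (\<not> s) S) = {f \<in> arr P. sig P f = S}"
  using sig_hom[of _ S] by (cases s) (auto simp: hom_def)

lemma cofamilies_sided_sig:
  assumes "\<alpha> |\<notin>| fmdom S"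
  shows "cofamilies (sided s P) X (part s S) (part (\<not> s) S) \<alpha> = pfamilies P s X S \<alpha>"
proof -
  have "hom (sided s P) (fmupd \<alpha> Y (part s S)) (part (\<not> s) S) = {f \<in> arr P. sig P f = fmupd \<alpha> (s, Y) S}" for Y
    using hom_sided_sig[of s "fmupd \<alpha> (s, Y) S"] assms by (simp add: part_upd)
  then show ?thesis
    by (simp add: cofamilies_def pfamilies_def)
qed

lemma cuttable_sided_sig:
  "cuttable (sided s P) \<gamma> h f \<longleftrightarrow> h \<in> arr P \<and> f \<in> arr P \<and> compat \<gamma> s (sig P f) (sig P h)"
  "cuttable (sided s P) \<gamma> f h \<longleftrightarrow> h \<in> arr P \<and> f \<in> arr P \<and> compat \<gamma> (\<not> s) (sig P f) (sig P h)"
proof -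
  have 1: "cuttable (sided s P) \<gamma> h f \<longleftrightarrow> (if s then cuttable P \<gamma> f h else cuttable P \<gamma> h f)" for h f
    by (cases s) (auto simp: sided_def opposite_def cuttable_def chans_def)
  show "cuttable (sided s P) \<gamma> h f \<longleftrightarrow> h \<in> arr P \<and> f \<in> arr P \<and> compat \<gamma> s (sig P f) (sig P h)"
    "cuttable (sided s P) \<gamma> f h \<longleftrightarrow> h \<in> arr P \<and> f \<in> arr P \<and> compat \<gamma> (\<not> s) (sig P f) (sig P h)"
    unfolding 1 using compat_sym[of \<gamma> True "sig P f" "sig P h"] compat_sym[of \<gamma> False "sig P f" "sig P h"]
      compat_sym[of \<gamma> True "sig P h" "sig P f"] compat_sym[of \<gamma> False "sig P h" "sig P f"]
    by (cases s; auto simp: cuttable_sig)+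
qed

lemma families_sided: "families P X \<Gamma> \<Delta> \<alpha> = cofamilies (sided True P) X \<Delta> \<Gamma> \<alpha>"
proof -
  have "hom (sided True P) \<Gamma> \<Delta> = hom P \<Delta> \<Gamma>" for \<Gamma> \<Delta>
    by (auto simp: hom_def)
  then show ?thesis
    by (simp add: families_def cofamilies_def)
qed

lemma cofamilies_sided_False: "cofamilies (sided False P) X \<Gamma> \<Delta> \<alpha> = cofamilies P X \<Gamma> \<Delta> \<alpha>"
proof -
  have "hom (sided False P) \<Gamma> \<Delta> = hom P \<Gamma> \<Delta>" for \<Gamma> \<Delta>
    by (auto simp: hom_def)
  then show ?thesis
    by (simp add: cofamilies_def)
qed

end

section \<open>Derivations of signed sequents\<close>

text \<open>The sign of a connective is the side on which its rule takes a whole family: the domain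
  for sums and the codomain for products. A selection on side \<open>s\<close> therefore introduces
  \<open>con (\<not> s)\<close>.\<close>

definition con :: "bool \<Rightarrow> (name, 'o form) fmap \<Rightarrow> 'o form" where
  "con s X = (if s then Prod X else Sum X)"

definition fam :: "bool \<Rightarrow> (chan, bool \<times> 'o form) fmap \<Rightarrow> chan \<Rightarrow> (name, 'o form) fmap
    \<Rightarrow> (name, ('o, 'm) deriv) fmap \<Rightarrow> ('o, 'm) deriv" where
  "fam s S \<alpha> X fs = (if s then Tuple else Cotuple) (part False S) (part True S) \<alpha> X fs"

definition sel :: "bool \<Rightarrow> chan \<Rightarrow> name \<Rightarrow> (name, 'o form) fmap \<Rightarrow> ('o, 'm) deriv \<Rightarrow> ('o, 'm) deriv" where
  "sel s \<alpha> k X f = (if s then Inj else Proj) \<alpha> k X f"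

definition xcut :: "bool \<Rightarrow> chan \<Rightarrow> ('o, 'm) deriv \<Rightarrow> ('o, 'm) deriv \<Rightarrow> ('o, 'm) deriv" where
  "xcut s \<gamma> f g = (if s then Cut \<gamma> f g else Cut \<gamma> g f)"

text \<open>As for \<open>pidn\<close>, the sign belongs to the second channel.\<close>

definition xi :: "('o, 'm, 'z) polycat_scheme \<Rightarrow> bool \<Rightarrow> chan \<Rightarrow> chan \<Rightarrow> 'o form \<Rightarrow> ('o, 'm) deriv" where
  "xi A s \<alpha> \<beta> Z = (if s then iota A \<alpha> \<beta> Z else iota A \<beta> \<alpha> Z)"

definition der :: "('o, 'm, 'z) polycat_scheme \<Rightarrow> ('o, 'm) deriv \<Rightarrow> (chan, bool \<times> 'o form) fmap \<Rightarrow> bool" where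
  "der A t S \<longleftrightarrow> derives A t (part False S) (part True S)"

lemma xcut_not: "xcut (\<not> s) \<gamma> f g = xcut s \<gamma> g f"
  by (simp add: xcut_def)

lemma con_inject [simp]: "con s X = con s' Y \<longleftrightarrow> s = s' \<and> X = Y"
  by (simp add: con_def)

lemma con_neq_Atom [simp]: "con s X \<noteq> Atom a" "Atom a \<noteq> con s X"
  by (simp_all add: con_def)

lemma form_induct [case_names atom con]:
  assumes "\<And>a. P (Atom a)" "\<And>s X. (\<And>i Y. fmlookup X i = Some Y \<Longrightarrow> P Y) \<Longrightarrow> P (con s X)"
  shows "P Z"
proof (induction Z)
  case (Sum X)
  then show ?case using assms(2)[of X False] by (auto simp: con_def intro: fmran'I)
next
  case (Prod X)
  then show ?case using assms(2)[of X True] by (auto simp: con_def intro: fmran'I)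
qed (simp add: assms)

lemma con_formulas: "con s X \<in> formulas A \<longleftrightarrow> fmran' X \<subseteq> formulas A"
  by (cases s) (auto simp: con_def formulas_def)

lemma Sum_Prod_formulas: "Sum X \<in> formulas A \<longleftrightarrow> fmran' X \<subseteq> formulas A"
  "Prod X \<in> formulas A \<longleftrightarrow> fmran' X \<subseteq> formulas A"
  by (auto simp: formulas_def)

lemma Atom_formulas [simp]: "Atom a \<in> formulas A \<longleftrightarrow> a \<in> obj A"
  by (simp add: formulas_def)

lemma fmupd_eqD:
  assumes "fmupd c x m = fmupd c y n" "c |\<notin>| fmdom m" "c |\<notin>| fmdom n"
  shows "x = y" "m = n"
proof -
  show "x = y" using assms(1) by (metis fmupd_lookup option.inject)
  show "m = n" using assms by (metis fmdrop_fmupd_same fmdrop_idle)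
qed

text \<open>Families are annotated with both contexts. For a selection or a cut, the sequents of the
  premises are determined by induction, and removing the active channel from them leaves the
  contexts of the conclusion.\<close>

lemma derives_unique: "derives A t \<Gamma> \<Delta> \<Longrightarrow> derives A t \<Gamma>' \<Delta>' \<Longrightarrow> \<Gamma>' = \<Gamma> \<and> \<Delta>' = \<Delta>"
proof (induction arbitrary: \<Gamma>' \<Delta>' rule: derives.induct)
  case (proj f \<alpha> Y \<Gamma> \<Delta> X a)
  note IH = proj.IH and hyps = proj.hyps
  from proj.prems show ?case
  proof cases
    case (proj Y' \<Gamma>'')
    with IH[of "fmupd \<alpha> Y' \<Gamma>''" \<Delta>'] hyps show ?thesis
      using fmupd_eqD(2) by metis
  qed
next
  case (inj f \<Gamma> \<alpha> Y \<Delta> X a)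
  note IH = inj.IH and hyps = inj.hyps
  from inj.prems show ?case
  proof cases
    case (inj Y' \<Delta>'')
    with IH[of \<Gamma>' "fmupd \<alpha> Y' \<Delta>''"] hyps show ?thesis
      using fmupd_eqD(2) by metis
  qed
next
  case (cut f \<Gamma> \<gamma> Z \<Delta> g \<Gamma>' \<Delta>' \<Gamma>'' \<Delta>'')
  note IH = cut.IH and hyps = cut.hyps
  from cut.prems show ?case
  proof cases
    case (cut \<Gamma>1 Z' \<Delta>1 \<Gamma>2 \<Delta>2)
    have "\<Gamma>1 = \<Gamma>" "\<Delta>1 = \<Delta>"
      using IH(1)[of \<Gamma>1 "fmupd \<gamma> Z' \<Delta>1"] hyps cut fmupd_eqD(2) by metis+
    moreover have "\<Gamma>2 = \<Gamma>'" "\<Delta>2 = \<Delta>'"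
      using IH(2)[of "fmupd \<gamma> Z' \<Gamma>2" \<Delta>2] hyps cut fmupd_eqD(2) by metis+
    ultimately show ?thesis using cut by simp
  qed
qed (auto elim: derives.cases)

text \<open>Transitivity is the delicate rule: the sequents obtained from the two halves agree
  because the middle term has only one sequent.\<close>

lemma sim_derives: "sim A t u \<Longrightarrow> \<exists>\<Gamma> \<Delta>. derives A t \<Gamma> \<Delta> \<and> derives A u \<Gamma> \<Delta>"
proof (induction rule: sim.induct)
  case (trans t u v)
  then show ?case using derives_unique by metis
qed blast+

lemma sim_derivesD: "sim A t u \<Longrightarrow> derives A t \<Gamma> \<Delta> \<longleftrightarrow> derives A u \<Gamma> \<Delta>"
  using sim_derives derives_unique by metis

lemma sim_der: "sim A t u \<Longrightarrow> der A t S \<longleftrightarrow> der A u S"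
  by (simp add: der_def sim_derivesD)

lemma der_unique: "der A t S \<Longrightarrow> der A t T \<Longrightarrow> T = S"
  unfolding der_def by (metis derives_unique signed_part)

definition asig :: "('o, 'm, 'z) polycat_scheme \<Rightarrow> 'm \<Rightarrow> (chan, bool \<times> 'o form) fmap" where
  "asig A m = signed (fmmap Atom (src A m)) (fmmap Atom (tgt A m))"

text \<open>The annotations determine the whole last inference, so derivability of a family can be
  stated as an equivalence, which then rewrites in both introduction and inversion.\<close>

lemma der_fam_iff: "der A (fam s S \<alpha> X fs) T \<longleftrightarrow> T = fmupd \<alpha> (s, con s X) S \<and> \<alpha> |\<notin>| fmdom S \<and>
    over (formulas A) S \<and> fmran' X \<subseteq> formulas A \<and> fmrel (\<lambda>f Y. der A f (fmupd \<alpha> (s, Y) S)) fs X"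
    (is "?L \<longleftrightarrow> ?R")
proof
  assume ?R
  then have "sequent (formulas A) (part False (fmupd \<alpha> (s, con s X) S)) (part True (fmupd \<alpha> (s, con s X) S))"
    by (simp add: sequent_part over_upd con_formulas)
  then show ?L
    using \<open>?R\<close> by (auto simp: der_def part_upd fam_def con_def dest: in_fmdom_part
      intro!: derives.cotuple derives.tuple)
next
  assume L: ?L
  have *: "\<alpha> |\<notin>| fmdom S \<and> T = fmupd \<alpha> (s, con s X) S"
  proof (cases s)
    case True
    with L have "derives A (Tuple (part False S) (part True S) \<alpha> X fs) (part False T) (part True T)"
      by (simp add: der_def fam_def)
    then show ?thesis
    proof cases
      case tuple
      then have notin: "\<alpha> |\<notin>| fmdom S"
        using fmdom_part[of S] by (auto simp: sequent_def fset_eq_iff)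
      moreover have "T = signed (part False S) (fmupd \<alpha> (Prod X) (part True S))"
        using tuple by (metis signed_part)
      then have "T = fmupd \<alpha> (s, con s X) S"
        using signed_part[of "fmupd \<alpha> (s, con s X) S"] notin True by (simp add: part_upd con_def)
      ultimately show ?thesis by simp
    qed
  next
    case False
    with L have "derives A (Cotuple (part False S) (part True S) \<alpha> X fs) (part False T) (part True T)"
      by (simp add: der_def fam_def)
    then show ?thesis
    proof cases
      case cotuple
      then have notin: "\<alpha> |\<notin>| fmdom S"
        using fmdom_part[of S] by (auto simp: sequent_def fset_eq_iff)
      moreover have "T = signed (fmupd \<alpha> (Sum X) (part False S)) (part True S)"
        using cotuple by (metis signed_part)
      then have "T = fmupd \<alpha> (s, con s X) S"
        using signed_part[of "fmupd \<alpha> (s, con s X) S"] notin False by (simp add: part_upd con_def)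
      ultimately show ?thesis by simp
    qed
  qed
  from L have "over (formulas A) T \<and> fmrel (\<lambda>f Y. der A f (fmupd \<alpha> (s, Y) S)) fs X"
    using * by (cases s) (auto simp: der_def fam_def part_upd sequent_part[symmetric] elim: derives.cases)
  then show ?R
    using * by (auto simp: over_upd con_formulas)
qed

lemma der_sel:
  assumes "der A f (fmupd \<alpha> (s, Y) S)" "\<alpha> |\<notin>| fmdom S" "fmlookup X k = Some Y" "fmran' X \<subseteq> formulas A"
  shows "der A (sel s \<alpha> k X f) (fmupd \<alpha> (s, con (\<not> s) X) S)"
  using assms by (auto simp: der_def part_upd sel_def con_def Sum_Prod_formulas
      dest: in_fmdom_part intro!: derives.proj derives.inj)

lemma der_xcut:
  assumes "der A f S" "der A g T" "compat \<gamma> s S T"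
  shows "der A (xcut s \<gamma> f g) (join \<gamma> S T)"
proof -
  have True_case: "der A (Cut \<gamma> f g) (join \<gamma> S T)"
    if f: "der A f S" and g: "der A g T" and c: "compat \<gamma> True S T" for f g S T
  proof -
    obtain Z where Z: "fmlookup S \<gamma> = Some (True, Z)" "fmlookup T \<gamma> = Some (False, Z)"
      using c by (auto simp: compat_def)
    have disj: "c = \<gamma>" if "fmlookup S c = Some v" "fmlookup T c = Some w" for c v w
      using compat_dom[OF c] that by (auto simp: fmlookup_dom_iff)
    have "fmupd \<gamma> Z (fmdrop \<gamma> (part True S)) = part True S" "fmupd \<gamma> Z (fmdrop \<gamma> (part False T)) = part False T"
      by (rule fmap_eqI, use Z in auto)+
    then have "derives A (Cut \<gamma> f g) (part False S ++\<^sub>f fmdrop \<gamma> (part False T)) (fmdrop \<gamma> (part True S) ++\<^sub>f part True T)"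
      using f g unfolding der_def
      by (intro derives.cut[where Z = Z]) (auto simp: fset_eq_iff fmlookup_dom_iff Z dest: disj)
    then show ?thesis
      by (simp add: der_def part_join[OF c])
  qed
  show ?thesis
  proof (cases s)
    case True
    with True_case[OF assms(1,2)] assms(3) show ?thesis by (simp add: xcut_def)
  next
    case False
    with True_case[OF assms(2,1)] compat_sym[OF assms(3)] show ?thesis
      using compat_join_commute[OF assms(3)] by (simp add: xcut_def)
  qed
qed

lemma fmran'_upd: "c |\<notin>| fmdom m \<Longrightarrow> fmran' (fmupd c x m) = insert x (fmran' m)"
  by (auto simp: fmlookup_ran'_iff in_fmdom_iff split: if_splits) (metis option.distinct(1))

lemma derives_sequent:
  assumes "polycategory A" "derives A t \<Gamma> \<Delta>"
  shows "sequent (formulas A) \<Gamma> \<Delta>"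
proof -
  interpret polycategory A by fact
  show ?thesis
    using assms(2)
  proof induction
    case (axiom m)
    from arr_sequent[OF this] show ?case
      by (auto simp: sequent_def)
  next
    case (proj f \<alpha> Y \<Gamma> \<Delta> X a)
    then show ?case by (simp add: sequent_def fmran'_upd)
  next
    case (inj f \<Gamma> \<alpha> Y \<Delta> X a)
    then show ?case by (simp add: sequent_def fmran'_upd)
  next
    case (cut f \<Gamma> \<gamma> Z \<Delta> g \<Gamma>' \<Delta>')
    have "fmran' (m ++\<^sub>f n) \<subseteq> fmran' m \<union> fmran' n" for m n :: "'a form ctx"
      unfolding fmlookup_ran'_iff fmlookup_add_Some subset_iff Un_iff by blast
    then have "fmran' (\<Gamma> ++\<^sub>f \<Gamma>') \<subseteq> formulas A" "fmran' (\<Delta> ++\<^sub>f \<Delta>') \<subseteq> formulas A"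
      using cut by (auto simp: sequent_def fmran'_upd dest!: subsetD)
    moreover have "fmdom (\<Gamma> ++\<^sub>f \<Gamma>') |\<inter>| fmdom (\<Delta> ++\<^sub>f \<Delta>') = {||}"
      using cut unfolding sequent_def by auto
    ultimately show ?case
      by (simp add: sequent_def)
  qed (auto simp: sequent_def)
qed

lemma der_over: "polycategory A \<Longrightarrow> der A t S \<Longrightarrow> over (formulas A) S"
  using derives_sequent by (force simp: der_def sequent_part[symmetric])

lemma derives_der:
  assumes "polycategory A" "derives A t \<Gamma> \<Delta>"
  shows "der A t (signed \<Gamma> \<Delta>)"
  using assms derives_sequent[OF assms] by (simp add: der_def part_signed sequent_def)

section \<open>Congruence of \<open>sim\<close>, and the conversions for cuts in signed form\<close>

lemma sim_refl_der: "der A t S \<Longrightarrow> sim A t t"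
  unfolding der_def by (rule sim.refl)

lemma sim_conv: "conv A t u \<Longrightarrow> der A t S \<Longrightarrow> der A u S \<Longrightarrow> sim A t u"
  unfolding der_def by (rule sim.conv)

lemma fmrel_sim_der: "fmrel (sim A) fs gs \<Longrightarrow> fmrel (\<lambda>f Y. der A f (F Y)) fs X \<Longrightarrow> fmrel (\<lambda>f Y. der A f (F Y)) gs X"
  by (simp add: fmrel_Some_iff in_fmdom_iff fset_eq_iff) (metis not_None_eq sim_der)

lemma sim_fam:
  assumes "fmrel (sim A) fs gs" "der A (fam s S \<alpha> X fs) T"
  shows "sim A (fam s S \<alpha> X fs) (fam s S \<alpha> X gs)"
proof -
  have "der A (fam s S \<alpha> X gs) T"
    using assms fmrel_sim_der by (auto simp: der_fam_iff)
  then show ?thesis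
    using assms by (cases s) (auto simp: fam_def der_def intro: sim.cotuple sim.tuple)
qed

lemma sim_sel:
  assumes "sim A f g" "der A f (fmupd \<alpha> (s, Y) S)" "\<alpha> |\<notin>| fmdom S" "fmlookup X k = Some Y" "fmran' X \<subseteq> formulas A"
  shows "sim A (sel s \<alpha> k X f) (sel s \<alpha> k X g)"
proof -
  have "der A (sel s \<alpha> k X f) (fmupd \<alpha> (s, con (\<not> s) X) S)" "der A (sel s \<alpha> k X g) (fmupd \<alpha> (s, con (\<not> s) X) S)"
    using assms by (auto intro!: der_sel simp: sim_der)
  then show ?thesis
    using assms(1) by (cases s) (auto simp: sel_def der_def intro: sim.proj sim.inj)
qed

lemma sim_xcut:
  assumes "sim A f f'" "sim A g g'" "der A f S" "der A g T" "compat \<gamma> s S T"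
  shows "sim A (xcut s \<gamma> f g) (xcut s \<gamma> f' g')"
proof -
  have "der A (xcut s \<gamma> f g) (join \<gamma> S T)" "der A (xcut s \<gamma> f' g') (join \<gamma> S T)"
    using assms by (auto intro!: der_xcut simp: sim_der)
  then show ?thesis
    using assms(1,2) by (cases s) (auto simp: xcut_def der_def intro: sim.cut)
qed

lemma compat_upd: "\<alpha> \<noteq> \<gamma> \<Longrightarrow> compat \<gamma> s (fmupd \<alpha> v S) T \<longleftrightarrow> compat \<gamma> s (fmupd \<alpha> w S) T"
  "\<alpha> \<noteq> \<gamma> \<Longrightarrow> compat \<gamma> s S (fmupd \<alpha> v T) \<longleftrightarrow> compat \<gamma> s S (fmupd \<alpha> w T)"
  by (simp_all add: compat_def)

lemma compat_upd_same: "compat \<gamma> s (fmupd \<gamma> (s, Z) S) (fmupd \<gamma> (\<not> s, Z) T) \<longleftrightarrow>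
    compat \<gamma> s (fmupd \<gamma> (s, Z') S) (fmupd \<gamma> (\<not> s, Z') T)"
  by (simp add: compat_def)

lemma compat_notin: "compat \<gamma> s (fmupd \<alpha> v S) T \<Longrightarrow> \<alpha> \<noteq> \<gamma> \<Longrightarrow> \<alpha> |\<notin>| fmdom T"
  using compat_dom[of \<gamma> s "fmupd \<alpha> v S" T \<alpha>] by auto

text \<open>The conversions \<open>c3\<close>, \<open>c4\<close>, \<open>c9\<close> and
  \<open>c10\<close> at once. They leave the new annotation open; \<open>join \<gamma> S T\<close>
  is the one for which both sides derive the same sequent.\<close>

lemma xcut_fam:
  assumes f: "der A (fam s' S \<alpha> X fs) S'" and g: "der A g T" and c: "compat \<gamma> s S' T" and "\<alpha> \<noteq> \<gamma>"
    and A: "polycategory A"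
  shows "sim A (xcut s \<gamma> (fam s' S \<alpha> X fs) g) (fam s' (join \<gamma> S T) \<alpha> X (fmmap (\<lambda>f. xcut s \<gamma> f g) fs))"
proof (rule sim_conv)
  show "conv A (xcut s \<gamma> (fam s' S \<alpha> X fs) g) (fam s' (join \<gamma> S T) \<alpha> X (fmmap (\<lambda>f. xcut s \<gamma> f g) fs))"
    using \<open>\<alpha> \<noteq> \<gamma>\<close> by (cases s; cases s') (simp_all add: xcut_def fam_def conv.intros)
  show "der A (xcut s \<gamma> (fam s' S \<alpha> X fs) g) (join \<gamma> S' T)"
    by (rule der_xcut[OF f g c])
  have S': "S' = fmupd \<alpha> (s', con s' X) S"
    using f by (simp add: der_fam_iff)
  then have \<alpha>T: "\<alpha> |\<notin>| fmdom T"
    using c \<open>\<alpha> \<noteq> \<gamma>\<close> compat_notin by blast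
  have c': "compat \<gamma> s (fmupd \<alpha> (s', Y) S) T" for Y
    using c unfolding S' by (metis compat_upd(1)[OF \<open>\<alpha> \<noteq> \<gamma>\<close>])
  have "fmrel (\<lambda>f Y. der A f (fmupd \<alpha> (s', Y) (join \<gamma> S T))) (fmmap (\<lambda>f. xcut s \<gamma> f g) fs) X"
    using f \<alpha>T \<open>\<alpha> \<noteq> \<gamma>\<close> by (auto simp: der_fam_iff fmrel_Some_iff join_upd[symmetric]
        intro!: der_xcut[OF _ g c'])
  then show "der A (fam s' (join \<gamma> S T) \<alpha> X (fmmap (\<lambda>f. xcut s \<gamma> f g) fs)) (join \<gamma> S' T)"
    using f \<open>\<alpha> \<noteq> \<gamma>\<close> \<alpha>T S' over_join[OF _ der_over[OF A g]] by (auto simp: der_fam_iff join_upd)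
qed

text \<open>The conversions \<open>c5\<close> to \<open>c8\<close> at once. The second conclusion
  keeps the sequent in the shape needed to push further cuts into the premise.\<close>

lemma xcut_sel:
  assumes f: "der A f (fmupd \<alpha> (s', Y) S)" and \<alpha>: "\<alpha> |\<notin>| fmdom S" and X: "fmlookup X k = Some Y" "fmran' X \<subseteq> formulas A"
    and g: "der A g T" and c: "compat \<gamma> s (fmupd \<alpha> (s', con (\<not> s') X) S) T" and "\<alpha> \<noteq> \<gamma>"
  shows "sim A (xcut s \<gamma> (sel s' \<alpha> k X f) g) (sel s' \<alpha> k X (xcut s \<gamma> f g))"
    and "der A (xcut s \<gamma> f g) (fmupd \<alpha> (s', Y) (join \<gamma> S T))"
proof -
  have \<alpha>T: "\<alpha> |\<notin>| fmdom T"
    using c \<open>\<alpha> \<noteq> \<gamma>\<close> compat_notin by blast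
  show 1: "der A (xcut s \<gamma> f g) (fmupd \<alpha> (s', Y) (join \<gamma> S T))"
    using der_xcut[OF f g compat_upd(1)[OF \<open>\<alpha> \<noteq> \<gamma>\<close>, THEN iffD1, OF c]] \<open>\<alpha> \<noteq> \<gamma>\<close> \<alpha>T by (simp add: join_upd)
  show "sim A (xcut s \<gamma> (sel s' \<alpha> k X f) g) (sel s' \<alpha> k X (xcut s \<gamma> f g))"
  proof (rule sim_conv)
    show "conv A (xcut s \<gamma> (sel s' \<alpha> k X f) g) (sel s' \<alpha> k X (xcut s \<gamma> f g))"
      using \<open>\<alpha> \<noteq> \<gamma>\<close> by (cases s; cases s') (simp_all add: xcut_def sel_def conv.intros)
    show "der A (xcut s \<gamma> (sel s' \<alpha> k X f) g) (join \<gamma> (fmupd \<alpha> (s', con (\<not> s') X) S) T)"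
      by (rule der_xcut[OF der_sel[OF f \<alpha> X] g c])
    show "der A (sel s' \<alpha> k X (xcut s \<gamma> f g)) (join \<gamma> (fmupd \<alpha> (s', con (\<not> s') X) S) T)"
      using der_sel[OF 1 _ X] \<alpha> \<alpha>T \<open>\<alpha> \<noteq> \<gamma>\<close> by (simp add: join_upd)
  qed
qed

text \<open>The principal conversions \<open>c11\<close> and \<open>c12\<close> at once. The
  connective \<open>con (\<not> s) X\<close> is introduced by a selection on side \<open>s\<close>
  and by a family on the other side, so both meet in one formula.\<close>

lemma xcut_beta:
  assumes f: "der A f (fmupd \<gamma> (s, Y) S)" "\<gamma> |\<notin>| fmdom S" and X: "fmlookup X k = Some Y"
    and gs: "der A (fam (\<not> s) T \<gamma> X gs) T'"
    and c: "compat \<gamma> s (fmupd \<gamma> (s, con (\<not> s) X) S) T'" and g: "fmlookup gs k = Some g"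
  shows "sim A (xcut s \<gamma> (sel s \<gamma> k X f) (fam (\<not> s) T \<gamma> X gs)) (xcut s \<gamma> f g)"
proof (rule sim_conv)
  show "conv A (xcut s \<gamma> (sel s \<gamma> k X f) (fam (\<not> s) T \<gamma> X gs)) (xcut s \<gamma> f g)"
    using g by (cases s) (simp_all add: xcut_def fam_def sel_def conv.intros)
  have T': "T' = fmupd \<gamma> (\<not> s, con (\<not> s) X) T" and XA: "fmran' X \<subseteq> formulas A"
    using gs by (simp_all add: der_fam_iff)
  have "der A g (fmupd \<gamma> (\<not> s, Y) T)"
    using gs g X by (auto simp: der_fam_iff fmrel_Some_iff)
  then show "der A (xcut s \<gamma> f g) (join \<gamma> S T)"
    using der_xcut[OF f(1)] c unfolding T' by (metis compat_upd_same join_upd_same)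
  show "der A (xcut s \<gamma> (sel s \<gamma> k X f) (fam (\<not> s) T \<gamma> X gs)) (join \<gamma> S T)"
    using der_xcut[OF der_sel[OF f X XA] gs c] by (simp add: T')
qed

lemma asig_Some:
  assumes "polycategory A" "m \<in> arr A"
  shows "fmlookup (asig A m) c = Some (b, Z) \<longleftrightarrow> (\<exists>a. Z = Atom a \<and> fmlookup ((if b then tgt A else src A) m) c = Some a)"
proof -
  have "fmdom (src A m) |\<inter>| fmdom (tgt A m) = {||}"
    using assms by (simp add: polycategory.arr_sequent sequent_def polycategory_def)
  then have "part b (asig A m) = fmmap Atom ((if b then tgt A else src A) m)"
    by (simp add: asig_def part_signed)
  then have "fmlookup (part b (asig A m)) c = Some Z \<longleftrightarrow> fmlookup (fmmap Atom ((if b then tgt A else src A) m)) c = Some Z"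
    by simp
  then show ?thesis by auto
qed

lemma fmdom_asig: "fmdom (asig A m) = chans A m"
  by (simp add: asig_def signed_def chans_def)

lemma der_axiom:
  assumes "polycategory A" "m \<in> arr A"
  shows "der A (Axiom m) (asig A m)"
proof -
  have "part False (asig A m) = fmmap Atom (src A m)" "part True (asig A m) = fmmap Atom (tgt A m)"
    by (rule fmap_eqI, auto simp: asig_Some[OF assms])+
  then show ?thesis
    using derives.axiom[OF assms(2)] by (simp add: der_def)
qed

lemma compat_asig:
  assumes "polycategory A" "m \<in> arr A" "n \<in> arr A" "compat \<gamma> s (asig A m) (asig A n)"
  shows "if s then cuttable A \<gamma> m n else cuttable A \<gamma> n m"
  using assms(2-4) by (auto simp: cuttable_def compat_def asig_Some[OF assms(1)] fmdom_asig)

text \<open>The endpoint of pushing a cut upwards: between two axioms, \<open>c0\<close> turns it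
  into a composite in \<open>A\<close>, whose sequent is again atomic.\<close>

lemma pcut_axiom:
  assumes A: "polycategory A" and m: "m \<in> arr A" and n: "n \<in> arr A" and c: "compat \<gamma> s (asig A m) (asig A n)"
  shows "pcut A s \<gamma> m n \<in> arr A" and "asig A (pcut A s \<gamma> m n) = join \<gamma> (asig A m) (asig A n)"
    and "sim A (xcut s \<gamma> (Axiom m) (Axiom n)) (Axiom (pcut A s \<gamma> m n))"
proof -
  interpret polycategory A by fact
  have h: "pcut A s \<gamma> m n \<in> arr A \<and>
      src A (pcut A s \<gamma> m n) = (if s then src A m ++\<^sub>f fmdrop \<gamma> (src A n) else src A n ++\<^sub>f fmdrop \<gamma> (src A m)) \<and>
      tgt A (pcut A s \<gamma> m n) = (if s then fmdrop \<gamma> (tgt A m) ++\<^sub>f tgt A n else fmdrop \<gamma> (tgt A n) ++\<^sub>f tgt A m)"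
    using compat_asig[OF assms] cut_hom[of \<gamma> m n] cut_hom[of \<gamma> n m] by (auto simp: pcut_def hom_def)
  then show 1: "pcut A s \<gamma> m n \<in> arr A" by simp
  have "derives A (xcut s \<gamma> (Axiom m) (Axiom n)) (part False (asig A (pcut A s \<gamma> m n))) (part True (asig A (pcut A s \<gamma> m n)))"
  proof -
    have p: "part b (asig A k) = fmmap Atom ((if b then tgt A else src A) k)" if "k \<in> arr A" for b k
      by (rule fmap_eqI) (auto simp: asig_Some[OF A that])
    have "der A (xcut s \<gamma> (Axiom m) (Axiom n)) (join \<gamma> (asig A m) (asig A n))"
      by (intro der_xcut der_axiom A m n c)
    moreover have "part b (join \<gamma> (asig A m) (asig A n)) = part b (asig A (pcut A s \<gamma> m n))" for b
    proof (cases s)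
      case True
      with c h p[OF m] p[OF n] p[OF 1] show ?thesis by (cases b) (simp_all add: part_join)
    next
      case False
      with compat_sym[OF c] h p[OF m] p[OF n] p[OF 1] show ?thesis
        by (subst compat_join_commute[OF c, symmetric], cases b) (simp_all add: part_join)
    qed
    ultimately show ?thesis by (simp add: der_def)
  qed
  then have 2: "der A (xcut s \<gamma> (Axiom m) (Axiom n)) (asig A (pcut A s \<gamma> m n))"
    by (simp add: der_def)
  with der_xcut[OF der_axiom[OF A m] der_axiom[OF A n] c]
  show "asig A (pcut A s \<gamma> m n) = join \<gamma> (asig A m) (asig A n)"
    by (metis der_unique)
  show "sim A (xcut s \<gamma> (Axiom m) (Axiom n)) (Axiom (pcut A s \<gamma> m n))"
    by (rule sim_conv[OF _ 2 der_axiom[OF A 1]]) (simp add: xcut_def pcut_def conv.c0)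
qed

section \<open>Cut elimination\<close>

text \<open>The number bounds the height of the cut-free derivation.\<close>

inductive cfree :: "('o, 'm, 'z) polycat_scheme \<Rightarrow> nat \<Rightarrow> ('o, 'm) deriv \<Rightarrow> (chan, bool \<times> 'o form) fmap \<Rightarrow> bool"
  for A where
  ax: "m \<in> arr A \<Longrightarrow> cfree A n (Axiom m) (asig A m)"
| fam: "\<lbrakk>\<alpha> |\<notin>| fmdom S; over (formulas A) S; fmran' X \<subseteq> formulas A;
     fmrel (\<lambda>f Y. cfree A n f (fmupd \<alpha> (s, Y) S)) fs X\<rbrakk>
   \<Longrightarrow> cfree A (Suc n) (fam s S \<alpha> X fs) (fmupd \<alpha> (s, con s X) S)"
| sel: "\<lbrakk>cfree A n f (fmupd \<alpha> (s, Y) S); \<alpha> |\<notin>| fmdom S; fmlookup X k = Some Y; fmran' X \<subseteq> formulas A\<rbrakk>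
   \<Longrightarrow> cfree A (Suc n) (sel s \<alpha> k X f) (fmupd \<alpha> (s, con (\<not> s) X) S)"

text \<open>Axioms count as principal on every channel, since no conversion moves a cut past
  them.\<close>

definition principal :: "chan \<Rightarrow> ('o, 'm) deriv \<Rightarrow> bool" where
  "principal \<gamma> f \<longleftrightarrow> (\<exists>m. f = Axiom m) \<or> (\<exists>s S X fs. f = fam s S \<gamma> X fs) \<or> (\<exists>s k X g. f = sel s \<gamma> k X g)"

lemma principal_simps [simp]: "principal \<gamma> (Axiom m)"
  "principal \<gamma> (fam s S \<alpha> X fs) \<longleftrightarrow> \<alpha> = \<gamma>" "principal \<gamma> (sel s \<alpha> k X f) \<longleftrightarrow> \<alpha> = \<gamma>"
  unfolding principal_def by (blast, auto simp: fam_def sel_def split: if_splits)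

text \<open>The channel \<open>\<delta>\<close> lies in \<open>U\<close>, which is disjoint from
  \<open>S\<close>. Hence the cut with \<open>S\<close> leaves it in place and the second cut
  remains possible.\<close>

lemma compat_join:
  assumes "compat \<gamma> s T S" "compat \<delta> r T U" "fmdom S |\<inter>| fmdom U = {||}"
  shows "compat \<delta> r (join \<gamma> T S) U"
proof -
  obtain Z where Z: "fmlookup T \<delta> = Some (r, Z)" "fmlookup U \<delta> = Some (\<not> r, Z)"
    using assms(2) by (auto simp: compat_def)
  have "\<gamma> |\<in>| fmdom S" "\<delta> |\<in>| fmdom U"
    using compat_in assms(1,2) by metis+
  then have *: "\<delta> \<noteq> \<gamma>" "fmlookup S \<delta> = None"
    using assms(3) by auto
  show ?thesis
  proof (rule compatI)
    show "fmlookup (join \<gamma> T S) \<delta> = Some (r, Z)"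
      using Z * by (simp add: fmlookup_join)
    show "c = \<delta>" if "c |\<in>| fmdom (join \<gamma> T S)" "c |\<in>| fmdom U" for c
      using that assms(3) compat_dom[OF assms(2)] by auto
  qed (rule Z)
qed

lemma join_assoc:
  assumes "\<delta> |\<notin>| fmdom S" "\<gamma> |\<notin>| fmdom U"
  shows "join \<delta> (join \<gamma> S T) U = join \<gamma> S (join \<delta> T U)"
  by (rule fmap_ext) (use assms in \<open>auto simp: fmlookup_join in_fmdom_iff\<close>)

text \<open>Inversion relative to the cut channel. Either the last rule acts elsewhere, so that a
  cut can move past it, or it acts on \<open>\<gamma>\<close>, and then the sign and the outer
  connective of the formula there are known.\<close>

lemma cfree_cases [consumes 2, case_names ax fam sel pfam psel]:
  assumes "cfree A n f S" "fmlookup S \<gamma> = Some (b, Z)"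
  obtains
    m where "f = Axiom m" "m \<in> arr A" "S = asig A m"
  | n' s S0 \<alpha> X fs where "\<alpha> \<noteq> \<gamma>" "f = fam s S0 \<alpha> X fs" "n = Suc n'"
      "S = fmupd \<alpha> (s, con s X) S0" "\<alpha> |\<notin>| fmdom S0" "over (formulas A) S0" "fmran' X \<subseteq> formulas A"
      "fmrel (\<lambda>f Y. cfree A n' f (fmupd \<alpha> (s, Y) S0)) fs X"
  | n' s S0 \<alpha> X k Y g where "\<alpha> \<noteq> \<gamma>" "f = sel s \<alpha> k X g" "n = Suc n'"
      "S = fmupd \<alpha> (s, con (\<not> s) X) S0" "\<alpha> |\<notin>| fmdom S0" "fmlookup X k = Some Y" "fmran' X \<subseteq> formulas A"
      "cfree A n' g (fmupd \<alpha> (s, Y) S0)"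
  | n' S0 X fs where "f = fam b S0 \<gamma> X fs" "n = Suc n'" "Z = con b X"
      "S = fmupd \<gamma> (b, con b X) S0" "\<gamma> |\<notin>| fmdom S0" "over (formulas A) S0" "fmran' X \<subseteq> formulas A"
      "fmrel (\<lambda>f Y. cfree A n' f (fmupd \<gamma> (b, Y) S0)) fs X"
  | n' S0 X k Y g where "f = sel b \<gamma> k X g" "n = Suc n'" "Z = con (\<not> b) X"
      "S = fmupd \<gamma> (b, con (\<not> b) X) S0" "\<gamma> |\<notin>| fmdom S0" "fmlookup X k = Some Y" "fmran' X \<subseteq> formulas A"
      "cfree A n' g (fmupd \<gamma> (b, Y) S0)"
  using assms(1)
proof cases
  case (ax m)
  then show thesis using that(1) by blast
next
  case (fam \<alpha> S0 X n' s fs)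
  show thesis
  proof (cases "\<alpha> = \<gamma>")
    case True
    with fam assms(2) have "b = s" "Z = con s X" by auto
    with True fam show thesis using that(4) by blast
  next
    case False
    with fam show thesis using that(2) by blast
  qed
next
  case (sel n' g \<alpha> s Y S0 X k)
  show thesis
  proof (cases "\<alpha> = \<gamma>")
    case True
    with sel assms(2) have "b = s" "Z = con (\<not> s) X" by auto
    with True sel show thesis using that(5) by blast
  next
    case False
    with sel show thesis using that(3) by blast
  qed
qed

lemma cfree_mono: "cfree A n t S \<Longrightarrow> n \<le> m \<Longrightarrow> cfree A m t S"
proof (induction arbitrary: m rule: cfree.induct)
  case (ax k n)
  then show ?case by (auto intro: cfree.ax)
next
  case (fam \<alpha> S X n s fs)
  then obtain m' where "m = Suc m'" "n \<le> m'" by (cases m) auto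
  with fam show ?case by (auto simp: fmrel_Some_iff intro!: cfree.fam)
next
  case (sel n f \<alpha> s Y S X k)
  then obtain m' where "m = Suc m'" "n \<le> m'" by (cases m) auto
  with sel show ?case by (auto intro!: cfree.sel)
qed

lemma cfree_bound:
  assumes "fmrel (\<lambda>u Y. \<exists>n. cfree A n u (F Y)) gs X"
  shows "\<exists>n. fmrel (\<lambda>u Y. cfree A n u (F Y)) gs X"
proof -
  have "\<forall>i. \<exists>n. \<forall>u Y. fmlookup gs i = Some u \<longrightarrow> fmlookup X i = Some Y \<longrightarrow> cfree A n u (F Y)"
    using assms unfolding fmrel_Some_iff by (metis option.inject)
  then obtain N where N: "\<And>i u Y. fmlookup gs i = Some u \<Longrightarrow> fmlookup X i = Some Y \<Longrightarrow> cfree A (N i) u (F Y)"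
    by metis
  \<comment> \<open>The sum of the individual bounds is a common bound; unlike a maximum it needs no
    separate treatment of the empty family.\<close>
  have "cfree A (sum N (fset (fmdom gs))) u (F Y)" if "fmlookup gs i = Some u" "fmlookup X i = Some Y" for i u Y
    using N[OF that] by (rule cfree_mono) (use that in \<open>auto intro!: member_le_sum simp: fmlookup_dom_iff\<close>)
  then show ?thesis
    using assms unfolding fmrel_Some_iff by blast
qed

text \<open>Choice for finite families, obtained from the composition law of the relator instead of
  an explicit choice function.\<close>

lemma fmrel_choice:
  assumes "fmrel (\<lambda>f Y. \<exists>u. R f u \<and> Q u Y) fs X"
  shows "\<exists>gs. fmrel R fs gs \<and> fmrel Q gs X"
proof -
  have "fmrel (R OO Q) fs X"
    using assms by (simp add: OO_def)
  then show ?thesis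
    by (auto simp: fmap.rel_compp)
qed

context polycategory
begin

lemmas pc = polycategory_axioms

text \<open>Axioms contain only atoms, so an axiom cannot meet a rule that acts on the cut channel.
  This closes the mixed cases of the inductions below.\<close>

lemma asig_not_con: "h \<in> arr P \<Longrightarrow> fmlookup (asig P h) \<gamma> \<noteq> Some (b', con b X)"
  by (auto simp: asig_Some[OF pc])

lemma cfree_der: "cfree P n t S \<Longrightarrow> der P t S"
proof (induction rule: cfree.induct)
  case (ax m n)
  then show ?case by (rule der_axiom[OF pc])
next
  case (fam \<alpha> S X n s fs)
  then show ?case by (auto simp: der_fam_iff fmrel_Some_iff)
next
  case (sel n f \<alpha> s Y S X k)
  then show ?case by (auto intro: der_sel)
qed

text \<open>Pushing a cut into a family copies the other premise, but every copy keeps its height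
  while the pushed side becomes shorter; a principal step shortens both sides. The induction can
  thus run on the sum of the heights alone, and the height \<open>k\<close> of the result is left
  unspecified.\<close>

lemma cut_cfree:
  "cfree P n f S \<Longrightarrow> cfree P m g T \<Longrightarrow> compat \<gamma> s S T \<Longrightarrow>
    \<exists>k u. sim P (xcut s \<gamma> f g) u \<and> cfree P k u (join \<gamma> S T)"
proof (induction "n + m" arbitrary: n m f g S T s rule: less_induct)
  case less
  \<comment> \<open>Only the first premise is treated. The sign is arbitrary and the heights enter
    through their sum, so the same statement with the premises exchanged and the sign negated covers
    the second.\<close>
  have left: "\<exists>k u. sim P (xcut s \<gamma> f g) u \<and> cfree P k u (join \<gamma> S T)"
    if nm: "n' + m' = n + m" and f: "cfree P n' f S" and g: "cfree P m' g T" and c: "compat \<gamma> s S T"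
      and np: "\<not> principal \<gamma> f" for s f g S T n' m'
  proof -
    obtain Z where Z: "fmlookup S \<gamma> = Some (s, Z)" using c by (auto simp: compat_def)
    from f Z show ?thesis
    proof (cases rule: cfree_cases)
      case (fam n'' s' S0 \<alpha> X fs)
      have \<alpha>T: "\<alpha> |\<notin>| fmdom T"
        using c fam compat_notin by blast
      have "fmrel (\<lambda>f Y. \<exists>u. sim P (xcut s \<gamma> f g) u \<and> (\<exists>k. cfree P k u (fmupd \<alpha> (s', Y) (join \<gamma> S0 T)))) fs X"
        unfolding fmrel_Some_iff
      proof (intro conjI allI impI)
        show "fmdom fs = fmdom X" using fam by (simp add: fmrel_Some_iff)
        fix i f' Y assume "fmlookup fs i = Some f'" "fmlookup X i = Some Y"
        then have "cfree P n'' f' (fmupd \<alpha> (s', Y) S0)" using fam by (simp add: fmrel_Some_iff)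
        moreover have "compat \<gamma> s (fmupd \<alpha> (s', Y) S0) T"
          using c unfolding fam by (rule compat_upd(1)[OF \<open>\<alpha> \<noteq> \<gamma>\<close>, THEN iffD1])
        ultimately show "\<exists>u. sim P (xcut s \<gamma> f' g) u \<and> (\<exists>k. cfree P k u (fmupd \<alpha> (s', Y) (join \<gamma> S0 T)))"
          using less.hyps[of n'' m' f' _ g T s] nm g fam \<alpha>T by (fastforce simp: join_upd)
      qed
      from fmrel_choice[OF this] obtain gs where gs: "fmrel (sim P) (fmmap (\<lambda>f. xcut s \<gamma> f g) fs) gs"
        "fmrel (\<lambda>u Y. \<exists>k. cfree P k u (fmupd \<alpha> (s', Y) (join \<gamma> S0 T))) gs X"
        unfolding fmap.rel_map by blast
      from cfree_bound[OF gs(2)] obtain k where k: "fmrel (\<lambda>u Y. cfree P k u (fmupd \<alpha> (s', Y) (join \<gamma> S0 T))) gs X"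
        by blast
      have 1: "sim P (xcut s \<gamma> f g) (fam s' (join \<gamma> S0 T) \<alpha> X (fmmap (\<lambda>f. xcut s \<gamma> f g) fs))"
        using cfree_der[OF f] cfree_der[OF g] c \<open>\<alpha> \<noteq> \<gamma>\<close> unfolding fam by (rule xcut_fam) (rule pc)
      moreover have d: "der P (xcut s \<gamma> f g) (join \<gamma> S T)"
        by (intro der_xcut[OF _ _ c] cfree_der[OF f] cfree_der[OF g])
      then have "sim P (fam s' (join \<gamma> S0 T) \<alpha> X (fmmap (\<lambda>f. xcut s \<gamma> f g) fs)) (fam s' (join \<gamma> S0 T) \<alpha> X gs)"
        using sim_fam[OF gs(1)] sim_der[OF 1] by blast
      moreover have "cfree P (Suc k) (fam s' (join \<gamma> S0 T) \<alpha> X gs) (join \<gamma> S T)"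
        unfolding \<open>S = _\<close> join_upd[OF \<open>\<alpha> \<noteq> \<gamma>\<close> \<alpha>T]
        using fam \<alpha>T k over_join[OF _ der_over[OF pc cfree_der[OF g]]] by (intro cfree.fam) auto
      ultimately show ?thesis
        by (meson sim.trans)
    next
      case (sel n'' s' S0 \<alpha> X k Y f')
      have \<alpha>T: "\<alpha> |\<notin>| fmdom T"
        using c sel compat_notin by blast
      have "compat \<gamma> s (fmupd \<alpha> (s', Y) S0) T"
        using c unfolding sel by (rule compat_upd(1)[OF \<open>\<alpha> \<noteq> \<gamma>\<close>, THEN iffD1])
      then obtain l u where u: "sim P (xcut s \<gamma> f' g) u" "cfree P l u (fmupd \<alpha> (s', Y) (join \<gamma> S0 T))"
        using less.hyps[of n'' m' f' "fmupd \<alpha> (s', Y) S0" g T s] nm g sel \<alpha>T by (auto simp: join_upd)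
      have c': "compat \<gamma> s (fmupd \<alpha> (s', con (\<not> s') X) S0) T"
        using c sel by simp
      note x = xcut_sel[OF cfree_der[OF \<open>cfree P n'' _ _\<close>] \<open>\<alpha> |\<notin>| fmdom S0\<close> \<open>fmlookup X k = Some Y\<close> \<open>fmran' X \<subseteq> _\<close> cfree_der[OF g] c' \<open>\<alpha> \<noteq> \<gamma>\<close>]
      have "sim P (sel s' \<alpha> k X (xcut s \<gamma> f' g)) (sel s' \<alpha> k X u)"
        using sim_sel[OF u(1) x(2)] sel \<alpha>T by auto
      then have "sim P (xcut s \<gamma> f g) (sel s' \<alpha> k X u)"
        using x(1) sel sim.trans by metis
      moreover have "cfree P (Suc l) (sel s' \<alpha> k X u) (join \<gamma> S T)"
        unfolding \<open>S = _\<close> join_upd[OF \<open>\<alpha> \<noteq> \<gamma>\<close> \<alpha>T]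
        using sel \<alpha>T u(2) by (intro cfree.sel) auto
      ultimately show ?thesis by blast
    qed (use np in auto)
  qed
  \<comment> \<open>Again one orientation suffices: the selection is taken as the first premise. The
    decomposition \<open>Suc n' + Suc m'\<close> of the measure allows the premises to be
    exchanged.\<close>
  have beta: "\<exists>k u. sim P (xcut s \<gamma> f g) u \<and> cfree P k u (join \<gamma> S T)"
    if nm: "Suc n' + Suc m' = n + m" and f: "f = sel s \<gamma> k X f'" "S = fmupd \<gamma> (s, con (\<not> s) X) Sa" "cfree P n' f' (fmupd \<gamma> (s, Y) Sa)"
      "\<gamma> |\<notin>| fmdom Sa" "fmlookup X k = Some Y"
      and g: "g = fam (\<not> s) Ta \<gamma> X gs" "T = fmupd \<gamma> (\<not> s, con (\<not> s) X) Ta" "fmrel (\<lambda>g Y. cfree P m' g (fmupd \<gamma> (\<not> s, Y) Ta)) gs X"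
      and dg: "der P g T"
      and c: "compat \<gamma> s S T"
    for s f g S T n' m' k X f' Sa Y Ta gs
  proof -
    obtain g' where g': "fmlookup gs k = Some g'" "cfree P m' g' (fmupd \<gamma> (\<not> s, Y) Ta)"
      using fmrelE2[OF g(3) f(5)] by blast
    have "compat \<gamma> s (fmupd \<gamma> (s, Y) Sa) (fmupd \<gamma> (\<not> s, Y) Ta)"
      using c unfolding f g by (rule compat_upd_same[THEN iffD1])
    from less.hyps[OF _ f(3) g'(2) this] nm
    obtain l u where u: "sim P (xcut s \<gamma> f' g') u" "cfree P l u (join \<gamma> Sa Ta)"
      by auto
    moreover have "sim P (xcut s \<gamma> f g) (xcut s \<gamma> f' g')"
      using xcut_beta[OF cfree_der[OF f(3)] f(4,5)] dg c g' unfolding f g by blast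
    ultimately show ?thesis
      unfolding f g join_upd_same by (meson sim.trans)
  qed
  obtain Z where Z: "fmlookup S \<gamma> = Some (s, Z)" "fmlookup T \<gamma> = Some (\<not> s, Z)"
    using less.prems by (auto simp: compat_def)
  note commute = compat_join_commute[OF less.prems(3)]
  show ?case
  proof (cases "principal \<gamma> f \<and> principal \<gamma> g")
    case False
    then consider "\<not> principal \<gamma> f" | "\<not> principal \<gamma> g" by blast
    then show ?thesis
    proof cases
      case 1
      then show ?thesis using left less.prems by blast
    next
      case 2
      then have "\<exists>k u. sim P (xcut (\<not> s) \<gamma> g f) u \<and> cfree P k u (join \<gamma> T S)"
        using left[of m n, OF _ less.prems(2,1) compat_sym[OF less.prems(3)]] by auto
      then show ?thesis by (simp add: xcut_not commute)
    qed
  next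
    case True
    from less.prems(1) Z(1) show ?thesis
    proof (cases rule: cfree_cases)
      case (ax k)
      from less.prems(2) Z(2) show ?thesis
      proof (cases rule: cfree_cases)
        case (ax l)
        with \<open>f = Axiom k\<close> \<open>k \<in> arr P\<close> \<open>S = asig P k\<close> show ?thesis
          using pcut_axiom[OF pc, of k l \<gamma> s] less.prems(3) cfree.ax[of "pcut P s \<gamma> k l" P] by metis
      qed (use True ax asig_not_con Z in auto)
    next
      case f: (pfam n' S0 X fs)
      from less.prems(2) Z(2) show ?thesis
      proof (cases rule: cfree_cases)
        case g: (psel m' T0 X' k Y g')
        \<comment> \<open>The selection is the second premise here, so the principal step is applied
          to the reversed cut.\<close>
        have "\<exists>k u. sim P (xcut (\<not> s) \<gamma> g f) u \<and> cfree P k u (join \<gamma> T S)"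
          by (rule beta[where n' = m' and m' = n' and k = k and Ta = S0 and gs = fs and Sa = T0 and f' = g' and Y = Y and X = X])
            (use f g cfree_der[OF less.prems(1)] compat_sym[OF less.prems(3)] in auto)
        then show ?thesis by (simp add: xcut_not commute)
      qed (use True f asig_not_con Z in auto)
    next
      case f: (psel n' S0 X k Y f')
      from less.prems(2) Z(2) show ?thesis
      proof (cases rule: cfree_cases)
        case g: (pfam m' T0 X' gs)
        show ?thesis
          by (rule beta[where n' = n' and m' = m' and k = k and Ta = T0 and gs = gs and Sa = S0 and f' = f' and Y = Y and X = X])
            (use f g cfree_der[OF less.prems(2)] less.prems(3) in auto)
      qed (use True f asig_not_con Z in auto)
    qed (use True in auto)
  qed
qed

end

section \<open>Inversion and induction for derivations of signed sequents\<close>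

lemma signed_upd:
  "\<alpha> |\<notin>| fmdom \<Delta> \<Longrightarrow> signed (fmupd \<alpha> Y \<Gamma>) \<Delta> = fmupd \<alpha> (False, Y) (signed \<Gamma> \<Delta>)"
  "signed \<Gamma> (fmupd \<alpha> Y \<Delta>) = fmupd \<alpha> (True, Y) (signed \<Gamma> \<Delta>)"
  by (rule fmap_ext, auto simp: signed_def in_fmdom_iff)+

lemma cut_signed:
  assumes "sequent F \<Gamma> (fmupd \<gamma> Z \<Delta>)" "sequent G (fmupd \<gamma> Z \<Gamma>') \<Delta>'" "\<gamma> |\<notin>| fmdom \<Delta>" "\<gamma> |\<notin>| fmdom \<Gamma>'"
    "(fmdom \<Gamma> |\<union>| fmdom \<Delta>) |\<inter>| (fmdom \<Gamma>' |\<union>| fmdom \<Delta>') = {||}"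
  shows "compat \<gamma> True (signed \<Gamma> (fmupd \<gamma> Z \<Delta>)) (signed (fmupd \<gamma> Z \<Gamma>') \<Delta>')"
    and "join \<gamma> (signed \<Gamma> (fmupd \<gamma> Z \<Delta>)) (signed (fmupd \<gamma> Z \<Gamma>') \<Delta>') = signed (\<Gamma> ++\<^sub>f \<Gamma>') (\<Delta> ++\<^sub>f \<Delta>')"
proof -
  have d: "\<gamma> |\<notin>| fmdom \<Gamma>" "\<gamma> |\<notin>| fmdom \<Delta>'"
    using assms(1,2) by (auto simp: sequent_def)
  show "compat \<gamma> True (signed \<Gamma> (fmupd \<gamma> Z \<Delta>)) (signed (fmupd \<gamma> Z \<Gamma>') \<Delta>')"
    using assms(5) by (intro compatI[where Z = Z]) (auto simp: signed_upd d fset_eq_iff)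
  have "fmlookup \<Delta> c = None \<and> fmlookup \<Gamma> c = None \<or> fmlookup \<Gamma>' c = None \<and> fmlookup \<Delta>' c = None" for c
    using assms(5) unfolding fset_eq_iff by (auto simp: in_fmdom_iff)
  then show "join \<gamma> (signed \<Gamma> (fmupd \<gamma> Z \<Delta>)) (signed (fmupd \<gamma> Z \<Gamma>') \<Delta>') = signed (\<Gamma> ++\<^sub>f \<Gamma>') (\<Delta> ++\<^sub>f \<Delta>')"
    by (intro fmap_ext) (use d assms(3,4) in \<open>auto simp: signed_def fmlookup_join in_fmdom_iff; metis option.distinct(1)\<close>)
qed

lemma der_CutE:
  assumes A: "polycategory A" and "der A (Cut \<gamma> f g) U"
  obtains S T where "der A f S" "der A g T" "compat \<gamma> True S T" "U = join \<gamma> S T"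
proof -
  have "derives A (Cut \<gamma> f g) (part False U) (part True U)"
    using assms by (simp add: der_def)
  then show thesis
  proof cases
    case (cut \<Gamma> Z \<Delta> \<Gamma>' \<Delta>')
    note c = cut_signed[OF derives_sequent[OF A cut(3)] derives_sequent[OF A cut(4)] cut(5-7)]
    have "U = signed (\<Gamma> ++\<^sub>f \<Gamma>') (\<Delta> ++\<^sub>f \<Delta>')"
      using cut(1,2) by (metis signed_part)
    then show thesis
      using that[OF derives_der[OF A cut(3)] derives_der[OF A cut(4)] c(1)] c(2) by simp
  qed
qed

context polycategory
begin

text \<open>Cuts appear only with sign \<open>True\<close>, since \<open>xcut False\<close> is the
  same constructor with its arguments exchanged. Derivability of the premises is kept beside the
  induction hypothesis because nearly every use needs both.\<close>

lemma der_induct [consumes 1, case_names ax fam sel xcut]: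
  assumes "der P t U"
    and ax: "\<And>m. m \<in> arr P \<Longrightarrow> Q (Axiom m) (asig P m)"
    and fam: "\<And>s S \<alpha> X fs. \<lbrakk>\<alpha> |\<notin>| fmdom S; over (formulas P) S; fmran' X \<subseteq> formulas P;
      fmrel (\<lambda>f Y. der P f (fmupd \<alpha> (s, Y) S) \<and> Q f (fmupd \<alpha> (s, Y) S)) fs X\<rbrakk>
      \<Longrightarrow> Q (fam s S \<alpha> X fs) (fmupd \<alpha> (s, con s X) S)"
    and sel: "\<And>s S \<alpha> X k Y f. \<lbrakk>\<alpha> |\<notin>| fmdom S; fmran' X \<subseteq> formulas P; fmlookup X k = Some Y;
      der P f (fmupd \<alpha> (s, Y) S); Q f (fmupd \<alpha> (s, Y) S)\<rbrakk>
      \<Longrightarrow> Q (sel s \<alpha> k X f) (fmupd \<alpha> (s, con (\<not> s) X) S)"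
    and xcut: "\<And>\<gamma> f g S T. \<lbrakk>der P f S; der P g T; compat \<gamma> True S T; Q f S; Q g T\<rbrakk>
      \<Longrightarrow> Q (xcut True \<gamma> f g) (join \<gamma> S T)"
  shows "Q t U"
proof -
  have "Q t (signed \<Gamma> \<Delta>)" if "derives P t \<Gamma> \<Delta>" for \<Gamma> \<Delta>
    using that
  proof induction
    case (axiom m)
    then show ?case using ax by (simp add: asig_def)
  next
    case (cotuple \<alpha> X \<Gamma> \<Delta> fs)
    have d: "\<alpha> |\<notin>| fmdom \<Delta>" "fmdom \<Gamma> |\<inter>| fmdom \<Delta> = {||}"
      using cotuple(1) by (auto simp: sequent_def)
    have "fmrel (\<lambda>f Y. der P f (fmupd \<alpha> (False, Y) (signed \<Gamma> \<Delta>)) \<and> Q f (fmupd \<alpha> (False, Y) (signed \<Gamma> \<Delta>))) fs X"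
      using cotuple(3) derives_der[OF pc] by (auto simp: fmrel_Some_iff signed_upd[symmetric] d)
    moreover have "over (formulas P) (signed \<Gamma> \<Delta>)" "fmran' X \<subseteq> formulas P"
      using cotuple(1,2) by (auto simp: sequent_part[symmetric] part_signed d sequent_def fmran'_upd Sum_Prod_formulas)
    ultimately show ?case
      using fam[of \<alpha> "signed \<Gamma> \<Delta>" X False fs] cotuple(2) d
      by (simp add: fam_def con_def part_signed signed_upd)
  next
    case (tuple \<Gamma> \<alpha> X \<Delta> fs)
    have d: "\<alpha> |\<notin>| fmdom \<Gamma>" "fmdom \<Gamma> |\<inter>| fmdom \<Delta> = {||}"
      using tuple(1) by (auto simp: sequent_def)
    have "fmrel (\<lambda>f Y. der P f (fmupd \<alpha> (True, Y) (signed \<Gamma> \<Delta>)) \<and> Q f (fmupd \<alpha> (True, Y) (signed \<Gamma> \<Delta>))) fs X"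
      using tuple(3) derives_der[OF pc] by (auto simp: fmrel_Some_iff signed_upd[symmetric])
    moreover have "over (formulas P) (signed \<Gamma> \<Delta>)" "fmran' X \<subseteq> formulas P"
      using tuple(1,2) by (auto simp: sequent_part[symmetric] part_signed d sequent_def fmran'_upd Sum_Prod_formulas)
    ultimately show ?case
      using fam[of \<alpha> "signed \<Gamma> \<Delta>" X True fs] tuple(2) d
      by (simp add: fam_def con_def part_signed signed_upd)
  next
    case (proj f \<alpha> Y \<Gamma> \<Delta> X a)
    have d: "\<alpha> |\<notin>| fmdom \<Delta>"
      using derives_sequent[OF pc proj(1)] by (auto simp: sequent_def)
    then show ?case
      using sel[of \<alpha> "signed \<Gamma> \<Delta>" X a Y f False] proj derives_der[OF pc proj(1)]
      by (simp add: sel_def con_def signed_upd Sum_Prod_formulas)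
  next
    case (inj f \<Gamma> \<alpha> Y \<Delta> X a)
    have d: "\<alpha> |\<notin>| fmdom \<Gamma>"
      using derives_sequent[OF pc inj(1)] by (auto simp: sequent_def)
    then show ?case
      using sel[of \<alpha> "signed \<Gamma> \<Delta>" X a Y f True] inj derives_der[OF pc inj(1)]
      by (simp add: sel_def con_def signed_upd Sum_Prod_formulas)
  next
    case (cut f \<Gamma> \<gamma> Z \<Delta> g \<Gamma>' \<Delta>')
    note c = cut_signed[OF derives_sequent[OF pc cut(1)] derives_sequent[OF pc cut(2)] cut(3-5)]
    then show ?case
      using xcut[OF derives_der[OF pc cut(1)] derives_der[OF pc cut(2)] c(1)] cut(6,7)
      by (simp add: xcut_def)
  qed
  from this[of "part False U" "part True U"] show ?thesis
    using assms(1) by (simp add: der_def)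
qed

lemma fmmap_fmmap_keys: "fmmap h (fmmap_keys F X) = fmmap_keys (\<lambda>i x. h (F i x)) X"
  by (rule fmap_ext) (simp add: option.map_comp comp_def)

section \<open>Renaming acts on derivations and respects their equality\<close>

lemma rename_fam: "rename_deriv P p (fam s S \<alpha> X fs)
    = fam s (rename_ctx p S) (apply p \<alpha>) X (fmmap (rename_deriv P p) fs)"
  by (simp add: fam_def part_rename)

lemma rename_sel: "rename_deriv P p (sel s \<alpha> k X f) = sel s (apply p \<alpha>) k X (rename_deriv P p f)"
  by (simp add: sel_def)

lemma rename_xcut: "rename_deriv P p (xcut s \<gamma> f g) = xcut s (apply p \<gamma>) (rename_deriv P p f) (rename_deriv P p g)"
  by (simp add: xcut_def)

lemma asig_ren: "m \<in> arr P \<Longrightarrow> ren P p m \<in> arr P \<and> asig P (ren P p m) = rename_ctx p (asig P m)"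
  using ren_hom[of m p] by (simp add: asig_def rename_signed hom_def)

lemma der_AxiomD:
  assumes "der P (Axiom m) S"
  shows "m \<in> arr P" "S = asig P m"
proof -
  show "m \<in> arr P"
    using assms by (auto simp: der_def elim: derives.cases)
  from der_unique[OF der_axiom[OF pc this] assms] show "S = asig P m" .
qed

lemma der_rename: "der P t S \<Longrightarrow> der P (rename_deriv P p t) (rename_ctx p S)"
proof (induction rule: der_induct)
  case (ax m)
  then show ?case using der_axiom[OF pc] asig_ren by (metis rename_deriv.simps(1))
next
  case (fam s S \<alpha> X fs)
  then show ?case by (auto simp: rename_fam der_fam_iff over_rename fmrel_Some_iff)
next
  case (sel s S \<alpha> X k Y f)
  then show ?case by (auto simp: rename_sel intro: der_sel)
next
  case (xcut \<gamma> f g S T)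
  then show ?case by (auto simp: rename_xcut join_rename intro!: der_xcut compat_rename)
qed

lemma rename_deriv_mult: "der P t S \<Longrightarrow> rename_deriv P (p * q) t = rename_deriv P p (rename_deriv P q t)"
proof (induction rule: der_induct)
  case (ax m)
  then show ?case by (simp add: ren_mult)
next
  case (fam s S \<alpha> X fs)
  then have "fmmap (rename_deriv P (p * q)) fs = fmmap (rename_deriv P p) (fmmap (rename_deriv P q) fs)"
    by (intro fmap_ext) (auto simp: fmap.map_comp comp_def elim!: fmrelE1 intro!: map_option_cong)
  then show ?case by (simp add: rename_fam rename_ctx_mult apply_times)
qed (simp_all add: rename_sel rename_xcut apply_times)

text \<open>In a cut-free derivation every channel survives into the conclusion. A cut removes its
  channel from the sequent, so the equation of terms is stated for cut-free derivations.\<close>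

lemma rename_deriv_fix: "cfree P n t S \<Longrightarrow> (\<And>c. c |\<in>| fmdom S \<Longrightarrow> apply p c = c) \<Longrightarrow> rename_deriv P p t = t"
proof (induction rule: cfree.induct)
  case (ax m n)
  then show ?case by (simp add: ren_fix fmdom_asig)
next
  case (fam \<alpha> S X n s fs)
  then have "fmmap (rename_deriv P p) fs = fs"
    by (intro fmap_ext) (auto simp: elim!: fmrelE1 intro!: map_option_idI)
  with fam show ?case by (simp add: rename_fam rename_ctx_fix)
qed (simp add: rename_sel)

lemma swap_conj: "p * Perm.swap a b = Perm.swap (apply p a) (apply p b) * p"
  by (rule perm_eqI) (simp add: apply_times, metis apply_eq_iff apply_swap_simp apply_swap_same)

text \<open>Derivability enters where laws of \<open>P\<close> are applied inside a term:
  \<open>c0\<close> needs the two axioms to be composable, and \<open>c1\<close> and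
  \<open>c2\<close> need renaming to be an action on the derivation.\<close>

lemma conv_rename:
  assumes "conv P t u" "der P t S"
  shows "conv P (rename_deriv P p t) (rename_deriv P p u)"
  using assms
proof cases
  case (c0 \<gamma> m n)
  obtain S T where "der P (Axiom m) S" "der P (Axiom n) T" "compat \<gamma> True S T"
    using assms(2) unfolding c0 by (rule der_CutE[OF pc])
  then have "m \<in> arr P" "n \<in> arr P" "compat \<gamma> True (asig P m) (asig P n)"
    using der_AxiomD by blast+
  then have "ren P p (cut P \<gamma> m n) = cut P (apply p \<gamma>) (ren P p m) (ren P p n)"
    using compat_asig[OF pc] ren_cut by force
  then show ?thesis by (simp add: c0 conv.c0)
next
  case (c1 a \<gamma> \<beta> f)
  obtain S where "der P f S"
    using assms(2) unfolding c1 by (rule der_CutE[OF pc])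
  then have "rename_deriv P p (rename_deriv P (Perm.swap \<gamma> \<beta>) f)
      = rename_deriv P (Perm.swap (apply p \<gamma>) (apply p \<beta>)) (rename_deriv P p f)"
    by (simp flip: rename_deriv_mult add: swap_conj)
  then show ?thesis
    using c1 by (simp add: ren_idn conv.c1)
next
  case (c2 a \<alpha> \<gamma> f)
  obtain S where "der P f S"
    using assms(2) unfolding c2 by (rule der_CutE[OF pc])
  then have "rename_deriv P p (rename_deriv P (Perm.swap \<gamma> \<alpha>) f)
      = rename_deriv P (Perm.swap (apply p \<gamma>) (apply p \<alpha>)) (rename_deriv P p f)"
    by (simp flip: rename_deriv_mult add: swap_conj)
  then show ?thesis
    using c2 by (simp add: ren_idn conv.c2)
next
  case c13
  then show ?thesis by (auto simp: fmmap_fmmap_keys intro!: conv.c13)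
next
  case c14
  then show ?thesis by (auto simp: fmmap_fmmap_keys intro!: conv.c14)
next
  case c19
  then show ?thesis by (auto simp: fmmap_fmmap_keys intro!: conv.c19)
next
  case (c3 \<alpha> \<gamma> \<Gamma> \<Delta> X fs g \<Gamma>' \<Delta>')
  with conv.c3[where fs = "fmmap (rename_deriv P p) fs" and \<alpha> = "apply p \<alpha>" and \<gamma> = "apply p \<gamma>" and A = P]
  show ?thesis by (simp add: fmap.map_comp comp_def)
next
  case (c4 \<beta> \<gamma> f \<Gamma> \<Delta> Y gs \<Gamma>' \<Delta>')
  with conv.c4[where gs = "fmmap (rename_deriv P p) gs" and \<beta> = "apply p \<beta>" and \<gamma> = "apply p \<gamma>" and A = P]
  show ?thesis by (simp add: fmap.map_comp comp_def)
next
  case (c9 \<alpha> \<gamma> \<Gamma> \<Delta> X fs g \<Gamma>' \<Delta>')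
  with conv.c9[where fs = "fmmap (rename_deriv P p) fs" and \<alpha> = "apply p \<alpha>" and \<gamma> = "apply p \<gamma>" and A = P]
  show ?thesis by (simp add: fmap.map_comp comp_def)
next
  case (c10 \<beta> \<gamma> f \<Gamma> \<Delta> Y gs \<Gamma>' \<Delta>')
  with conv.c10[where gs = "fmmap (rename_deriv P p) gs" and \<beta> = "apply p \<beta>" and \<gamma> = "apply p \<gamma>" and A = P]
  show ?thesis by (simp add: fmap.map_comp comp_def)
next
  case (c15 \<alpha> \<beta> Y k Yk \<Gamma> \<Delta> X fs)
  with conv.c15[where fs = "fmmap (rename_deriv P p) fs" and \<alpha> = "apply p \<alpha>" and \<beta> = "apply p \<beta>" and A = P]
  show ?thesis by (simp add: fmap.map_comp comp_def)
next
  case (c16 \<alpha> \<beta> X k Xk \<Gamma> \<Delta> Y gs)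
  with conv.c16[where gs = "fmmap (rename_deriv P p) gs" and \<alpha> = "apply p \<alpha>" and \<beta> = "apply p \<beta>" and A = P]
  show ?thesis by (simp add: fmap.map_comp comp_def)
next
  case (c17 \<alpha> \<beta> Y k Yk \<Gamma> \<Delta> X fs)
  with conv.c17[where fs = "fmmap (rename_deriv P p) fs" and \<alpha> = "apply p \<alpha>" and \<beta> = "apply p \<beta>" and A = P]
  show ?thesis by (simp add: fmap.map_comp comp_def)
next
  case (c18 \<alpha> \<beta> X k Xk \<Gamma> \<Delta> Y gs)
  with conv.c18[where gs = "fmmap (rename_deriv P p) gs" and \<alpha> = "apply p \<alpha>" and \<beta> = "apply p \<beta>" and A = P]
  show ?thesis by (simp add: fmap.map_comp comp_def)
qed (auto intro: conv.intros)

lemma sim_der_ex: "sim P t u \<Longrightarrow> \<exists>S. der P t S \<and> der P u S"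
  using sim_derives derives_der[OF pc] by blast

lemma sim_rename: "sim P t u \<Longrightarrow> sim P (rename_deriv P p t) (rename_deriv P p u)"
proof (induction rule: sim.induct)
  case (conv t u \<Gamma> \<Delta>)
  then show ?case
    using sim_conv conv_rename der_rename derives_der[OF pc] by metis
next
  case (refl t \<Gamma> \<Delta>)
  then show ?case
    using sim_refl_der der_rename derives_der[OF pc] by metis
next
  case (cotuple fs gs \<Gamma> \<Delta> \<alpha> X \<Gamma>' \<Delta>')
  have "fmrel (sim P) (fmmap (rename_deriv P p) fs) (fmmap (rename_deriv P p) gs)"
    using cotuple(1) by (auto simp: fmap.rel_map elim!: fmap.rel_mono_strong)
  then show ?case
    using sim.cotuple der_rename[OF derives_der[OF pc cotuple(2)], of p] der_rename[OF derives_der[OF pc cotuple(3)], of p]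
    by (auto simp: der_def)
next
  case (tuple fs gs \<Gamma> \<Delta> \<alpha> X \<Gamma>' \<Delta>')
  have "fmrel (sim P) (fmmap (rename_deriv P p) fs) (fmmap (rename_deriv P p) gs)"
    using tuple(1) by (auto simp: fmap.rel_map elim!: fmap.rel_mono_strong)
  then show ?case
    using sim.tuple der_rename[OF derives_der[OF pc tuple(2)], of p] der_rename[OF derives_der[OF pc tuple(3)], of p]
    by (auto simp: der_def)
next
  case (proj f g \<alpha> a X \<Gamma> \<Delta>)
  then show ?case
    using sim.proj der_rename[OF derives_der[OF pc proj(2)], of p] der_rename[OF derives_der[OF pc proj(3)], of p]
    by (auto simp: der_def)
next
  case (inj f g \<alpha> a X \<Gamma> \<Delta>)
  then show ?case
    using sim.inj der_rename[OF derives_der[OF pc inj(2)], of p] der_rename[OF derives_der[OF pc inj(3)], of p]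
    by (auto simp: der_def)
next
  case (cut f f' g g' \<gamma> \<Gamma> \<Delta>)
  then show ?case
    using sim.cut der_rename[OF derives_der[OF pc cut(3)], of p] der_rename[OF derives_der[OF pc cut(4)], of p]
    by (auto simp: der_def)
qed (blast intro: sim.intros)+

text \<open>Premises are made cut-free first, after which \<open>cut_cfree\<close> deals with the
  last cut. For a family, the cut-free components are chosen together and then given a common
  height.\<close>

lemma cut_elim: "der P t S \<Longrightarrow> \<exists>n u. sim P t u \<and> cfree P n u S"
proof (induction rule: der_induct)
  case (ax m)
  then show ?case using cfree.ax sim_refl_der der_axiom[OF pc] by metis
next
  case (fam s S \<alpha> X fs)
  then have "fmrel (\<lambda>f Y. \<exists>u. sim P f u \<and> (\<exists>n. cfree P n u (fmupd \<alpha> (s, Y) S))) fs X"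
    by (auto simp: fmrel_Some_iff) blast
  from fmrel_choice[OF this] obtain gs where
    gs: "fmrel (sim P) fs gs" "fmrel (\<lambda>u Y. \<exists>n. cfree P n u (fmupd \<alpha> (s, Y) S)) gs X"
    by blast
  from cfree_bound[OF gs(2)] obtain n where n: "fmrel (\<lambda>u Y. cfree P n u (fmupd \<alpha> (s, Y) S)) gs X"
    by blast
  have "der P (fam s S \<alpha> X fs) (fmupd \<alpha> (s, con s X) S)"
    using fam by (auto simp: der_fam_iff fmrel_Some_iff)
  then show ?case
    using sim_fam[OF gs(1)] cfree.fam[OF fam(1-3) n] by blast
next
  case (sel s S \<alpha> X k Y f)
  then obtain n u where u: "sim P f u" "cfree P n u (fmupd \<alpha> (s, Y) S)" by blast
  then show ?case
    using sim_sel[OF u(1)] cfree.sel[OF u(2)] sel by blast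
next
  case (xcut \<gamma> f g S T)
  then obtain n m f' g' where *: "sim P f f'" "cfree P n f' S" "sim P g g'" "cfree P m g' T" by blast
  from cut_cfree[OF *(2,4) xcut(3)] sim_xcut[OF *(1,3) xcut(1-3)]
  show ?case by (meson sim.trans)
qed

text \<open>The channels of hidden cuts may move, so the derivation is compared with a cut-free one,
  which really is fixed.\<close>

lemma sim_rename_fix:
  assumes "der P t S" "\<And>c. c |\<in>| fmdom S \<Longrightarrow> apply p c = c"
  shows "sim P (rename_deriv P p t) t"
proof -
  obtain n u where u: "sim P t u" "cfree P n u S"
    using cut_elim[OF assms(1)] by blast
  then show ?thesis
    using sim_rename[OF u(1), of p] rename_deriv_fix[OF u(2), of p] assms(2) by (metis sim.sym sim.trans)
qed

lemma neq_Axiom [simp]: "fam s S \<alpha> X fs \<noteq> Axiom m" "sel s \<alpha> k X f \<noteq> Axiom m"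
  by (simp_all add: fam_def sel_def)

section \<open>Associativity and interchange of cuts up to \<open>sim\<close>\<close>

lemma compat_asig_sig: "m \<in> arr P \<Longrightarrow> n \<in> arr P \<Longrightarrow> compat \<gamma> s (asig P m) (asig P n) \<Longrightarrow> compat \<gamma> s (sig P m) (sig P n)"
  using compat_asig[OF pc, of m n \<gamma> s] compat_sym[of \<gamma> True "sig P n" "sig P m"]
  by (cases s) (simp_all add: cuttable_sig)

lemma axiom_assoc:
  assumes f: "f \<in> arr P" and g: "g \<in> arr P" and h: "h \<in> arr P"
    and c: "compat \<gamma> s (asig P g) (asig P f)" and d: "compat \<delta> r (asig P g) (asig P h)"
    and disj: "chans P f |\<inter>| chans P h = {||}"
  shows "pcut P r \<delta> (pcut P s \<gamma> g f) h = pcut P s \<gamma> (pcut P r \<delta> g h) f"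
  using pcut_assoc[OF f g h compat_asig_sig[OF g f c] compat_asig_sig[OF g h d]] disj by (simp add: fmdom_sig)

text \<open>A family on a channel different from both cut channels leaves the two cuts one after the
  other. This serves for the middle piece on both sides of the associativity equation and for an
  outer piece on one side of it.\<close>

lemma xcut_fam2:
  assumes dg: "der P (fam s' T0 \<alpha> X gs) T" and df: "der P f S" and dh: "der P h U"
    and c: "compat \<gamma> s T S" and d: "compat \<delta> r (join \<gamma> T S) U" and \<alpha>: "\<alpha> \<noteq> \<gamma>" "\<alpha> \<noteq> \<delta>"
  shows "sim P (xcut r \<delta> (xcut s \<gamma> (fam s' T0 \<alpha> X gs) f) h)
      (fam s' (join \<delta> (join \<gamma> T0 S) U) \<alpha> X (fmmap (\<lambda>g. xcut r \<delta> (xcut s \<gamma> g f) h) gs))"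
proof -
  note dgf = der_xcut[OF dg df c] and a1 = xcut_fam[OF dg df c \<alpha>(1) pc]
  have "sim P (xcut r \<delta> (xcut s \<gamma> (fam s' T0 \<alpha> X gs) f) h)
      (xcut r \<delta> (fam s' (join \<gamma> T0 S) \<alpha> X (fmmap (\<lambda>g. xcut s \<gamma> g f) gs)) h)"
    by (rule sim_xcut[OF a1 sim_refl_der[OF dh] dgf dh d])
  moreover have "sim P (xcut r \<delta> (fam s' (join \<gamma> T0 S) \<alpha> X (fmmap (\<lambda>g. xcut s \<gamma> g f) gs)) h)
      (fam s' (join \<delta> (join \<gamma> T0 S) U) \<alpha> X (fmmap (\<lambda>g. xcut r \<delta> g h) (fmmap (\<lambda>g. xcut s \<gamma> g f) gs)))"
    using dgf unfolding sim_der[OF a1] by (rule xcut_fam[OF _ dh d \<alpha>(2) pc])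
  ultimately show ?thesis
    unfolding fmap.map_comp comp_def by (rule sim.trans)
qed

lemma xcut_sel2:
  assumes dg: "der P g (fmupd \<alpha> (s', Y) T0)" and \<alpha>0: "\<alpha> |\<notin>| fmdom T0" and X: "fmlookup X k = Some Y" "fmran' X \<subseteq> formulas P"
    and df: "der P f S" and dh: "der P h U"
    and c: "compat \<gamma> s (fmupd \<alpha> (s', con (\<not> s') X) T0) S"
    and d: "compat \<delta> r (join \<gamma> (fmupd \<alpha> (s', con (\<not> s') X) T0) S) U" and \<alpha>: "\<alpha> \<noteq> \<gamma>" "\<alpha> \<noteq> \<delta>"
  shows "sim P (xcut r \<delta> (xcut s \<gamma> (sel s' \<alpha> k X g) f) h) (sel s' \<alpha> k X (xcut r \<delta> (xcut s \<gamma> g f) h))"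
    and "der P (xcut r \<delta> (xcut s \<gamma> g f) h) (fmupd \<alpha> (s', Y) (join \<delta> (join \<gamma> T0 S) U))"
    and "\<alpha> |\<notin>| fmdom (join \<delta> (join \<gamma> T0 S) U)"
proof -
  have \<alpha>S: "\<alpha> |\<notin>| fmdom S"
    using compat_notin[OF c \<alpha>(1)] .
  have d': "compat \<delta> r (fmupd \<alpha> (s', con (\<not> s') X) (join \<gamma> T0 S)) U" and \<alpha>j: "\<alpha> |\<notin>| fmdom (join \<gamma> T0 S)"
    using d \<alpha>S \<alpha>0 \<alpha> by (auto simp: join_upd)
  then show "\<alpha> |\<notin>| fmdom (join \<delta> (join \<gamma> T0 S) U)"
    using compat_notin[OF d' \<alpha>(2)] by auto
  note x = xcut_sel[OF dg \<alpha>0 X df c \<alpha>(1)]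
  note y = xcut_sel[OF x(2) \<alpha>j X dh d' \<alpha>(2)]
  show "der P (xcut r \<delta> (xcut s \<gamma> g f) h) (fmupd \<alpha> (s', Y) (join \<delta> (join \<gamma> T0 S) U))"
    by (rule y(2))
  have "sim P (xcut r \<delta> (xcut s \<gamma> (sel s' \<alpha> k X g) f) h) (xcut r \<delta> (sel s' \<alpha> k X (xcut s \<gamma> g f)) h)"
    by (rule sim_xcut[OF x(1) sim_refl_der[OF dh] der_xcut[OF der_sel[OF dg \<alpha>0 X] df c] dh d])
  with y(1) show "sim P (xcut r \<delta> (xcut s \<gamma> (sel s' \<alpha> k X g) f) h) (sel s' \<alpha> k X (xcut r \<delta> (xcut s \<gamma> g f) h))"
    by (rule sim.trans[rotated])
qed

text \<open>The piece \<open>g\<close> is in the middle, and exchanging \<open>f\<close> with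
  \<open>h\<close> together with the channels and signs reverses the equation. Some rule can always
  be moved out of both sides or reduced on both sides, leaving the same equation for pieces of
  smaller total height, until three axioms remain.\<close>

lemma assoc_cfree:
  "\<lbrakk>cfree P n f S; cfree P m g T; cfree P l h U; compat \<gamma> s T S; compat \<delta> r T U; fmdom S |\<inter>| fmdom U = {||}\<rbrakk>
    \<Longrightarrow> sim P (xcut r \<delta> (xcut s \<gamma> g f) h) (xcut s \<gamma> (xcut r \<delta> g h) f)"
proof (induction "n + m + l" arbitrary: n m l f g h S T U \<gamma> \<delta> s r rule: less_induct)
  case less
  note IH = less.hyps
  \<comment> \<open>If \<open>f\<close> ends with a rule away from \<open>\<gamma>\<close>, that
    rule can be moved outside on both sides. The heights are tied only by their sum, so the
    statement also applies to \<open>h\<close> in the place of \<open>f\<close>.\<close>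
  have outer: "sim P (xcut r \<delta> (xcut s \<gamma> g f) h) (xcut s \<gamma> (xcut r \<delta> g h) f)"
    if N: "n' + m' + l' = n + m + l" and cf: "cfree P n' f S" and cg: "cfree P m' g T" and ch: "cfree P l' h U"
      and ct: "compat \<gamma> s T S" and cu: "compat \<delta> r T U" and disj: "fmdom S |\<inter>| fmdom U = {||}"
      and np: "\<not> principal \<gamma> f"
    for n' m' l' f g h S T U \<gamma> \<delta> s r
  proof -
    have df: "der P f S" and dg: "der P g T" and dh: "der P h U"
      using cf cg ch cfree_der by blast+
    have in_dom: "\<gamma> |\<in>| fmdom S" "\<delta> |\<in>| fmdom U"
      using compat_in ct cu by metis+
    then have notin: "\<gamma> |\<notin>| fmdom U" "\<delta> |\<notin>| fmdom S"
      using disj by auto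
    have ct': "compat \<gamma> (\<not> s) S T" using compat_sym[OF ct] .
    have ctu': "compat \<delta> r (join \<gamma> S T) U"
      using compat_join[OF ct cu disj] by (simp add: compat_join_commute[OF ct])
    have cut: "compat \<gamma> s (join \<delta> T U) S"
      using compat_join[OF cu ct] disj by (simp add: inf_commute)
    have cut': "compat \<gamma> (\<not> s) S (join \<delta> T U)"
      using compat_sym[OF cut] .
    have dgh: "der P (xcut r \<delta> g h) (join \<delta> T U)"
      by (rule der_xcut[OF dg dh cu])
    obtain Z where Z: "fmlookup S \<gamma> = Some (\<not> s, Z)" using ct by (auto simp: compat_def)
    from cf Z show ?thesis
    proof (cases rule: cfree_cases)
      case (fam n'' s' S0 \<alpha> X fs)
      have \<alpha>: "\<alpha> \<noteq> \<delta>"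
        using notin(2) fam by auto
      have a3: "sim P (xcut r \<delta> (xcut (\<not> s) \<gamma> f g) h)
          (fam s' (join \<delta> (join \<gamma> S0 T) U) \<alpha> X (fmmap (\<lambda>f. xcut r \<delta> (xcut (\<not> s) \<gamma> f g) h) fs))"
        using df dg dh ct' ctu' \<open>\<alpha> \<noteq> \<gamma>\<close> \<alpha> unfolding \<open>f = _\<close> by (rule xcut_fam2)
      have a4: "sim P (xcut (\<not> s) \<gamma> f (xcut r \<delta> g h))
          (fam s' (join \<gamma> S0 (join \<delta> T U)) \<alpha> X (fmmap (\<lambda>f. xcut (\<not> s) \<gamma> f (xcut r \<delta> g h)) fs))"
        using df dgh cut' \<open>\<alpha> \<noteq> \<gamma>\<close> unfolding \<open>f = _\<close> by (rule xcut_fam) (rule pc)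
      have "fmrel (sim P) (fmmap (\<lambda>f. xcut r \<delta> (xcut (\<not> s) \<gamma> f g) h) fs) (fmmap (\<lambda>f. xcut (\<not> s) \<gamma> f (xcut r \<delta> g h)) fs)"
      proof (rule fmrel_Some_iff[THEN iffD2], intro conjI allI impI)
        fix i x y
        assume "fmlookup (fmmap (\<lambda>f. xcut r \<delta> (xcut (\<not> s) \<gamma> f g) h) fs) i = Some x"
          "fmlookup (fmmap (\<lambda>f. xcut (\<not> s) \<gamma> f (xcut r \<delta> g h)) fs) i = Some y"
        then obtain f' where f': "fmlookup fs i = Some f'" "x = xcut r \<delta> (xcut (\<not> s) \<gamma> f' g) h" "y = xcut (\<not> s) \<gamma> f' (xcut r \<delta> g h)"
          by auto
        from fmrelE1[OF fam(8) f'(1)] obtain Y where Y: "cfree P n'' f' (fmupd \<alpha> (s', Y) S0)" .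
        have "compat \<gamma> s T (fmupd \<alpha> (s', Y) S0)"
          using ct unfolding \<open>S = _\<close> by (rule compat_upd(2)[OF \<open>\<alpha> \<noteq> \<gamma>\<close>, THEN iffD1])
        from IH[OF _ Y cg ch this cu] N disj fam show "sim P x y"
          unfolding f'(2,3) xcut_not by simp
      qed simp
      from sim_fam[OF this] have a5: "sim P (fam s' (join \<delta> (join \<gamma> S0 T) U) \<alpha> X (fmmap (\<lambda>f. xcut r \<delta> (xcut (\<not> s) \<gamma> f g) h) fs))
          (fam s' (join \<delta> (join \<gamma> S0 T) U) \<alpha> X (fmmap (\<lambda>f. xcut (\<not> s) \<gamma> f (xcut r \<delta> g h)) fs))"
        using sim_der_ex[OF a3] by blast
      have "join \<delta> (join \<gamma> S0 T) U = join \<gamma> S0 (join \<delta> T U)"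
        by (rule join_assoc) (use notin fam in auto)
      with a3 a4 a5 show ?thesis
        unfolding xcut_not by (metis sim.sym sim.trans)
    next
      case (sel n'' s' S0 \<alpha> X k Y f')
      have \<alpha>: "\<alpha> \<noteq> \<delta>"
        using notin(2) sel by auto
      note df' = cfree_der[OF \<open>cfree P n'' _ _\<close>]
      note x2 = xcut_sel2[OF df' \<open>\<alpha> |\<notin>| fmdom S0\<close> \<open>fmlookup X k = _\<close> \<open>fmran' X \<subseteq> _\<close> dg dh
          ct'[unfolded \<open>S = _\<close>] ctu'[unfolded \<open>S = _\<close>] \<open>\<alpha> \<noteq> \<gamma>\<close> \<alpha>]
      note x3 = xcut_sel[OF df' \<open>\<alpha> |\<notin>| fmdom S0\<close> \<open>fmlookup X k = _\<close> \<open>fmran' X \<subseteq> _\<close> dgh cut'[unfolded \<open>S = _\<close>] \<open>\<alpha> \<noteq> \<gamma>\<close>]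
      have "compat \<gamma> s T (fmupd \<alpha> (s', Y) S0)"
        using ct unfolding \<open>S = _\<close> by (rule compat_upd(2)[OF \<open>\<alpha> \<noteq> \<gamma>\<close>, THEN iffD1])
      from IH[OF _ \<open>cfree P n'' _ _\<close> cg ch this cu] N disj sel
      have "sim P (xcut r \<delta> (xcut (\<not> s) \<gamma> f' g) h) (xcut (\<not> s) \<gamma> f' (xcut r \<delta> g h))"
        unfolding xcut_not by simp
      then have "sim P (sel s' \<alpha> k X (xcut r \<delta> (xcut (\<not> s) \<gamma> f' g) h)) (sel s' \<alpha> k X (xcut (\<not> s) \<gamma> f' (xcut r \<delta> g h)))"
        using sim_sel[OF _ x2(2,3)] sel by blast
      with x2(1) x3(1) sel show ?thesis
        unfolding xcut_not by (metis sim.sym sim.trans)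
    qed (use np in auto)
  qed
  \<comment> \<open>Here \<open>f\<close> and \<open>g\<close> face each other on
    \<open>\<gamma>\<close> and neither is an axiom. Both sides admit the same principal step, after
    which the induction hypothesis applies to the two premises and \<open>h\<close>.\<close>
  have mid: "sim P (xcut r \<delta> (xcut s \<gamma> g f) h) (xcut s \<gamma> (xcut r \<delta> g h) f)"
    if N: "n' + m' + l' = n + m + l" and cf: "cfree P n' f S" and cg: "cfree P m' g T" and ch: "cfree P l' h U"
      and ct: "compat \<gamma> s T S" and cu: "compat \<delta> r T U" and disj: "fmdom S |\<inter>| fmdom U = {||}"
      and pf: "principal \<gamma> f" and pg: "principal \<gamma> g" "\<And>k. g \<noteq> Axiom k"
    for n' m' l' f g h S T U \<gamma> \<delta> s r
  proof -
    have df: "der P f S" and dg: "der P g T" and dh: "der P h U"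
      using cf cg ch cfree_der by blast+
    have "\<gamma> |\<in>| fmdom S" "\<delta> |\<in>| fmdom U"
      using compat_in ct cu by metis+
    then have \<gamma>\<delta>: "\<gamma> \<noteq> \<delta>" and "\<gamma> |\<notin>| fmdom U"
      using disj by auto
    have ct': "compat \<gamma> (\<not> s) S T" using compat_sym[OF ct] .
    have ctu: "compat \<delta> r (join \<gamma> T S) U"
      using compat_join[OF ct cu disj] .
    have cut: "compat \<gamma> s (join \<delta> T U) S"
      using compat_join[OF cu ct] disj by (simp add: inf_commute)
    have cut': "compat \<gamma> (\<not> s) S (join \<delta> T U)"
      using compat_sym[OF cut] .
    have dgh: "der P (xcut r \<delta> g h) (join \<delta> T U)"
      by (rule der_xcut[OF dg dh cu])
    have dgf: "der P (xcut s \<gamma> g f) (join \<gamma> T S)"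
      by (rule der_xcut[OF dg df ct])
    obtain Z where Z: "fmlookup T \<gamma> = Some (s, Z)" "fmlookup S \<gamma> = Some (\<not> s, Z)"
      using ct by (auto simp: compat_def)
    from cg Z(1) show ?thesis
    proof (cases rule: cfree_cases)
      case g: (pfam m'' T0 X gs)
      from cf Z(2) show ?thesis
      proof (cases rule: cfree_cases)
        case f: (psel n'' S0 X' k Y f')
        have [simp]: "X' = X" using g f by simp
        obtain g' where g': "fmlookup gs k = Some g'" "cfree P m'' g' (fmupd \<gamma> (s, Y) T0)"
          using fmrelE2[OF g(8)] f by auto
        have c1: "compat \<gamma> s (fmupd \<gamma> (s, Y) T0) (fmupd \<gamma> (\<not> s, Y) S0)"
          using ct unfolding \<open>T = _\<close> \<open>S = _\<close> by (metis compat_upd_same g f)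
        have c2: "compat \<delta> r (fmupd \<gamma> (s, Y) T0) U"
          using cu unfolding \<open>T = _\<close> by (rule compat_upd(1)[OF \<gamma>\<delta>, THEN iffD1])
        have "sim P (xcut (\<not> s) \<gamma> f g) (xcut (\<not> s) \<gamma> f' g')"
          using xcut_beta[OF cfree_der[OF \<open>cfree P n'' _ _\<close>] \<open>\<gamma> |\<notin>| fmdom S0\<close> \<open>fmlookup X' k = _\<close>, of T0 gs T g'] f g g' ct' dg by simp
        then have 1: "sim P (xcut r \<delta> (xcut s \<gamma> g f) h) (xcut r \<delta> (xcut s \<gamma> g' f') h)"
          unfolding xcut_not by (rule sim_xcut[OF _ sim_refl_der[OF dh] dgf dh ctu])
        have 2: "sim P (xcut r \<delta> (xcut s \<gamma> g' f') h) (xcut s \<gamma> (xcut r \<delta> g' h) f')"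
          using IH[OF _ \<open>cfree P n'' _ _\<close> g'(2) ch c1 c2] N disj f g by simp
        \<comment> \<open>On the right-hand side the cut with \<open>h\<close> must first be pushed
          into the family \<open>g\<close>, so that the family stands directly against
          \<open>f\<close> for the principal step.\<close>
        have 3: "sim P (xcut r \<delta> g h) (fam s (join \<delta> T0 U) \<gamma> X (fmmap (\<lambda>g. xcut r \<delta> g h) gs))"
          using dg dh cu \<gamma>\<delta> unfolding \<open>g = _\<close> by (rule xcut_fam) (rule pc)
        then have 4: "sim P (xcut (\<not> s) \<gamma> f (xcut r \<delta> g h)) (xcut (\<not> s) \<gamma> f (fam s (join \<delta> T0 U) \<gamma> X (fmmap (\<lambda>g. xcut r \<delta> g h) gs)))"
          by (rule sim_xcut[OF sim_refl_der[OF df] _ df dgh cut'])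
        have 5: "sim P (xcut (\<not> s) \<gamma> f (fam s (join \<delta> T0 U) \<gamma> X (fmmap (\<lambda>g. xcut r \<delta> g h) gs))) (xcut (\<not> s) \<gamma> f' (xcut r \<delta> g' h))"
          using xcut_beta[OF cfree_der[OF \<open>cfree P n'' _ _\<close>] \<open>\<gamma> |\<notin>| fmdom S0\<close> \<open>fmlookup X' k = _\<close>, of "join \<delta> T0 U" "fmmap (\<lambda>g. xcut r \<delta> g h) gs" "join \<delta> T U" "xcut r \<delta> g' h"]
            f g' cut' dgh sim_der[OF 3] by simp
        from 1 2 4 5 show ?thesis
          unfolding xcut_not by (metis sim.sym sim.trans)
      qed (use pf asig_not_con Z g in auto)
    next
      case g: (psel m'' T0 X k Y g')
      from cf Z(2) show ?thesis
      proof (cases rule: cfree_cases)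
        case f: (pfam n'' S0 X' fs)
        have [simp]: "X' = X" using g f by simp
        obtain f' where f': "fmlookup fs k = Some f'" "cfree P n'' f' (fmupd \<gamma> (\<not> s, Y) S0)"
          using fmrelE2[OF f(8)] g by auto
        have c1: "compat \<gamma> s (fmupd \<gamma> (s, Y) T0) (fmupd \<gamma> (\<not> s, Y) S0)"
          using ct unfolding \<open>T = _\<close> \<open>S = _\<close> by (metis compat_upd_same g f)
        have c2: "compat \<delta> r (fmupd \<gamma> (s, Y) T0) U"
          using cu unfolding \<open>T = _\<close> by (rule compat_upd(1)[OF \<gamma>\<delta>, THEN iffD1])
        have "sim P (xcut s \<gamma> g f) (xcut s \<gamma> g' f')"
          using xcut_beta[OF cfree_der[OF \<open>cfree P m'' _ _\<close>] \<open>\<gamma> |\<notin>| fmdom T0\<close> \<open>fmlookup X k = _\<close>, of S0 fs S f'] f g f' ct df by simp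
        then have 1: "sim P (xcut r \<delta> (xcut s \<gamma> g f) h) (xcut r \<delta> (xcut s \<gamma> g' f') h)"
          by (rule sim_xcut[OF _ sim_refl_der[OF dh] dgf dh ctu])
        have 2: "sim P (xcut r \<delta> (xcut s \<gamma> g' f') h) (xcut s \<gamma> (xcut r \<delta> g' h) f')"
          using IH[OF _ f'(2) \<open>cfree P m'' _ _\<close> ch c1 c2] N disj f g by simp
        note 3 = xcut_sel[OF cfree_der[OF \<open>cfree P m'' _ _\<close>] \<open>\<gamma> |\<notin>| fmdom T0\<close> \<open>fmlookup X k = _\<close> \<open>fmran' X \<subseteq> _\<close> dh cu[unfolded \<open>T = _\<close>] \<gamma>\<delta>]
        have 4: "sim P (xcut s \<gamma> (xcut r \<delta> g h) f) (xcut s \<gamma> (sel s \<gamma> k X (xcut r \<delta> g' h)) f)"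
          using sim_xcut[OF _ sim_refl_der[OF df] dgh df cut] 3(1) g by blast
        have "\<gamma> |\<notin>| fmdom (join \<delta> T0 U)" "join \<delta> T U = fmupd \<gamma> (s, con (\<not> s) X) (join \<delta> T0 U)"
          using g \<open>\<gamma> |\<notin>| fmdom U\<close> \<gamma>\<delta> by (auto simp: join_upd)
        then have 5: "sim P (xcut s \<gamma> (sel s \<gamma> k X (xcut r \<delta> g' h)) f) (xcut s \<gamma> (xcut r \<delta> g' h) f')"
          using xcut_beta[OF 3(2) _ \<open>fmlookup X k = _\<close>, of S0 fs S f'] f f' cut df by simp
        from 1 2 4 5 show ?thesis
          by (metis sim.sym sim.trans)
      qed (use pf asig_not_con Z g in auto)
    qed (use pg in auto)
  qed
  note cf = less.prems(1) and cg = less.prems(2) and ch = less.prems(3)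
    and ct = less.prems(4) and cu = less.prems(5) and disj = less.prems(6)
  have disj': "fmdom U |\<inter>| fmdom S = {||}" using disj by (simp add: inf_commute)
  have ctu: "compat \<delta> r (join \<gamma> T S) U"
    using compat_join[OF ct cu disj] .
  have cut: "compat \<gamma> s (join \<delta> T U) S"
    using compat_join[OF cu ct disj'] .
  have df: "der P f S" and dg: "der P g T" and dh: "der P h U"
    using cf cg ch cfree_der by blast+
  obtain Z where Z: "fmlookup T \<gamma> = Some (s, Z)" "fmlookup S \<gamma> = Some (\<not> s, Z)"
    using ct by (auto simp: compat_def)
  obtain Z' where Z': "fmlookup T \<delta> = Some (r, Z')" "fmlookup U \<delta> = Some (\<not> r, Z')"
    using cu by (auto simp: compat_def)
  \<comment> \<open>Stated for every \<open>T0\<close> within the domain of \<open>T\<close>,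
    because it is applied to the context of \<open>g\<close> without the channel of its last
    rule.\<close>
  have jj: "join \<gamma> (join \<delta> T0 U) S = join \<delta> (join \<gamma> T0 S) U" if "fmdom T0 |\<subseteq>| fmdom T" for T0
  proof (rule join_join)
    show "fmdom S |\<inter>| fmdom U = {||}" by (rule disj)
    show "\<gamma> |\<notin>| fmdom U" "\<delta> |\<notin>| fmdom S"
      using compat_in[OF ct] compat_in[OF cu] disj by auto
    show "c = \<gamma>" if "c |\<in>| fmdom S" "c |\<in>| fmdom T0" for c
      using that \<open>fmdom T0 |\<subseteq>| fmdom T\<close> compat_dom[OF ct, of c] by auto
    show "c = \<delta>" if "c |\<in>| fmdom T0" "c |\<in>| fmdom U" for c
      using that \<open>fmdom T0 |\<subseteq>| fmdom T\<close> compat_dom[OF cu, of c] by auto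
  qed
  consider "\<not> principal \<gamma> f" | "\<not> principal \<delta> h" | "principal \<gamma> f" "principal \<delta> h" by blast
  then show ?case
  proof cases
    case 1
    then show ?thesis using outer[OF HOL.refl cf cg ch ct cu disj] by blast
  next
    case 2
    then show ?thesis using outer[OF _ ch cg cf cu ct disj'] by (simp add: sim.sym)
  next
    case 3
    from cg Z(1) show ?thesis
    proof (cases rule: cfree_cases)
      \<comment> \<open>All formulas of \<open>g\<close> are atoms, so the principal pieces
        \<open>f\<close> and \<open>h\<close> must be axioms too, and the equation becomes one of
        the laws of \<open>P\<close>.\<close>
      case g: (ax k)
      from cf Z(2) 3(1) obtain i where f: "f = Axiom i" "i \<in> arr P" "S = asig P i"
        by (cases rule: cfree_cases) (use Z g asig_not_con in auto)
      from ch Z'(2) 3(2) obtain j where h: "h = Axiom j" "j \<in> arr P" "U = asig P j"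
        by (cases rule: cfree_cases) (use Z' g asig_not_con in auto)
      note c = ct[unfolded g f] and d = cu[unfolded g h]
      note 1 = pcut_axiom[OF pc \<open>k \<in> arr P\<close> f(2) c] and 2 = pcut_axiom[OF pc \<open>k \<in> arr P\<close> h(2) d]
      have c': "compat \<gamma> s (asig P (pcut P r \<delta> k j)) (asig P i)" and d': "compat \<delta> r (asig P (pcut P s \<gamma> k i)) (asig P j)"
        using ctu cut unfolding 1(2) 2(2) g(3) f(3) h(3) by auto
      note 3 = pcut_axiom[OF pc 1(1) h(2) d'] and 4 = pcut_axiom[OF pc 2(1) f(2) c']
      have "sim P (xcut r \<delta> (xcut s \<gamma> g f) h) (xcut r \<delta> (Axiom (pcut P s \<gamma> k i)) h)"
        using sim_xcut[OF _ sim_refl_der[OF dh] der_xcut[OF dg df ct] dh ctu] 1(3) g f by blast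
      moreover have "sim P (xcut s \<gamma> (xcut r \<delta> g h) f) (xcut s \<gamma> (Axiom (pcut P r \<delta> k j)) f)"
        using sim_xcut[OF _ sim_refl_der[OF df] der_xcut[OF dg dh cu] df cut] 2(3) g h by blast
      moreover have "pcut P r \<delta> (pcut P s \<gamma> k i) j = pcut P s \<gamma> (pcut P r \<delta> k j) i"
        using axiom_assoc[OF f(2) \<open>k \<in> arr P\<close> h(2) c d] disj f h by (simp add: fmdom_asig)
      ultimately show ?thesis
        using 3(3) 4(3) f h by (metis sim.sym sim.trans)
    next
      case (fam m' s' T0 \<alpha> X gs)
      show ?thesis
      proof (cases "\<alpha> = \<delta>")
        case True
        \<comment> \<open>The rule of \<open>g\<close> acts on \<open>\<delta>\<close>, so it is
          \<open>h\<close> that takes part in the principal step; the roles of \<open>f\<close> and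
          \<open>h\<close> are exchanged.\<close>
        have "sim P (xcut s \<gamma> (xcut r \<delta> g h) f) (xcut r \<delta> (xcut s \<gamma> g f) h)"
          by (rule mid[OF _ ch cg cf cu ct disj' 3(2)]) (use fam True in auto)
        then show ?thesis by (rule sim.sym)
      next
        case False
        have 1: "sim P (xcut r \<delta> (xcut s \<gamma> g f) h) (fam s' (join \<delta> (join \<gamma> T0 S) U) \<alpha> X (fmmap (\<lambda>g. xcut r \<delta> (xcut s \<gamma> g f) h) gs))"
          using dg df dh ct ctu \<open>\<alpha> \<noteq> \<gamma>\<close> False unfolding \<open>g = _\<close> by (rule xcut_fam2)
        have 2: "sim P (xcut s \<gamma> (xcut r \<delta> g h) f) (fam s' (join \<gamma> (join \<delta> T0 U) S) \<alpha> X (fmmap (\<lambda>g. xcut s \<gamma> (xcut r \<delta> g h) f) gs))"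
          using dg dh df cu cut False \<open>\<alpha> \<noteq> \<gamma>\<close> unfolding \<open>g = _\<close> by (rule xcut_fam2)
        have "fmrel (sim P) (fmmap (\<lambda>g. xcut r \<delta> (xcut s \<gamma> g f) h) gs) (fmmap (\<lambda>g. xcut s \<gamma> (xcut r \<delta> g h) f) gs)"
        proof (rule fmrel_Some_iff[THEN iffD2], intro conjI allI impI)
          fix i x y
          assume "fmlookup (fmmap (\<lambda>g. xcut r \<delta> (xcut s \<gamma> g f) h) gs) i = Some x"
            "fmlookup (fmmap (\<lambda>g. xcut s \<gamma> (xcut r \<delta> g h) f) gs) i = Some y"
          then obtain g' where g': "fmlookup gs i = Some g'" "x = xcut r \<delta> (xcut s \<gamma> g' f) h" "y = xcut s \<gamma> (xcut r \<delta> g' h) f"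
            by auto
          from fmrelE1[OF fam(8) g'(1)] obtain Y where Y: "cfree P m' g' (fmupd \<alpha> (s', Y) T0)" .
          have c1: "compat \<gamma> s (fmupd \<alpha> (s', Y) T0) S"
            using ct unfolding \<open>T = _\<close> by (rule compat_upd(1)[OF \<open>\<alpha> \<noteq> \<gamma>\<close>, THEN iffD1])
          have c2: "compat \<delta> r (fmupd \<alpha> (s', Y) T0) U"
            using cu unfolding \<open>T = _\<close> by (rule compat_upd(1)[OF False, THEN iffD1])
          from IH[OF _ cf Y ch c1 c2 disj] fam show "sim P x y"
            unfolding g'(2,3) by simp
        qed simp
        from sim_fam[OF this] have 3: "sim P (fam s' (join \<delta> (join \<gamma> T0 S) U) \<alpha> X (fmmap (\<lambda>g. xcut r \<delta> (xcut s \<gamma> g f) h) gs))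
            (fam s' (join \<delta> (join \<gamma> T0 S) U) \<alpha> X (fmmap (\<lambda>g. xcut s \<gamma> (xcut r \<delta> g h) f) gs))"
          using sim_der_ex[OF 1] by blast
        have "join \<gamma> (join \<delta> T0 U) S = join \<delta> (join \<gamma> T0 S) U"
          using fam by (intro jj) auto
        with 2 show ?thesis
          by (simp add: sim.trans[OF 1 sim.trans[OF 3 sim.sym]])
      qed
    next
      case (sel m' s' T0 \<alpha> X k Y g')
      show ?thesis
      proof (cases "\<alpha> = \<delta>")
        case True
        have "sim P (xcut s \<gamma> (xcut r \<delta> g h) f) (xcut r \<delta> (xcut s \<gamma> g f) h)"
          by (rule mid[OF _ ch cg cf cu ct disj' 3(2)]) (use sel True in auto)
        then show ?thesis by (rule sim.sym)
      next
        case False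
        note dg' = cfree_der[OF \<open>cfree P m' _ _\<close>] \<open>\<alpha> |\<notin>| fmdom T0\<close> \<open>fmlookup X k = _\<close> \<open>fmran' X \<subseteq> _\<close>
        note 1 = xcut_sel2[OF dg' df dh ct[unfolded \<open>T = _\<close>] ctu[unfolded \<open>T = _\<close>] \<open>\<alpha> \<noteq> \<gamma>\<close> False]
        note 2 = xcut_sel2[OF dg' dh df cu[unfolded \<open>T = _\<close>] cut[unfolded \<open>T = _\<close>] False \<open>\<alpha> \<noteq> \<gamma>\<close>]
        have c1: "compat \<gamma> s (fmupd \<alpha> (s', Y) T0) S"
          using ct unfolding \<open>T = _\<close> by (rule compat_upd(1)[OF \<open>\<alpha> \<noteq> \<gamma>\<close>, THEN iffD1])
        have c2: "compat \<delta> r (fmupd \<alpha> (s', Y) T0) U"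
          using cu unfolding \<open>T = _\<close> by (rule compat_upd(1)[OF False, THEN iffD1])
        from IH[OF _ cf \<open>cfree P m' _ _\<close> ch c1 c2 disj] sel
        have "sim P (xcut r \<delta> (xcut s \<gamma> g' f) h) (xcut s \<gamma> (xcut r \<delta> g' h) f)"
          by simp
        then have "sim P (sel s' \<alpha> k X (xcut r \<delta> (xcut s \<gamma> g' f) h)) (sel s' \<alpha> k X (xcut s \<gamma> (xcut r \<delta> g' h) f))"
          using sim_sel[OF _ 1(2,3)] sel by blast
        with 1(1) 2(1) sel show ?thesis
          by (metis sim.sym sim.trans)
      qed
    next
      case pfam
      show ?thesis by (rule mid[OF HOL.refl cf cg ch ct cu disj 3(1)]) (use pfam in auto)
    next
      case psel
      show ?thesis by (rule mid[OF HOL.refl cf cg ch ct cu disj 3(1)]) (use psel in auto)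
    qed
  qed
qed

lemma sim_assoc:
  assumes f: "der P f S" and g: "der P g T" and h: "der P h U"
    and c: "compat \<gamma> s T S" and d: "compat \<delta> r T U" and disj: "fmdom S |\<inter>| fmdom U = {||}"
  shows "sim P (xcut r \<delta> (xcut s \<gamma> g f) h) (xcut s \<gamma> (xcut r \<delta> g h) f)"
proof -
  obtain n f' where f': "sim P f f'" "cfree P n f' S" using cut_elim[OF f] by blast
  obtain m g' where g': "sim P g g'" "cfree P m g' T" using cut_elim[OF g] by blast
  obtain l h' where h': "sim P h h'" "cfree P l h' U" using cut_elim[OF h] by blast
  have disj': "fmdom U |\<inter>| fmdom S = {||}" using disj by (simp add: inf_commute)
  have "sim P (xcut r \<delta> (xcut s \<gamma> g f) h) (xcut r \<delta> (xcut s \<gamma> g' f') h')"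
    by (rule sim_xcut[OF sim_xcut[OF g'(1) f'(1) g f c] h'(1) der_xcut[OF g f c] h compat_join[OF c d disj]])
  moreover have "sim P (xcut s \<gamma> (xcut r \<delta> g h) f) (xcut s \<gamma> (xcut r \<delta> g' h') f')"
    by (rule sim_xcut[OF sim_xcut[OF g'(1) h'(1) g h d] f'(1) der_xcut[OF g h d] f compat_join[OF d c disj']])
  ultimately show ?thesis
    using assoc_cfree[OF f'(2) g'(2) h'(2) c d disj] by (meson sim.sym sim.trans)
qed

section \<open>Identity derivations and the unit laws\<close>

lemma xi_Atom: "xi P s \<alpha> \<beta> (Atom a) = Axiom (if s then idn P \<alpha> \<beta> a else idn P \<beta> \<alpha> a)"
  by (simp add: xi_def)

text \<open>According to the connective, the family stands at one end of the identity and the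
  selections at the other; the two equations give the two possibilities relative to the
  sign.\<close>

lemma xi_con:
  "xi P s \<alpha> \<beta> (con s X) = fam s (single \<alpha> (\<not> s, con s X)) \<beta> X (fmmap_keys (\<lambda>i Y. sel (\<not> s) \<alpha> i X (xi P s \<alpha> \<beta> Y)) X)"
  "xi P s \<alpha> \<beta> (con (\<not> s) X) = fam (\<not> s) (single \<beta> (s, con (\<not> s) X)) \<alpha> X (fmmap_keys (\<lambda>i Y. sel s \<beta> i X (xi P s \<alpha> \<beta> Y)) X)"
proof -
  have [simp]: "fmmap_keys F (fmmap h X) = fmmap_keys (\<lambda>i Y. F i (h Y)) X" for F h and X :: "(name, 'a form) fmap"
    by (rule fmap_ext) (simp add: option.map_comp comp_def)
  show "xi P s \<alpha> \<beta> (con s X) = fam s (single \<alpha> (\<not> s, con s X)) \<beta> X (fmmap_keys (\<lambda>i Y. sel (\<not> s) \<alpha> i X (xi P s \<alpha> \<beta> Y)) X)"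
    "xi P s \<alpha> \<beta> (con (\<not> s) X) = fam (\<not> s) (single \<beta> (s, con (\<not> s) X)) \<alpha> X (fmmap_keys (\<lambda>i Y. sel s \<beta> i X (xi P s \<alpha> \<beta> Y)) X)"
    by (cases s; simp add: xi_def con_def fam_def sel_def part_upd)+
qed

lemma fmran'_formulas: "fmran' X \<subseteq> formulas P \<Longrightarrow> fmlookup X i = Some Y \<Longrightarrow> Y \<in> formulas P"
  by (auto intro: fmran'I)

lemma der_xi: "Z \<in> formulas P \<Longrightarrow> \<alpha> \<noteq> \<beta> \<Longrightarrow> der P (xi P s \<alpha> \<beta> Z) (fmupd \<alpha> (\<not> s, Z) (single \<beta> (s, Z)))"
proof (induction Z rule: form_induct)
  case (atom a)
  define m where "m = (if s then idn P \<alpha> \<beta> a else idn P \<beta> \<alpha> a)"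
  have m: "m \<in> arr P" "src P m = single (if s then \<alpha> else \<beta>) a" "tgt P m = single (if s then \<beta> else \<alpha>) a"
    using idn_hom[of a \<alpha> \<beta>] idn_hom[of a \<beta> \<alpha>] atom by (auto simp: hom_def m_def)
  then have "asig P m = fmupd \<alpha> (\<not> s, Atom a) (single \<beta> (s, Atom a))"
    using \<open>\<alpha> \<noteq> \<beta>\<close> by (intro fmap_ext) (auto simp: asig_def signed_def fmmap_fmupd)
  with der_axiom[OF pc m(1)] show ?case by (simp add: xi_Atom m_def)
next
  case (con b X)
  have XP: "fmran' X \<subseteq> formulas P" using con.prems by (simp add: con_formulas)
  have IH: "der P (xi P s \<alpha> \<beta> Y) (fmupd \<alpha> (\<not> s, Y) (single \<beta> (s, Y)))" if "fmlookup X i = Some Y" for i Y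
    using con.IH[OF that] fmran'_formulas[OF XP that] con.prems by blast
  have swap: "fmupd \<beta> v (single \<alpha> w) = fmupd \<alpha> w (single \<beta> v)" for v w :: "bool \<times> 'a form"
    using \<open>\<alpha> \<noteq> \<beta>\<close> by (rule fmupd_reorder_neq[OF not_sym])
  consider "b = s" | "b = (\<not> s)" by blast
  then show ?case
  proof cases
    case 1
    have "der P (sel (\<not> s) \<alpha> i X (xi P s \<alpha> \<beta> Y)) (fmupd \<beta> (s, Y) (single \<alpha> (\<not> s, con s X)))" if "fmlookup X i = Some Y" for i Y
      using der_sel[OF IH[OF that] _ that XP] \<open>\<alpha> \<noteq> \<beta>\<close> by (simp add: swap)
    then show ?thesis
      using \<open>\<alpha> \<noteq> \<beta>\<close> XP unfolding 1 xi_con(1) der_fam_iff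
      by (auto simp: swap over_upd con_formulas fmrel_Some_iff over_def)
  next
    case 2
    have "der P (sel s \<beta> i X (xi P s \<alpha> \<beta> Y)) (fmupd \<alpha> (\<not> s, Y) (single \<beta> (s, con (\<not> s) X)))" if "fmlookup X i = Some Y" for i Y
      using der_sel[of P _ \<beta> s Y "single \<alpha> (\<not> s, Y)", OF IH[OF that, folded swap] _ that XP] \<open>\<alpha> \<noteq> \<beta>\<close> by (simp add: swap)
    then show ?thesis
      using \<open>\<alpha> \<noteq> \<beta>\<close> XP unfolding 2 xi_con(2) der_fam_iff
      by (auto simp: over_upd con_formulas fmrel_Some_iff over_def)
  qed
qed

lemma rename_xi: "Z \<in> formulas P \<Longrightarrow> \<alpha> \<noteq> \<beta> \<Longrightarrow> rename_deriv P p (xi P s \<alpha> \<beta> Z) = xi P s (apply p \<alpha>) (apply p \<beta>) Z"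
proof (induction Z rule: form_induct)
  case (atom a)
  then show ?case by (simp add: xi_Atom ren_idn)
next
  case (con b X)
  have XP: "fmran' X \<subseteq> formulas P" using con.prems by (simp add: con_formulas)
  have IH: "rename_deriv P p (xi P s \<alpha> \<beta> Y) = xi P s (apply p \<alpha>) (apply p \<beta>) Y" if "fmlookup X i = Some Y" for i Y
    using con.IH[OF that] fmran'_formulas[OF XP that] con.prems by blast
  have *: "fmmap_keys (\<lambda>i Y. sel b' \<gamma> i X (rename_deriv P p (xi P s \<alpha> \<beta> Y))) X
      = fmmap_keys (\<lambda>i Y. sel b' \<gamma> i X (xi P s (apply p \<alpha>) (apply p \<beta>) Y)) X" for b' \<gamma>
    by (rule fmap_ext) (auto simp: IH intro!: map_option_cong)
  consider "b = s" | "b = (\<not> s)" by blast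
  then show ?case
    by cases (simp_all add: xi_con rename_fam rename_sel fmmap_fmmap_keys *)
qed

text \<open>On contexts the cut with an identity is a transposition, which makes both sides of the
  unit law derive the same sequent.\<close>

lemma join_swap:
  assumes "fmlookup S \<gamma> = Some (s, Z)" "\<beta> |\<notin>| fmdom S"
  shows "join \<gamma> S (fmupd \<gamma> v (single \<beta> (s, Z))) = rename_ctx (Perm.swap \<gamma> \<beta>) S"
proof (rule fmap_ext)
  fix c
  show "fmlookup (join \<gamma> S (fmupd \<gamma> v (single \<beta> (s, Z)))) c = fmlookup (rename_ctx (Perm.swap \<gamma> \<beta>) S) c"
    using assms by (cases "c = \<gamma>"; cases "c = \<beta>") (auto simp: fmlookup_join)
qed

text \<open>The induction is on the height of \<open>f\<close> with the formula \<open>Z\<close>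
  left arbitrary: in a principal case the cut passes to a premise of \<open>f\<close> and, at the
  same moment, to the identity of a component of \<open>Z\<close>.\<close>

lemma xcut_xi_cfree:
  "cfree P n f S \<Longrightarrow> fmlookup S \<gamma> = Some (s, Z) \<Longrightarrow> \<beta> |\<notin>| fmdom S \<Longrightarrow>
    sim P (xcut s \<gamma> f (xi P s \<gamma> \<beta> Z)) (rename_deriv P (Perm.swap \<gamma> \<beta>) f)"
proof (induction n arbitrary: f S Z rule: less_induct)
  case (less n)
  note cf = less.prems(1) and Z = less.prems(2) and \<beta> = less.prems(3)
  let ?r = "rename_deriv P (Perm.swap \<gamma> \<beta>)"
  have df: "der P f S" by (rule cfree_der[OF cf])
  have \<gamma>\<beta>: "\<gamma> \<noteq> \<beta>" using Z \<beta> by auto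
  have ZP: "Z \<in> formulas P" using der_over[OF pc df] Z by (auto simp: over_def)
  note dx = der_xi[OF ZP \<gamma>\<beta>, of s]
  have compat: "compat \<gamma> s S' (fmupd \<gamma> (\<not> s, Z) (single \<beta> (s, Z)))"
    if "fmlookup S' \<gamma> = Some (s, Z)" "\<beta> |\<notin>| fmdom S'" for S' Z
    using that by (intro compatI[where Z = Z]) auto
  note c = compat[OF Z \<beta>]
  have dcut: "der P (xcut s \<gamma> f (xi P s \<gamma> \<beta> Z)) (rename_ctx (Perm.swap \<gamma> \<beta>) S)"
    using der_xcut[OF df dx c] unfolding join_swap[OF Z \<beta>] .
  from cf Z show ?case
  proof (cases rule: cfree_cases)
    case (ax m)
    then obtain a where a: "Z = Atom a" using Z by (auto simp: asig_Some[OF pc])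
    have "conv P (xcut s \<gamma> f (xi P s \<gamma> \<beta> Z)) (?r f)"
      using \<gamma>\<beta> ZP by (cases s) (simp_all add: a xi_Atom xcut_def conv.c1 conv.c2)
    then show ?thesis
      by (rule sim_conv[OF _ dcut der_rename[OF df]])
  next
    case (fam n' s' S0 \<alpha> X fs)
    have S0: "fmlookup S0 \<gamma> = Some (s, Z)" "\<beta> |\<notin>| fmdom S0" "\<alpha> \<noteq> \<beta>"
      using Z \<beta> fam by auto
    have 1: "sim P (xcut s \<gamma> f (xi P s \<gamma> \<beta> Z))
        (fam s' (rename_ctx (Perm.swap \<gamma> \<beta>) S0) \<alpha> X (fmmap (\<lambda>f. xcut s \<gamma> f (xi P s \<gamma> \<beta> Z)) fs))"
      using xcut_fam[OF df[unfolded \<open>f = _\<close>] dx c \<open>\<alpha> \<noteq> \<gamma>\<close> pc] unfolding join_swap[OF S0(1,2)] \<open>f = _\<close> .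
    have "fmrel (sim P) (fmmap (\<lambda>f. xcut s \<gamma> f (xi P s \<gamma> \<beta> Z)) fs) (fmmap ?r fs)"
    proof (rule fmrel_Some_iff[THEN iffD2], intro conjI allI impI)
      fix i x y
      assume "fmlookup (fmmap (\<lambda>f. xcut s \<gamma> f (xi P s \<gamma> \<beta> Z)) fs) i = Some x" "fmlookup (fmmap ?r fs) i = Some y"
      then obtain f' where f': "fmlookup fs i = Some f'" "x = xcut s \<gamma> f' (xi P s \<gamma> \<beta> Z)" "y = ?r f'"
        by auto
      from fmrelE1[OF fam(8) f'(1)] obtain Y where Y: "cfree P n' f' (fmupd \<alpha> (s', Y) S0)" .
      from less.IH[OF _ Y] S0 \<open>\<alpha> \<noteq> \<gamma>\<close> fam show "sim P x y"
        unfolding f'(2,3) by simp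
    qed simp
    from sim_fam[OF this] have "sim P (fam s' (rename_ctx (Perm.swap \<gamma> \<beta>) S0) \<alpha> X (fmmap (\<lambda>f. xcut s \<gamma> f (xi P s \<gamma> \<beta> Z)) fs))
        (fam s' (rename_ctx (Perm.swap \<gamma> \<beta>) S0) \<alpha> X (fmmap ?r fs))"
      using sim_der_ex[OF 1] by blast
    from sim.trans[OF 1 this] show ?thesis
      using \<open>\<alpha> \<noteq> \<gamma>\<close> S0(3) by (simp add: fam(2) rename_fam)
  next
    case (sel n' s' S0 \<alpha> X k Y f')
    have S0: "fmlookup S0 \<gamma> = Some (s, Z)" "\<beta> |\<notin>| fmdom S0" "\<alpha> \<noteq> \<beta>"
      using Z \<beta> sel by auto
    note x = xcut_sel[OF cfree_der[OF \<open>cfree P n' _ _\<close>] \<open>\<alpha> |\<notin>| fmdom S0\<close> \<open>fmlookup X k = _\<close> \<open>fmran' X \<subseteq> _\<close> dx c[unfolded \<open>S = _\<close>] \<open>\<alpha> \<noteq> \<gamma>\<close>]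
    have "sim P (xcut s \<gamma> f' (xi P s \<gamma> \<beta> Z)) (?r f')"
      using less.IH[OF _ \<open>cfree P n' _ _\<close>] S0 \<open>\<alpha> \<noteq> \<gamma>\<close> sel by simp
    then have "sim P (sel s' \<alpha> k X (xcut s \<gamma> f' (xi P s \<gamma> \<beta> Z))) (sel s' \<alpha> k X (?r f'))"
      by (rule sim_sel[OF _ x(2)]) (use sel S0 in auto)
    from sim.trans[OF x(1) this] show ?thesis
      using \<open>\<alpha> \<noteq> \<gamma>\<close> S0(3) by (simp add: sel(2) rename_sel)
  next
    case (pfam n' S0 X fs)
    let ?xs = "fmmap_keys (\<lambda>i Y. sel (\<not> s) \<gamma> i X (xi P s \<gamma> \<beta> Y)) X"
    have S0: "\<beta> |\<notin>| fmdom S0" using \<beta> pfam by auto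
    have xi: "xi P s \<gamma> \<beta> Z = fam s (single \<gamma> (\<not> s, Z)) \<beta> X ?xs"
      by (simp add: pfam xi_con)
    \<comment> \<open>Neither \<open>\<gamma>\<close> nor \<open>\<beta>\<close> occurs in
      \<open>S0\<close>, so the transposition fixes it.\<close>
    have ctx: "join \<gamma> (single \<gamma> (\<not> s, Z)) S = rename_ctx (Perm.swap \<gamma> \<beta>) S0"
      using S0 \<open>\<gamma> |\<notin>| fmdom S0\<close> unfolding pfam(4)
      by (subst rename_ctx_fix[of S0]) (metis apply_swap_same, auto intro!: fmap_ext simp: fmlookup_join)
    \<comment> \<open>The cut is read from the identity, whose family stands at the free end
      \<open>\<beta>\<close> and can be pushed out. Each component is then a selection at
      \<open>\<gamma>\<close> facing the family \<open>f\<close>.\<close>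
    have 1: "sim P (xcut (\<not> s) \<gamma> (xi P s \<gamma> \<beta> Z) f)
        (fam s (rename_ctx (Perm.swap \<gamma> \<beta>) S0) \<beta> X (fmmap (\<lambda>x. xcut (\<not> s) \<gamma> x f) ?xs))"
      using dx df compat_sym[OF c] \<gamma>\<beta>[symmetric] unfolding xi ctx[symmetric] by (rule xcut_fam) (rule pc)
    have "fmrel (sim P) (fmmap (\<lambda>x. xcut (\<not> s) \<gamma> x f) ?xs) (fmmap ?r fs)"
    proof (rule fmrel_Some_iff[THEN iffD2], intro conjI allI impI)
      show "fmdom (fmmap (\<lambda>x. xcut (\<not> s) \<gamma> x f) ?xs) = fmdom (fmmap ?r fs)"
        using pfam(8) by (simp add: fmrel_Some_iff)
      fix i x y
      assume "fmlookup (fmmap (\<lambda>x. xcut (\<not> s) \<gamma> x f) ?xs) i = Some x" "fmlookup (fmmap ?r fs) i = Some y"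
      then obtain f' Y where f': "fmlookup fs i = Some f'" "y = ?r f'" "fmlookup X i = Some Y"
          "x = xcut (\<not> s) \<gamma> (sel (\<not> s) \<gamma> i X (xi P s \<gamma> \<beta> Y)) f"
        by auto
      then have cf': "cfree P n' f' (fmupd \<gamma> (s, Y) S0)" using pfam(8) by (simp add: fmrel_Some_iff)
      have "der P (xi P s \<gamma> \<beta> Y) (fmupd \<gamma> (\<not> s, Y) (single \<beta> (s, Y)))"
        by (rule der_xi[OF fmran'_formulas[OF pfam(7) f'(3)] \<gamma>\<beta>])
      moreover have "compat \<gamma> (\<not> s) (fmupd \<gamma> (\<not> s, con s X) (single \<beta> (s, Y))) S"
        by (rule compatI[where Z = "con s X"]) (use S0 \<gamma>\<beta> in \<open>auto simp: pfam(4)\<close>)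
      ultimately have "sim P x (xcut (\<not> s) \<gamma> (xi P s \<gamma> \<beta> Y) f')"
        using xcut_beta[of P "xi P s \<gamma> \<beta> Y" \<gamma> "\<not> s" Y "single \<beta> (s, Y)" X i S0 fs S f'] f' df \<gamma>\<beta> pfam(1) by simp
      moreover have "sim P (xcut s \<gamma> f' (xi P s \<gamma> \<beta> Y)) (?r f')"
        using less.IH[OF _ cf'] S0 \<gamma>\<beta> pfam(2) by simp
      ultimately show "sim P x y"
        unfolding f'(2) xcut_not by (rule sim.trans)
    qed
    from sim_fam[OF this] have "sim P (fam s (rename_ctx (Perm.swap \<gamma> \<beta>) S0) \<beta> X (fmmap (\<lambda>x. xcut (\<not> s) \<gamma> x f) ?xs))
        (fam s (rename_ctx (Perm.swap \<gamma> \<beta>) S0) \<beta> X (fmmap ?r fs))"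
      using sim_der_ex[OF 1] by blast
    from sim.trans[OF 1 this] show ?thesis
      unfolding xcut_not by (simp add: pfam(1) rename_fam)
  next
    case (psel n' S0 X k Y f')
    let ?xs = "fmmap_keys (\<lambda>i Y. sel s \<beta> i X (xi P s \<gamma> \<beta> Y)) X"
    have S0: "\<beta> |\<notin>| fmdom S0" using \<beta> psel by auto
    have xi: "xi P s \<gamma> \<beta> Z = fam (\<not> s) (single \<beta> (s, Z)) \<gamma> X ?xs"
      by (simp add: psel xi_con)
    have df': "der P f' (fmupd \<gamma> (s, Y) S0)" by (rule cfree_der[OF psel(8)])
    have YP: "Y \<in> formulas P" by (rule fmran'_formulas[OF psel(7,6)])
    \<comment> \<open>Now the identity is a family at \<open>\<gamma>\<close> itself. The principal
      step picks its component \<open>k\<close>, whose selection at \<open>\<beta>\<close>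
      afterwards leaves the cut and restores the last rule of \<open>f\<close>.\<close>
    have 1: "sim P (xcut s \<gamma> f (xi P s \<gamma> \<beta> Z)) (xcut s \<gamma> f' (sel s \<beta> k X (xi P s \<gamma> \<beta> Y)))"
      using xcut_beta[OF df' psel(5,6), of "single \<beta> (s, Z)" ?xs _ "sel s \<beta> k X (xi P s \<gamma> \<beta> Y)"] dx c
      unfolding xi by (simp add: psel)
    have dY: "der P (xi P s \<gamma> \<beta> Y) (fmupd \<beta> (s, Y) (single \<gamma> (\<not> s, Y)))"
      using der_xi[OF YP \<gamma>\<beta>] by (simp add: fmupd_reorder_neq[OF \<gamma>\<beta>])
    have cY: "compat \<gamma> (\<not> s) (fmupd \<beta> (s, con (\<not> s) X) (single \<gamma> (\<not> s, Y))) (fmupd \<gamma> (s, Y) S0)"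
      by (rule compatI[where Z = Y]) (use S0 \<gamma>\<beta> in auto)
    note 2 = xcut_sel[OF dY _ psel(6,7) df' cY \<gamma>\<beta>[symmetric]]
    have "sim P (xcut s \<gamma> f' (xi P s \<gamma> \<beta> Y)) (?r f')"
      using less.IH[OF _ psel(8)] S0 \<gamma>\<beta> psel(2) by simp
    then have "sim P (sel s \<beta> k X (xcut s \<gamma> f' (xi P s \<gamma> \<beta> Y))) (sel s \<beta> k X (?r f'))"
      using sim_sel[OF _ 2(2)[unfolded xcut_not]] psel S0 \<gamma>\<beta> by auto
    moreover have "sim P (xcut s \<gamma> f' (sel s \<beta> k X (xi P s \<gamma> \<beta> Y))) (sel s \<beta> k X (xcut s \<gamma> f' (xi P s \<gamma> \<beta> Y)))"
      using 2(1) \<gamma>\<beta> by (simp add: xcut_not)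
    ultimately have "sim P (xcut s \<gamma> f (xi P s \<gamma> \<beta> Z)) (sel s \<beta> k X (?r f'))"
      using 1 by (meson sim.trans)
    then show ?thesis
      by (simp add: psel(1) rename_sel)
  qed
qed

lemma xcut_xi:
  assumes "der P f S" "fmlookup S \<gamma> = Some (s, Z)" "\<beta> |\<notin>| fmdom S"
  shows "sim P (xcut s \<gamma> f (xi P s \<gamma> \<beta> Z)) (rename_deriv P (Perm.swap \<gamma> \<beta>) f)"
proof -
  obtain n u where u: "sim P f u" "cfree P n u S" using cut_elim[OF assms(1)] by blast
  have ZP: "Z \<in> formulas P" using der_over[OF pc assms(1)] assms(2) by (auto simp: over_def)
  have "\<gamma> \<noteq> \<beta>" using assms by auto
  note dx = der_xi[OF ZP this, of s]
  have "compat \<gamma> s S (fmupd \<gamma> (\<not> s, Z) (single \<beta> (s, Z)))"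
    using assms by (intro compatI[where Z = Z]) auto
  from sim_xcut[OF u(1) sim_refl_der[OF dx] assms(1) dx this] xcut_xi_cfree[OF u(2) assms(2,3)] sim_rename[OF u(1)]
  show ?thesis by (meson sim.sym sim.trans)
qed

end

section \<open>The polycategory of derivations\<close>

lemma ex_fresh: "\<exists>c :: nat. c |\<notin>| C"
  using ex_new_if_finite[OF infinite_UNIV_nat, of "fset C"] by auto

definition smor :: "('o, 'm, 'z) polycat_scheme \<Rightarrow> (chan, bool \<times> 'o form) fmap \<Rightarrow> ('o, 'm) deriv \<Rightarrow> ('o, 'm) sp_arr" where
  "smor A S t = mor A (part False S) (part True S) t"

lemma sigma_pi_simps [simp]:
  "obj (sigma_pi A) = formulas A"
  "src (sigma_pi A) f = dom_ctx f" "tgt (sigma_pi A) f = cod_ctx f"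
  "sum_ob (sigma_pi A) = Sum" "prod_ob (sigma_pi A) = Prod"
  by (simp_all add: sigma_pi_def)

context polycategory
begin

abbreviation "sctx \<equiv> sig (sigma_pi P)"
abbreviation "scut \<equiv> pcut (sigma_pi P)"

section \<open>Families of derivations and their components up to \<open>sim\<close>\<close>

lemma rename_swap_swap: "der P t S \<Longrightarrow> sim P (rename_deriv P (Perm.swap a b) (rename_deriv P (Perm.swap a b) t)) t"
  using sim_rename_fix[of t S 1] by (simp flip: rename_deriv_mult)

text \<open>The selection applied to an identity is the injection or projection with index
  \<open>i\<close>. A principal step and the unit law leave the component \<open>f\<close>, moved to
  \<open>\<beta>\<close> because the channel \<open>\<alpha>\<close> is consumed by the cut.\<close>

lemma fam_component:
  assumes d: "der P (fam s S \<alpha> X fs) T" and i: "fmlookup fs i = Some f" "fmlookup X i = Some Y" and \<beta>: "\<beta> |\<notin>| fmdom T"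
  shows "sim P (xcut s \<alpha> (fam s S \<alpha> X fs) (sel (\<not> s) \<alpha> i X (xi P s \<alpha> \<beta> Y))) (rename_deriv P (Perm.swap \<alpha> \<beta>) f)"
    and "der P (sel (\<not> s) \<alpha> i X (xi P s \<alpha> \<beta> Y)) (fmupd \<alpha> (\<not> s, con s X) (single \<beta> (s, Y)))"
    and "compat \<alpha> s T (fmupd \<alpha> (\<not> s, con s X) (single \<beta> (s, Y)))"
proof -
  have T: "T = fmupd \<alpha> (s, con s X) S" "\<alpha> |\<notin>| fmdom S" "fmran' X \<subseteq> formulas P"
    "fmrel (\<lambda>f Y. der P f (fmupd \<alpha> (s, Y) S)) fs X"
    using d by (simp_all add: der_fam_iff)
  then have \<alpha>\<beta>: "\<alpha> \<noteq> \<beta>" "\<beta> |\<notin>| fmdom S" using \<beta> by auto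
  have df: "der P f (fmupd \<alpha> (s, Y) S)"
    using T(4) i by (simp add: fmrel_Some_iff)
  note dx = der_xi[OF fmran'_formulas[OF T(3) i(2)] \<alpha>\<beta>(1), of s]
  show c: "compat \<alpha> s T (fmupd \<alpha> (\<not> s, con s X) (single \<beta> (s, Y)))"
    by (rule compatI[where Z = "con s X"]) (use \<beta> in \<open>auto simp: T(1)\<close>)
  show "der P (sel (\<not> s) \<alpha> i X (xi P s \<alpha> \<beta> Y)) (fmupd \<alpha> (\<not> s, con s X) (single \<beta> (s, Y)))"
    using der_sel[OF dx _ i(2) T(3)] \<alpha>\<beta> by simp
  have "sim P (xcut (\<not> s) \<alpha> (sel (\<not> s) \<alpha> i X (xi P s \<alpha> \<beta> Y)) (fam s S \<alpha> X fs)) (xcut (\<not> s) \<alpha> (xi P s \<alpha> \<beta> Y) f)"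
    using xcut_beta[OF dx _ i(2), of S fs T f] \<alpha>\<beta> d compat_sym[OF c] i(1) by simp
  moreover have "sim P (xcut s \<alpha> f (xi P s \<alpha> \<beta> Y)) (rename_deriv P (Perm.swap \<alpha> \<beta>) f)"
    by (rule xcut_xi[OF df]) (use \<alpha>\<beta> in auto)
  ultimately show "sim P (xcut s \<alpha> (fam s S \<alpha> X fs) (sel (\<not> s) \<alpha> i X (xi P s \<alpha> \<beta> Y))) (rename_deriv P (Perm.swap \<alpha> \<beta>) f)"
    unfolding xcut_not by (rule sim.trans)
qed

lemma sim_famD:
  assumes sim: "sim P (fam s S \<alpha> X fs) (fam s S \<alpha> X gs)" and d: "der P (fam s S \<alpha> X fs) T"
  shows "fmrel (sim P) fs gs"
proof -
  have d': "der P (fam s S \<alpha> X gs) T" using d sim_der[OF sim] by simp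
  have rel: "fmrel (\<lambda>f Y. der P f (fmupd \<alpha> (s, Y) S)) fs X" "fmrel (\<lambda>f Y. der P f (fmupd \<alpha> (s, Y) S)) gs X"
    using d d' by (simp_all add: der_fam_iff)
  obtain \<beta> where \<beta>: "\<beta> |\<notin>| fmdom T" using ex_fresh by blast
  show ?thesis
    unfolding fmrel_Some_iff
  proof (intro conjI allI impI)
    show "fmdom fs = fmdom gs" using rel by (simp add: fmrel_Some_iff)
    fix i f g assume i: "fmlookup fs i = Some f" "fmlookup gs i = Some g"
    from fmrelE1[OF rel(1) i(1)] obtain Y where Y: "fmlookup X i = Some Y" "der P f (fmupd \<alpha> (s, Y) S)" .
    have dg: "der P g (fmupd \<alpha> (s, Y) S)" using rel(2) i(2) Y(1) by (simp add: fmrel_Some_iff)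
    note cf = fam_component[OF d i(1) Y(1) \<beta>] and cg = fam_component[OF d' i(2) Y(1) \<beta>]
    have "sim P (rename_deriv P (Perm.swap \<alpha> \<beta>) f) (rename_deriv P (Perm.swap \<alpha> \<beta>) g)"
      using cf(1) cg(1) sim_xcut[OF sim sim_refl_der[OF cf(2)] d cf(2,3)] by (meson sim.sym sim.trans)
    from sim_rename[OF this, of "Perm.swap \<alpha> \<beta>"] rename_swap_swap[OF Y(2)] rename_swap_swap[OF dg]
    show "sim P f g" by (meson sim.sym sim.trans)
  qed
qed

lemma fam_surj:
  assumes d: "der P t (fmupd \<alpha> (s, con s X) S)" and \<alpha>: "\<alpha> |\<notin>| fmdom S"
  shows "\<exists>fs. sim P t (fam s S \<alpha> X fs)"
proof -
  let ?T = "fmupd \<alpha> (s, con s X) S"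
  obtain \<beta> where \<beta>: "\<beta> |\<notin>| fmdom ?T" using ex_fresh by blast
  \<comment> \<open>Moving \<open>t\<close> to \<open>\<beta>\<close> frees \<open>\<alpha>\<close>
    for the outer end of the identity, so that the family pushed out of the cut acts on the original
    channel.\<close>
  let ?t = "rename_deriv P (Perm.swap \<alpha> \<beta>) t"
  have T': "rename_ctx (Perm.swap \<alpha> \<beta>) ?T = fmupd \<beta> (s, con s X) S"
    using \<alpha> \<beta> by (simp, subst rename_ctx_fix) (metis apply_swap_same, simp)
  then have dt: "der P ?t (fmupd \<beta> (s, con s X) S)"
    using der_rename[OF d, of "Perm.swap \<alpha> \<beta>"] by simp
  have Z: "con s X \<in> formulas P" using der_over[OF pc d] \<alpha> by (simp add: over_upd)
  have "\<beta> \<noteq> \<alpha>" using \<beta> by auto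
  note dx = der_xi[OF Z this, of s]
  have c: "compat \<beta> s (fmupd \<beta> (s, con s X) S) (fmupd \<beta> (\<not> s, con s X) (single \<alpha> (s, con s X)))"
    by (rule compatI[where Z = "con s X"]) (use \<alpha> \<beta> in auto)
  have "sim P (xcut s \<beta> ?t (xi P s \<beta> \<alpha> (con s X))) (rename_deriv P (Perm.swap \<alpha> \<beta>) ?t)"
    using xcut_xi[OF dt, of \<beta> s "con s X" \<alpha>] \<alpha> \<beta> by (simp add: swap_sym)
  moreover have "join \<beta> (single \<beta> (\<not> s, con s X)) (fmupd \<beta> (s, con s X) S) = S"
    using \<beta> by (intro fmap_ext) (auto simp: fmlookup_join)
  then have "\<exists>fs. sim P (xcut (\<not> s) \<beta> (xi P s \<beta> \<alpha> (con s X)) ?t) (fam s S \<alpha> X fs)"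
    using xcut_fam[OF dx[unfolded xi_con] dt compat_sym[OF c] \<open>\<beta> \<noteq> \<alpha>\<close>[symmetric] pc]
    unfolding xi_con by auto
  ultimately show ?thesis
    using rename_swap_swap[OF d, of \<alpha> \<beta>] unfolding xcut_not by (meson sim.sym sim.trans)
qed

section \<open>Classes of derivations as polymorphisms\<close>

lemma smor_sctx: "der P t S \<Longrightarrow> sctx (smor P S t) = S"
  by (simp add: smor_def sig_def mor_def)

lemma arr_sigma: "f \<in> arr (sigma_pi P) \<longleftrightarrow> (\<exists>t S. der P t S \<and> f = smor P S t)"
proof
  assume "f \<in> arr (sigma_pi P)"
  then obtain \<Gamma> \<Delta> t where f: "f = mor P \<Gamma> \<Delta> t" "derives P t \<Gamma> \<Delta>"
    by (auto simp: sigma_pi_def)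
  moreover have "part False (signed \<Gamma> \<Delta>) = \<Gamma>" "part True (signed \<Gamma> \<Delta>) = \<Delta>"
    using derives_sequent[OF pc f(2)] by (simp_all add: sequent_def part_signed)
  ultimately show "\<exists>t S. der P t S \<and> f = smor P S t"
    using derives_der[OF pc f(2)] by (metis smor_def)
qed (auto simp: sigma_pi_def smor_def der_def)

lemma smor_arr: "der P t S \<Longrightarrow> smor P S t \<in> arr (sigma_pi P)"
  using arr_sigma by blast

text \<open>Since \<open>sim\<close> is a congruence, this lets the operations of
  \<open>sigma_pi\<close> be computed on any derivation in place of the chosen one.\<close>

lemma rep_smor:
  assumes "der P t S"
  shows "sim P (rep (smor P S t)) t" "der P (rep (smor P S t)) S"
proof -
  have "sim P t (rep (smor P S t))"
    using someI[of "\<lambda>u. sim P t u" t] sim_refl_der[OF assms] by (simp add: rep_def smor_def mor_def)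
  then show "sim P (rep (smor P S t)) t" "der P (rep (smor P S t)) S"
    using assms sim_der by (blast intro: sim.sym)+
qed

lemma smor_eq: "sim P t u \<Longrightarrow> smor P S t = smor P S u"
  by (auto simp: smor_def mor_def intro: sim.sym sim.trans)

lemma arr_rep:
  assumes "f \<in> arr (sigma_pi P)"
  shows "der P (rep f) (sctx f)" "f = smor P (sctx f) (rep f)"
    "dom_ctx f = part False (sctx f)" "cod_ctx f = part True (sctx f)"
proof -
  obtain t S where f: "der P t S" "f = smor P S t" using assms arr_sigma by blast
  then show "der P (rep f) (sctx f)" "f = smor P (sctx f) (rep f)"
    using rep_smor[OF f(1)] smor_eq by (auto simp: smor_sctx)
  show "dom_ctx f = part False (sctx f)" "cod_ctx f = part True (sctx f)"
    using f by (auto simp: smor_sctx) (simp_all add: smor_def mor_def)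
qed

text \<open>The contexts need no separate comparison: they are determined by the representatives,
  and \<open>sim\<close> preserves sequents.\<close>

lemma arr_eqI:
  assumes f: "f \<in> arr (sigma_pi P)" and g: "g \<in> arr (sigma_pi P)" and sim: "sim P (rep f) (rep g)"
  shows "f = g"
proof -
  have "sctx g = sctx f"
    using arr_rep(1)[OF f] unfolding sim_der[OF sim] by (rule der_unique[OF _ arr_rep(1)[OF g]])
  then show ?thesis
    using arr_rep(2)[OF f] arr_rep(2)[OF g] smor_eq[OF sim] by metis
qed

lemma chans_sigma: "chans (sigma_pi P) f = fmdom (sctx f)"
  by (simp add: chans_def sig_def)

lemma cuttable_sigma: "cuttable (sigma_pi P) \<gamma> f g \<longleftrightarrow>
    f \<in> arr (sigma_pi P) \<and> g \<in> arr (sigma_pi P) \<and> compat \<gamma> True (sctx f) (sctx g)"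
  by (auto simp: cuttable_def compat_def chans_sigma arr_rep(3,4))

lemma scut:
  assumes f: "f \<in> arr (sigma_pi P)" and g: "g \<in> arr (sigma_pi P)" and c: "compat \<gamma> s (sctx f) (sctx g)"
  shows "scut s \<gamma> f g \<in> arr (sigma_pi P)" "sctx (scut s \<gamma> f g) = join \<gamma> (sctx f) (sctx g)"
    "sim P (rep (scut s \<gamma> f g)) (xcut s \<gamma> (rep f) (rep g))"
proof -
  have *: "cut (sigma_pi P) \<gamma> f g = smor P (join \<gamma> (sctx f) (sctx g)) (Cut \<gamma> (rep f) (rep g))"
    if "f \<in> arr (sigma_pi P)" "g \<in> arr (sigma_pi P)" "compat \<gamma> True (sctx f) (sctx g)" for f g
    using part_join[OF that(3)] arr_rep(3,4)[OF that(1)] arr_rep(3,4)[OF that(2)]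
    by (simp add: sigma_pi_def smor_def)
  have "scut s \<gamma> f g = smor P (join \<gamma> (sctx f) (sctx g)) (xcut s \<gamma> (rep f) (rep g))"
    using *[OF f g] *[OF g f] c compat_sym[OF c] compat_join_commute[OF c]
    by (cases s) (simp_all add: pcut_def xcut_def)
  moreover have "der P (xcut s \<gamma> (rep f) (rep g)) (join \<gamma> (sctx f) (sctx g))"
    by (rule der_xcut[OF arr_rep(1)[OF f] arr_rep(1)[OF g] c])
  ultimately show "scut s \<gamma> f g \<in> arr (sigma_pi P)" "sctx (scut s \<gamma> f g) = join \<gamma> (sctx f) (sctx g)"
    "sim P (rep (scut s \<gamma> f g)) (xcut s \<gamma> (rep f) (rep g))"
    by (simp_all add: smor_arr smor_sctx rep_smor)
qed

lemma sren:
  assumes f: "f \<in> arr (sigma_pi P)"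
  shows "ren (sigma_pi P) p f \<in> arr (sigma_pi P)" "sctx (ren (sigma_pi P) p f) = rename_ctx p (sctx f)"
    "sim P (rep (ren (sigma_pi P) p f)) (rename_deriv P p (rep f))"
proof -
  have "ren (sigma_pi P) p f = smor P (rename_ctx p (sctx f)) (rename_deriv P p (rep f))"
    using arr_rep(3,4)[OF f] by (simp add: sigma_pi_def smor_def part_rename)
  moreover have "der P (rename_deriv P p (rep f)) (rename_ctx p (sctx f))"
    by (rule der_rename[OF arr_rep(1)[OF f]])
  ultimately show "ren (sigma_pi P) p f \<in> arr (sigma_pi P)" "sctx (ren (sigma_pi P) p f) = rename_ctx p (sctx f)"
    "sim P (rep (ren (sigma_pi P) p f)) (rename_deriv P p (rep f))"
    by (simp_all add: smor_arr smor_sctx rep_smor)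
qed

lemma sidn:
  assumes "X \<in> formulas P" "\<alpha> \<noteq> \<beta>"
  shows "idn (sigma_pi P) \<alpha> \<beta> X \<in> arr (sigma_pi P)"
    "sctx (idn (sigma_pi P) \<alpha> \<beta> X) = fmupd \<alpha> (False, X) (single \<beta> (True, X))"
    "sim P (rep (idn (sigma_pi P) \<alpha> \<beta> X)) (xi P True \<alpha> \<beta> X)"
proof -
  have "idn (sigma_pi P) \<alpha> \<beta> X = smor P (fmupd \<alpha> (False, X) (single \<beta> (True, X))) (xi P True \<alpha> \<beta> X)"
    using assms by (simp add: sigma_pi_def smor_def part_upd xi_def)
  then show "idn (sigma_pi P) \<alpha> \<beta> X \<in> arr (sigma_pi P)"
    "sctx (idn (sigma_pi P) \<alpha> \<beta> X) = fmupd \<alpha> (False, X) (single \<beta> (True, X))"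
    "sim P (rep (idn (sigma_pi P) \<alpha> \<beta> X)) (xi P True \<alpha> \<beta> X)"
    using der_xi[OF assms, of True] by (simp_all add: smor_arr smor_sctx rep_smor)
qed

lemma scut_assoc:
  assumes f: "f \<in> arr (sigma_pi P)" and g: "g \<in> arr (sigma_pi P)" and h: "h \<in> arr (sigma_pi P)"
    and c: "compat \<gamma> s (sctx g) (sctx f)" and d: "compat \<delta> r (sctx g) (sctx h)"
    and disj: "fmdom (sctx f) |\<inter>| fmdom (sctx h) = {||}"
  shows "scut r \<delta> (scut s \<gamma> g f) h = scut s \<gamma> (scut r \<delta> g h) f"
proof (rule arr_eqI)
  have disj': "fmdom (sctx h) |\<inter>| fmdom (sctx f) = {||}" using disj by (simp add: inf_commute)
  note 1 = scut[OF g f c] and 2 = scut[OF g h d]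
  have d': "compat \<delta> r (sctx (scut s \<gamma> g f)) (sctx h)" and c': "compat \<gamma> s (sctx (scut r \<delta> g h)) (sctx f)"
    unfolding 1(2) 2(2) by (rule compat_join[OF c d disj] compat_join[OF d c disj'])+
  note 3 = scut[OF 1(1) h d'] and 4 = scut[OF 2(1) f c']
  show "scut r \<delta> (scut s \<gamma> g f) h \<in> arr (sigma_pi P)" "scut s \<gamma> (scut r \<delta> g h) f \<in> arr (sigma_pi P)"
    by (rule 3(1) 4(1))+
  note rf = arr_rep(1)[OF f] and rg = arr_rep(1)[OF g] and rh = arr_rep(1)[OF h]
  have "sim P (xcut r \<delta> (rep (scut s \<gamma> g f)) (rep h)) (xcut r \<delta> (xcut s \<gamma> (rep g) (rep f)) (rep h))"
    by (rule sim_xcut[OF 1(3) sim_refl_der[OF rh] arr_rep(1)[OF 1(1)] rh d'])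
  moreover have "sim P (xcut s \<gamma> (rep (scut r \<delta> g h)) (rep f)) (xcut s \<gamma> (xcut r \<delta> (rep g) (rep h)) (rep f))"
    by (rule sim_xcut[OF 2(3) sim_refl_der[OF rf] arr_rep(1)[OF 2(1)] rf c'])
  ultimately show "sim P (rep (scut r \<delta> (scut s \<gamma> g f) h)) (rep (scut s \<gamma> (scut r \<delta> g h) f))"
    using sim_assoc[OF rf rg rh c d disj] 3(3) 4(3) by (meson sim.sym sim.trans)
qed

lemma scut_simps: "scut True \<gamma> f g = cut (sigma_pi P) \<gamma> f g" "scut False \<gamma> f g = cut (sigma_pi P) \<gamma> g f"
  by (simp_all add: pcut_def)

lemma polycategory_sigma: "polycategory (sigma_pi P)"
proof
  let ?S = "sigma_pi P"
  fix f assume f: "f \<in> arr ?S"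
  show "sequent (obj ?S) (src ?S f) (tgt ?S f)"
    using der_over[OF pc arr_rep(1)[OF f]] by (simp add: arr_rep(3,4)[OF f] sequent_part)
  fix p
  show "ren ?S p f \<in> hom ?S (rename_ctx p (src ?S f)) (rename_ctx p (tgt ?S f))"
    using sren(1)[OF f] by (simp add: hom_def) (simp add: sigma_pi_def mor_def)
  fix q
  show "ren ?S (p * q) f = ren ?S p (ren ?S q f)"
  proof (rule arr_eqI[OF sren(1)[OF f] sren(1)[OF sren(1)[OF f]]])
    have "sim P (rep (ren ?S p (ren ?S q f))) (rename_deriv P (p * q) (rep f))"
      using sim.trans[OF sren(3)[OF sren(1)[OF f]] sim_rename[OF sren(3)[OF f]]]
      by (simp add: rename_deriv_mult[OF arr_rep(1)[OF f]])
    then show "sim P (rep (ren ?S (p * q) f)) (rep (ren ?S p (ren ?S q f)))"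
      by (rule sim.trans[OF sren(3)[OF f] sim.sym])
  qed
next
  let ?S = "sigma_pi P"
  fix f p assume f: "f \<in> arr ?S" and p: "\<And>\<alpha>. \<alpha> |\<in>| chans ?S f \<Longrightarrow> apply p \<alpha> = \<alpha>"
  show "ren ?S p f = f"
    using sim.trans[OF sren(3)[OF f] sim_rename_fix[OF arr_rep(1)[OF f]]] p
    by (intro arr_eqI[OF sren(1)[OF f] f]) (simp add: chans_sigma)
next
  let ?S = "sigma_pi P"
  fix X and \<alpha> \<beta> :: chan assume X: "X \<in> obj ?S" and \<alpha>\<beta>: "\<alpha> \<noteq> \<beta>"
  then have XP: "X \<in> formulas P" by simp
  note i = sidn[OF XP \<alpha>\<beta>]
  show "idn ?S \<alpha> \<beta> X \<in> hom ?S (single \<alpha> X) (single \<beta> X)"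
    using i(1) by (simp add: hom_def) (simp add: sigma_pi_def mor_def)
  fix p
  have "apply p \<alpha> \<noteq> apply p \<beta>" using \<alpha>\<beta> by simp
  note j = sidn[OF XP this]
  show "ren ?S p (idn ?S \<alpha> \<beta> X) = idn ?S (apply p \<alpha>) (apply p \<beta>) X"
  proof (rule arr_eqI[OF sren(1)[OF i(1)] j(1)])
    have "sim P (rep (ren ?S p (idn ?S \<alpha> \<beta> X))) (xi P True (apply p \<alpha>) (apply p \<beta>) X)"
      using sim.trans[OF sren(3)[OF i(1)] sim_rename[OF i(3)]] by (simp add: rename_xi[OF XP \<alpha>\<beta>])
    then show "sim P (rep (ren ?S p (idn ?S \<alpha> \<beta> X))) (rep (idn ?S (apply p \<alpha>) (apply p \<beta>) X))"
      by (rule sim.trans[OF _ sim.sym[OF j(3)]])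
  qed
next
  let ?S = "sigma_pi P"
  fix \<gamma> f g assume c: "cuttable ?S \<gamma> f g"
  then have f: "f \<in> arr ?S" and g: "g \<in> arr ?S" and c: "compat \<gamma> True (sctx f) (sctx g)"
    by (simp_all add: cuttable_sigma)
  note fg = scut[OF f g c, unfolded scut_simps]
  show "cut ?S \<gamma> f g \<in> hom ?S (src ?S f ++\<^sub>f fmdrop \<gamma> (src ?S g)) (fmdrop \<gamma> (tgt ?S f) ++\<^sub>f tgt ?S g)"
    using fg(1) by (simp add: hom_def) (simp add: sigma_pi_def mor_def)
  fix p
  note rf = sren[OF f, of p] and rg = sren[OF g, of p] and rfg = sren[OF fg(1), of p]
  have c': "compat (apply p \<gamma>) True (sctx (ren ?S p f)) (sctx (ren ?S p g))"
    unfolding rf(2) rg(2) by (rule compat_rename[OF c])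
  note fg' = scut[OF rf(1) rg(1) c', unfolded scut_simps]
  show "ren ?S p (cut ?S \<gamma> f g) = cut ?S (apply p \<gamma>) (ren ?S p f) (ren ?S p g)"
  proof (rule arr_eqI[OF rfg(1) fg'(1)])
    have "sim P (rename_deriv P p (rep (cut ?S \<gamma> f g))) (xcut True (apply p \<gamma>) (rename_deriv P p (rep f)) (rename_deriv P p (rep g)))"
      using sim_rename[OF fg(3), of p] by (simp add: rename_xcut)
    moreover have "sim P (xcut True (apply p \<gamma>) (rep (ren ?S p f)) (rep (ren ?S p g)))
        (xcut True (apply p \<gamma>) (rename_deriv P p (rep f)) (rename_deriv P p (rep g)))"
      by (rule sim_xcut[OF rf(3) rg(3) arr_rep(1)[OF rf(1)] arr_rep(1)[OF rg(1)] c'])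
    ultimately show "sim P (rep (ren ?S p (cut ?S \<gamma> f g))) (rep (cut ?S (apply p \<gamma>) (ren ?S p f) (ren ?S p g)))"
      using rfg(3) fg'(3) by (meson sim.sym sim.trans)
  qed
next
  let ?S = "sigma_pi P"
  \<comment> \<open>Both unit laws come from one signed statement; the conditional picks the
    direction of the identity.\<close>
  have unit: "scut s \<gamma> f (if s then idn ?S \<gamma> \<beta> X else idn ?S \<beta> \<gamma> X) = ren ?S (Perm.swap \<gamma> \<beta>) f"
    if f: "f \<in> arr ?S" and X: "fmlookup (sctx f) \<gamma> = Some (s, X)" and \<beta>: "\<beta> |\<notin>| chans ?S f" for f \<gamma> s X \<beta>
  proof -
    let ?i = "if s then idn ?S \<gamma> \<beta> X else idn ?S \<beta> \<gamma> X"
    have \<beta>: "\<beta> |\<notin>| fmdom (sctx f)" using \<beta> by (simp add: chans_sigma)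
    then have "\<gamma> \<noteq> \<beta>" using X by auto
    have XP: "X \<in> formulas P" using der_over[OF pc arr_rep(1)[OF f]] X by (auto simp: over_def)
    have i: "?i \<in> arr ?S" "sctx ?i = fmupd \<gamma> (\<not> s, X) (single \<beta> (s, X))" "sim P (rep ?i) (xi P s \<gamma> \<beta> X)"
      using sidn[OF XP \<open>\<gamma> \<noteq> \<beta>\<close>] sidn[OF XP \<open>\<gamma> \<noteq> \<beta>\<close>[symmetric]] fmupd_reorder_neq[OF \<open>\<gamma> \<noteq> \<beta>\<close>, where x = "(True, X)" and y = "(False, X)" and m = fmempty]
      by (cases s; simp add: xi_def)+
    have c: "compat \<gamma> s (sctx f) (sctx ?i)"
      using X \<beta> unfolding i(2) by (intro compatI[where Z = X]) auto
    note fi = scut[OF f i(1) c]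
    have "sim P (xcut s \<gamma> (rep f) (rep ?i)) (xcut s \<gamma> (rep f) (xi P s \<gamma> \<beta> X))"
      by (rule sim_xcut[OF sim_refl_der[OF arr_rep(1)[OF f]] i(3) arr_rep(1)[OF f] arr_rep(1)[OF i(1)] c])
    with fi(3) xcut_xi[OF arr_rep(1)[OF f] X \<beta>] sren(3)[OF f]
    have "sim P (rep (scut s \<gamma> f ?i)) (rep (ren ?S (Perm.swap \<gamma> \<beta>) f))"
      by (meson sim.sym sim.trans)
    then show ?thesis
      by (rule arr_eqI[OF fi(1) sren(1)[OF f]])
  qed
  fix f \<gamma> X \<beta> assume f: "f \<in> arr ?S" and \<beta>: "\<beta> |\<notin>| chans ?S f"
  show "cut ?S \<gamma> f (idn ?S \<gamma> \<beta> X) = ren ?S (Perm.swap \<gamma> \<beta>) f" if "fmlookup (tgt ?S f) \<gamma> = Some X"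
    using unit[OF f _ \<beta>, of \<gamma> True X] that by (simp add: arr_rep(4)[OF f] scut_simps)
  show "cut ?S \<gamma> (idn ?S \<beta> \<gamma> X) f = ren ?S (Perm.swap \<gamma> \<beta>) f" if "fmlookup (src ?S f) \<gamma> = Some X"
    using unit[OF f _ \<beta>, of \<gamma> False X] that by (simp add: arr_rep(3)[OF f] scut_simps)
next
  let ?S = "sigma_pi P"
  fix \<gamma> f g \<delta> h
  assume "cuttable ?S \<gamma> f g" "cuttable ?S \<delta> g h" "chans ?S f |\<inter>| chans ?S h = {||}"
  then show "cut ?S \<delta> (cut ?S \<gamma> f g) h = cut ?S \<gamma> f (cut ?S \<delta> g h)"
    \<comment> \<open>In \<open>scut_assoc\<close> the middle piece is the first argument of each
      inner cut. Here it is \<open>g\<close>, which receives \<open>f\<close> in its domain and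
      passes on to \<open>h\<close> from its codomain, hence the signs \<open>False\<close> and
      \<open>True\<close>; the two interchange laws use equal signs.\<close>
    using scut_assoc[of f g h \<gamma> False \<delta> True] compat_sym[of \<gamma> True "sctx f" "sctx g"]
    by (simp add: cuttable_sigma chans_sigma scut_simps)
next
  let ?S = "sigma_pi P"
  fix \<gamma> f g \<delta> h
  assume "cuttable ?S \<gamma> f g" "cuttable ?S \<delta> f h" "chans ?S g |\<inter>| chans ?S h = {||}"
  then show "cut ?S \<delta> (cut ?S \<gamma> f g) h = cut ?S \<gamma> (cut ?S \<delta> f h) g"
    using scut_assoc[of g f h \<gamma> True \<delta> True]
    by (simp add: cuttable_sigma chans_sigma scut_simps)
next
  let ?S = "sigma_pi P"
  fix \<gamma> f g \<delta> h
  assume "cuttable ?S \<gamma> f h" "cuttable ?S \<delta> g h" "chans ?S f |\<inter>| chans ?S g = {||}"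
  then show "cut ?S \<gamma> f (cut ?S \<delta> g h) = cut ?S \<delta> g (cut ?S \<gamma> f h)"
    using scut_assoc[of g h f \<delta> False \<gamma> False] compat_sym[of \<gamma> True "sctx f" "sctx h"] compat_sym[of \<delta> True "sctx g" "sctx h"]
    by (simp add: cuttable_sigma chans_sigma scut_simps inf_commute)
qed

end

text \<open>The chosen cotuple or tuple of \<open>sigma_pi\<close>, with its two contexts coded as
  one signed context.\<close>

definition sfam :: "('o, 'm, 'z) polycat_scheme \<Rightarrow> bool \<Rightarrow> (name, 'o form) fmap \<Rightarrow> (chan, bool \<times> 'o form) fmap \<Rightarrow> chan
    \<Rightarrow> (name, ('o, 'm) sp_arr) fmap \<Rightarrow> ('o, 'm) sp_arr" where
  "sfam A s X S \<alpha> fs = smor A (fmupd \<alpha> (s, con s X) S) (fam s S \<alpha> X (fmmap rep fs))"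

context polycategory
begin

context
  fixes s :: bool and X :: "(name, 'o form) fmap" and S :: "(chan, bool \<times> 'o form) fmap" and \<alpha> :: chan
  assumes \<alpha>: "\<alpha> |\<notin>| fmdom S" and S: "over (formulas P) S" and X: "fmran' X \<subseteq> formulas P"
begin

lemma der_sfam:
  assumes "fs \<in> pfamilies (sigma_pi P) s X S \<alpha>"
  shows "der P (fam s S \<alpha> X (fmmap rep fs)) (fmupd \<alpha> (s, con s X) S)"
  using assms \<alpha> S X arr_rep(1) by (fastforce simp: der_fam_iff pfamilies_def fmrel_Some_iff)

lemma sfam:
  assumes "fs \<in> pfamilies (sigma_pi P) s X S \<alpha>"
  shows "sfam P s X S \<alpha> fs \<in> arr (sigma_pi P)" "sctx (sfam P s X S \<alpha> fs) = fmupd \<alpha> (s, con s X) S"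
    "sim P (rep (sfam P s X S \<alpha> fs)) (fam s S \<alpha> X (fmmap rep fs))"
  using der_sfam[OF assms] by (simp_all add: sfam_def smor_arr smor_sctx rep_smor)

text \<open>The family \<open>gs\<close> need not consist of chosen representatives; agreement of
  the components up to \<open>sim\<close> is enough. All equations between (co)tuples below are
  proved in this form.\<close>

lemma sfam_eqI:
  assumes fs: "fs \<in> pfamilies (sigma_pi P) s X S \<alpha>"
    and f: "f \<in> arr (sigma_pi P)" and sim: "sim P (rep f) (fam s S \<alpha> X gs)" and rel: "fmrel (sim P) (fmmap rep fs) gs"
  shows "f = sfam P s X S \<alpha> fs"
proof (rule arr_eqI[OF f sfam(1)[OF fs]])
  have "sim P (fam s S \<alpha> X (fmmap rep fs)) (fam s S \<alpha> X gs)"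
    by (rule sim_fam[OF rel der_sfam[OF fs]])
  then show "sim P (rep f) (rep (sfam P s X S \<alpha> fs))"
    using sim sfam(3)[OF fs] by (meson sim.sym sim.trans)
qed

lemma sfam_bij:
  "bij_betw (sfam P s X S \<alpha>) (pfamilies (sigma_pi P) s X S \<alpha>) {f \<in> arr (sigma_pi P). sctx f = fmupd \<alpha> (s, con s X) S}"
  unfolding bij_betw_def
proof
  show "inj_on (sfam P s X S \<alpha>) (pfamilies (sigma_pi P) s X S \<alpha>)"
  proof (rule inj_onI)
    fix fs gs assume fs: "fs \<in> pfamilies (sigma_pi P) s X S \<alpha>" and gs: "gs \<in> pfamilies (sigma_pi P) s X S \<alpha>"
      and eq: "sfam P s X S \<alpha> fs = sfam P s X S \<alpha> gs"
    have "sim P (fam s S \<alpha> X (fmmap rep fs)) (fam s S \<alpha> X (fmmap rep gs))"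
      using sfam(3)[OF fs] sfam(3)[OF gs] unfolding eq by (meson sim.sym sim.trans)
    from sim_famD[OF this der_sfam[OF fs]] have rel: "fmrel (\<lambda>f g. sim P (rep f) (rep g)) fs gs"
      by (simp add: fmap.rel_map)
    have "fmrel (=) fs gs"
      using rel fs gs unfolding pfamilies_def fmrel_Some_iff mem_Collect_eq
      by (metis arr_eqI fmdomE fmdomI)
    then show "fs = gs" by (simp add: fmap.rel_eq)
  qed
  show "sfam P s X S \<alpha> ` pfamilies (sigma_pi P) s X S \<alpha> = {f \<in> arr (sigma_pi P). sctx f = fmupd \<alpha> (s, con s X) S}"
  proof (intro subset_antisym subsetI)
    fix f assume f: "f \<in> {f \<in> arr (sigma_pi P). sctx f = fmupd \<alpha> (s, con s X) S}"
    then have d: "der P (rep f) (fmupd \<alpha> (s, con s X) S)" using arr_rep(1)[of f] by simp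
    obtain gs where gs: "sim P (rep f) (fam s S \<alpha> X gs)" using fam_surj[OF d \<alpha>] by blast
    then have rel: "fmrel (\<lambda>f Y. der P f (fmupd \<alpha> (s, Y) S)) gs X"
      using d by (simp add: sim_der der_fam_iff)
    \<comment> \<open>The indices and the formula on \<open>\<alpha>\<close> are read off from
      \<open>X\<close>; the lookup in \<open>gs\<close> is defined there because \<open>gs\<close>
      is a family of derivations over \<open>X\<close>.\<close>
    define fs where "fs = fmmap_keys (\<lambda>i Y. smor P (fmupd \<alpha> (s, Y) S) (the (fmlookup gs i))) X"
    have fs: "fs \<in> pfamilies (sigma_pi P) s X S \<alpha>"
    proof (rule pfamiliesI)
      fix i f Y assume "fmlookup fs i = Some f" and Y: "fmlookup X i = Some Y"
      moreover obtain g where "fmlookup gs i = Some g" "der P g (fmupd \<alpha> (s, Y) S)"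
        using fmrelE2[OF rel Y] .
      ultimately show "f \<in> arr (sigma_pi P) \<and> sctx f = fmupd \<alpha> (s, Y) S"
        by (auto simp: fs_def smor_arr smor_sctx)
    qed (simp add: fs_def)
    have "fmrel (sim P) (fmmap rep fs) gs"
    proof (rule fmrel_Some_iff[THEN iffD2], intro conjI allI impI)
      show "fmdom (fmmap rep fs) = fmdom gs" using rel by (simp add: fs_def fmrel_fmdom_eq)
      fix i f g assume f: "fmlookup (fmmap rep fs) i = Some f" and g: "fmlookup gs i = Some g"
      obtain Y where Y: "fmlookup X i = Some Y" "der P g (fmupd \<alpha> (s, Y) S)"
        using fmrelE1[OF rel g] .
      then have "f = rep (smor P (fmupd \<alpha> (s, Y) S) g)" using f g by (simp add: fs_def)
      then show "sim P f g" using rep_smor(1)[OF Y(2)] by simp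
    qed
    from sfam_eqI[OF fs _ gs this] f fs show "f \<in> sfam P s X S \<alpha> ` pfamilies (sigma_pi P) s X S \<alpha>"
      by auto
  qed (use sfam in auto)
qed

text \<open>The surrounding context fixes \<open>S\<close>, but the resulting family lives over
  \<open>join \<gamma> S (sctx h)\<close>. The lemma therefore provides only the hypotheses of
  \<open>sfam_eqI\<close>, which \<open>sfam_natural\<close> applies at the new context.\<close>

lemma sfam_scut:
  assumes fs: "fs \<in> pfamilies (sigma_pi P) s X S \<alpha>" and h: "h \<in> arr (sigma_pi P)" and c: "compat \<gamma> r (fmupd \<alpha> (s, con s X) S) (sctx h)"
    and "\<alpha> \<noteq> \<gamma>"
  shows "fmmap (\<lambda>f. scut r \<gamma> f h) fs \<in> pfamilies (sigma_pi P) s X (join \<gamma> S (sctx h)) \<alpha>"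
    "\<exists>gs. sim P (rep (scut r \<gamma> (sfam P s X S \<alpha> fs) h)) (fam s (join \<gamma> S (sctx h)) \<alpha> X gs) \<and>
       fmrel (sim P) (fmmap rep (fmmap (\<lambda>f. scut r \<gamma> f h) fs)) gs"
    "scut r \<gamma> (sfam P s X S \<alpha> fs) h \<in> arr (sigma_pi P)"
proof -
  have \<alpha>h: "\<alpha> |\<notin>| fmdom (sctx h)" by (rule compat_notin[OF c \<open>\<alpha> \<noteq> \<gamma>\<close>])
  have c': "compat \<gamma> r (fmupd \<alpha> (s, Y) S) (sctx h)" for Y
    using c by (rule compat_upd(1)[OF \<open>\<alpha> \<noteq> \<gamma>\<close>, THEN iffD1])
  have comp: "scut r \<gamma> f h \<in> arr (sigma_pi P)" "sctx (scut r \<gamma> f h) = fmupd \<alpha> (s, Y) (join \<gamma> S (sctx h))"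
      "sim P (rep (scut r \<gamma> f h)) (xcut r \<gamma> (rep f) (rep h))"
    if f: "f \<in> arr (sigma_pi P)" "sctx f = fmupd \<alpha> (s, Y) S" for f Y
  proof -
    note fh = scut[OF f(1) h c'[of Y, folded f(2)]]
    show "scut r \<gamma> f h \<in> arr (sigma_pi P)" "sctx (scut r \<gamma> f h) = fmupd \<alpha> (s, Y) (join \<gamma> S (sctx h))"
      "sim P (rep (scut r \<gamma> f h)) (xcut r \<gamma> (rep f) (rep h))"
      using fh \<open>\<alpha> \<noteq> \<gamma>\<close> \<alpha>h by (simp_all add: f(2) join_upd)
  qed
  show "fmmap (\<lambda>f. scut r \<gamma> f h) fs \<in> pfamilies (sigma_pi P) s X (join \<gamma> S (sctx h)) \<alpha>"
    using comp by (intro pfamilies_map[OF fs]) blast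
  note F = sfam[OF fs] and dF = der_sfam[OF fs]
  have cF: "compat \<gamma> r (sctx (sfam P s X S \<alpha> fs)) (sctx h)" unfolding F(2) by (rule c)
  note Fh = scut[OF F(1) h cF]
  show "scut r \<gamma> (sfam P s X S \<alpha> fs) h \<in> arr (sigma_pi P)" by (rule Fh(1))
  have "sim P (xcut r \<gamma> (rep (sfam P s X S \<alpha> fs)) (rep h)) (xcut r \<gamma> (fam s S \<alpha> X (fmmap rep fs)) (rep h))"
    by (rule sim_xcut[OF F(3) sim_refl_der[OF arr_rep(1)[OF h]] arr_rep(1)[OF F(1)] arr_rep(1)[OF h] cF])
  with Fh(3) xcut_fam[OF dF arr_rep(1)[OF h] c \<open>\<alpha> \<noteq> \<gamma>\<close> pc]
  have "sim P (rep (scut r \<gamma> (sfam P s X S \<alpha> fs) h))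
      (fam s (join \<gamma> S (sctx h)) \<alpha> X (fmmap (\<lambda>f. xcut r \<gamma> f (rep h)) (fmmap rep fs)))"
    by (meson sim.sym sim.trans)
  moreover have "fmrel (sim P) (fmmap rep (fmmap (\<lambda>f. scut r \<gamma> f h) fs)) (fmmap (\<lambda>f. xcut r \<gamma> f (rep h)) (fmmap rep fs))"
    using comp(3) fs unfolding fmap.rel_map by (intro pfamilies_rel[OF fs]) blast
  ultimately show "\<exists>gs. sim P (rep (scut r \<gamma> (sfam P s X S \<alpha> fs) h)) (fam s (join \<gamma> S (sctx h)) \<alpha> X gs) \<and>
       fmrel (sim P) (fmmap rep (fmmap (\<lambda>f. scut r \<gamma> f h) fs)) gs"
    by blast
qed

lemma sfam_ren:
  assumes fs: "fs \<in> pfamilies (sigma_pi P) s X S \<alpha>"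
  shows "fmmap (ren (sigma_pi P) p) fs \<in> pfamilies (sigma_pi P) s X (rename_ctx p S) (apply p \<alpha>)"
    "\<exists>gs. sim P (rep (ren (sigma_pi P) p (sfam P s X S \<alpha> fs))) (fam s (rename_ctx p S) (apply p \<alpha>) X gs) \<and>
       fmrel (sim P) (fmmap rep (fmmap (ren (sigma_pi P) p) fs)) gs"
    "ren (sigma_pi P) p (sfam P s X S \<alpha> fs) \<in> arr (sigma_pi P)"
proof -
  note F = sfam[OF fs]
  show "fmmap (ren (sigma_pi P) p) fs \<in> pfamilies (sigma_pi P) s X (rename_ctx p S) (apply p \<alpha>)"
    by (rule pfamilies_map[OF fs]) (simp add: sren)
  show "ren (sigma_pi P) p (sfam P s X S \<alpha> fs) \<in> arr (sigma_pi P)" by (rule sren(1)[OF F(1)])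
  have "sim P (rep (ren (sigma_pi P) p (sfam P s X S \<alpha> fs))) (fam s (rename_ctx p S) (apply p \<alpha>) X (fmmap (rename_deriv P p) (fmmap rep fs)))"
    using sim.trans[OF sren(3)[OF F(1)] sim_rename[OF F(3)]] by (simp add: rename_fam)
  moreover have "fmrel (sim P) (fmmap rep (fmmap (ren (sigma_pi P) p) fs)) (fmmap (rename_deriv P p) (fmmap rep fs))"
    unfolding fmap.rel_map by (intro pfamilies_rel[OF fs]) (rule sren(3))
  ultimately show "\<exists>gs. sim P (rep (ren (sigma_pi P) p (sfam P s X S \<alpha> fs))) (fam s (rename_ctx p S) (apply p \<alpha>) X gs) \<and>
       fmrel (sim P) (fmmap rep (fmmap (ren (sigma_pi P) p) fs)) gs"
    by blast
qed

end

lemma sfam_natural: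
  assumes "\<alpha> |\<notin>| fmdom S" "over (formulas P) S" "fmran' X \<subseteq> formulas P" "fs \<in> pfamilies (sigma_pi P) s X S \<alpha>"
    "h \<in> arr (sigma_pi P)" "compat \<gamma> r (fmupd \<alpha> (s, con s X) S) (sctx h)" "\<alpha> \<noteq> \<gamma>"
  shows "scut r \<gamma> (sfam P s X S \<alpha> fs) h = sfam P s X (join \<gamma> S (sctx h)) \<alpha> (fmmap (\<lambda>f. scut r \<gamma> f h) fs)"
proof -
  note * = sfam_scut[OF assms]
  have "\<alpha> |\<notin>| fmdom (join \<gamma> S (sctx h))"
    using assms(1) compat_notin[OF assms(6,7)] by auto
  then show ?thesis
    using * sfam_eqI[OF _ over_join[OF assms(2) der_over[OF pc arr_rep(1)[OF assms(5)]]] assms(3) *(1,3)] by blast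
qed

lemma sfam_rename:
  assumes "\<alpha> |\<notin>| fmdom S" "over (formulas P) S" "fmran' X \<subseteq> formulas P" "fs \<in> pfamilies (sigma_pi P) s X S \<alpha>"
  shows "ren (sigma_pi P) p (sfam P s X S \<alpha> fs) = sfam P s X (rename_ctx p S) (apply p \<alpha>) (fmmap (ren (sigma_pi P) p) fs)"
proof -
  note * = sfam_ren[OF assms, of p]
  have "apply p \<alpha> |\<notin>| fmdom (rename_ctx p S)" using assms(1) by simp
  then show ?thesis
    using * sfam_eqI[OF _ over_rename[OF assms(2)] assms(3) *(1,3)] by blast
qed

lemma sided_cotuple_sigma:
  assumes "\<alpha> |\<notin>| fmdom S"
  shows "sided_cotuple s (sigma_pi P) X (part s S) (part (\<not> s) S) \<alpha> fs = sfam P s X S \<alpha> fs"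
  using assms by (cases s) (simp_all add: sided_cotuple_def sigma_pi_def sfam_def smor_def fam_def con_def part_upd)

text \<open>Products are sums in the opposite polycategory, so a single verification with a sign
  establishes both.\<close>

lemma poly_sum_sided:
  assumes X: "fmran' X \<subseteq> formulas P"
  shows "poly_sum (sided s (sigma_pi P)) X (con s X) (sided_cotuple s (sigma_pi P) X)"
proof -
  let ?S = "sided s (sigma_pi P)" and ?ct = "sided_cotuple s (sigma_pi P) X"
  have "bij_betw (?ct \<Gamma> \<Delta> \<alpha>) (cofamilies ?S X \<Gamma> \<Delta> \<alpha>) (hom ?S (fmupd \<alpha> (con s X) \<Gamma>) \<Delta>) \<and>
    (\<forall>fs \<in> cofamilies ?S X \<Gamma> \<Delta> \<alpha>.
      (\<forall>\<gamma> h. \<gamma> \<noteq> \<alpha> \<and> cuttable ?S \<gamma> h (?ct \<Gamma> \<Delta> \<alpha> fs) \<longrightarrow> cut ?S \<gamma> h (?ct \<Gamma> \<Delta> \<alpha> fs)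
        = ?ct (src ?S h ++\<^sub>f fmdrop \<gamma> \<Gamma>) (fmdrop \<gamma> (tgt ?S h) ++\<^sub>f \<Delta>) \<alpha> (fmmap (cut ?S \<gamma> h) fs)) \<and>
      (\<forall>\<gamma> h. \<gamma> \<noteq> \<alpha> \<and> cuttable ?S \<gamma> (?ct \<Gamma> \<Delta> \<alpha> fs) h \<longrightarrow> cut ?S \<gamma> (?ct \<Gamma> \<Delta> \<alpha> fs) h
        = ?ct (\<Gamma> ++\<^sub>f fmdrop \<gamma> (src ?S h)) (fmdrop \<gamma> \<Delta> ++\<^sub>f tgt ?S h) \<alpha> (fmmap (\<lambda>f. cut ?S \<gamma> f h) fs)) \<and>
      (\<forall>p. ren ?S p (?ct \<Gamma> \<Delta> \<alpha> fs)
        = ?ct (rename_ctx p \<Gamma>) (rename_ctx p \<Delta>) (apply p \<alpha>) (fmmap (ren ?S p) fs)))"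
    if seq: "sequent (formulas P) \<Gamma> \<Delta>" and \<alpha>: "\<alpha> |\<notin>| fmdom \<Gamma> |\<union>| fmdom \<Delta>" for \<Gamma> \<Delta> \<alpha>
  proof -
    obtain S where S: "\<Gamma> = part s S" "\<Delta> = part (\<not> s) S" "over (formulas P) S" "\<alpha> |\<notin>| fmdom S"
      using sided_parts[OF seq, of s] \<alpha> by metis
    have hom: "hom ?S (fmupd \<alpha> (con s X) (part s S)) (part (\<not> s) S) = {f \<in> arr (sigma_pi P). sctx f = fmupd \<alpha> (s, con s X) S}"
      using polycategory.hom_sided_sig[OF polycategory_sigma, of s "fmupd \<alpha> (s, con s X) S"] S(4) by (simp add: part_upd)
    have ct: "?ct (part s S) (part (\<not> s) S) \<alpha> = sfam P s X S \<alpha>"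
      by (rule ext) (rule sided_cotuple_sigma[OF S(4)])
    show ?thesis
      unfolding S(1,2) polycategory.cofamilies_sided_sig[OF polycategory_sigma S(4)] hom ct
    proof (intro conjI ballI allI impI)
      show "bij_betw (sfam P s X S \<alpha>) (pfamilies (sigma_pi P) s X S \<alpha>) {f \<in> arr (sigma_pi P). sctx f = fmupd \<alpha> (s, con s X) S}"
        by (rule sfam_bij[OF S(4,3) X])
      fix fs assume fs: "fs \<in> pfamilies (sigma_pi P) s X S \<alpha>"
      note F = sfam[OF S(4,3) X fs]
      have natural: "scut r \<gamma> (sfam P s X S \<alpha> fs) h
          = ?ct (part s (join \<gamma> S (sctx h))) (part (\<not> s) (join \<gamma> S (sctx h))) \<alpha> (fmmap (\<lambda>f. scut r \<gamma> f h) fs)"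
        "compat \<gamma> r S (sctx h)"
        if h: "h \<in> arr (sigma_pi P)" and c: "compat \<gamma> r (fmupd \<alpha> (s, con s X) S) (sctx h)" and "\<gamma> \<noteq> \<alpha>" for r \<gamma> h
      proof -
        have "\<alpha> |\<notin>| fmdom (join \<gamma> S (sctx h))"
          using S(4) compat_notin[OF c \<open>\<gamma> \<noteq> \<alpha>\<close>[symmetric]] by auto
        then show "scut r \<gamma> (sfam P s X S \<alpha> fs) h
          = ?ct (part s (join \<gamma> S (sctx h))) (part (\<not> s) (join \<gamma> S (sctx h))) \<alpha> (fmmap (\<lambda>f. scut r \<gamma> f h) fs)"
          using sfam_natural[OF S(4,3) X fs h c \<open>\<gamma> \<noteq> \<alpha>\<close>[symmetric]] by (simp add: sided_cotuple_sigma)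
        show "compat \<gamma> r S (sctx h)"
          by (rule compat_updD[OF c \<open>\<gamma> \<noteq> \<alpha>\<close>[symmetric]])
      qed
      have scut: "cut ?S \<gamma> h f = scut s \<gamma> f h" "cut ?S \<gamma> f h = scut (\<not> s) \<gamma> f h" for \<gamma> f h
        by (simp_all add: pcut_def)
      have parts: "src ?S h = part s (sctx h)" "tgt ?S h = part (\<not> s) (sctx h)" if "h \<in> arr (sigma_pi P)" for h
        using arr_rep(3,4)[OF that] by (cases s; simp)+
      show "cut ?S \<gamma> h (sfam P s X S \<alpha> fs)
        = ?ct (src ?S h ++\<^sub>f fmdrop \<gamma> (part s S)) (fmdrop \<gamma> (tgt ?S h) ++\<^sub>f part (\<not> s) S) \<alpha> (fmmap (cut ?S \<gamma> h) fs)"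
        if "\<gamma> \<noteq> \<alpha> \<and> cuttable ?S \<gamma> h (sfam P s X S \<alpha> fs)" for \<gamma> h
      proof -
        from that have h: "h \<in> arr (sigma_pi P)" and c: "compat \<gamma> s (fmupd \<alpha> (s, con s X) S) (sctx h)" and "\<gamma> \<noteq> \<alpha>"
          by (simp_all add: polycategory.cuttable_sided_sig(1)[OF polycategory_sigma] F(2))
        note n = natural[OF this]
        obtain Z where "fmlookup S \<gamma> = Some (s, Z)" "fmlookup (sctx h) \<gamma> = Some (\<not> s, Z)"
          using n(2) by (auto simp: compat_def)
        \<comment> \<open>The laws of \<open>poly_sum\<close> drop \<open>\<gamma>\<close> only on
          the side where it occurs. \<open>fmdrop_part\<close> shows that dropping it on the other
          side changes nothing, which reconciles this with \<open>join\<close>.\<close>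
        then have "src ?S h ++\<^sub>f fmdrop \<gamma> (part s S) = part s (join \<gamma> S (sctx h))"
          "fmdrop \<gamma> (tgt ?S h) ++\<^sub>f part (\<not> s) S = part (\<not> s) (join \<gamma> S (sctx h))"
          unfolding parts[OF h] part_join_drop(2)[OF n(2)] by (simp_all add: fmdrop_part)
        then show ?thesis
          unfolding scut(1) by (simp add: n(1))
      qed
      show "cut ?S \<gamma> (sfam P s X S \<alpha> fs) h
        = ?ct (part s S ++\<^sub>f fmdrop \<gamma> (src ?S h)) (fmdrop \<gamma> (part (\<not> s) S) ++\<^sub>f tgt ?S h) \<alpha> (fmmap (\<lambda>f. cut ?S \<gamma> f h) fs)"
        if "\<gamma> \<noteq> \<alpha> \<and> cuttable ?S \<gamma> (sfam P s X S \<alpha> fs) h" for \<gamma> h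
      proof -
        from that have h: "h \<in> arr (sigma_pi P)" and c: "compat \<gamma> (\<not> s) (fmupd \<alpha> (s, con s X) S) (sctx h)" and "\<gamma> \<noteq> \<alpha>"
          by (simp_all add: polycategory.cuttable_sided_sig(2)[OF polycategory_sigma] F(2))
        note n = natural[OF this]
        obtain Z where "fmlookup S \<gamma> = Some (\<not> s, Z)" "fmlookup (sctx h) \<gamma> = Some (s, Z)"
          using n(2) by (auto simp: compat_def)
        then have "part s S ++\<^sub>f fmdrop \<gamma> (src ?S h) = part s (join \<gamma> S (sctx h))"
          "fmdrop \<gamma> (part (\<not> s) S) ++\<^sub>f tgt ?S h = part (\<not> s) (join \<gamma> S (sctx h))"
          unfolding parts[OF h] part_join_drop(1)[OF n(2)] by (simp_all add: fmdrop_part)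
        then show ?thesis
          unfolding scut(2) by (simp add: n(1))
      qed
      show "ren ?S p (sfam P s X S \<alpha> fs)
        = ?ct (rename_ctx p (part s S)) (rename_ctx p (part (\<not> s) S)) (apply p \<alpha>) (fmmap (ren ?S p) fs)" for p
        using sfam_rename[OF S(4,3) X fs, of p] S(4)
        by (simp add: part_rename[symmetric] sided_cotuple_sigma)
    qed
  qed
  then show ?thesis
    unfolding poly_sum_def using X by (simp add: con_formulas del: sided_simps(3-6))
qed

lemma sp_polycategory_sigma: "sp_polycategory (sigma_pi P)"
proof (rule sp_polycategory.intro[OF polycategory_sigma], unfold_locales)
  fix X :: "(name, 'o form) fmap" assume "fmran' X \<subseteq> obj (sigma_pi P)"
  then have X: "fmran' X \<subseteq> formulas P" by simp
  have [simp]: "sided_cotuple False (sigma_pi P) X = cotuple (sigma_pi P) X"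
    "sided_cotuple True (sigma_pi P) X = (\<lambda>\<Gamma> \<Delta>. tuple (sigma_pi P) X \<Delta> \<Gamma>)"
    by (simp_all add: sided_cotuple_def fun_eq_iff)
  show "poly_sum (sigma_pi P) X (sum_ob (sigma_pi P) X) (cotuple (sigma_pi P) X)"
    using poly_sum_sided[OF X, of False] by (simp add: sided_def con_def poly_sum_opposite_opposite)
  show "poly_product (sigma_pi P) X (prod_ob (sigma_pi P) X) (tuple (sigma_pi P) X)"
    using poly_sum_sided[OF X, of True] by (simp add: sided_def con_def poly_product_def)
qed

section \<open>The inclusion of the given polycategory\<close>

lemma axiom_arr_smor:
  assumes m: "m \<in> arr P"
  shows "axiom_arr P m = smor P (asig P m) (Axiom m)"
proof -
  have "part b (asig P m) = fmmap Atom ((if b then tgt P else src P) m)" for b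
    by (rule fmap_eqI) (auto simp: asig_Some[OF pc m])
  then show ?thesis
    by (simp add: axiom_arr_def smor_def)
qed

lemma axiom_arr_morphism: "polycat_morphism P (sigma_pi P) Atom (axiom_arr P)"
proof -
  have ax: "axiom_arr P m \<in> arr (sigma_pi P)" "sctx (axiom_arr P m) = asig P m" "sim P (rep (axiom_arr P m)) (Axiom m)"
    "dom_ctx (axiom_arr P m) = fmmap Atom (src P m)" "cod_ctx (axiom_arr P m) = fmmap Atom (tgt P m)"
    if m: "m \<in> arr P" for m
  proof -
    show "axiom_arr P m \<in> arr (sigma_pi P)" "sctx (axiom_arr P m) = asig P m" "sim P (rep (axiom_arr P m)) (Axiom m)"
      using der_axiom[OF pc m] unfolding axiom_arr_smor[OF m] by (simp_all add: smor_arr smor_sctx rep_smor)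
    show "dom_ctx (axiom_arr P m) = fmmap Atom (src P m)" "cod_ctx (axiom_arr P m) = fmmap Atom (tgt P m)"
      by (simp_all add: axiom_arr_def mor_def)
  qed
  show ?thesis
    unfolding polycat_morphism_def
  proof (intro conjI ballI allI impI)
    fix m assume m: "m \<in> arr P"
    show "axiom_arr P m \<in> hom (sigma_pi P) (fmmap Atom (src P m)) (fmmap Atom (tgt P m))"
      using ax[OF m] by (simp add: hom_def)
    fix p
    have m': "ren P p m \<in> arr P" using asig_ren[OF m] by simp
    show "axiom_arr P (ren P p m) = ren (sigma_pi P) p (axiom_arr P m)"
    proof (rule arr_eqI[OF ax(1)[OF m'] sren(1)[OF ax(1)[OF m]]])
      show "sim P (rep (axiom_arr P (ren P p m))) (rep (ren (sigma_pi P) p (axiom_arr P m)))"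
        using ax(3)[OF m'] sren(3)[OF ax(1)[OF m], of p] sim_rename[OF ax(3)[OF m], of p]
        by (simp, meson sim.sym sim.trans)
    qed
  next
    fix X and \<alpha> \<beta> :: chan assume X: "X \<in> obj P" and "\<alpha> \<noteq> \<beta>"
    then have "idn P \<alpha> \<beta> X \<in> hom P (single \<alpha> X) (single \<beta> X)" by (rule idn_hom)
    then show "axiom_arr P (idn P \<alpha> \<beta> X) = idn (sigma_pi P) \<alpha> \<beta> (Atom X)"
      by (simp add: axiom_arr_def sigma_pi_def hom_def fmmap_fmupd)
  next
    fix \<gamma> f g assume c: "cuttable P \<gamma> f g"
    then have f: "f \<in> arr P" and g: "g \<in> arr P" by (simp_all add: cuttable_def)
    have c': "compat \<gamma> True (asig P f) (asig P g)"
      using c by (auto simp: cuttable_def compat_def asig_Some[OF pc f] asig_Some[OF pc g] fmdom_asig)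
    note x = pcut_axiom[OF pc f g c']
    have m: "cut P \<gamma> f g \<in> arr P" using x(1) by (simp add: pcut_def)
    have c'': "compat \<gamma> True (sctx (axiom_arr P f)) (sctx (axiom_arr P g))"
      using c' by (simp add: ax f g)
    note fg = scut[OF ax(1)[OF f] ax(1)[OF g] c'', unfolded scut_simps]
    show "axiom_arr P (cut P \<gamma> f g) = cut (sigma_pi P) \<gamma> (axiom_arr P f) (axiom_arr P g)"
    proof (rule arr_eqI[OF ax(1)[OF m] fg(1)])
      have "sim P (xcut True \<gamma> (rep (axiom_arr P f)) (rep (axiom_arr P g))) (xcut True \<gamma> (Axiom f) (Axiom g))"
        by (rule sim_xcut[OF ax(3)[OF f] ax(3)[OF g] arr_rep(1)[OF ax(1)[OF f]] arr_rep(1)[OF ax(1)[OF g]] c''])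
      then show "sim P (rep (axiom_arr P (cut P \<gamma> f g))) (rep (cut (sigma_pi P) \<gamma> (axiom_arr P f) (axiom_arr P g)))"
        using ax(3)[OF m] x(3) fg(3) unfolding pcut_def by (simp, meson sim.sym sim.trans)
    qed
  qed simp
qed

end

section \<open>Sums and products in an arbitrary polycategory\<close>

definition pcon :: "('o, 'm, 'z) sp_polycat_scheme \<Rightarrow> bool \<Rightarrow> (name, 'o) fmap \<Rightarrow> 'o" where
  "pcon P s X = (if s then prod_ob P X else sum_ob P X)"

definition pfam :: "('o, 'm, 'z) sp_polycat_scheme \<Rightarrow> bool \<Rightarrow> (name, 'o) fmap \<Rightarrow> (chan, bool \<times> 'o) fmap \<Rightarrow> chan
    \<Rightarrow> (name, 'm) fmap \<Rightarrow> 'm" where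
  "pfam P s X S \<alpha> fs = (if s then tuple else cotuple) P X (part False S) (part True S) \<alpha> fs"

context sp_polycategory
begin

lemma poly_sum_pcon: "fmran' X \<subseteq> obj P \<Longrightarrow> poly_sum (sided s P) X (pcon P s X) (sided_cotuple s P X)"
proof -
  assume X: "fmran' X \<subseteq> obj P"
  have [simp]: "sided_cotuple False P X = cotuple P X" "sided_cotuple True P X = (\<lambda>\<Gamma> \<Delta>. tuple P X \<Delta> \<Gamma>)"
    by (simp_all add: sided_cotuple_def fun_eq_iff)
  show "poly_sum (sided s P) X (pcon P s X) (sided_cotuple s P X)"
    using sums[OF X] products[OF X]
    by (cases s) (simp_all add: sided_def pcon_def poly_sum_opposite_opposite poly_product_def)
qed

lemma pcon_obj: "fmran' X \<subseteq> obj P \<Longrightarrow> pcon P s X \<in> obj P"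
  using poly_sum_pcon[of X s] by (simp add: poly_sum_def)

lemma sided_cotuple_pfam: "sided_cotuple s P X (part s S) (part (\<not> s) S) \<alpha> fs = pfam P s X S \<alpha> fs"
  by (cases s) (simp_all add: sided_cotuple_def pfam_def)

context
  fixes s :: bool and X :: "(name, 'o) fmap" and S :: "(chan, bool \<times> 'o) fmap" and \<alpha> :: chan
  assumes X: "fmran' X \<subseteq> obj P" and S: "over (obj P) S" and \<alpha>: "\<alpha> |\<notin>| fmdom S"
begin

text \<open>This unpacks \<open>poly_sum\<close> for both signs. The contexts in the naturality laws
  are still those written there; \<open>pfam_natural\<close> gives them a common form.\<close>

lemma poly_sum_part:
  shows "bij_betw (pfam P s X S \<alpha>) (pfamilies P s X S \<alpha>) {f \<in> arr P. sig P f = fmupd \<alpha> (s, pcon P s X) S}"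
    and "fs \<in> pfamilies P s X S \<alpha> \<Longrightarrow> \<gamma> \<noteq> \<alpha> \<Longrightarrow> cuttable (sided s P) \<gamma> h (pfam P s X S \<alpha> fs) \<Longrightarrow>
      pcut P s \<gamma> (pfam P s X S \<alpha> fs) h
        = sided_cotuple s P X (src (sided s P) h ++\<^sub>f fmdrop \<gamma> (part s S)) (fmdrop \<gamma> (tgt (sided s P) h) ++\<^sub>f part (\<not> s) S) \<alpha> (fmmap (\<lambda>f. pcut P s \<gamma> f h) fs)"
    and "fs \<in> pfamilies P s X S \<alpha> \<Longrightarrow> \<gamma> \<noteq> \<alpha> \<Longrightarrow> cuttable (sided s P) \<gamma> (pfam P s X S \<alpha> fs) h \<Longrightarrow>
      pcut P (\<not> s) \<gamma> (pfam P s X S \<alpha> fs) h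
        = sided_cotuple s P X (part s S ++\<^sub>f fmdrop \<gamma> (src (sided s P) h)) (fmdrop \<gamma> (part (\<not> s) S) ++\<^sub>f tgt (sided s P) h) \<alpha> (fmmap (\<lambda>f. pcut P (\<not> s) \<gamma> f h) fs)"
    and "fs \<in> pfamilies P s X S \<alpha> \<Longrightarrow> ren P p (pfam P s X S \<alpha> fs) = pfam P s X (rename_ctx p S) (apply p \<alpha>) (fmmap (ren P p) fs)"
proof -
  have seq: "sequent (obj P) (part s S) (part (\<not> s) S)"
    using sequent_part[of "obj P" S] S by (cases s) (simp_all add: sequent_def inf_commute)
  have \<alpha>': "\<alpha> |\<notin>| fmdom (part s S) |\<union>| fmdom (part (\<not> s) S)"
    using \<alpha> in_fmdom_part by auto
  have hom: "hom (sided s P) (fmupd \<alpha> (pcon P s X) (part s S)) (part (\<not> s) S) = {f \<in> arr P. sig P f = fmupd \<alpha> (s, pcon P s X) S}"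
    using hom_sided_sig[of s "fmupd \<alpha> (s, pcon P s X) S"] \<alpha> by (simp add: part_upd)
  have ct: "sided_cotuple s P X (part s S) (part (\<not> s) S) \<alpha> = pfam P s X S \<alpha>"
    by (rule ext) (rule sided_cotuple_pfam)
  have cut: "cut (sided s P) \<gamma> h f = pcut P s \<gamma> f h" "cut (sided s P) \<gamma> f h = pcut P (\<not> s) \<gamma> f h" for \<gamma> f h
    by (simp_all add: pcut_def)
  have cut': "cut (sided s P) \<gamma> h = (\<lambda>f. pcut P s \<gamma> f h)" for \<gamma> h
    by (rule ext) (simp add: pcut_def)
  have seq': "sequent (obj (sided s P)) (part s S) (part (\<not> s) S) \<and> \<alpha> |\<notin>| fmdom (part s S) |\<union>| fmdom (part (\<not> s) S)"
    using seq \<alpha>' by simp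
  note ps = poly_sum_pcon[OF X, of s, unfolded poly_sum_def, THEN conjunct2, THEN conjunct2, rule_format, OF seq',
    unfolded hom ct cofamilies_sided_sig[OF \<alpha>]]
  show "bij_betw (pfam P s X S \<alpha>) (pfamilies P s X S \<alpha>) {f \<in> arr P. sig P f = fmupd \<alpha> (s, pcon P s X) S}"
    using ps by blast
  assume fs: "fs \<in> pfamilies P s X S \<alpha>"
  note ps' = ps[THEN conjunct2, rule_format, OF fs]
  {
    assume a: "\<gamma> \<noteq> \<alpha>" "cuttable (sided s P) \<gamma> h (pfam P s X S \<alpha> fs)"
    show "pcut P s \<gamma> (pfam P s X S \<alpha> fs) h
        = sided_cotuple s P X (src (sided s P) h ++\<^sub>f fmdrop \<gamma> (part s S)) (fmdrop \<gamma> (tgt (sided s P) h) ++\<^sub>f part (\<not> s) S) \<alpha> (fmmap (\<lambda>f. pcut P s \<gamma> f h) fs)"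
      using ps'[THEN conjunct1, rule_format, of \<gamma> h] a unfolding cut(1) cut' by blast
  }
  {
    assume a: "\<gamma> \<noteq> \<alpha>" "cuttable (sided s P) \<gamma> (pfam P s X S \<alpha> fs) h"
    show "pcut P (\<not> s) \<gamma> (pfam P s X S \<alpha> fs) h
        = sided_cotuple s P X (part s S ++\<^sub>f fmdrop \<gamma> (src (sided s P) h)) (fmdrop \<gamma> (part (\<not> s) S) ++\<^sub>f tgt (sided s P) h) \<alpha> (fmmap (\<lambda>f. pcut P (\<not> s) \<gamma> f h) fs)"
      using ps'[THEN conjunct2, THEN conjunct1, rule_format, of \<gamma> h] a unfolding cut(2) by blast
  }
  show "ren P p (pfam P s X S \<alpha> fs) = pfam P s X (rename_ctx p S) (apply p \<alpha>) (fmmap (ren P p) fs)"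
    using ps'[THEN conjunct2, THEN conjunct2, rule_format, of p]
    by (simp add: part_rename[symmetric] sided_cotuple_pfam)
qed

lemma pfam:
  assumes "fs \<in> pfamilies P s X S \<alpha>"
  shows "pfam P s X S \<alpha> fs \<in> arr P" "sig P (pfam P s X S \<alpha> fs) = fmupd \<alpha> (s, pcon P s X) S"
  using poly_sum_part(1) assms by (auto simp: bij_betw_def)

lemma pfam_inj:
  "fs \<in> pfamilies P s X S \<alpha> \<Longrightarrow> gs \<in> pfamilies P s X S \<alpha> \<Longrightarrow> pfam P s X S \<alpha> fs = pfam P s X S \<alpha> gs \<Longrightarrow> fs = gs"
  using poly_sum_part(1) by (auto simp: bij_betw_def dest: inj_onD)

lemma pfam_surj:
  assumes "f \<in> arr P" "sig P f = fmupd \<alpha> (s, pcon P s X) S"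
  obtains fs where "fs \<in> pfamilies P s X S \<alpha>" "f = pfam P s X S \<alpha> fs"
  using poly_sum_part(1) assms by (auto simp: bij_betw_def)

text \<open>Both naturality laws together: \<open>r\<close> tells on which side of the (co)tuple the
  cut is made, and it decides, by comparison with \<open>s\<close>, which of the two laws is
  meant.\<close>

lemma pfam_natural:
  assumes fs: "fs \<in> pfamilies P s X S \<alpha>" and h: "h \<in> arr P" and c: "compat \<gamma> r (fmupd \<alpha> (s, pcon P s X) S) (sig P h)" and "\<gamma> \<noteq> \<alpha>"
  shows "pcut P r \<gamma> (pfam P s X S \<alpha> fs) h = pfam P s X (join \<gamma> S (sig P h)) \<alpha> (fmmap (\<lambda>f. pcut P r \<gamma> f h) fs)"
proof -
  note F = pfam[OF fs]
  note n = compat_updD[OF c \<open>\<gamma> \<noteq> \<alpha>\<close>[symmetric]]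
  obtain Z where Z: "fmlookup S \<gamma> = Some (r, Z)" "fmlookup (sig P h) \<gamma> = Some (\<not> r, Z)"
    using n by (auto simp: compat_def)
  have parts: "src (sided s P) h = part s (sig P h)" "tgt (sided s P) h = part (\<not> s) (sig P h)"
    using src_sig[OF h] tgt_sig[OF h] by (cases s; simp)+
  consider "r = s" | "r = (\<not> s)" by blast
  then show ?thesis
  proof cases
    case 1
    have "src (sided s P) h ++\<^sub>f fmdrop \<gamma> (part s S) = part s (join \<gamma> S (sig P h))"
      "fmdrop \<gamma> (tgt (sided s P) h) ++\<^sub>f part (\<not> s) S = part (\<not> s) (join \<gamma> S (sig P h))"
      unfolding parts part_join_drop(2)[OF n] using Z 1 by (simp_all add: fmdrop_part)
    then show ?thesis
      using poly_sum_part(2)[OF fs \<open>\<gamma> \<noteq> \<alpha>\<close>, of h] h F c 1 by (simp add: cuttable_sided_sig(1) sided_cotuple_pfam)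
  next
    case 2
    have "part s S ++\<^sub>f fmdrop \<gamma> (src (sided s P) h) = part s (join \<gamma> S (sig P h))"
      "fmdrop \<gamma> (part (\<not> s) S) ++\<^sub>f tgt (sided s P) h = part (\<not> s) (join \<gamma> S (sig P h))"
      unfolding parts part_join_drop(1)[OF n] using Z 2 by (simp_all add: fmdrop_part)
    then show ?thesis
      using poly_sum_part(3)[OF fs \<open>\<gamma> \<noteq> \<alpha>\<close>, of h] h F c 2 by (simp add: cuttable_sided_sig(2) sided_cotuple_pfam)
  qed
qed

lemmas ren_pfam = poly_sum_part(4)

end

end

text \<open>
  The component \<open>i\<close> of the family whose (co)tuple is the identity: an injection into the sum if
  \<open>s\<close> is \<open>False\<close> and a projection from the product if \<open>s\<close> is \<open>True\<close>.
\<close>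

definition piota :: "('o, 'm, 'z) sp_polycat_scheme \<Rightarrow> bool \<Rightarrow> (name, 'o) fmap \<Rightarrow> chan \<Rightarrow> chan \<Rightarrow> name \<Rightarrow> 'm" where
  "piota P s X \<gamma> \<delta> i = the (fmlookup
     (inv_into (pfamilies P s X (single \<gamma> (\<not> s, pcon P s X)) \<delta>) (pfam P s X (single \<gamma> (\<not> s, pcon P s X)) \<delta>)
       (pidn P s \<gamma> \<delta> (pcon P s X))) i)"

text \<open>A cut consumes its channel, whereas a selection keeps the channel and changes the
  formula on it. So \<open>h\<close> is first moved to a fresh \<open>\<delta>\<close>, and the
  injection or projection puts the new formula back on \<open>\<alpha>\<close>.\<close>

definition psel :: "('o, 'm, 'z) sp_polycat_scheme \<Rightarrow> bool \<Rightarrow> chan \<Rightarrow> name \<Rightarrow> (name, 'o) fmap \<Rightarrow> 'm \<Rightarrow> 'm" where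
  "psel P t \<alpha> k X h = (let \<delta> = SOME \<delta>. \<delta> |\<notin>| fmdom (sig P h)
     in pcut P t \<delta> (ren P (Perm.swap \<alpha> \<delta>) h) (piota P (\<not> t) X \<alpha> \<delta> k))"

lemma join_single: "\<gamma> |\<notin>| fmdom S \<Longrightarrow> join \<gamma> (single \<gamma> v) (fmupd \<gamma> w S) = S"
  "\<gamma> |\<notin>| fmdom S \<Longrightarrow> \<delta> |\<notin>| fmdom S \<Longrightarrow> \<gamma> \<noteq> \<delta> \<Longrightarrow> join \<gamma> (fmupd \<gamma> w S) (fmupd \<delta> v (single \<gamma> u)) = fmupd \<delta> v S"
  "\<gamma> |\<notin>| fmdom S \<Longrightarrow> \<delta> |\<notin>| fmdom S \<Longrightarrow> \<gamma> \<noteq> \<delta> \<Longrightarrow> join \<gamma> (fmupd \<gamma> w S) (fmupd \<gamma> u (single \<delta> v)) = fmupd \<delta> v S"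
  by (rule fmap_ext, auto simp: fmlookup_join in_fmdom_iff)+

lemma rename_swap_upd: "\<alpha> |\<notin>| fmdom S \<Longrightarrow> \<delta> |\<notin>| fmdom S \<Longrightarrow> rename_ctx (Perm.swap \<alpha> \<delta>) (fmupd \<alpha> v S) = fmupd \<delta> v S"
  by (simp, subst rename_ctx_fix) (metis apply_swap_same, simp)

lemma over_single [simp]: "over Ob (single \<gamma> (b, X)) \<longleftrightarrow> X \<in> Ob"
  by (auto simp: over_def split: if_splits)

lemma ran_obj: "fmran' X \<subseteq> Ob \<Longrightarrow> fmlookup X i = Some Y \<Longrightarrow> Y \<in> Ob"
  by (auto intro: fmran'I)

context sp_polycategory
begin

section \<open>Injections and projections as components of identities\<close>

lemma pfam_piota:
  assumes X: "fmran' X \<subseteq> obj P" and "\<gamma> \<noteq> \<delta>"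
  shows "fmmap_keys (\<lambda>i _. piota P s X \<gamma> \<delta> i) X \<in> pfamilies P s X (single \<gamma> (\<not> s, pcon P s X)) \<delta>"
    and "pfam P s X (single \<gamma> (\<not> s, pcon P s X)) \<delta> (fmmap_keys (\<lambda>i _. piota P s X \<gamma> \<delta> i) X) = pidn P s \<gamma> \<delta> (pcon P s X)"
proof -
  let ?S = "single \<gamma> (\<not> s, pcon P s X)" and ?i = "pidn P s \<gamma> \<delta> (pcon P s X)"
  have C: "pcon P s X \<in> obj P" by (rule pcon_obj[OF X])
  have S: "over (obj P) ?S" "\<delta> |\<notin>| fmdom ?S" using C \<open>\<gamma> \<noteq> \<delta>\<close> by auto
  note id = pidn[OF C \<open>\<gamma> \<noteq> \<delta>\<close>, of s]
  have "sig P ?i = fmupd \<delta> (s, pcon P s X) ?S"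
    unfolding id(2) by (rule fmupd_reorder_neq[OF \<open>\<gamma> \<noteq> \<delta>\<close>])
  from pfam_surj[OF X S id(1) this] obtain fs where fs: "fs \<in> pfamilies P s X ?S \<delta>" "?i = pfam P s X ?S \<delta> fs" .
  then have "inv_into (pfamilies P s X ?S \<delta>) (pfam P s X ?S \<delta>) ?i = fs"
    using poly_sum_part(1)[OF X S] by (simp add: bij_betw_def inv_into_f_f)
  then have "fmmap_keys (\<lambda>i _. piota P s X \<gamma> \<delta> i) X = fs"
    using fs(1) by (intro pfamilies_eqI[OF fs(1), symmetric]) (simp_all add: piota_def)
  with fs show "fmmap_keys (\<lambda>i _. piota P s X \<gamma> \<delta> i) X \<in> pfamilies P s X ?S \<delta>"
    "pfam P s X ?S \<delta> (fmmap_keys (\<lambda>i _. piota P s X \<gamma> \<delta> i) X) = ?i"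
    by simp_all
qed

lemma piota:
  assumes "fmran' X \<subseteq> obj P" "\<gamma> \<noteq> \<delta>" "fmlookup X i = Some Y"
  shows "piota P s X \<gamma> \<delta> i \<in> arr P" "sig P (piota P s X \<gamma> \<delta> i) = fmupd \<delta> (s, Y) (single \<gamma> (\<not> s, pcon P s X))"
  using pfamiliesD[OF pfam_piota(1)[OF assms(1,2), of s] assms(3)] assms(3) by auto

text \<open>Injectivity of the (co)tuple. It serves to recognise injections and projections after a
  renaming or after transport along a morphism.\<close>

lemma piota_unique:
  assumes X: "fmran' X \<subseteq> obj P" and "\<gamma> \<noteq> \<delta>" and i: "fmlookup X i = Some Y"
    and fs: "fs \<in> pfamilies P s X (single \<gamma> (\<not> s, pcon P s X)) \<delta>" "fmlookup fs i = Some f"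
    and eq: "pfam P s X (single \<gamma> (\<not> s, pcon P s X)) \<delta> fs = pidn P s \<gamma> \<delta> (pcon P s X)"
  shows "piota P s X \<gamma> \<delta> i = f"
proof -
  have "over (obj P) (single \<gamma> (\<not> s, pcon P s X))" "\<delta> |\<notin>| fmdom (single \<gamma> (\<not> s, pcon P s X))"
    using pcon_obj[OF X] \<open>\<gamma> \<noteq> \<delta>\<close> by auto
  from pfam_inj[OF X this pfam_piota(1)[OF X \<open>\<gamma> \<noteq> \<delta>\<close>] fs(1)] eq pfam_piota(2)[OF X \<open>\<gamma> \<noteq> \<delta>\<close>, of s]
  have "fmmap_keys (\<lambda>i _. piota P s X \<gamma> \<delta> i) X = fs" by simp
  from arg_cong[OF this, of "\<lambda>m. fmlookup m i"] fs(2) i show ?thesis by simp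
qed

text \<open>Renaming commutes with the (co)tuple and carries identities to identities, so the
  renamed family also has an identity as its (co)tuple.\<close>

lemma ren_piota:
  assumes X: "fmran' X \<subseteq> obj P" and "\<gamma> \<noteq> \<delta>" and i: "fmlookup X i = Some Y"
  shows "ren P p (piota P s X \<gamma> \<delta> i) = piota P s X (apply p \<gamma>) (apply p \<delta>) i"
proof (rule piota_unique[symmetric, OF X _ i])
  let ?S = "single \<gamma> (\<not> s, pcon P s X)" and ?fs = "fmmap_keys (\<lambda>i _. piota P s X \<gamma> \<delta> i) X"
  have C: "pcon P s X \<in> obj P" by (rule pcon_obj[OF X])
  have S: "over (obj P) ?S" "\<delta> |\<notin>| fmdom ?S" using C \<open>\<gamma> \<noteq> \<delta>\<close> by auto
  note fs = pfam_piota[OF X \<open>\<gamma> \<noteq> \<delta>\<close>, of s]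
  show "apply p \<gamma> \<noteq> apply p \<delta>" using \<open>\<gamma> \<noteq> \<delta>\<close> by simp
  show "fmmap (ren P p) ?fs \<in> pfamilies P s X (single (apply p \<gamma>) (\<not> s, pcon P s X)) (apply p \<delta>)"
    by (rule pfamilies_map[OF fs(1)]) (simp add: ren_sig)
  show "fmlookup (fmmap (ren P p) ?fs) i = Some (ren P p (piota P s X \<gamma> \<delta> i))"
    using i by simp
  show "pfam P s X (single (apply p \<gamma>) (\<not> s, pcon P s X)) (apply p \<delta>) (fmmap (ren P p) ?fs)
      = pidn P s (apply p \<gamma>) (apply p \<delta>) (pcon P s X)"
    using ren_pfam[OF X S fs(1), of p] fs(2) ren_pidn[OF C \<open>\<gamma> \<noteq> \<delta>\<close>, of p s] by simp
qed

text \<open>Cutting the (co)tuple with an identity only renames it. That identity is the (co)tuple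
  of all \<open>piota\<close>, so naturality carries the cut into each of them, while the renaming
  acts on each component of \<open>fs\<close>; injectivity then equates the two families.\<close>

lemma pcut_piota:
  assumes X: "fmran' X \<subseteq> obj P" and S: "over (obj P) S" "\<gamma> |\<notin>| fmdom S" and fs: "fs \<in> pfamilies P s X S \<gamma>"
    and \<delta>: "\<delta> |\<notin>| fmdom S" "\<gamma> \<noteq> \<delta>" and i: "fmlookup X i = Some Y" "fmlookup fs i = Some f"
  shows "pcut P s \<gamma> (pfam P s X S \<gamma> fs) (piota P s X \<gamma> \<delta> i) = ren P (Perm.swap \<gamma> \<delta>) f"
proof -
  let ?C = "pcon P s X" and ?F = "pfam P s X S \<gamma> fs" and ?js = "fmmap_keys (\<lambda>i _. piota P s X \<gamma> \<delta> i) X"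
  have C: "?C \<in> obj P" by (rule pcon_obj[OF X])
  note F = pfam[OF X S fs]
  have T: "over (obj P) (single \<gamma> (\<not> s, ?C))" "\<delta> |\<notin>| fmdom (single \<gamma> (\<not> s, ?C))" using C \<delta> by auto
  note fi = pfam_piota[OF X \<delta>(2), of s]
  have c: "compat \<gamma> (\<not> s) (fmupd \<delta> (s, ?C) (single \<gamma> (\<not> s, ?C))) (sig P ?F)"
    unfolding F(2) by (rule compatI[where Z = ?C]) (use \<delta> in auto)
  have ci: "compat \<gamma> (\<not> s) (fmupd \<delta> (s, Y) (single \<gamma> (\<not> s, ?C))) (sig P ?F)" for Y
    using c by (rule compat_upd(1)[OF \<delta>(2)[symmetric], THEN iffD1])
  have j: "join \<gamma> (single \<gamma> (\<not> s, ?C)) (sig P ?F) = S"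
    unfolding F(2) by (rule join_single(1)[OF S(2)])
  have "ren P (Perm.swap \<gamma> \<delta>) ?F = pcut P s \<gamma> ?F (pidn P s \<gamma> \<delta> ?C)"
    using pcut_pidn[OF F(1), of \<gamma> s ?C \<delta>] F(2) \<delta> by simp
  also have "\<dots> = pcut P (\<not> s) \<gamma> (pfam P s X (single \<gamma> (\<not> s, ?C)) \<delta> ?js) ?F"
    by (simp add: pcut_not fi(2))
  also have "\<dots> = pfam P s X S \<delta> (fmmap (\<lambda>f. pcut P (\<not> s) \<gamma> f ?F) ?js)"
    using pfam_natural[OF X T fi(1) F(1) c \<delta>(2)] unfolding j .
  finally have eq: "pfam P s X S \<delta> (fmmap (ren P (Perm.swap \<gamma> \<delta>)) fs) = pfam P s X S \<delta> (fmmap (\<lambda>f. pcut P (\<not> s) \<gamma> f ?F) ?js)"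
    using ren_pfam[OF X S fs, of "Perm.swap \<gamma> \<delta>"] rename_ctx_fix[of S "Perm.swap \<gamma> \<delta>"] S(2) \<delta>(1)
    by (metis apply_swap_same apply_swap_simp(1))
  have 1: "fmmap (ren P (Perm.swap \<gamma> \<delta>)) fs \<in> pfamilies P s X S \<delta>"
    by (rule pfamilies_map[OF fs]) (use S \<delta> in \<open>simp add: ren_sig rename_swap_upd del: rename_ctx_upd\<close>)
  have 2: "fmmap (\<lambda>f. pcut P (\<not> s) \<gamma> f ?F) ?js \<in> pfamilies P s X S \<delta>"
  proof (rule pfamilies_map[OF fi(1)])
    fix f Y assume f: "f \<in> arr P" "sig P f = fmupd \<delta> (s, Y) (single \<gamma> (\<not> s, ?C))"
    have "join \<gamma> (sig P f) (sig P ?F) = fmupd \<delta> (s, Y) S"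
      unfolding f(2) using \<delta> j F(2) by (subst join_upd) auto
    then show "pcut P (\<not> s) \<gamma> f ?F \<in> arr P \<and> sig P (pcut P (\<not> s) \<gamma> f ?F) = fmupd \<delta> (s, Y) S"
      using pcut[OF f(1) F(1) ci[of Y, folded f(2)]] by simp
  qed
  from pfam_inj[OF X S(1) \<delta>(1) 1 2 eq] have "fmlookup (fmmap (ren P (Perm.swap \<gamma> \<delta>)) fs) i = fmlookup (fmmap (\<lambda>f. pcut P (\<not> s) \<gamma> f ?F) ?js) i"
    by simp
  then show ?thesis
    using i by (simp add: pcut_not)
qed

section \<open>Selections in a polycategory with sums and products\<close>

context
  fixes t :: bool and \<alpha> :: chan and k :: name and X :: "(name, 'o) fmap" and Y :: 'o and S :: "(chan, bool \<times> 'o) fmap" and h :: 'm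
  assumes h: "h \<in> arr P" "sig P h = fmupd \<alpha> (t, Y) S" "\<alpha> |\<notin>| fmdom S"
    and k: "fmlookup X k = Some Y" and X: "fmran' X \<subseteq> obj P"
begin

lemma psel_aux:
  assumes \<delta>: "\<delta> |\<notin>| fmdom (sig P h)"
  shows "compat \<delta> t (sig P (ren P (Perm.swap \<alpha> \<delta>) h)) (sig P (piota P (\<not> t) X \<alpha> \<delta> k))"
    and "sig P (ren P (Perm.swap \<alpha> \<delta>) h) = fmupd \<delta> (t, Y) S"
    and "pcut P t \<delta> (ren P (Perm.swap \<alpha> \<delta>) h) (piota P (\<not> t) X \<alpha> \<delta> k) \<in> arr P"
    and "sig P (pcut P t \<delta> (ren P (Perm.swap \<alpha> \<delta>) h) (piota P (\<not> t) X \<alpha> \<delta> k)) = fmupd \<alpha> (t, pcon P (\<not> t) X) S"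
proof -
  have \<delta>': "\<delta> |\<notin>| fmdom S" "\<alpha> \<noteq> \<delta>" using \<delta> h by auto
  show 1: "sig P (ren P (Perm.swap \<alpha> \<delta>) h) = fmupd \<delta> (t, Y) S"
    using h \<delta>' by (simp add: ren_sig rename_swap_upd del: rename_ctx_upd)
  note i = piota[OF X \<delta>'(2) k, of "\<not> t"]
  show c: "compat \<delta> t (sig P (ren P (Perm.swap \<alpha> \<delta>) h)) (sig P (piota P (\<not> t) X \<alpha> \<delta> k))"
    unfolding 1 i(2) by (rule compatI[where Z = Y]) (use h \<delta>' in auto)
  note p = pcut[OF ren_sig(1)[OF h(1)] i(1) c]
  show "pcut P t \<delta> (ren P (Perm.swap \<alpha> \<delta>) h) (piota P (\<not> t) X \<alpha> \<delta> k) \<in> arr P" by (rule p(1))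
  show "sig P (pcut P t \<delta> (ren P (Perm.swap \<alpha> \<delta>) h) (piota P (\<not> t) X \<alpha> \<delta> k)) = fmupd \<alpha> (t, pcon P (\<not> t) X) S"
    unfolding p(2) 1 i(2) by (subst join_single(3)) (use h \<delta>' in auto)
qed

text \<open>The fresh channel does not occur in the result. Exchanging two candidates therefore
  leaves the result unchanged, while it turns the defining cut for one into that for the
  other.\<close>

lemma psel_eq:
  assumes \<delta>: "\<delta> |\<notin>| fmdom (sig P h)"
  shows "psel P t \<alpha> k X h = pcut P t \<delta> (ren P (Perm.swap \<alpha> \<delta>) h) (piota P (\<not> t) X \<alpha> \<delta> k)"
proof -
  define \<epsilon> where "\<epsilon> = (SOME \<epsilon>. \<epsilon> |\<notin>| fmdom (sig P h))"
  have \<epsilon>: "\<epsilon> |\<notin>| fmdom (sig P h)"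
    unfolding \<epsilon>_def by (rule someI_ex[OF ex_fresh])
  let ?e = "\<lambda>\<delta>. pcut P t \<delta> (ren P (Perm.swap \<alpha> \<delta>) h) (piota P (\<not> t) X \<alpha> \<delta> k)"
  have ne: "\<alpha> \<noteq> \<delta>" "\<alpha> \<noteq> \<epsilon>" using h \<delta> \<epsilon> by auto
  note i = piota[OF X ne(1) k, of "\<not> t"]
  note e = psel_aux[OF \<delta>]
  let ?p = "Perm.swap \<delta> \<epsilon>"
  have "?e \<delta> = ren P ?p (?e \<delta>)"
    by (rule ren_swap_fix[symmetric, OF e(3)]) (use h \<delta> \<epsilon> ne e(4) in auto)
  also have "\<dots> = pcut P t \<epsilon> (ren P ?p (ren P (Perm.swap \<alpha> \<delta>) h)) (piota P (\<not> t) X \<alpha> \<epsilon> k)"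
    using ren_pcut[OF ren_sig(1)[OF h(1)] i(1) e(1), of ?p] ren_piota[OF X ne(1) k, of ?p "\<not> t"] ne by simp
  also have "ren P ?p (ren P (Perm.swap \<alpha> \<delta>) h) = ren P (Perm.swap \<alpha> \<epsilon>) (ren P ?p h)"
    using ne h(1) by (simp add: ren_mult[symmetric] swap_conj[of ?p \<alpha> \<delta>])
  also have "ren P ?p h = h"
    by (rule ren_swap_fix[OF h(1) \<delta> \<epsilon>])
  finally show ?thesis
    by (simp add: psel_def flip: \<epsilon>_def)
qed

lemma psel: "psel P t \<alpha> k X h \<in> arr P" "sig P (psel P t \<alpha> k X h) = fmupd \<alpha> (t, pcon P (\<not> t) X) S"
proof -
  obtain \<delta> where \<delta>: "\<delta> |\<notin>| fmdom (sig P h)" using ex_fresh by blast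
  show "psel P t \<alpha> k X h \<in> arr P" "sig P (psel P t \<alpha> k X h) = fmupd \<alpha> (t, pcon P (\<not> t) X) S"
    unfolding psel_eq[OF \<delta>] using psel_aux[OF \<delta>] by simp_all
qed

end

lemma ren_psel:
  assumes h: "h \<in> arr P" "sig P h = fmupd \<alpha> (t, Y) S" "\<alpha> |\<notin>| fmdom S" and k: "fmlookup X k = Some Y" and X: "fmran' X \<subseteq> obj P"
  shows "ren P p (psel P t \<alpha> k X h) = psel P t (apply p \<alpha>) k X (ren P p h)"
proof -
  obtain \<delta> where \<delta>: "\<delta> |\<notin>| fmdom (sig P h)" using ex_fresh by blast
  have ne: "\<alpha> \<noteq> \<delta>" using h \<delta> by auto
  note i = piota[OF X ne k, of "\<not> t"]
  have h': "ren P p h \<in> arr P" "sig P (ren P p h) = fmupd (apply p \<alpha>) (t, Y) (rename_ctx p S)" "apply p \<alpha> |\<notin>| fmdom (rename_ctx p S)"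
    using h by (simp_all add: ren_sig)
  have \<delta>': "apply p \<delta> |\<notin>| fmdom (sig P (ren P p h))" using h \<delta> by (simp add: ren_sig)
  have "ren P p (ren P (Perm.swap \<alpha> \<delta>) h) = ren P (Perm.swap (apply p \<alpha>) (apply p \<delta>)) (ren P p h)"
    using h(1) by (simp add: ren_mult[symmetric] swap_conj)
  then show ?thesis
    unfolding psel_eq[OF h k X \<delta>] psel_eq[OF h' k X \<delta>']
    using ren_pcut[OF ren_sig(1)[OF h(1)] i(1) psel_aux(1)[OF h k X \<delta>], of p] ren_piota[OF X ne k, of p "\<not> t"] by simp
qed

text \<open>The counterpart of \<open>c5\<close> to \<open>c8\<close>. In the cut that defines
  \<open>psel\<close>, \<open>h\<close> is the middle piece between \<open>piota\<close> and
  \<open>g\<close>, so \<open>pcut_assoc\<close> exchanges the two cuts; \<open>\<delta>\<close> is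
  chosen outside \<open>g\<close> as well, so that the renaming does not touch
  \<open>g\<close>.\<close>

lemma pcut_psel:
  assumes h: "h \<in> arr P" "sig P h = fmupd \<alpha> (t, Y) S" "\<alpha> |\<notin>| fmdom S" and k: "fmlookup X k = Some Y" and X: "fmran' X \<subseteq> obj P"
    and g: "g \<in> arr P" and c: "compat \<gamma> r (fmupd \<alpha> (t, pcon P (\<not> t) X) S) (sig P g)" and "\<alpha> \<noteq> \<gamma>"
  shows "pcut P r \<gamma> (psel P t \<alpha> k X h) g = psel P t \<alpha> k X (pcut P r \<gamma> h g)"
    and "pcut P r \<gamma> h g \<in> arr P" and "sig P (pcut P r \<gamma> h g) = fmupd \<alpha> (t, Y) (join \<gamma> S (sig P g))"
    and "\<alpha> |\<notin>| fmdom (join \<gamma> S (sig P g))"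
proof -
  have \<alpha>g: "\<alpha> |\<notin>| fmdom (sig P g)" by (rule compat_notin[OF c \<open>\<alpha> \<noteq> \<gamma>\<close>])
  have c': "compat \<gamma> r (sig P h) (sig P g)"
    unfolding h(2) using c by (rule compat_upd(1)[OF \<open>\<alpha> \<noteq> \<gamma>\<close>, THEN iffD1])
  note hg = pcut[OF h(1) g c']
  show "pcut P r \<gamma> h g \<in> arr P" by (rule hg(1))
  show hg2: "sig P (pcut P r \<gamma> h g) = fmupd \<alpha> (t, Y) (join \<gamma> S (sig P g))"
    unfolding hg(2) h(2) by (rule join_upd[OF \<open>\<alpha> \<noteq> \<gamma>\<close> \<alpha>g])
  show \<alpha>j: "\<alpha> |\<notin>| fmdom (join \<gamma> S (sig P g))" using h(3) \<alpha>g by simp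
  obtain \<delta> where "\<delta> |\<notin>| fmdom (sig P h) |\<union>| fmdom (sig P g)" using ex_fresh by blast
  then have \<delta>: "\<delta> |\<notin>| fmdom (sig P h)" "\<delta> |\<notin>| fmdom (sig P g)" by auto
  have ne: "\<alpha> \<noteq> \<delta>" "\<delta> \<noteq> \<gamma>" using h \<delta> compat_in(1)[OF c'] by auto
  have \<delta>': "\<delta> |\<notin>| fmdom (sig P (pcut P r \<gamma> h g))" using \<delta> by (simp add: hg(2))
  note aux = psel_aux[OF h k X \<delta>(1)] and i = piota[OF X ne(1) k, of "\<not> t"]
  let ?h = "ren P (Perm.swap \<alpha> \<delta>) h"
  have g': "ren P (Perm.swap \<alpha> \<delta>) g = g" by (rule ren_swap_fix[OF g \<alpha>g \<delta>(2)])
  have c2: "compat \<gamma> r (sig P ?h) (sig P g)"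
    using compat_rename[OF c', of "Perm.swap \<alpha> \<delta>"] ren_sig(2)[OF g, of "Perm.swap \<alpha> \<delta>"] ren_sig(2)[OF h(1), of "Perm.swap \<alpha> \<delta>"] g' ne \<open>\<alpha> \<noteq> \<gamma>\<close>
    by simp
  have "fmdom (sig P (piota P (\<not> t) X \<alpha> \<delta> k)) |\<inter>| fmdom (sig P g) = {||}"
    using \<alpha>g \<delta>(2) by (simp add: i(2))
  from pcut_assoc[OF i(1) ren_sig(1)[OF h(1)] g aux(1) c2 this]
  have "pcut P r \<gamma> (psel P t \<alpha> k X h) g = pcut P t \<delta> (pcut P r \<gamma> ?h g) (piota P (\<not> t) X \<alpha> \<delta> k)"
    by (simp add: psel_eq[OF h k X \<delta>(1)])
  also have "pcut P r \<gamma> ?h g = ren P (Perm.swap \<alpha> \<delta>) (pcut P r \<gamma> h g)"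
    using ren_pcut[OF h(1) g c', of "Perm.swap \<alpha> \<delta>"] g' ne \<open>\<alpha> \<noteq> \<gamma>\<close> by simp
  finally show "pcut P r \<gamma> (psel P t \<alpha> k X h) g = psel P t \<alpha> k X (pcut P r \<gamma> h g)"
    by (simp add: psel_eq[OF hg(1) hg2 \<alpha>j k X \<delta>'])
qed

text \<open>The counterpart of \<open>c11\<close> and \<open>c12\<close>. This time
  \<open>piota\<close> is the middle piece: reassociating brings it against the (co)tuple, where
  \<open>pcut_piota\<close> extracts the component, and the auxiliary renaming disappears with the
  cut channel.\<close>

lemma pcut_psel_pfam:
  assumes h: "h \<in> arr P" "sig P h = fmupd \<gamma> (t, Y) S" "\<gamma> |\<notin>| fmdom S" and k: "fmlookup X k = Some Y" and X: "fmran' X \<subseteq> obj P"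
    and T: "over (obj P) T" "\<gamma> |\<notin>| fmdom T" and gs: "gs \<in> pfamilies P (\<not> t) X T \<gamma>" and g: "fmlookup gs k = Some g"
    and disj: "fmdom S |\<inter>| fmdom T = {||}"
  shows "pcut P t \<gamma> (psel P t \<gamma> k X h) (pfam P (\<not> t) X T \<gamma> gs) = pcut P t \<gamma> h g"
proof -
  let ?F = "pfam P (\<not> t) X T \<gamma> gs"
  note F = pfam[OF X T gs]
  obtain \<delta> where "\<delta> |\<notin>| fmdom (sig P h) |\<union>| fmdom T" using ex_fresh by blast
  then have \<delta>: "\<delta> |\<notin>| fmdom (sig P h)" "\<delta> |\<notin>| fmdom T" "\<delta> |\<notin>| fmdom S" and ne: "\<gamma> \<noteq> \<delta>" using h by auto
  note aux = psel_aux[OF h k X \<delta>(1)] and i = piota[OF X ne k, of "\<not> t"]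
  have g': "g \<in> arr P" "sig P g = fmupd \<gamma> (\<not> t, Y) T"
    using pfamiliesD[OF gs k] g by auto
  let ?h = "ren P (Perm.swap \<gamma> \<delta>) h" and ?i = "piota P (\<not> t) X \<gamma> \<delta> k"
  have c: "compat \<gamma> t (sig P ?i) (sig P ?F)"
    unfolding i(2) F(2) by (rule compatI[where Z = "pcon P (\<not> t) X"]) (use \<delta> ne in auto)
  have cg: "compat \<gamma> (\<not> t) (sig P g) (sig P h)"
    unfolding g'(2) h(2) by (rule compatI[where Z = Y]) (use disj in auto)
  have j: "join \<gamma> (sig P g) (sig P h) = join \<gamma> T S" by (simp add: g' h)
  have "pcut P t \<gamma> (psel P t \<gamma> k X h) ?F = pcut P t \<gamma> (pcut P (\<not> t) \<delta> ?i ?h) ?F"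
    by (simp add: psel_eq[OF h k X \<delta>(1)] pcut_not)
  also have "\<dots> = pcut P (\<not> t) \<delta> (pcut P t \<gamma> ?i ?F) ?h"
    by (rule pcut_assoc[OF ren_sig(1)[OF h(1)] i(1) F(1) compat_sym[OF aux(1)] c]) (use disj h \<delta> ne aux(2) F(2) in auto)
  also have "pcut P t \<gamma> ?i ?F = ren P (Perm.swap \<gamma> \<delta>) g"
    using pcut_piota[OF X T gs \<delta>(2) ne k g] by (simp add: pcut_not)
  also have "pcut P (\<not> t) \<delta> (ren P (Perm.swap \<gamma> \<delta>) g) ?h = ren P (Perm.swap \<gamma> \<delta>) (pcut P (\<not> t) \<gamma> g h)"
    using ren_pcut[OF g'(1) h(1) cg, of "Perm.swap \<gamma> \<delta>"] by simp
  also have "\<dots> = pcut P (\<not> t) \<gamma> g h"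
    by (rule ren_swap_fix[OF pcut(1)[OF g'(1) h(1) cg]]) (use h(3) T \<delta> in \<open>simp_all add: pcut(2)[OF g'(1) h(1) cg] j\<close>)
  finally show ?thesis by (simp add: pcut_not)
qed

text \<open>The injections are jointly epic and the projections jointly monic: every such
  polymorphism is a (co)tuple, and its components are its cuts with the \<open>piota\<close> up to
  renaming.\<close>

lemma pfam_ext:
  assumes X: "fmran' X \<subseteq> obj P" and S: "over (obj P) S" "\<alpha> |\<notin>| fmdom S"
    and u: "u \<in> arr P" "sig P u = fmupd \<alpha> (s, pcon P s X) S" and v: "v \<in> arr P" "sig P v = fmupd \<alpha> (s, pcon P s X) S"
    and \<delta>: "\<delta> |\<notin>| fmdom S" "\<alpha> \<noteq> \<delta>"
    and eq: "\<And>i Y. fmlookup X i = Some Y \<Longrightarrow> pcut P s \<alpha> u (piota P s X \<alpha> \<delta> i) = pcut P s \<alpha> v (piota P s X \<alpha> \<delta> i)"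
  shows "u = v"
proof -
  obtain us where us: "us \<in> pfamilies P s X S \<alpha>" "u = pfam P s X S \<alpha> us" using pfam_surj[OF X S u] .
  obtain vs where vs: "vs \<in> pfamilies P s X S \<alpha>" "v = pfam P s X S \<alpha> vs" using pfam_surj[OF X S v] .
  have "us = vs"
  proof (rule pfamilies_eqI[OF us(1) pfamilies_dom[OF vs(1)]])
    fix i Y f assume i: "fmlookup X i = Some Y" and f: "fmlookup us i = Some f" "f \<in> arr P"
    obtain g where g: "fmlookup vs i = Some g" "g \<in> arr P" using pfamiliesD[OF vs(1) i] by blast
    have "ren P (Perm.swap \<alpha> \<delta>) f = ren P (Perm.swap \<alpha> \<delta>) g"
      using eq[OF i] pcut_piota[OF X S us(1) \<delta> i f(1)] pcut_piota[OF X S vs(1) \<delta> i g(1)] us(2) vs(2) by simp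
    then have "f = g" using f(2) g(2) by (metis ren_swap_swap)
    then show "fmlookup vs i = Some f" using g by simp
  qed
  then show ?thesis using us vs by simp
qed

text \<open>The counterpart of \<open>c13\<close>, \<open>c14\<close> and \<open>c19\<close>. By
  \<open>pfam_ext\<close> it suffices to cut both sides with each \<open>piota\<close> for
  \<open>X\<close>. On the left this extracts row \<open>i\<close>; on the right naturality carries
  the cut into every column, where it extracts the entry \<open>F i j\<close>.\<close>

lemma pfam_pfam:
  assumes X: "fmran' X \<subseteq> obj P" and Y: "fmran' Y \<subseteq> obj P" and S: "over (obj P) S" "\<alpha> |\<notin>| fmdom S" "\<beta> |\<notin>| fmdom S" and "\<alpha> \<noteq> \<beta>"
    and F: "\<And>i j Xi Yj. fmlookup X i = Some Xi \<Longrightarrow> fmlookup Y j = Some Yj \<Longrightarrow>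
      F i j \<in> arr P \<and> sig P (F i j) = fmupd \<alpha> (s, Xi) (fmupd \<beta> (t, Yj) S)"
  shows "pfam P s X (fmupd \<beta> (t, pcon P t Y) S) \<alpha>
      (fmmap_keys (\<lambda>i Xi. pfam P t Y (fmupd \<alpha> (s, Xi) S) \<beta> (fmmap_keys (\<lambda>j _. F i j) Y)) X)
    = pfam P t Y (fmupd \<alpha> (s, pcon P s X) S) \<beta>
      (fmmap_keys (\<lambda>j Yj. pfam P s X (fmupd \<beta> (t, Yj) S) \<alpha> (fmmap_keys (\<lambda>i _. F i j) X)) Y)" (is "?u = ?v")
proof -
  let ?C = "pcon P s X" and ?D = "pcon P t Y"
  note C = pcon_obj[OF X, of s] and D = pcon_obj[OF Y, of t]
  have reorder: "fmupd \<alpha> v (fmupd \<beta> w S) = fmupd \<beta> w (fmupd \<alpha> v S)" for v w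
    by (rule fmupd_reorder_neq[OF \<open>\<alpha> \<noteq> \<beta>\<close>])
  have inX: "over (obj P) (fmupd \<alpha> (s, Z) S)" "\<beta> |\<notin>| fmdom (fmupd \<alpha> (s, Z) S)" if "Z \<in> obj P" for Z
    using that S \<open>\<alpha> \<noteq> \<beta>\<close> by (auto simp: over_upd)
  have inY: "over (obj P) (fmupd \<beta> (t, Z) S)" "\<alpha> |\<notin>| fmdom (fmupd \<beta> (t, Z) S)" if "Z \<in> obj P" for Z
    using that S \<open>\<alpha> \<noteq> \<beta>\<close> by (auto simp: over_upd)
  have row: "fmmap_keys (\<lambda>j _. F i j) Y \<in> pfamilies P t Y (fmupd \<alpha> (s, Xi) S) \<beta>" if "fmlookup X i = Some Xi" for i Xi
    by (rule pfamiliesI) (use F[OF that] reorder in auto)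
  have col: "fmmap_keys (\<lambda>i _. F i j) X \<in> pfamilies P s X (fmupd \<beta> (t, Yj) S) \<alpha>" if "fmlookup Y j = Some Yj" for j Yj
    by (rule pfamiliesI) (use F[OF _ that] in auto)
  let ?us = "fmmap_keys (\<lambda>i Xi. pfam P t Y (fmupd \<alpha> (s, Xi) S) \<beta> (fmmap_keys (\<lambda>j _. F i j) Y)) X"
  let ?vs = "fmmap_keys (\<lambda>j Yj. pfam P s X (fmupd \<beta> (t, Yj) S) \<alpha> (fmmap_keys (\<lambda>i _. F i j) X)) Y"
  have us: "?us \<in> pfamilies P s X (fmupd \<beta> (t, ?D) S) \<alpha>"
    by (rule pfamiliesI) (use pfam[OF Y inX row] ran_obj[OF X] reorder in auto)
  have vs: "?vs \<in> pfamilies P t Y (fmupd \<alpha> (s, ?C) S) \<beta>"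
    by (rule pfamiliesI) (use pfam[OF X inY col] ran_obj[OF Y] reorder in auto)
  note u = pfam[OF X inY[OF D] us] and v = pfam[OF Y inX[OF C] vs]
  obtain \<delta> where \<delta>: "\<delta> |\<notin>| fmdom (fmupd \<alpha> (s, ?C) (fmupd \<beta> (t, ?D) S))" using ex_fresh by blast
  then have \<delta>': "\<delta> |\<notin>| fmdom (fmupd \<beta> (t, Z) S)" "\<alpha> \<noteq> \<delta>" "\<beta> \<noteq> \<delta>" "\<delta> |\<notin>| fmdom S" for Z by auto
  show ?thesis
  proof (rule pfam_ext[OF X inY[OF D] u v(1) v(2)[folded reorder] \<delta>'(1,2)])
    fix i Xi assume i: "fmlookup X i = Some Xi"
    have Xi: "Xi \<in> obj P" using ran_obj[OF X i] .
    note io = piota[OF X \<delta>'(2) i, of s]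
    let ?r = "ren P (Perm.swap \<alpha> \<delta>)"
    have "pcut P s \<alpha> ?u (piota P s X \<alpha> \<delta> i) = ?r (pfam P t Y (fmupd \<alpha> (s, Xi) S) \<beta> (fmmap_keys (\<lambda>j _. F i j) Y))"
      by (rule pcut_piota[OF X inY[OF D] us \<delta>'(1,2) i]) (use i in simp)
    also have "\<dots> = pfam P t Y (fmupd \<delta> (s, Xi) S) \<beta> (fmmap ?r (fmmap_keys (\<lambda>j _. F i j) Y))"
      using ren_pfam[OF Y inX[OF Xi] row[OF i], of "Perm.swap \<alpha> \<delta>"] S \<delta>' \<open>\<alpha> \<noteq> \<beta>\<close>
      by (simp add: rename_swap_upd del: rename_ctx_upd)
    finally have lhs: "pcut P s \<alpha> ?u (piota P s X \<alpha> \<delta> i) = pfam P t Y (fmupd \<delta> (s, Xi) S) \<beta> (fmmap ?r (fmmap_keys (\<lambda>j _. F i j) Y))" .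
    have c: "compat \<alpha> s (fmupd \<beta> (t, ?D) (fmupd \<alpha> (s, ?C) S)) (sig P (piota P s X \<alpha> \<delta> i))"
      unfolding io(2) by (rule compatI[where Z = ?C]) (use \<delta>' \<open>\<alpha> \<noteq> \<beta>\<close> in auto)
    have "pcut P s \<alpha> ?v (piota P s X \<alpha> \<delta> i)
        = pfam P t Y (join \<alpha> (fmupd \<alpha> (s, ?C) S) (sig P (piota P s X \<alpha> \<delta> i))) \<beta> (fmmap (\<lambda>f. pcut P s \<alpha> f (piota P s X \<alpha> \<delta> i)) ?vs)"
      by (rule pfam_natural[OF Y inX[OF C] vs io(1) c \<open>\<alpha> \<noteq> \<beta>\<close>])
    also have "join \<alpha> (fmupd \<alpha> (s, ?C) S) (sig P (piota P s X \<alpha> \<delta> i)) = fmupd \<delta> (s, Xi) S"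
      unfolding io(2) by (rule join_single(2)[OF S(2) \<delta>'(4) \<delta>'(2)])
    also have "fmmap (\<lambda>f. pcut P s \<alpha> f (piota P s X \<alpha> \<delta> i)) ?vs = fmmap ?r (fmmap_keys (\<lambda>j _. F i j) Y)"
    proof (rule fmap_ext)
      fix j
      show "fmlookup (fmmap (\<lambda>f. pcut P s \<alpha> f (piota P s X \<alpha> \<delta> i)) ?vs) j = fmlookup (fmmap ?r (fmmap_keys (\<lambda>j _. F i j) Y)) j"
      proof (cases "fmlookup Y j")
        case (Some Yj)
        have "pcut P s \<alpha> (pfam P s X (fmupd \<beta> (t, Yj) S) \<alpha> (fmmap_keys (\<lambda>i _. F i j) X)) (piota P s X \<alpha> \<delta> i) = ?r (F i j)"
          by (rule pcut_piota[OF X inY[OF ran_obj[OF Y Some]] col[OF Some] \<delta>'(1,2) i]) (use i in simp)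
        then show ?thesis using Some by simp
      qed simp
    qed
    finally show "pcut P s \<alpha> ?u (piota P s X \<alpha> \<delta> i) = pcut P s \<alpha> ?v (piota P s X \<alpha> \<delta> i)"
      using lhs by simp
  qed
qed

text \<open>The counterpart of \<open>c15\<close> to \<open>c18\<close>. A selection on
  \<open>\<beta>\<close> is a renaming followed by a cut away from \<open>\<alpha>\<close>, and the
  (co)tuple is natural in both.\<close>

lemma pfam_psel:
  assumes X: "fmran' X \<subseteq> obj P" and Y: "fmran' Y \<subseteq> obj P" and S: "over (obj P) S" "\<alpha> |\<notin>| fmdom S" "\<beta> |\<notin>| fmdom S" and "\<alpha> \<noteq> \<beta>"
    and k: "fmlookup Y k = Some Z" and fs: "fs \<in> pfamilies P s X (fmupd \<beta> (t, Z) S) \<alpha>"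
  shows "pfam P s X (fmupd \<beta> (t, pcon P (\<not> t) Y) S) \<alpha> (fmmap (psel P t \<beta> k Y) fs)
    = psel P t \<beta> k Y (pfam P s X (fmupd \<beta> (t, Z) S) \<alpha> fs)"
proof -
  let ?D = "pcon P (\<not> t) Y" and ?C = "pcon P s X"
  have Z: "Z \<in> obj P" by (rule ran_obj[OF Y k])
  have reorder: "fmupd \<alpha> v (fmupd \<gamma> w S) = fmupd \<gamma> w (fmupd \<alpha> v S)" if "\<alpha> \<noteq> \<gamma>" for v w \<gamma>
    by (rule fmupd_reorder_neq[OF that])
  have inY: "over (obj P) (fmupd \<gamma> (t, Z) S)" "\<alpha> |\<notin>| fmdom (fmupd \<gamma> (t, Z) S)" if "\<gamma> \<noteq> \<alpha>" "\<gamma> |\<notin>| fmdom S" for \<gamma>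
    using S Z that by (auto simp: over_upd)
  note inY\<beta> = inY[OF \<open>\<alpha> \<noteq> \<beta>\<close>[symmetric] S(3)]
  note F = pfam[OF X inY\<beta> fs]
  let ?F = "pfam P s X (fmupd \<beta> (t, Z) S) \<alpha> fs"
  have F': "sig P ?F = fmupd \<beta> (t, Z) (fmupd \<alpha> (s, ?C) S)" "\<beta> |\<notin>| fmdom (fmupd \<alpha> (s, ?C) S)"
    using F(2) reorder[OF \<open>\<alpha> \<noteq> \<beta>\<close>] S \<open>\<alpha> \<noteq> \<beta>\<close> by auto
  obtain \<delta> where \<delta>: "\<delta> |\<notin>| fmdom (sig P ?F)" using ex_fresh by blast
  then have \<delta>': "\<alpha> \<noteq> \<delta>" "\<beta> \<noteq> \<delta>" "\<delta> |\<notin>| fmdom S" by (auto simp: F)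
  note i = piota[OF Y \<delta>'(2) k, of "\<not> t"] and inY\<delta> = inY[OF \<delta>'(1)[symmetric] \<delta>'(3)]
  let ?r = "ren P (Perm.swap \<beta> \<delta>)" and ?i = "piota P (\<not> t) Y \<beta> \<delta> k"
  have rF: "?r ?F = pfam P s X (fmupd \<delta> (t, Z) S) \<alpha> (fmmap ?r fs)"
    using ren_pfam[OF X inY\<beta> fs, of "Perm.swap \<beta> \<delta>"] S \<delta>' \<open>\<alpha> \<noteq> \<beta>\<close> by (simp add: rename_swap_upd del: rename_ctx_upd)
  have rfs: "fmmap ?r fs \<in> pfamilies P s X (fmupd \<delta> (t, Z) S) \<alpha>"
  proof (rule pfamilies_map[OF fs])
    fix f Xi assume f: "f \<in> arr P" "sig P f = fmupd \<alpha> (s, Xi) (fmupd \<beta> (t, Z) S)"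
    then show "?r f \<in> arr P \<and> sig P (?r f) = fmupd \<alpha> (s, Xi) (fmupd \<delta> (t, Z) S)"
      using rename_swap_upd[of \<beta> "fmupd \<alpha> (s, Xi) S" \<delta> "(t, Z)"] S \<delta>' \<open>\<alpha> \<noteq> \<beta>\<close>
      by (simp add: ren_sig reorder del: rename_ctx_upd)
  qed
  have c: "compat \<delta> t (fmupd \<alpha> (s, ?C) (fmupd \<delta> (t, Z) S)) (sig P ?i)"
    unfolding i(2) by (rule compatI[where Z = Z]) (use S \<delta>' \<open>\<alpha> \<noteq> \<beta>\<close> in auto)
  have "psel P t \<beta> k Y ?F = pcut P t \<delta> (pfam P s X (fmupd \<delta> (t, Z) S) \<alpha> (fmmap ?r fs)) ?i"
    by (simp add: psel_eq[OF F(1) F' k Y \<delta>] rF)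
  also have "\<dots> = pfam P s X (join \<delta> (fmupd \<delta> (t, Z) S) (sig P ?i)) \<alpha> (fmmap (\<lambda>f. pcut P t \<delta> f ?i) (fmmap ?r fs))"
    by (rule pfam_natural[OF X inY\<delta> rfs i(1) c \<delta>'(1)[symmetric]])
  also have "join \<delta> (fmupd \<delta> (t, Z) S) (sig P ?i) = fmupd \<beta> (t, ?D) S"
    unfolding i(2) by (subst join_single(3)) (use S \<delta>' in auto)
  also have "fmmap (\<lambda>f. pcut P t \<delta> f ?i) (fmmap ?r fs) = fmmap (psel P t \<beta> k Y) fs"
    unfolding fmap.map_comp
  proof (rule fmap.map_cong0)
    fix f assume "f \<in> fmran' fs"
    then obtain j where j: "fmlookup fs j = Some f" by (rule fmran'E)
    then obtain Xi where Xi: "fmlookup X j = Some Xi" using pfamilies_dom[OF fs] by (metis fmdomE fmdomI)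
    have f: "f \<in> arr P" "sig P f = fmupd \<beta> (t, Z) (fmupd \<alpha> (s, Xi) S)"
      using pfamiliesD[OF fs Xi] j reorder[OF \<open>\<alpha> \<noteq> \<beta>\<close>] by auto
    have "\<beta> |\<notin>| fmdom (fmupd \<alpha> (s, Xi) S)" "\<delta> |\<notin>| fmdom (sig P f)" using S \<delta>' \<open>\<alpha> \<noteq> \<beta>\<close> by (auto simp: f)
    from psel_eq[OF f this(1) k Y this(2)] show "((\<lambda>f. pcut P t \<delta> f ?i) \<circ> ?r) f = psel P t \<beta> k Y f" by simp
  qed
  finally show ?thesis by simp
qed

text \<open>The counterpart of \<open>c20\<close> to \<open>c22\<close>. By \<open>pcut_psel\<close>
  the outer selection passes into the cut that defines the inner one.\<close>

lemma psel_psel: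
  assumes X: "fmran' X \<subseteq> obj P" and Y: "fmran' Y \<subseteq> obj P" and S: "\<alpha> |\<notin>| fmdom S" "\<beta> |\<notin>| fmdom S" and "\<alpha> \<noteq> \<beta>"
    and k: "fmlookup X k = Some Xk" and l: "fmlookup Y l = Some Yl"
    and f: "f \<in> arr P" "sig P f = fmupd \<alpha> (s, Xk) (fmupd \<beta> (t, Yl) S)"
  shows "psel P s \<alpha> k X (psel P t \<beta> l Y f) = psel P t \<beta> l Y (psel P s \<alpha> k X f)"
proof -
  have reorder: "fmupd \<alpha> v (fmupd \<gamma> w S) = fmupd \<gamma> w (fmupd \<alpha> v S)" if "\<alpha> \<noteq> \<gamma>" for v w \<gamma>
    by (rule fmupd_reorder_neq[OF that])
  have f': "sig P f = fmupd \<beta> (t, Yl) (fmupd \<alpha> (s, Xk) S)" "\<beta> |\<notin>| fmdom (fmupd \<alpha> (s, Xk) S)" "\<alpha> |\<notin>| fmdom (fmupd \<beta> (t, Yl) S)"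
    using f(2) reorder[OF \<open>\<alpha> \<noteq> \<beta>\<close>] S \<open>\<alpha> \<noteq> \<beta>\<close> by auto
  note sf = psel[OF f f'(3) k X]
  let ?C = "pcon P (\<not> s) X"
  have sf': "sig P (psel P s \<alpha> k X f) = fmupd \<beta> (t, Yl) (fmupd \<alpha> (s, ?C) S)" "\<beta> |\<notin>| fmdom (fmupd \<alpha> (s, ?C) S)"
    using sf(2) reorder[OF \<open>\<alpha> \<noteq> \<beta>\<close>] S \<open>\<alpha> \<noteq> \<beta>\<close> by auto
  obtain \<delta> where \<delta>: "\<delta> |\<notin>| fmdom (sig P f)" using ex_fresh by blast
  then have \<delta>': "\<alpha> \<noteq> \<delta>" "\<beta> \<noteq> \<delta>" "\<delta> |\<notin>| fmdom S" by (auto simp: f)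
  have \<delta>s: "\<delta> |\<notin>| fmdom (sig P (psel P s \<alpha> k X f))" using \<delta>' by (auto simp: sf)
  note i = piota[OF Y \<delta>'(2) l, of "\<not> t"] and aux = psel_aux[OF f(1) f'(1,2) l Y \<delta>]
  let ?r = "ren P (Perm.swap \<beta> \<delta>)" and ?i = "piota P (\<not> t) Y \<beta> \<delta> l"
  have rf: "?r f \<in> arr P" "sig P (?r f) = fmupd \<alpha> (s, Xk) (fmupd \<delta> (t, Yl) S)" "\<alpha> |\<notin>| fmdom (fmupd \<delta> (t, Yl) S)"
    using ren_sig(1)[OF f(1)] aux(2) reorder[OF \<delta>'(1)] S \<delta>' by auto
  have c: "compat \<delta> t (fmupd \<alpha> (s, ?C) (fmupd \<delta> (t, Yl) S)) (sig P ?i)"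
    unfolding i(2) by (rule compatI[where Z = Yl]) (use S \<delta>' \<open>\<alpha> \<noteq> \<beta>\<close> in auto)
  have "psel P s \<alpha> k X (psel P t \<beta> l Y f) = psel P s \<alpha> k X (pcut P t \<delta> (?r f) ?i)"
    by (simp add: psel_eq[OF f(1) f'(1,2) l Y \<delta>])
  also have "\<dots> = pcut P t \<delta> (psel P s \<alpha> k X (?r f)) ?i"
    by (rule pcut_psel(1)[symmetric, OF rf k X i(1) c \<delta>'(1)])
  also have "psel P s \<alpha> k X (?r f) = ?r (psel P s \<alpha> k X f)"
    using ren_psel[OF f f'(3) k X, of "Perm.swap \<beta> \<delta>"] \<delta>' \<open>\<alpha> \<noteq> \<beta>\<close> by simp
  finally show ?thesis
    by (simp add: psel_eq[OF sf(1) sf' l Y \<delta>s])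
qed

text \<open>The selection detours through a fresh \<open>\<epsilon>\<close>; the unit law turns the
  cut with the identity into a renaming, which brings \<open>piota\<close> back to
  \<open>\<delta>\<close>.\<close>

lemma psel_pidn:
  assumes X: "fmran' X \<subseteq> obj P" and "\<gamma> \<noteq> \<delta>" and i: "fmlookup X i = Some Y"
  shows "psel P (\<not> s) \<gamma> i X (pidn P s \<gamma> \<delta> Y) = piota P s X \<gamma> \<delta> i"
proof -
  have Y: "Y \<in> obj P" by (rule ran_obj[OF X i])
  note id = pidn[OF Y \<open>\<gamma> \<noteq> \<delta>\<close>, of s]
  obtain \<epsilon> where \<epsilon>: "\<epsilon> |\<notin>| fmdom (sig P (pidn P s \<gamma> \<delta> Y))" using ex_fresh by blast
  then have ne: "\<gamma> \<noteq> \<epsilon>" "\<epsilon> \<noteq> \<delta>" by (auto simp: id)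
  have "\<gamma> |\<notin>| fmdom (single \<delta> (s, Y))" using \<open>\<gamma> \<noteq> \<delta>\<close> by auto
  note eq = psel_eq[OF id this i X \<epsilon>]
  note io = piota[OF X ne(1) i, of s]
  have "psel P (\<not> s) \<gamma> i X (pidn P s \<gamma> \<delta> Y) = pcut P s \<epsilon> (piota P s X \<gamma> \<epsilon> i) (pidn P s \<epsilon> \<delta> Y)"
    unfolding eq using ren_pidn[OF Y \<open>\<gamma> \<noteq> \<delta>\<close>, of "Perm.swap \<gamma> \<epsilon>" s] ne \<open>\<gamma> \<noteq> \<delta>\<close> by (simp add: pcut_not)
  also have "\<dots> = ren P (Perm.swap \<epsilon> \<delta>) (piota P s X \<gamma> \<epsilon> i)"
    by (rule pcut_pidn[OF io(1)]) (use io(2) ne \<open>\<gamma> \<noteq> \<delta>\<close> in auto)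
  also have "\<dots> = piota P s X \<gamma> \<delta> i"
    using ren_piota[OF X ne(1) i, of "Perm.swap \<epsilon> \<delta>" s] ne \<open>\<gamma> \<noteq> \<delta>\<close> by simp
  finally show ?thesis .
qed

text \<open>This is the recursion equation of \<open>iota\<close> carried out inside
  \<open>P\<close>; it makes the interpretation of identity derivations an induction on
  formulas.\<close>

lemma pfam_psel_pidn:
  assumes X: "fmran' X \<subseteq> obj P" and "\<gamma> \<noteq> \<delta>"
  shows "pfam P s X (single \<gamma> (\<not> s, pcon P s X)) \<delta> (fmmap_keys (\<lambda>i Y. psel P (\<not> s) \<gamma> i X (pidn P s \<gamma> \<delta> Y)) X)
    = pidn P s \<gamma> \<delta> (pcon P s X)"
proof -
  have "fmmap_keys (\<lambda>i Y. psel P (\<not> s) \<gamma> i X (pidn P s \<gamma> \<delta> Y)) X = fmmap_keys (\<lambda>i _. piota P s X \<gamma> \<delta> i) X"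
    by (rule fmap_ext) (auto simp: psel_pidn[OF assms] intro!: map_option_cong)
  then show ?thesis by (simp add: pfam_piota(2)[OF assms])
qed

end

section \<open>Interpretation of derivations\<close>

primrec obj_ext :: "('p, 'n, 'z) sp_polycat_scheme \<Rightarrow> ('o \<Rightarrow> 'p) \<Rightarrow> 'o form \<Rightarrow> 'p" where
  "obj_ext B Fo (Atom a) = Fo a"
| "obj_ext B Fo (Sum X) = sum_ob B (fmmap (obj_ext B Fo) X)"
| "obj_ext B Fo (Prod X) = prod_ob B (fmmap (obj_ext B Fo) X)"

primrec arr_ext :: "('p, 'n, 'z) sp_polycat_scheme \<Rightarrow> ('o \<Rightarrow> 'p) \<Rightarrow> ('m \<Rightarrow> 'n) \<Rightarrow> ('o, 'm) deriv \<Rightarrow> 'n" where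
  "arr_ext B Fo Fm (Axiom m) = Fm m"
| "arr_ext B Fo Fm (Cotuple \<Gamma> \<Delta> \<alpha> X fs) = cotuple B (fmmap (obj_ext B Fo) X)
     (fmmap (obj_ext B Fo) \<Gamma>) (fmmap (obj_ext B Fo) \<Delta>) \<alpha> (fmmap (arr_ext B Fo Fm) fs)"
| "arr_ext B Fo Fm (Tuple \<Gamma> \<Delta> \<alpha> X fs) = tuple B (fmmap (obj_ext B Fo) X)
     (fmmap (obj_ext B Fo) \<Gamma>) (fmmap (obj_ext B Fo) \<Delta>) \<alpha> (fmmap (arr_ext B Fo Fm) fs)"
| "arr_ext B Fo Fm (Proj \<alpha> k X f) = psel B False \<alpha> k (fmmap (obj_ext B Fo) X) (arr_ext B Fo Fm f)"
| "arr_ext B Fo Fm (Inj \<alpha> k X f) = psel B True \<alpha> k (fmmap (obj_ext B Fo) X) (arr_ext B Fo Fm f)"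
| "arr_ext B Fo Fm (Cut \<gamma> f g) = cut B \<gamma> (arr_ext B Fo Fm f) (arr_ext B Fo Fm g)"

definition smap :: "('o \<Rightarrow> 'p) \<Rightarrow> (chan, bool \<times> 'o) fmap \<Rightarrow> (chan, bool \<times> 'p) fmap" where
  "smap h S = fmmap (map_prod id h) S"

lemma smap_upd [simp]: "smap h (fmupd \<alpha> (s, Y) S) = fmupd \<alpha> (s, h Y) (smap h S)"
  by (simp add: smap_def fmmap_fmupd)

lemma smap_empty [simp]: "smap h fmempty = fmempty"
  by (simp add: smap_def)

lemma fmdom_smap [simp]: "fmdom (smap h S) = fmdom S"
  by (simp add: smap_def)

lemma smap_join: "smap h (join \<gamma> S T) = join \<gamma> (smap h S) (smap h T)"
  by (simp add: smap_def join_def)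

lemma smap_rename: "smap h (rename_ctx p S) = rename_ctx p (smap h S)"
  by (simp add: smap_def)

lemma part_smap: "part b (smap h S) = fmmap h (part b S)"
  by (rule fmap_eqI) (force simp: smap_def)

lemma smap_signed: "smap h (signed \<Gamma> \<Delta>) = signed (fmmap h \<Gamma>) (fmmap h \<Delta>)"
  by (simp add: smap_def signed_def fmap.map_comp comp_def)

lemma compat_smap: "compat \<gamma> s S T \<Longrightarrow> compat \<gamma> s (smap h S) (smap h T)"
  by (auto simp: compat_def smap_def)

lemma over_smap: "over Ob S \<Longrightarrow> (\<And>X. X \<in> Ob \<Longrightarrow> h X \<in> Ob') \<Longrightarrow> over Ob' (smap h S)"
  by (force simp: over_def smap_def)

lemma fmupd_fmdrop [simp]: "fmupd c v (fmdrop c m) = fmupd c v m"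
  by (rule fmap_ext) simp

lemma fam_simps: "fam False S \<alpha> X = Cotuple (part False S) (part True S) \<alpha> X"
  "fam True S \<alpha> X = Tuple (part False S) (part True S) \<alpha> X"
  "sel False \<alpha> k X = Proj \<alpha> k X" "sel True \<alpha> k X = Inj \<alpha> k X"
  "xcut False \<gamma> f g = Cut \<gamma> g f" "xcut True \<gamma> f g = Cut \<gamma> f g" "con False X = Sum X" "con True X = Prod X"
  by (simp_all add: fam_def sel_def xcut_def con_def fun_eq_iff)

lemma der_CotupleD:
  assumes "der A (Cotuple \<Gamma> \<Delta> \<alpha> X fs) T"
  shows "\<alpha> |\<notin>| fmdom \<Gamma>" "\<alpha> |\<notin>| fmdom \<Delta>" "fmdom \<Gamma> |\<inter>| fmdom \<Delta> = {||}"
proof -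
  have "derives A (Cotuple \<Gamma> \<Delta> \<alpha> X fs) (part False T) (part True T)" using assms by (simp add: der_def)
  then show "\<alpha> |\<notin>| fmdom \<Gamma>" "\<alpha> |\<notin>| fmdom \<Delta>" "fmdom \<Gamma> |\<inter>| fmdom \<Delta> = {||}"
    by (cases, auto simp: sequent_def)+
qed

lemma der_TupleD:
  assumes "der A (Tuple \<Gamma> \<Delta> \<alpha> X fs) T"
  shows "\<alpha> |\<notin>| fmdom \<Gamma>" "\<alpha> |\<notin>| fmdom \<Delta>" "fmdom \<Gamma> |\<inter>| fmdom \<Delta> = {||}"
proof -
  have "derives A (Tuple \<Gamma> \<Delta> \<alpha> X fs) (part False T) (part True T)" using assms by (simp add: der_def)
  then show "\<alpha> |\<notin>| fmdom \<Gamma>" "\<alpha> |\<notin>| fmdom \<Delta>" "fmdom \<Gamma> |\<inter>| fmdom \<Delta> = {||}"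
    by (cases, auto simp: sequent_def)+
qed

text \<open>The annotated contexts of a derivable term are disjoint and hence form a signed context.
  The raw conversions are brought into signed form in this way.\<close>

lemma der_Cotuple_fam:
  assumes "der A (Cotuple \<Gamma> \<Delta> \<alpha> X fs) T"
  shows "Cotuple \<Gamma> \<Delta> \<alpha> X fs = fam False (signed \<Gamma> \<Delta>) \<alpha> X fs"
  using der_CotupleD[OF assms] by (simp add: fam_simps part_signed)

lemma der_Tuple_fam:
  assumes "der A (Tuple \<Gamma> \<Delta> \<alpha> X fs) T"
  shows "Tuple \<Gamma> \<Delta> \<alpha> X fs = fam True (signed \<Gamma> \<Delta>) \<alpha> X fs"
  using der_TupleD[OF assms] by (simp add: fam_simps part_signed)

context polycategory
begin

lemma der_selE:
  assumes "der P (sel s \<alpha> k X f) T"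
  obtains S Y where "T = fmupd \<alpha> (s, con (\<not> s) X) S" "\<alpha> |\<notin>| fmdom S" "fmlookup X k = Some Y"
    "fmran' X \<subseteq> formulas P" "der P f (fmupd \<alpha> (s, Y) S)"
proof -
  \<comment> \<open>Replacing the selection by a variable with an equation lets the signed induction
    rule serve as an inversion rule.\<close>
  define t where "t = sel s \<alpha> k X f"
  have "der P t T" using assms by (simp add: t_def)
  then have "t = sel s \<alpha> k X f \<Longrightarrow> \<exists>S Y. T = fmupd \<alpha> (s, con (\<not> s) X) S \<and> \<alpha> |\<notin>| fmdom S \<and> fmlookup X k = Some Y \<and>
      fmran' X \<subseteq> formulas P \<and> der P f (fmupd \<alpha> (s, Y) S)"
  proof (induction rule: der_induct)
    case (sel s' S \<alpha>' X' k' Y f')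
    then have "s' = s \<and> \<alpha>' = \<alpha> \<and> X' = X \<and> k' = k \<and> f' = f"
      by (cases s; cases s') (simp_all add: fam_simps)
    with sel show ?case by auto
  next
    case (ax m)
    then show ?case by (metis neq_Axiom(2))
  next
    case (fam s' S \<alpha>' X' fs)
    then show ?case by (cases s; cases s') (simp_all add: fam_simps)
  next
    case (xcut \<gamma> f' g S T)
    then show ?case by (cases s) (simp_all add: fam_simps)
  qed
  with that show thesis by (auto simp: t_def)
qed

lemma der_xcutE:
  assumes "der P (xcut s \<gamma> f g) U"
  obtains S T where "der P f S" "der P g T" "compat \<gamma> s S T" "U = join \<gamma> S T"
proof (cases s)
  case True
  with assms show thesis using that by (auto simp: fam_simps elim!: der_CutE[OF pc])
next
  case False
  with assms have "der P (Cut \<gamma> g f) U" by (simp add: fam_simps)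
  then obtain S T where "der P g S" "der P f T" "compat \<gamma> True S T" "U = join \<gamma> S T"
    by (rule der_CutE[OF pc])
  with that[of T S] compat_sym[of \<gamma> True S T] compat_join_commute[of \<gamma> True S T] False show thesis by simp
qed

end

section \<open>Soundness of the interpretation in \<open>B\<close>\<close>

locale sp_morphism = A: polycategory A + B: sp_polycategory B
  for A :: "('o, 'm, 'y) polycat_scheme" and B :: "('p, 'n, 'z) sp_polycat_scheme" +
  fixes Fo :: "'o \<Rightarrow> 'p" and Fm :: "'m \<Rightarrow> 'n"
  assumes morphism: "polycat_morphism A B Fo Fm"
begin

abbreviation go :: "'o form \<Rightarrow> 'p" where "go \<equiv> obj_ext B Fo"
abbreviation ga :: "('o, 'm) deriv \<Rightarrow> 'n" where "ga \<equiv> arr_ext B Fo Fm"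
abbreviation gS :: "(chan, bool \<times> 'o form) fmap \<Rightarrow> (chan, bool \<times> 'p) fmap" where "gS \<equiv> smap go"

lemma go_con: "go (con s X) = pcon B s (fmmap go X)"
  by (simp add: con_def pcon_def)

lemma go_obj: "Z \<in> formulas A \<Longrightarrow> go Z \<in> obj B"
proof (induction Z rule: form_induct)
  case (atom a)
  then show ?case using morphism by (simp add: polycat_morphism_def)
next
  case (con s X)
  then have "fmran' (fmmap go X) \<subseteq> obj B"
    by (auto simp: con_formulas) (meson fmran'E fmran'I subsetD)
  then show ?case by (simp add: go_con B.pcon_obj)
qed

lemma go_ran: "fmran' X \<subseteq> formulas A \<Longrightarrow> fmran' (fmmap go X) \<subseteq> obj B"
  by (auto intro: go_obj)

lemma go_over: "over (formulas A) S \<Longrightarrow> over (obj B) (gS S)"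
  by (erule over_smap) (rule go_obj)

lemma ga_fam: "ga (fam s S \<alpha> X fs) = pfam B s (fmmap go X) (gS S) \<alpha> (fmmap ga fs)"
  by (simp add: fam_def pfam_def part_smap)

lemma ga_sel: "ga (sel s \<alpha> k X f) = psel B s \<alpha> k (fmmap go X) (ga f)"
  by (cases s) (simp_all add: sel_def)

lemma ga_xcut: "ga (xcut s \<gamma> f g) = pcut B s \<gamma> (ga f) (ga g)"
  by (simp add: xcut_def pcut_def)

lemma Fm_sig: "m \<in> arr A \<Longrightarrow> Fm m \<in> arr B \<and> sig B (Fm m) = gS (asig A m)"
  using morphism by (simp add: polycat_morphism_def hom_def sig_def asig_def smap_signed fmap.map_comp comp_def)

lemma ga_der: "der A t S \<Longrightarrow> ga t \<in> arr B \<and> sig B (ga t) = gS S"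
proof (induction rule: A.der_induct)
  case (ax m)
  then show ?case by (simp add: Fm_sig)
next
  case (fam s S \<alpha> X fs)
  have "fmmap ga fs \<in> pfamilies B s (fmmap go X) (gS S) \<alpha>"
    using fam(4) by (auto simp: pfamilies_def fmap.rel_map elim!: fmap.rel_mono_strong)
  from B.pfam[OF go_ran[OF fam(3)] go_over[OF fam(2)] _ this] fam(1) show ?case
    by (simp add: ga_fam go_con)
next
  case (sel s S \<alpha> X k Y f)
  then show ?case
    using B.psel[of "ga f" \<alpha> s "go Y" "gS S" "fmmap go X" k] go_ran[of X] by (simp add: ga_sel go_con)
next
  case (xcut \<gamma> f g S T)
  then show ?case
    using B.pcut[of "ga f" "ga g" \<gamma> True] compat_smap[of \<gamma> True S T go] by (simp add: ga_xcut smap_join)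
qed

lemma ga_arr: "der A t S \<Longrightarrow> ga t \<in> arr B"
  and ga_sig: "der A t S \<Longrightarrow> sig B (ga t) = gS S"
  using ga_der by blast+

lemma ga_families:
  assumes "der A (fam s S \<alpha> X fs) T"
  shows "fmmap ga fs \<in> pfamilies B s (fmmap go X) (gS S) \<alpha>"
  using assms ga_der by (auto simp: der_fam_iff pfamilies_def fmap.rel_map elim!: fmap.rel_mono_strong)

lemma ga_rename: "der A t S \<Longrightarrow> ga (rename_deriv A p t) = ren B p (ga t)"
proof (induction rule: A.der_induct)
  case (ax m)
  then show ?case using morphism by (simp add: polycat_morphism_def)
next
  case (fam s S \<alpha> X fs)
  have d: "der A (fam s S \<alpha> X fs) (fmupd \<alpha> (s, con s X) S)"
    using fam by (auto simp: der_fam_iff elim!: fmap.rel_mono_strong)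
  have "fmmap ga (fmmap (rename_deriv A p) fs) = fmmap (ren B p) (fmmap ga fs)"
    using fam(4) by (intro fmap_ext) (auto simp: fmap.map_comp comp_def elim!: fmrelE1 intro!: map_option_cong)
  with B.ren_pfam[OF go_ran[OF fam(3)] go_over[OF fam(2)] _ ga_families[OF d], of p] fam(1) show ?case
    by (simp add: ga_fam A.rename_fam smap_rename)
next
  case (sel s S \<alpha> X k Y f)
  then show ?case
    using B.ren_psel[of "ga f" \<alpha> s "go Y" "gS S" "fmmap go X" k p] go_ran[of X] ga_der[OF sel(4)]
    by (simp add: ga_sel A.rename_sel)
next
  case (xcut \<gamma> f g S T)
  then show ?case
    using B.ren_pcut[of "ga f" "ga g" \<gamma> True p] compat_smap[of \<gamma> True S T go] ga_der[OF xcut(1)] ga_der[OF xcut(2)]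
    by (simp add: ga_xcut A.rename_xcut)
qed

text \<open>\<open>iota\<close> and the identities of \<open>B\<close> satisfy the same recursion,
  by \<open>pfam_psel_pidn\<close>; the two cases below are the two ends at which the family can
  stand.\<close>

lemma ga_xi: "Z \<in> formulas A \<Longrightarrow> \<alpha> \<noteq> \<beta> \<Longrightarrow> ga (xi A s \<alpha> \<beta> Z) = pidn B s \<alpha> \<beta> (go Z)"
proof (induction Z rule: form_induct)
  case (atom a)
  then show ?case using morphism by (auto simp: A.xi_Atom pidn_def polycat_morphism_def)
next
  case (con b X)
  have XA: "fmran' X \<subseteq> formulas A" using con.prems by (simp add: con_formulas)
  have IH: "ga (xi A s \<alpha> \<beta> Y) = pidn B s \<alpha> \<beta> (go Y)" if "fmlookup X i = Some Y" for i Y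
    using con.IH[OF that] A.fmran'_formulas[OF XA that] con.prems by blast
  have *: "fmmap ga (fmmap_keys (\<lambda>i Y. sel r \<gamma> i X (xi A s \<alpha> \<beta> Y)) X)
      = fmmap_keys (\<lambda>i Y. psel B r \<gamma> i (fmmap go X) (pidn B s \<alpha> \<beta> Y)) (fmmap go X)" for r \<gamma>
    by (rule fmap_ext) (auto simp: ga_sel IH option.map_comp comp_def intro!: map_option_cong)
  consider "b = s" | "b = (\<not> s)" by blast
  then show ?case
  proof cases
    case 1
    then show ?thesis
      using B.pfam_psel_pidn[OF go_ran[OF XA] con.prems(2), of s] by (simp add: A.xi_con ga_fam * go_con)
  next
    case 2
    then show ?thesis
      using B.pfam_psel_pidn[OF go_ran[OF XA] con.prems(2)[symmetric], of "\<not> s"]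
      by (simp add: A.xi_con ga_fam * go_con pidn_not)
  qed
qed

lemma ga_xcut_fam:
  assumes l: "der A (xcut s \<gamma> (fam s' S \<alpha> X fs) g) W" and r: "der A (fam s' S' \<alpha> X (fmmap (\<lambda>f. xcut s \<gamma> f g) fs)) W"
    and "\<alpha> \<noteq> \<gamma>"
  shows "ga (xcut s \<gamma> (fam s' S \<alpha> X fs) g) = ga (fam s' S' \<alpha> X (fmmap (\<lambda>f. xcut s \<gamma> f g) fs))"
proof -
  obtain T U where T: "der A (fam s' S \<alpha> X fs) T" and U: "der A g U" and c: "compat \<gamma> s T U" and W: "W = join \<gamma> T U"
    using A.der_xcutE[OF l] .
  have T': "T = fmupd \<alpha> (s', con s' X) S" and S: "\<alpha> |\<notin>| fmdom S" "over (formulas A) S" and X: "fmran' X \<subseteq> formulas A"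
    using T by (simp_all add: der_fam_iff)
  have "\<alpha> |\<notin>| fmdom U" using c \<open>\<alpha> \<noteq> \<gamma>\<close> unfolding T' by (rule compat_notin)
  then have "W = fmupd \<alpha> (s', con s' X) (join \<gamma> S U)" "\<alpha> |\<notin>| fmdom (join \<gamma> S U)"
    using W S by (simp_all add: T' join_upd[OF \<open>\<alpha> \<noteq> \<gamma>\<close>])
  \<comment> \<open>The conversions leave the annotation \<open>S'\<close> open, but both sides
    derive \<open>W\<close>, and removing \<open>\<alpha>\<close> from \<open>W\<close> determines
    it.\<close>
  then have S': "S' = join \<gamma> S U"
    using r by (metis der_fam_iff fmupd_eqD(2))
  have c': "compat \<gamma> s (fmupd \<alpha> (s', pcon B s' (fmmap go X)) (gS S)) (sig B (ga g))"
    using compat_smap[OF c, of go] by (simp add: T' go_con ga_sig[OF U])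
  have "ga (xcut s \<gamma> (fam s' S \<alpha> X fs) g)
      = pfam B s' (fmmap go X) (join \<gamma> (gS S) (gS U)) \<alpha> (fmmap (\<lambda>f. pcut B s \<gamma> f (ga g)) (fmmap ga fs))"
    using B.pfam_natural[OF go_ran[OF X] go_over[OF S(2)] _ ga_families[OF T] ga_arr[OF U] c' \<open>\<alpha> \<noteq> \<gamma>\<close>[symmetric]] S
    by (simp add: ga_xcut ga_fam ga_sig[OF U])
  then show ?thesis
    by (simp add: ga_fam S' smap_join fmap.map_comp comp_def ga_xcut)
qed

lemma ga_xcut_sel:
  assumes l: "der A (xcut s \<gamma> (sel s' \<alpha> k X f) g) W" and "\<alpha> \<noteq> \<gamma>"
  shows "ga (xcut s \<gamma> (sel s' \<alpha> k X f) g) = ga (sel s' \<alpha> k X (xcut s \<gamma> f g))"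
proof -
  obtain T U where T: "der A (sel s' \<alpha> k X f) T" and U: "der A g U" and c: "compat \<gamma> s T U"
    using A.der_xcutE[OF l] .
  obtain S Y where S: "T = fmupd \<alpha> (s', con (\<not> s') X) S" "\<alpha> |\<notin>| fmdom S" "fmlookup X k = Some Y"
      "fmran' X \<subseteq> formulas A" "der A f (fmupd \<alpha> (s', Y) S)"
    using A.der_selE[OF T] .
  have c': "compat \<gamma> s (fmupd \<alpha> (s', pcon B (\<not> s') (fmmap go X)) (gS S)) (sig B (ga g))"
    using compat_smap[OF c, of go] by (simp add: S(1) go_con ga_sig[OF U])
  show ?thesis
    using B.pcut_psel(1)[OF ga_arr[OF S(5)] _ _ _ go_ran[OF S(4)] ga_arr[OF U] c' \<open>\<alpha> \<noteq> \<gamma>\<close>] S ga_sig[OF S(5)]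
    by (simp add: ga_xcut ga_sel)
qed

lemma ga_beta:
  assumes l: "der A (xcut s \<gamma> (sel s \<gamma> k X f) (fam (\<not> s) T \<gamma> X gs)) W" and g: "fmlookup gs k = Some g"
  shows "ga (xcut s \<gamma> (sel s \<gamma> k X f) (fam (\<not> s) T \<gamma> X gs)) = ga (xcut s \<gamma> f g)"
proof -
  obtain V U where V: "der A (sel s \<gamma> k X f) V" and U: "der A (fam (\<not> s) T \<gamma> X gs) U" and c: "compat \<gamma> s V U"
    using A.der_xcutE[OF l] .
  obtain S Y where S: "V = fmupd \<gamma> (s, con (\<not> s) X) S" "\<gamma> |\<notin>| fmdom S" "fmlookup X k = Some Y"
      "fmran' X \<subseteq> formulas A" "der A f (fmupd \<gamma> (s, Y) S)"
    using A.der_selE[OF V] .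
  have T: "U = fmupd \<gamma> (\<not> s, con (\<not> s) X) T" "\<gamma> |\<notin>| fmdom T" "over (formulas A) T"
    using U by (simp_all add: der_fam_iff)
  have "fmdom S |\<inter>| fmdom T = {||}"
    using c S(2) T(2) unfolding S(1) T(1) compat_def by (auto simp: fset_eq_iff)
  then show ?thesis
    using B.pcut_psel_pfam[OF ga_arr[OF S(5)] _ _ _ go_ran[OF S(4)] go_over[OF T(3)] _ ga_families[OF U]] S T g ga_sig[OF S(5)]
    by (simp add: ga_xcut ga_sel ga_fam)
qed

lemma ga_fam_fam:
  assumes l: "der A (fam s (fmupd \<beta> (t, con t Y) S) \<alpha> X
      (fmmap_keys (\<lambda>i Xi. fam t (fmupd \<alpha> (s, Xi) S) \<beta> Y (fmmap_keys (\<lambda>j _. F i j) Y)) X)) W" (is "der A ?l W")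
    and S: "\<alpha> |\<notin>| fmdom S" "\<beta> |\<notin>| fmdom S" and "\<alpha> \<noteq> \<beta>"
  shows "ga (fam s (fmupd \<beta> (t, con t Y) S) \<alpha> X
      (fmmap_keys (\<lambda>i Xi. fam t (fmupd \<alpha> (s, Xi) S) \<beta> Y (fmmap_keys (\<lambda>j _. F i j) Y)) X))
    = ga (fam t (fmupd \<alpha> (s, con s X) S) \<beta> Y
      (fmmap_keys (\<lambda>j Yj. fam s (fmupd \<beta> (t, Yj) S) \<alpha> X (fmmap_keys (\<lambda>i _. F i j) X)) Y))"
proof -
  have X: "fmran' X \<subseteq> formulas A" and Y: "fmran' Y \<subseteq> formulas A" and S': "over (formulas A) S"
    using l S by (simp_all add: der_fam_iff over_upd con_formulas)
  have row: "der A (fam t (fmupd \<alpha> (s, Xi) S) \<beta> Y (fmmap_keys (\<lambda>j _. F i j) Y)) (fmupd \<alpha> (s, Xi) (fmupd \<beta> (t, con t Y) S))"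
    if "fmlookup X i = Some Xi" for i Xi
    using l[unfolded der_fam_iff[of A s], THEN conjunct2, THEN conjunct2, THEN conjunct2, THEN conjunct2] that
    by (auto elim!: fmrelE2[of _ _ X])
  have F: "der A (F i j) (fmupd \<alpha> (s, Xi) (fmupd \<beta> (t, Yj) S))" if "fmlookup X i = Some Xi" "fmlookup Y j = Some Yj" for i j Xi Yj
    using row[OF that(1)] that(2) by (auto simp: der_fam_iff fmrel_Some_iff fmupd_reorder_neq[OF \<open>\<alpha> \<noteq> \<beta>\<close>])
  have F': "ga (F i j) \<in> arr B \<and> sig B (ga (F i j)) = fmupd \<alpha> (s, Xi) (fmupd \<beta> (t, Yj) (gS S))"
    if "fmlookup (fmmap go X) i = Some Xi" "fmlookup (fmmap go Y) j = Some Yj" for i j Xi Yj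
    using that ga_der[OF F] by auto
  \<comment> \<open>Signs, channels and the two index families are generalised because this rewrites
    the nested families on both sides, where \<open>X\<close> and \<open>Y\<close> are
    exchanged.\<close>
  have e: "fmmap ga (fmmap_keys (\<lambda>i Xi. fam r (fmupd \<gamma> (r', Xi) S) \<delta> Y (fmmap_keys (\<lambda>j _. H i j) Y)) X)
      = fmmap_keys (\<lambda>i Xi. pfam B r (fmmap go Y) (fmupd \<gamma> (r', Xi) (gS S)) \<delta> (fmmap_keys (\<lambda>j _. ga (H i j)) (fmmap go Y))) (fmmap go X)"
    for r r' \<gamma> \<delta> H and X Y :: "(name, 'o form) fmap"
  proof -
    have "fmmap ga (fmmap_keys (\<lambda>j _. H i j) Y) = fmmap_keys (\<lambda>j _. ga (H i j)) (fmmap go Y)" for i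
      by (rule fmap_ext) (simp add: option.map_comp comp_def)
    then show ?thesis
      by (intro fmap_ext) (simp add: ga_fam option.map_comp comp_def)
  qed
  show ?thesis
    using B.pfam_pfam[OF go_ran[OF X] go_ran[OF Y] go_over[OF S'] _ _ \<open>\<alpha> \<noteq> \<beta>\<close> F'] S
    by (simp add: ga_fam[of s "fmupd \<beta> (t, con t Y) S"] ga_fam[of t "fmupd \<alpha> (s, con s X) S"] e go_con)
qed

lemma ga_fam_sel:
  assumes r: "der A (sel t \<beta> k Y (fam s (fmupd \<beta> (t, Z) S) \<alpha> X fs)) W"
    and S: "\<alpha> |\<notin>| fmdom S" "\<beta> |\<notin>| fmdom S" and "\<alpha> \<noteq> \<beta>" and k: "fmlookup Y k = Some Z"
  shows "ga (fam s (fmupd \<beta> (t, con (\<not> t) Y) S) \<alpha> X (fmmap (sel t \<beta> k Y) fs)) = ga (sel t \<beta> k Y (fam s (fmupd \<beta> (t, Z) S) \<alpha> X fs))"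
proof -
  obtain T where Y: "fmran' Y \<subseteq> formulas A" and d: "der A (fam s (fmupd \<beta> (t, Z) S) \<alpha> X fs) T"
    using A.der_selE[OF r] by metis
  have X: "fmran' X \<subseteq> formulas A" and S': "over (formulas A) S"
    using d S by (simp_all add: der_fam_iff over_upd)
  show ?thesis
    using B.pfam_psel[OF go_ran[OF X] go_ran[OF Y] go_over[OF S'] _ _ \<open>\<alpha> \<noteq> \<beta>\<close>, of k "go Z" "fmmap ga fs" s t] ga_families[OF d] S k
    by (simp add: ga_fam ga_sel go_con fmap.map_comp comp_def)
qed

lemma ga_sel_sel:
  assumes l: "der A (sel s \<alpha> k X (sel t \<beta> l Y f)) W" and "\<alpha> \<noteq> \<beta>"
  shows "ga (sel s \<alpha> k X (sel t \<beta> l Y f)) = ga (sel t \<beta> l Y (sel s \<alpha> k X f))"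
proof -
  obtain T Z where T: "\<alpha> |\<notin>| fmdom T" "fmlookup X k = Some Z" "fmran' X \<subseteq> formulas A" "der A (sel t \<beta> l Y f) (fmupd \<alpha> (s, Z) T)"
    using A.der_selE[OF l] by metis
  obtain U Z' where U: "fmupd \<alpha> (s, Z) T = fmupd \<beta> (t, con (\<not> t) Y) U" "\<beta> |\<notin>| fmdom U" "fmlookup Y l = Some Z'"
      "fmran' Y \<subseteq> formulas A" "der A f (fmupd \<beta> (t, Z') U)"
    using A.der_selE[OF T(4)] .
  \<comment> \<open>The context without both channels: \<open>U\<close> lacks
    \<open>\<beta>\<close>, and the equation of contexts shows that \<open>\<alpha>\<close> carries
    \<open>Z\<close> in \<open>U\<close>.\<close>
  let ?S = "fmdrop \<alpha> U"
  have "fmlookup U \<alpha> = Some (s, Z)"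
    using arg_cong[OF U(1), of "\<lambda>m. fmlookup m \<alpha>"] \<open>\<alpha> \<noteq> \<beta>\<close> by simp
  then have "U = fmupd \<alpha> (s, Z) ?S"
    by (intro fmap_ext) auto
  then have "fmupd \<beta> (t, Z') U = fmupd \<alpha> (s, Z) (fmupd \<beta> (t, Z') ?S)"
    using fmupd_reorder_neq[OF \<open>\<alpha> \<noteq> \<beta>\<close>] by metis
  with U(5) have f: "der A f (fmupd \<alpha> (s, Z) (fmupd \<beta> (t, Z') ?S))" by simp
  show ?thesis
    using B.psel_psel[OF go_ran[OF T(3)] go_ran[OF U(4)], of \<alpha> "gS ?S" \<beta> k "go Z" l "go Z'" "ga f" s t] T U(2,3) \<open>\<alpha> \<noteq> \<beta>\<close> ga_der[OF f]
    by (simp add: ga_sel)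
qed

text \<open>The work lies in recognising each pair of annotated contexts as one signed context;
  after that every conversion of compound rules is an instance of one of the six signed lemmas
  above.\<close>

lemma ga_conv:
  assumes "conv A t u" and t: "der A t W" and u: "der A u W"
  shows "ga t = ga u"
  using assms(1)
proof cases
  case (c0 \<gamma> m n)
  obtain S T where "der A (Axiom m) S" "der A (Axiom n) T" "compat \<gamma> True S T"
    using t unfolding c0 by (rule der_CutE[OF A.pc])
  then have "m \<in> arr A" "n \<in> arr A" "compat \<gamma> True (asig A m) (asig A n)"
    using A.der_AxiomD by blast+
  from compat_asig[OF A.pc this] show ?thesis
    using morphism by (simp add: c0 polycat_morphism_def)
next
  case (c1 a \<gamma> \<beta> f)
  obtain S T where f: "der A f S" and i: "der A (xi A True \<gamma> \<beta> (Atom a)) T" and c: "compat \<gamma> True S T"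
    using t unfolding c1 by (rule der_CutE[OF A.pc]) (simp add: A.xi_Atom)
  \<comment> \<open>The sequent of the identity axiom is forced. Hence \<open>\<beta>\<close> is its
    free end, and compatibility shows that it does not occur in the sequent of
    \<open>f\<close>.\<close>
  have "T = fmupd \<gamma> (False, Atom a) (single \<beta> (True, Atom a))"
    using A.der_xi[of "Atom a" \<gamma> \<beta> True] c1 der_unique[OF _ i] by auto
  then have "fmlookup (gS S) \<gamma> = Some (True, Fo a)" "\<beta> |\<notin>| fmdom (gS S)"
    using compat_smap[OF c, of go] compat_dom[OF c, of \<beta>] c1 by (auto simp: compat_def)
  then have "pcut B True \<gamma> (ga f) (pidn B True \<gamma> \<beta> (Fo a)) = ren B (Perm.swap \<gamma> \<beta>) (ga f)"
    by (intro B.pcut_pidn ga_arr[OF f]) (simp_all add: ga_sig[OF f])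
  then show ?thesis
    using ga_rename[OF f] morphism c1 by (simp add: polycat_morphism_def pcut_def pidn_def)
next
  case (c2 a \<alpha> \<gamma> f)
  obtain S T where f: "der A f S" and i: "der A (xi A False \<gamma> \<alpha> (Atom a)) T" and c: "compat \<gamma> False S T"
    using t unfolding c2 by (rule der_CutE[OF A.pc]) (metis A.xi_Atom compat_sym)
  have "T = fmupd \<gamma> (True, Atom a) (single \<alpha> (False, Atom a))"
    using A.der_xi[of "Atom a" \<gamma> \<alpha> False] c2 der_unique[OF _ i] by auto
  then have "fmlookup (gS S) \<gamma> = Some (False, Fo a)" "\<alpha> |\<notin>| fmdom (gS S)"
    using compat_smap[OF c, of go] compat_dom[OF c, of \<alpha>] c2 by (auto simp: compat_def)
  then have "pcut B False \<gamma> (ga f) (pidn B False \<gamma> \<alpha> (Fo a)) = ren B (Perm.swap \<gamma> \<alpha>) (ga f)"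
    by (intro B.pcut_pidn ga_arr[OF f]) (simp_all add: ga_sig[OF f])
  then show ?thesis
    using ga_rename[OF f] morphism c2 by (simp add: polycat_morphism_def pcut_def pidn_def)
next
  case (c3 \<alpha> \<gamma> \<Gamma> \<Delta> X fs g \<Gamma>' \<Delta>')
  obtain T where "der A (Cotuple \<Gamma> \<Delta> \<alpha> X fs) T" using t unfolding c3 by (rule der_CutE[OF A.pc])
  note e = der_Cotuple_fam[OF this] der_Cotuple_fam[OF u[unfolded c3]]
  show ?thesis
    using ga_xcut_fam[of True \<gamma> False "signed \<Gamma> \<Delta>" \<alpha> X fs g W "signed \<Gamma>' \<Delta>'"] t u c3 e
    by (simp add: fam_simps(5,6))
next
  case (c4 \<beta> \<gamma> f \<Gamma> \<Delta> Y gs \<Gamma>' \<Delta>')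
  obtain T where "der A (Tuple \<Gamma> \<Delta> \<beta> Y gs) T" using t unfolding c4 by (rule der_CutE[OF A.pc])
  note e = der_Tuple_fam[OF this] der_Tuple_fam[OF u[unfolded c4]]
  show ?thesis
    using ga_xcut_fam[of False \<gamma> True "signed \<Gamma> \<Delta>" \<beta> Y gs f W "signed \<Gamma>' \<Delta>'"] t u c4 e
    by (simp add: fam_simps(5,6))
next
  case (c9 \<alpha> \<gamma> \<Gamma> \<Delta> X fs g \<Gamma>' \<Delta>')
  obtain T where "der A (Tuple \<Gamma> \<Delta> \<alpha> X fs) T" using t unfolding c9 by (rule der_CutE[OF A.pc])
  note e = der_Tuple_fam[OF this] der_Tuple_fam[OF u[unfolded c9]]
  show ?thesis
    using ga_xcut_fam[of True \<gamma> True "signed \<Gamma> \<Delta>" \<alpha> X fs g W "signed \<Gamma>' \<Delta>'"] t u c9 e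
    by (simp add: fam_simps(5,6))
next
  case (c10 \<beta> \<gamma> f \<Gamma> \<Delta> Y gs \<Gamma>' \<Delta>')
  obtain T where "der A (Cotuple \<Gamma> \<Delta> \<beta> Y gs) T" using t unfolding c10 by (rule der_CutE[OF A.pc])
  note e = der_Cotuple_fam[OF this] der_Cotuple_fam[OF u[unfolded c10]]
  show ?thesis
    using ga_xcut_fam[of False \<gamma> False "signed \<Gamma> \<Delta>" \<beta> Y gs f W "signed \<Gamma>' \<Delta>'"] t u c10 e
    by (simp add: fam_simps(5,6))
next
  case (c5 \<alpha> \<gamma> k X f g)
  then show ?thesis using ga_xcut_sel[of True \<gamma> True \<alpha> k X f g W] t by (simp add: fam_simps)
next
  case (c6 \<beta> \<gamma> f k Y g)
  then show ?thesis using ga_xcut_sel[of False \<gamma> False \<beta> k Y g f W] t by (simp add: fam_simps)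
next
  case (c7 \<alpha> \<gamma> k X f g)
  then show ?thesis using ga_xcut_sel[of True \<gamma> False \<alpha> k X f g W] t by (simp add: fam_simps)
next
  case (c8 \<beta> \<gamma> f k Y g)
  then show ?thesis using ga_xcut_sel[of False \<gamma> True \<beta> k Y g f W] t by (simp add: fam_simps)
next
  case (c11 gs k g \<gamma> X f \<Gamma> \<Delta>)
  obtain T where "der A (Cotuple \<Gamma> \<Delta> \<gamma> X gs) T" using t unfolding c11 by (rule der_CutE[OF A.pc])
  from der_CotupleD[OF this] show ?thesis
    using ga_beta[of True \<gamma> k X f "signed \<Gamma> \<Delta>" gs W g] t c11 by (simp add: fam_simps part_signed)
next
  case (c12 fs k f \<gamma> \<Gamma> \<Delta> X g)
  obtain T where "der A (Tuple \<Gamma> \<Delta> \<gamma> X fs) T" using t unfolding c12 by (rule der_CutE[OF A.pc])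
  from der_TupleD[OF this] show ?thesis
    using ga_beta[of False \<gamma> k X g "signed \<Gamma> \<Delta>" fs W f] t c12 by (simp add: fam_simps part_signed)
next
  case (c13 \<alpha> \<beta> Y \<Gamma> \<Delta> X F)
  note d = der_CotupleD[OF t[unfolded c13]] der_CotupleD[OF u[unfolded c13]]
  then have d: "\<alpha> |\<notin>| fmdom \<Gamma>" "\<alpha> |\<notin>| fmdom \<Delta>" "\<beta> |\<notin>| fmdom \<Gamma>" "\<beta> |\<notin>| fmdom \<Delta>" "fmdom \<Gamma> |\<inter>| fmdom \<Delta> = {||}"
    by auto
  with ga_fam_fam[of False \<beta> False Y "signed \<Gamma> \<Delta>" \<alpha> X F W] t c13 show ?thesis
    by (simp add: fam_simps part_upd part_signed)
next
  case (c14 \<alpha> \<beta> \<Gamma> Y \<Delta> X F)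
  note d = der_TupleD[OF t[unfolded c14]] der_TupleD[OF u[unfolded c14]]
  then have d: "\<alpha> |\<notin>| fmdom \<Gamma>" "\<alpha> |\<notin>| fmdom \<Delta>" "\<beta> |\<notin>| fmdom \<Gamma>" "\<beta> |\<notin>| fmdom \<Delta>" "fmdom \<Gamma> |\<inter>| fmdom \<Delta> = {||}"
    by auto
  with ga_fam_fam[of True \<beta> True Y "signed \<Gamma> \<Delta>" \<alpha> X F W] t c14 show ?thesis
    by (simp add: fam_simps part_upd part_signed)
next
  case (c15 \<alpha> \<beta> Y k Yk \<Gamma> \<Delta> X fs)
  note d = der_CotupleD[OF t[unfolded c15]]
  \<comment> \<open>The raw context \<open>\<Delta>\<close> may already bind \<open>\<beta>\<close>,
    a binding that \<open>fmupd\<close> overwrites on both sides. Dropping it yields the context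
    without \<open>\<beta>\<close> that the signed lemma expects; the following three conversions
    are treated alike.\<close>
  then have d: "\<alpha> |\<notin>| fmdom \<Gamma>" "\<alpha> |\<notin>| fmdom (fmdrop \<beta> \<Delta>)" "\<beta> |\<notin>| fmdom \<Gamma>" "\<beta> |\<notin>| fmdom (fmdrop \<beta> \<Delta>)" "fmdom \<Gamma> |\<inter>| fmdom (fmdrop \<beta> \<Delta>) = {||}"
    by auto
  with ga_fam_sel[of True \<beta> k Y False Yk "signed \<Gamma> (fmdrop \<beta> \<Delta>)" \<alpha> X fs W] u c15 show ?thesis
    by (simp add: fam_simps part_upd part_signed)
next
  case (c16 \<alpha> \<beta> X k Xk \<Gamma> \<Delta> Y gs)
  note d = der_TupleD[OF u[unfolded c16]]
  then have d: "\<alpha> |\<notin>| fmdom (fmdrop \<alpha> \<Gamma>)" "\<alpha> |\<notin>| fmdom \<Delta>" "\<beta> |\<notin>| fmdom (fmdrop \<alpha> \<Gamma>)" "\<beta> |\<notin>| fmdom \<Delta>" "fmdom (fmdrop \<alpha> \<Gamma>) |\<inter>| fmdom \<Delta> = {||}"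
    by auto
  with ga_fam_sel[of False \<alpha> k X True Xk "signed (fmdrop \<alpha> \<Gamma>) \<Delta>" \<beta> Y gs W] t c16 show ?thesis
    by (simp add: fam_simps part_upd part_signed)
next
  case (c17 \<alpha> \<beta> Y k Yk \<Gamma> \<Delta> X fs)
  note d = der_CotupleD[OF t[unfolded c17]]
  then have d: "\<alpha> |\<notin>| fmdom (fmdrop \<beta> \<Gamma>)" "\<alpha> |\<notin>| fmdom \<Delta>" "\<beta> |\<notin>| fmdom (fmdrop \<beta> \<Gamma>)" "\<beta> |\<notin>| fmdom \<Delta>" "fmdom (fmdrop \<beta> \<Gamma>) |\<inter>| fmdom \<Delta> = {||}"
    by auto
  with ga_fam_sel[of False \<beta> k Y False Yk "signed (fmdrop \<beta> \<Gamma>) \<Delta>" \<alpha> X fs W] u c17 show ?thesis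
    by (simp add: fam_simps part_upd part_signed)
next
  case (c18 \<alpha> \<beta> X k Xk \<Gamma> \<Delta> Y gs)
  note d = der_TupleD[OF u[unfolded c18]]
  then have d: "\<alpha> |\<notin>| fmdom \<Gamma>" "\<alpha> |\<notin>| fmdom (fmdrop \<alpha> \<Delta>)" "\<beta> |\<notin>| fmdom \<Gamma>" "\<beta> |\<notin>| fmdom (fmdrop \<alpha> \<Delta>)" "fmdom \<Gamma> |\<inter>| fmdom (fmdrop \<alpha> \<Delta>) = {||}"
    by auto
  with ga_fam_sel[of True \<alpha> k X True Xk "signed \<Gamma> (fmdrop \<alpha> \<Delta>)" \<beta> Y gs W] t c18 show ?thesis
    by (simp add: fam_simps part_upd part_signed)
next
  case (c19 \<alpha> \<beta> \<Gamma> Y \<Delta> X F)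
  note d = der_CotupleD[OF t[unfolded c19]] der_TupleD[OF u[unfolded c19]]
  then have d: "\<alpha> |\<notin>| fmdom \<Gamma>" "\<alpha> |\<notin>| fmdom \<Delta>" "\<beta> |\<notin>| fmdom \<Gamma>" "\<beta> |\<notin>| fmdom \<Delta>" "fmdom \<Gamma> |\<inter>| fmdom \<Delta> = {||}"
    by auto
  with ga_fam_fam[of False \<beta> True Y "signed \<Gamma> \<Delta>" \<alpha> X F W] t c19 show ?thesis
    by (simp add: fam_simps part_upd part_signed)
next
  case (c20 \<alpha> \<beta> k X l Y f)
  then show ?thesis using ga_sel_sel[of True \<alpha> k X True \<beta> l Y f W] t by (simp add: fam_simps)
next
  case (c21 \<alpha> \<beta> k X l Y f)
  then show ?thesis using ga_sel_sel[of False \<alpha> k X False \<beta> l Y f W] t by (simp add: fam_simps)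
next
  case (c22 \<alpha> \<beta> k X l Y f)
  then show ?thesis using ga_sel_sel[of True \<alpha> k X False \<beta> l Y f W] t by (simp add: fam_simps)
qed

lemma ga_sim: "sim A t u \<Longrightarrow> ga t = ga u"
proof (induction rule: sim.induct)
  case (conv t u \<Gamma> \<Delta>)
  then show ?case using ga_conv derives_der[OF A.pc] by metis
next
  case (cotuple fs gs \<Gamma> \<Delta> \<alpha> X \<Gamma>' \<Delta>')
  then have "fmrel (=) (fmmap ga fs) (fmmap ga gs)" by (auto simp: fmap.rel_map elim!: fmap.rel_mono_strong)
  then show ?case by (simp add: fmap.rel_eq)
next
  case (tuple fs gs \<Gamma> \<Delta> \<alpha> X \<Gamma>' \<Delta>')
  then have "fmrel (=) (fmmap ga fs) (fmmap ga gs)" by (auto simp: fmap.rel_map elim!: fmap.rel_mono_strong)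
  then show ?case by (simp add: fmap.rel_eq)
qed simp_all

end

section \<open>Freeness\<close>

context polycategory
begin

section \<open>Compound derivations expressed through the operations of
  \<open>sigma_pi\<close>\<close>

lemma rep_ren_der:
  assumes "der P t S"
  shows "sim P (rep (ren (sigma_pi P) p (smor P S t))) (rename_deriv P p t)"
  using sim.trans[OF sren(3)[OF smor_arr[OF assms]] sim_rename[OF rep_smor(1)[OF assms]]] .

lemma smor_xcut:
  assumes "der P f S" "der P g T" "compat \<gamma> s S T"
  shows "scut s \<gamma> (smor P S f) (smor P T g) = smor P (join \<gamma> S T) (xcut s \<gamma> f g)"
proof -
  note f = smor_arr[OF assms(1)] smor_sctx[OF assms(1)] rep_smor[OF assms(1)]
    and g = smor_arr[OF assms(2)] smor_sctx[OF assms(2)] rep_smor[OF assms(2)]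
  note fg = scut[OF f(1) g(1), of \<gamma> s, unfolded f(2) g(2), OF assms(3)]
  have "sim P (rep (scut s \<gamma> (smor P S f) (smor P T g))) (xcut s \<gamma> f g)"
    using sim.trans[OF fg(3) sim_xcut[OF f(3) g(3) f(4) g(4) assms(3)]] .
  from smor_eq[OF this] show ?thesis
    using arr_rep(2)[OF fg(1)] fg(2) by simp
qed

lemma smor_ren:
  assumes "der P t S"
  shows "ren (sigma_pi P) p (smor P S t) = smor P (rename_ctx p S) (rename_deriv P p t)"
  using arr_rep(2)[OF sren(1)[OF smor_arr[OF assms]], of p] sren(2)[OF smor_arr[OF assms], of p]
    smor_eq[OF rep_ren_der[OF assms, of p]] smor_sctx[OF assms] by simp

text \<open>
  A selection is the cut with an injection or projection; this is how a morphism preserving sums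
  and products is determined on selections.
\<close>

lemma smor_sel:
  assumes f: "der P f (fmupd \<alpha> (t, Y) S)" "\<alpha> |\<notin>| fmdom S" and k: "fmlookup X k = Some Y" and X: "fmran' X \<subseteq> formulas P"
    and \<epsilon>: "\<epsilon> |\<notin>| fmdom (fmupd \<alpha> (t, Y) S)"
  shows "smor P (fmupd \<alpha> (t, con (\<not> t) X) S) (sel t \<alpha> k X f)
    = scut t \<epsilon> (ren (sigma_pi P) (Perm.swap \<alpha> \<epsilon>) (smor P (fmupd \<alpha> (t, Y) S) f))
        (smor P (fmupd \<alpha> (t, con (\<not> t) X) (single \<epsilon> (\<not> t, Y))) (sel t \<alpha> k X (xi P (\<not> t) \<alpha> \<epsilon> Y)))"
proof -
  have \<epsilon>': "\<alpha> \<noteq> \<epsilon>" "\<epsilon> |\<notin>| fmdom S" using \<epsilon> by auto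
  have Y: "Y \<in> formulas P" by (rule fmran'_formulas[OF X k])
  let ?f = "rename_deriv P (Perm.swap \<alpha> \<epsilon>) f" and ?x = "xi P (\<not> t) \<alpha> \<epsilon> Y"
  have rf: "der P ?f (fmupd \<epsilon> (t, Y) S)"
    using der_rename[OF f(1), of "Perm.swap \<alpha> \<epsilon>"] f(2) \<epsilon>' by (simp add: rename_swap_upd del: rename_ctx_upd)
  have dx: "der P ?x (fmupd \<alpha> (t, Y) (single \<epsilon> (\<not> t, Y)))"
    using der_xi[OF Y \<epsilon>'(1), of "\<not> t"] by simp
  have ds: "der P (sel t \<alpha> k X ?x) (fmupd \<alpha> (t, con (\<not> t) X) (single \<epsilon> (\<not> t, Y)))"
    using der_sel[OF dx _ k X] \<epsilon>' by simp
  have c: "compat \<epsilon> (\<not> t) (fmupd \<alpha> (t, con (\<not> t) X) (single \<epsilon> (\<not> t, Y))) (fmupd \<epsilon> (t, Y) S)"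
    by (rule compatI[where Z = Y]) (use f(2) \<epsilon>' in auto)
  have j: "join \<epsilon> (fmupd \<alpha> (t, con (\<not> t) X) (single \<epsilon> (\<not> t, Y))) (fmupd \<epsilon> (t, Y) S) = fmupd \<alpha> (t, con (\<not> t) X) S"
    using join_upd[OF \<epsilon>'(1), of "fmupd \<epsilon> (t, Y) S" "(t, con (\<not> t) X)" "single \<epsilon> (\<not> t, Y)"]
      join_single(1)[OF \<epsilon>'(2)] f(2) \<epsilon>' by (simp del: join_upd_same)
  have "\<alpha> |\<notin>| fmdom (single \<epsilon> (\<not> t, Y))" using \<epsilon>' by auto
  note x = xcut_sel[OF dx this k X rf c \<epsilon>'(1)]
  \<comment> \<open>Reversing the ends together with the sign gives the same identity. Cutting
    \<open>?f\<close> with it renames \<open>\<epsilon>\<close> back to \<open>\<alpha>\<close> and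
    so undoes the renaming in \<open>?f\<close>.\<close>
  have "xi P t \<epsilon> \<alpha> Y = ?x" by (simp add: xi_def)
  then have "sim P (xcut (\<not> t) \<epsilon> ?x ?f) (rename_deriv P (Perm.swap \<alpha> \<epsilon>) ?f)"
    using xcut_xi[OF rf, of \<epsilon> t Y \<alpha>] f(2) \<epsilon>' by (simp add: xcut_not swap_sym[of \<epsilon> \<alpha>])
  then have "sim P (xcut (\<not> t) \<epsilon> ?x ?f) f"
    by (rule sim.trans[OF _ rename_swap_swap[OF f(1)]])
  from sim_sel[OF this x(2) _ k X] have "sim P (sel t \<alpha> k X (xcut (\<not> t) \<epsilon> ?x ?f)) (sel t \<alpha> k X f)"
    using f(2) \<epsilon>' by simp
  from smor_eq[OF sim.trans[OF x(1) this]] smor_xcut[OF ds rf c]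
  have "smor P (fmupd \<alpha> (t, con (\<not> t) X) S) (sel t \<alpha> k X f)
      = scut (\<not> t) \<epsilon> (smor P (fmupd \<alpha> (t, con (\<not> t) X) (single \<epsilon> (\<not> t, Y))) (sel t \<alpha> k X ?x)) (smor P (fmupd \<epsilon> (t, Y) S) ?f)"
    unfolding j by simp
  also have "smor P (fmupd \<epsilon> (t, Y) S) ?f = ren (sigma_pi P) (Perm.swap \<alpha> \<epsilon>) (smor P (fmupd \<alpha> (t, Y) S) f)"
    using smor_ren[OF f(1), of "Perm.swap \<alpha> \<epsilon>"] f(2) \<epsilon>' by (simp add: rename_swap_upd del: rename_ctx_upd)
  finally show ?thesis by (simp add: pcut_def)
qed

text \<open>In this form a morphism preserving sums and products can be evaluated on a family. The
  lookup in \<open>X\<close> is always defined, since \<open>fs\<close> and \<open>X\<close> have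
  the same indices.\<close>

lemma smor_fam:
  assumes d: "der P (fam s S \<alpha> X fs) T"
  defines "gs \<equiv> fmmap_keys (\<lambda>i f. smor P (fmupd \<alpha> (s, the (fmlookup X i)) S) f) fs"
  shows "gs \<in> pfamilies (sigma_pi P) s X S \<alpha>" "smor P T (fam s S \<alpha> X fs) = sfam P s X S \<alpha> gs"
proof -
  have T: "T = fmupd \<alpha> (s, con s X) S" "\<alpha> |\<notin>| fmdom S" "over (formulas P) S" "fmran' X \<subseteq> formulas P"
    and rel: "fmrel (\<lambda>f Y. der P f (fmupd \<alpha> (s, Y) S)) fs X"
    using d by (simp_all add: der_fam_iff)
  show gs: "gs \<in> pfamilies (sigma_pi P) s X S \<alpha>"
  proof (rule pfamiliesI)
    fix i g Y assume g: "fmlookup gs i = Some g" and Y: "fmlookup X i = Some Y"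
    obtain f where "fmlookup fs i = Some f" "der P f (fmupd \<alpha> (s, Y) S)" using fmrelE2[OF rel Y] .
    with g Y show "g \<in> arr (sigma_pi P) \<and> sctx g = fmupd \<alpha> (s, Y) S"
      by (auto simp: gs_def smor_arr smor_sctx)
  qed (use rel in \<open>simp add: gs_def fmrel_fmdom_eq\<close>)
  have "fmrel (sim P) (fmmap rep gs) fs"
  proof (rule fmrel_Some_iff[THEN iffD2], intro conjI allI impI)
    fix i g f assume g: "fmlookup (fmmap rep gs) i = Some g" and f: "fmlookup fs i = Some f"
    obtain Y where Y: "fmlookup X i = Some Y" "der P f (fmupd \<alpha> (s, Y) S)" using fmrelE1[OF rel f] .
    then have "g = rep (smor P (fmupd \<alpha> (s, Y) S) f)" using f g by (simp add: gs_def)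
    then show "sim P g f" using rep_smor(1)[OF Y(2)] by simp
  qed (simp add: gs_def)
  from sfam_eqI[OF T(2-4) gs smor_arr[OF d] rep_smor(1)[OF d] this]
  show "smor P T (fam s S \<alpha> X fs) = sfam P s X S \<alpha> gs" .
qed

end

lemma polycat_morphismD:
  assumes "polycat_morphism P Q Fo Fm"
  shows "X \<in> obj P \<Longrightarrow> Fo X \<in> obj Q"
    and "f \<in> arr P \<Longrightarrow> Fm f \<in> hom Q (fmmap Fo (src P f)) (fmmap Fo (tgt P f))"
    and "X \<in> obj P \<Longrightarrow> \<alpha> \<noteq> \<beta> \<Longrightarrow> Fm (idn P \<alpha> \<beta> X) = idn Q \<alpha> \<beta> (Fo X)"
    and "cuttable P \<gamma> f g \<Longrightarrow> Fm (cut P \<gamma> f g) = cut Q \<gamma> (Fm f) (Fm g)"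
    and "f \<in> arr P \<Longrightarrow> Fm (ren P p f) = ren Q p (Fm f)"
  using assms unfolding polycat_morphism_def by blast+

lemma preserves_sums_products_sided:
  assumes "preserves_sums_products P Q Fo Fm" "polycategory P" "fmran' X \<subseteq> obj P"
    and S: "over (obj P) S" "\<alpha> |\<notin>| fmdom S" and fs: "fs \<in> cofamilies (sided s P) X (part s S) (part (\<not> s) S) \<alpha>"
  shows "Fm (sided_cotuple s P X (part s S) (part (\<not> s) S) \<alpha> fs) = pfam Q s (fmmap Fo X) (smap Fo S) \<alpha> (fmmap Fm fs)"
proof -
  have seq: "sequent (obj P) (part False S) (part True S)" using S by (simp add: sequent_part)
  have \<alpha>: "\<alpha> |\<notin>| fmdom (part False S) |\<union>| fmdom (part True S)"
    using S(2) by (simp add: fmdom_part)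
  show ?thesis
  proof (cases s)
    case True
    with fs have "fs \<in> families P X (part False S) (part True S) \<alpha>"
      by (simp add: polycategory.families_sided[OF assms(2)])
    with assms(1,3) seq \<alpha> True show ?thesis
      unfolding preserves_sums_products_def by (simp add: sided_cotuple_def pfam_def part_smap)
  next
    case False
    with fs have "fs \<in> cofamilies P X (part False S) (part True S) \<alpha>"
      by (simp add: polycategory.cofamilies_sided_False[OF assms(2)])
    with assms(1,3) seq \<alpha> False show ?thesis
      unfolding preserves_sums_products_def by (simp add: sided_cotuple_def pfam_def part_smap)
  qed
qed

section \<open>Existence of the extension\<close>

context sp_morphism
begin

definition gm :: "('o, 'm) sp_arr \<Rightarrow> 'n" where
  "gm f = ga (rep f)"

lemma gm_smor: "der A t S \<Longrightarrow> gm (smor A S t) = ga t"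
  unfolding gm_def by (rule ga_sim) (rule A.rep_smor)

lemma gm_hom:
  assumes f: "f \<in> arr (sigma_pi A)"
  shows "gm f \<in> hom B (fmmap go (dom_ctx f)) (fmmap go (cod_ctx f))"
proof -
  note r = A.arr_rep[OF f]
  have "gm f \<in> hom B (part False (gS (A.sctx f))) (part True (gS (A.sctx f)))"
    using ga_der[OF r(1)] by (simp add: B.sig_hom gm_def)
  then show ?thesis by (simp add: part_smap r(3,4))
qed

lemma gm_morphism: "polycat_morphism (sigma_pi A) B go gm"
  unfolding polycat_morphism_def
proof (intro conjI ballI allI impI)
  fix X assume "X \<in> obj (sigma_pi A)"
  then show "go X \<in> obj B" by (simp add: go_obj)
next
  fix f assume f: "f \<in> arr (sigma_pi A)"
  then show "gm f \<in> hom B (fmmap go (src (sigma_pi A) f)) (fmmap go (tgt (sigma_pi A) f))"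
    by (simp add: gm_hom)
  fix p
  show "gm (ren (sigma_pi A) p f) = ren B p (gm f)"
    unfolding gm_def ga_sim[OF A.sren(3)[OF f]] by (rule ga_rename[OF A.arr_rep(1)[OF f]])
next
  fix X and \<alpha> \<beta> :: chan assume X: "X \<in> obj (sigma_pi A)" and "\<alpha> \<noteq> \<beta>"
  then have XA: "X \<in> formulas A" by simp
  show "gm (idn (sigma_pi A) \<alpha> \<beta> X) = idn B \<alpha> \<beta> (go X)"
    unfolding gm_def ga_sim[OF A.sidn(3)[OF XA \<open>\<alpha> \<noteq> \<beta>\<close>]] by (simp add: ga_xi[OF XA \<open>\<alpha> \<noteq> \<beta>\<close>] pidn_def)
next
  fix \<gamma> f g assume "cuttable (sigma_pi A) \<gamma> f g"
  then have f: "f \<in> arr (sigma_pi A)" "g \<in> arr (sigma_pi A)" "compat \<gamma> True (A.sctx f) (A.sctx g)"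
    by (simp_all add: A.cuttable_sigma)
  from ga_sim[OF A.scut(3)[OF this]] show "gm (cut (sigma_pi A) \<gamma> f g) = cut B \<gamma> (gm f) (gm g)"
    by (simp add: gm_def pcut_def ga_xcut pcut_def)
qed

lemma gm_sfam:
  assumes "\<alpha> |\<notin>| fmdom S" "over (formulas A) S" "fmran' X \<subseteq> formulas A" "fs \<in> pfamilies (sigma_pi A) s X S \<alpha>"
  shows "gm (sfam A s X S \<alpha> fs) = pfam B s (fmmap go X) (gS S) \<alpha> (fmmap gm fs)"
proof -
  have "fmmap ga (fmmap rep fs) = fmmap gm fs"
    by (simp add: fmap.map_comp comp_def gm_def[abs_def])
  then show ?thesis
    using ga_sim[OF A.sfam(3)[OF assms]] by (simp add: gm_def ga_fam)
qed

lemma gm_preserves: "preserves_sums_products (sigma_pi A) B go gm"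
  unfolding preserves_sums_products_def
proof (intro allI impI conjI ballI)
  fix X :: "(name, 'o form) fmap" assume "fmran' X \<subseteq> obj (sigma_pi A)"
  then have X: "fmran' X \<subseteq> formulas A" by simp
  show "go (sum_ob (sigma_pi A) X) = sum_ob B (fmmap go X)" "go (prod_ob (sigma_pi A) X) = prod_ob B (fmmap go X)"
    by simp_all
  fix \<Gamma> \<Delta> :: "'o form ctx" and \<alpha>
  assume a: "sequent (obj (sigma_pi A)) \<Gamma> \<Delta> \<and> \<alpha> |\<notin>| fmdom \<Gamma> |\<union>| fmdom \<Delta>"
  then obtain S where S: "\<Gamma> = part False S" "\<Delta> = part True S" "over (formulas A) S" "\<alpha> |\<notin>| fmdom S"
    using A.sided_parts[of "formulas A" \<Gamma> \<Delta> False] by (metis (full_types) sigma_pi_simps(1))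
  show "gm (cotuple (sigma_pi A) X \<Gamma> \<Delta> \<alpha> fs) = cotuple B (fmmap go X) (fmmap go \<Gamma>) (fmmap go \<Delta>) \<alpha> (fmmap gm fs)"
    if "fs \<in> cofamilies (sigma_pi A) X \<Gamma> \<Delta> \<alpha>" for fs
  proof -
    have "fs \<in> pfamilies (sigma_pi A) False X S \<alpha>"
      using that polycategory.cofamilies_sided_sig[OF A.polycategory_sigma S(4), of False X] polycategory.cofamilies_sided_False[OF A.polycategory_sigma] by (simp add: S)
    from gm_sfam[OF S(4,3) X this] A.sided_cotuple_sigma[OF S(4), of False X fs] show ?thesis
      by (simp add: S(1,2) sided_cotuple_def pfam_def part_smap)
  qed
  show "gm (tuple (sigma_pi A) X \<Gamma> \<Delta> \<alpha> fs) = tuple B (fmmap go X) (fmmap go \<Gamma>) (fmmap go \<Delta>) \<alpha> (fmmap gm fs)"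
    if "fs \<in> families (sigma_pi A) X \<Gamma> \<Delta> \<alpha>" for fs
  proof -
    have "fs \<in> pfamilies (sigma_pi A) True X S \<alpha>"
      using that polycategory.cofamilies_sided_sig[OF A.polycategory_sigma S(4), of True X] polycategory.families_sided[OF A.polycategory_sigma] by (simp add: S)
    from gm_sfam[OF S(4,3) X this] A.sided_cotuple_sigma[OF S(4), of True X fs] show ?thesis
      by (simp add: S(1,2) sided_cotuple_def pfam_def part_smap)
  qed
qed

lemma gm_extension: "sp_extension A B Fo Fm go gm"
  unfolding sp_extension_def
proof (intro conjI ballI gm_morphism gm_preserves)
  fix m assume m: "m \<in> arr A"
  then show "gm (axiom_arr A m) = Fm m"
    using gm_smor[OF der_axiom[OF A.pc m]] by (simp add: A.axiom_arr_smor)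
qed simp

section \<open>Uniqueness of the extension\<close>

context
  fixes Ho Hm
  assumes ext: "sp_extension A B Fo Fm Ho Hm"
begin

lemma Hm_morphism: "polycat_morphism (sigma_pi A) B Ho Hm"
  and Hm_preserves: "preserves_sums_products (sigma_pi A) B Ho Hm"
  using ext by (simp_all add: sp_extension_def)

lemma Ho_unique: "Z \<in> formulas A \<Longrightarrow> Ho Z = go Z"
proof (induction Z rule: form_induct)
  case (atom a)
  then show ?case using ext by (simp add: sp_extension_def)
next
  case (con s X)
  then have X: "fmran' X \<subseteq> formulas A" by (simp add: con_formulas)
  have "fmmap Ho X = fmmap go X"
    using con.IH A.fmran'_formulas[OF X] by (intro fmap_ext) (auto intro!: map_option_cong)
  moreover have "Ho (con s X) = pcon B s (fmmap Ho X)"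
    using Hm_preserves X by (simp add: preserves_sums_products_def con_def pcon_def)
  ultimately show ?case by (simp add: go_con)
qed

lemma Ho_map: "fmran' X \<subseteq> formulas A \<Longrightarrow> fmmap Ho X = fmmap go X"
  by (rule fmap.map_cong0) (auto intro: Ho_unique)

lemma Ho_smap: "over (formulas A) S \<Longrightarrow> smap Ho S = gS S"
  unfolding smap_def
  by (rule fmap.map_cong0) (metis Ho_unique fmran'E map_prod_simp old.prod.exhaust over_def)

lemma Hm_sfam:
  assumes "\<alpha> |\<notin>| fmdom S" "over (formulas A) S" "fmran' X \<subseteq> formulas A" "fs \<in> pfamilies (sigma_pi A) s X S \<alpha>"
  shows "Hm (sfam A s X S \<alpha> fs) = pfam B s (fmmap go X) (gS S) \<alpha> (fmmap Hm fs)"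
  using preserves_sums_products_sided[OF Hm_preserves A.polycategory_sigma, of X S \<alpha> fs s] assms
  by (simp add: polycategory.cofamilies_sided_sig[OF A.polycategory_sigma] A.sided_cotuple_sigma Ho_map Ho_smap)

lemma Hm_scut:
  assumes "f \<in> arr (sigma_pi A)" "g \<in> arr (sigma_pi A)" "compat \<gamma> s (A.sctx f) (A.sctx g)"
  shows "Hm (A.scut s \<gamma> f g) = pcut B s \<gamma> (Hm f) (Hm g)"
  using polycat_morphismD(4)[OF Hm_morphism] assms compat_sym[OF assms(3)]
  by (cases s) (simp_all add: pcut_def pcut_def A.cuttable_sigma)

lemma Hm_sig:
  assumes f: "f \<in> arr (sigma_pi A)"
  shows "Hm f \<in> arr B" "sig B (Hm f) = gS (A.sctx f)"
proof -
  note r = A.arr_rep[OF f]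
  have "Hm f \<in> hom B (part False (smap Ho (A.sctx f))) (part True (smap Ho (A.sctx f)))"
    using polycat_morphismD(2)[OF Hm_morphism f] unfolding part_smap r(3,4)[symmetric] by simp
  then show "Hm f \<in> arr B" "sig B (Hm f) = gS (A.sctx f)"
    using der_over[OF A.pc r(1)] by (simp_all add: B.sig_hom Ho_smap)
qed

text \<open>The identity of \<open>con s X\<close> is the (co)tuple of the selections from
  identities. \<open>Hm\<close> preserves both identities and (co)tuples, so the images of these
  selections form a family whose (co)tuple is an identity of \<open>B\<close>, and
  \<open>piota_unique\<close> identifies them.\<close>

lemma Hm_piota:
  assumes X: "fmran' X \<subseteq> formulas A" and "\<alpha> \<noteq> \<epsilon>" and k: "fmlookup X k = Some Y"
  shows "Hm (smor A (fmupd \<alpha> (\<not> s, con s X) (single \<epsilon> (s, Y))) (sel (\<not> s) \<alpha> k X (xi A s \<alpha> \<epsilon> Y))) = piota B s (fmmap go X) \<alpha> \<epsilon> k"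
proof -
  let ?S = "single \<alpha> (\<not> s, con s X)" and ?xs = "fmmap_keys (\<lambda>i Y. sel (\<not> s) \<alpha> i X (xi A s \<alpha> \<epsilon> Y)) X"
  have C: "con s X \<in> formulas A" using X by (simp add: con_formulas)
  have "der A (fam s ?S \<epsilon> X ?xs) (fmupd \<alpha> (\<not> s, con s X) (single \<epsilon> (s, con s X)))"
    using A.der_xi[OF C \<open>\<alpha> \<noteq> \<epsilon>\<close>, of s] by (simp add: A.xi_con)
  then have d: "der A (fam s ?S \<epsilon> X ?xs) (fmupd \<epsilon> (s, con s X) ?S)"
    by (simp add: fmupd_reorder_neq[OF \<open>\<alpha> \<noteq> \<epsilon>\<close>])
  define gs where "gs = fmmap_keys (\<lambda>i f. smor A (fmupd \<epsilon> (s, the (fmlookup X i)) ?S) f) ?xs"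
  note f = A.smor_fam[OF d, folded gs_def]
  have S: "\<epsilon> |\<notin>| fmdom ?S" "over (formulas A) ?S" using \<open>\<alpha> \<noteq> \<epsilon>\<close> C by auto
  have "fmupd \<epsilon> (s, con s X) ?S = fmupd \<alpha> (\<not> s, con s X) (single \<epsilon> (s, con s X))"
    by (rule fmupd_reorder_neq[OF \<open>\<alpha> \<noteq> \<epsilon>\<close>, symmetric])
  then have "sfam A s X ?S \<epsilon> gs = smor A (fmupd \<alpha> (\<not> s, con s X) (single \<epsilon> (s, con s X))) (xi A s \<alpha> \<epsilon> (con s X))"
    using f(2) by (simp add: A.xi_con)
  also have "\<dots> = pidn (sigma_pi A) s \<alpha> \<epsilon> (con s X)"
    using \<open>\<alpha> \<noteq> \<epsilon>\<close> by (cases s) (simp_all add: sigma_pi_def smor_def pidn_def xi_def part_upd)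
  finally have "pfam B s (fmmap go X) (gS ?S) \<epsilon> (fmmap Hm gs) = Hm (pidn (sigma_pi A) s \<alpha> \<epsilon> (con s X))"
    using Hm_sfam[OF S X f(1)] by simp
  also have "\<dots> = pidn B s \<alpha> \<epsilon> (go (con s X))"
    using polycat_morphismD(3)[OF Hm_morphism, of "con s X"] C \<open>\<alpha> \<noteq> \<epsilon>\<close>
    by (cases s) (simp_all add: pidn_def Ho_unique)
  finally have eq: "pfam B s (fmmap go X) (single \<alpha> (\<not> s, pcon B s (fmmap go X))) \<epsilon> (fmmap Hm gs) = pidn B s \<alpha> \<epsilon> (pcon B s (fmmap go X))"
    by (simp add: go_con)
  have fam: "fmmap Hm gs \<in> pfamilies B s (fmmap go X) (single \<alpha> (\<not> s, pcon B s (fmmap go X))) \<epsilon>"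
  proof (rule pfamiliesI)
    fix i h W assume h: "fmlookup (fmmap Hm gs) i = Some h" and W: "fmlookup (fmmap go X) i = Some W"
    then obtain g Z where g: "fmlookup gs i = Some g" "h = Hm g" and Z: "fmlookup X i = Some Z" "W = go Z" by auto
    from pfamilies_lookup[OF f(1) g(1) Z(1)] Hm_sig show "h \<in> arr B \<and> sig B h = fmupd \<epsilon> (s, W) (single \<alpha> (\<not> s, pcon B s (fmmap go X)))"
      by (simp add: g Z go_con)
  qed (simp add: gs_def)
  have "fmlookup (fmmap Hm gs) k = Some (Hm (smor A (fmupd \<epsilon> (s, Y) ?S) (sel (\<not> s) \<alpha> k X (xi A s \<alpha> \<epsilon> Y))))"
    using k by (simp add: gs_def)
  from B.piota_unique[OF go_ran[OF X] \<open>\<alpha> \<noteq> \<epsilon>\<close> _ fam this eq] k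
  have "piota B s (fmmap go X) \<alpha> \<epsilon> k = Hm (smor A (fmupd \<epsilon> (s, Y) ?S) (sel (\<not> s) \<alpha> k X (xi A s \<alpha> \<epsilon> Y)))" by simp
  then show ?thesis
    by (simp add: fmupd_reorder_neq[OF \<open>\<alpha> \<noteq> \<epsilon>\<close>])
qed

lemma Hm_smor: "der A t S \<Longrightarrow> Hm (smor A S t) = ga t"
proof (induction rule: A.der_induct)
  case (ax m)
  then show ?case using ext by (simp add: sp_extension_def flip: A.axiom_arr_smor)
next
  case (fam s S \<alpha> X fs)
  have d: "der A (fam s S \<alpha> X fs) (fmupd \<alpha> (s, con s X) S)"
    using fam by (auto simp: der_fam_iff elim!: fmap.rel_mono_strong)
  define gs where "gs = fmmap_keys (\<lambda>i f. smor A (fmupd \<alpha> (s, the (fmlookup X i)) S) f) fs"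
  note f = A.smor_fam[OF d, folded gs_def]
  have "fmmap Hm gs = fmmap ga fs"
  proof (rule fmap_ext)
    fix i
    show "fmlookup (fmmap Hm gs) i = fmlookup (fmmap ga fs) i"
    proof (cases "fmlookup fs i")
      case (Some f)
      from fmrelE1[OF fam(4) this] obtain Y where "fmlookup X i = Some Y" "Hm (smor A (fmupd \<alpha> (s, Y) S) f) = ga f"
        by blast
      then show ?thesis using Some by (simp add: gs_def)
    qed (simp add: gs_def)
  qed
  then show ?case
    unfolding f(2) Hm_sfam[OF fam(1-3) f(1)] by (simp add: ga_fam)
next
  case (sel t S \<alpha> X k Y f)
  obtain \<epsilon> where \<epsilon>: "\<epsilon> |\<notin>| fmdom (fmupd \<alpha> (t, Y) S)" using ex_fresh by blast
  then have \<epsilon>': "\<alpha> \<noteq> \<epsilon>" "\<epsilon> |\<notin>| fmdom S" by auto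
  note df = sel(4)
  let ?f = "smor A (fmupd \<alpha> (t, Y) S) f" and ?i = "smor A (fmupd \<alpha> (t, con (\<not> t) X) (single \<epsilon> (\<not> t, Y))) (sel t \<alpha> k X (xi A (\<not> t) \<alpha> \<epsilon> Y))"
  note f = A.smor_arr[OF df] A.smor_sctx[OF df]
  have rf: "ren (sigma_pi A) (Perm.swap \<alpha> \<epsilon>) ?f \<in> arr (sigma_pi A)" "A.sctx (ren (sigma_pi A) (Perm.swap \<alpha> \<epsilon>) ?f) = fmupd \<epsilon> (t, Y) S"
    using A.sren(1,2)[OF f(1)] sel(1) \<epsilon>' by (simp_all add: f(2) rename_swap_upd del: rename_ctx_upd)
  have "der A (xi A (\<not> t) \<alpha> \<epsilon> Y) (fmupd \<alpha> (t, Y) (single \<epsilon> (\<not> t, Y)))"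
    using A.der_xi[OF A.fmran'_formulas[OF sel(2,3)] \<epsilon>'(1), of "\<not> t"] by simp
  from der_sel[OF this _ sel(3,2)] have ds: "der A (sel t \<alpha> k X (xi A (\<not> t) \<alpha> \<epsilon> Y)) (fmupd \<alpha> (t, con (\<not> t) X) (single \<epsilon> (\<not> t, Y)))"
    using \<epsilon>' by simp
  note i = A.smor_arr[OF ds] A.smor_sctx[OF ds]
  have c: "compat \<epsilon> t (A.sctx (ren (sigma_pi A) (Perm.swap \<alpha> \<epsilon>) ?f)) (A.sctx ?i)"
    unfolding rf(2) i(2) by (rule compatI[where Z = Y]) (use sel(1) \<epsilon>' in auto)
  have "Hm (smor A (fmupd \<alpha> (t, con (\<not> t) X) S) (sel t \<alpha> k X f)) = pcut B t \<epsilon> (Hm (ren (sigma_pi A) (Perm.swap \<alpha> \<epsilon>) ?f)) (Hm ?i)"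
    unfolding A.smor_sel[OF df sel(1,3,2) \<epsilon>] by (rule Hm_scut[OF rf(1) i(1) c])
  also have "Hm (ren (sigma_pi A) (Perm.swap \<alpha> \<epsilon>) ?f) = ren B (Perm.swap \<alpha> \<epsilon>) (ga f)"
    using polycat_morphismD(5)[OF Hm_morphism f(1)] sel(5) by simp
  also have "Hm ?i = piota B (\<not> t) (fmmap go X) \<alpha> \<epsilon> k"
    using Hm_piota[OF sel(2) \<epsilon>'(1) sel(3), of "\<not> t"] by simp
  \<comment> \<open>In \<open>B\<close> the selection was defined by a cut of the same shape, and
    \<open>psel_eq\<close> permits the channel \<open>\<epsilon>\<close> chosen here as its fresh
    channel.\<close>
  also have "pcut B t \<epsilon> (ren B (Perm.swap \<alpha> \<epsilon>) (ga f)) (piota B (\<not> t) (fmmap go X) \<alpha> \<epsilon> k) = psel B t \<alpha> k (fmmap go X) (ga f)"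
    using B.psel_eq[of "ga f" \<alpha> t "go Y" "gS S" "fmmap go X" k \<epsilon>] ga_der[OF df] sel(1,3) go_ran[OF sel(2)] \<epsilon> by simp
  finally show ?case by (simp add: ga_sel)
next
  case (xcut \<gamma> f g S T)
  note f = A.smor_arr[OF xcut(1)] A.smor_sctx[OF xcut(1)] and g = A.smor_arr[OF xcut(2)] A.smor_sctx[OF xcut(2)]
  have "Hm (A.scut True \<gamma> (smor A S f) (smor A T g)) = pcut B True \<gamma> (ga f) (ga g)"
    using Hm_scut[OF f(1) g(1), of \<gamma> True] xcut by (simp add: f(2) g(2))
  then show ?case by (simp add: A.smor_xcut[OF xcut(1-3)] ga_xcut)
qed

lemma Hm_unique: "f \<in> arr (sigma_pi A) \<Longrightarrow> Hm f = gm f"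
  using Hm_smor[OF A.arr_rep(1)] A.arr_rep(2) unfolding gm_def by metis

end

end

theorem proposition4p2p4:
  fixes A :: "('o, 'm) polycat"
  assumes "polycategory A"
  shows "sp_polycategory (sigma_pi A)
    \<and> polycat_morphism A (sigma_pi A) Atom (axiom_arr A)
    \<and> (\<forall>(B :: ('p, 'n) sp_polycat) Fo Fm.
         sp_polycategory B \<and> polycat_morphism A B Fo Fm \<longrightarrow>
         (\<exists>Go Gm. sp_extension A B Fo Fm Go Gm
            \<and> (\<forall>Ho Hm. sp_extension A B Fo Fm Ho Hm \<longrightarrow>
                 (\<forall>X \<in> obj (sigma_pi A). Ho X = Go X) \<and>
                 (\<forall>f \<in> arr (sigma_pi A). Hm f = Gm f))))"
proof (intro conjI allI impI)
  show "sp_polycategory (sigma_pi A)"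
    by (rule polycategory.sp_polycategory_sigma[OF assms])
  show "polycat_morphism A (sigma_pi A) Atom (axiom_arr A)"
    by (rule polycategory.axiom_arr_morphism[OF assms])
  fix B :: "('p, 'n) sp_polycat" and Fo Fm
  assume "sp_polycategory B \<and> polycat_morphism A B Fo Fm"
  then have "sp_morphism A B Fo Fm"
    using assms by (simp add: sp_morphism_def sp_morphism_axioms_def)
  then interpret sp_morphism A B Fo Fm .
  \<comment> \<open>Agreement is asserted on objects and polymorphisms only: as total functions,
    \<open>Ho\<close> and \<open>Hm\<close> are unconstrained elsewhere.\<close>
  show "\<exists>Go Gm. sp_extension A B Fo Fm Go Gm
      \<and> (\<forall>Ho Hm. sp_extension A B Fo Fm Ho Hm \<longrightarrow>
           (\<forall>X \<in> obj (sigma_pi A). Ho X = Go X) \<and> (\<forall>f \<in> arr (sigma_pi A). Hm f = Gm f))"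
    using gm_extension Ho_unique Hm_unique by (intro exI[of _ go] exI[of _ gm]) auto
qed

end
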